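(* There is an assignment $(R,A)\mapsto \Delta_{A/R}$ sending any rank-$n$ algebra $A$ over any ring $R$ to a rank-$2$ $R$-algebra $\Delta_{A/R}$ that is endowed with a canonical isomorphism $\bigwedge^2 \Delta_{A/R}\cong\bigwedge^n A$ identifying the discriminant bilinear form of $\Delta_{A/R}$ with that of $A$.
   Context: All rings and algebras are commutative, associative and unital, so an $R$-algebra structure on $A$ is a homomorphism of commutative rings $R\to A$. An $R$-algebra $A$ is of rank $n$ (a rank-$n$ algebra) if it is locally free of rank $n$ as an $R$-module, i.e. there are $r_1,\dots,r_k\in R$ together generating the unit ideal such that each localization $A_{r_i}$ is a free $R_{r_i}$-module of rank $n$. Exterior powers are taken over $R$. For an $R$-algebra $A$ of rank $n$ and $a\in A$, $\mathrm{Tr}_{A/R}(a)\in R$ denotes the trace of the $R$-linear map $A\to A$ given by multiplication by $a$. The discriminant bilinear form of $A$ is the bilinear form $\delta_{A/R}\colon \bigwedge^n A\times\bigwedge^n A\to R$ defined by $$\delta_{A/R}(a_1\wedge\cdots\wedge a_n,\; b_1\wedge\cdots\wedge b_n)=\det\bigl(\mathrm{Tr}_{A/R}(a_ib_j)\bigr)_{ij}.$$ The discriminant bilinear form of the rank-$2$ algebra $\Delta_{A/R}$ is the form on $\bigwedge^2\Delta_{A/R}$ given by the same definition with $n=2$. An isomorphism of $R$-modules $\bigwedge^2\Delta_{A/R}\cong\bigwedge^n A$ identifies the two discriminant bilinear forms if it carries one form to the other. *)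

theory Defs
  imports "HOL-Algebra.Module" "HOL-Algebra.QuotRing" "HOL-Combinatorics.Permutations"
begin

hide_const (open) Multiset.mult  (* it shadows the record field of monoids *)

section \<open>Linear maps and isomorphisms\<close>

text \<open>Additive maps that are linear along a map \<open>\<sigma>\<close> of base rings; \<open>\<sigma> = id\<close> gives the
  \<open>R\<close>-linear maps.\<close>

definition semilinear ::
  "('r, 'x) ring_scheme \<Rightarrow> ('r \<Rightarrow> 's) \<Rightarrow> ('r, 'm, 'y) module_scheme \<Rightarrow> ('s, 'k, 'z) module_scheme
    \<Rightarrow> ('m \<Rightarrow> 'k) set"
  where "semilinear R \<sigma> M N =
    {f \<in> carrier M \<rightarrow> carrier N.
       (\<forall>x\<in>carrier M. \<forall>y\<in>carrier M. f (x \<oplus>\<^bsub>M\<^esub> y) = f x \<oplus>\<^bsub>N\<^esub> f y) \<and>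
       (\<forall>r\<in>carrier R. \<forall>x\<in>carrier M. f (r \<odot>\<^bsub>M\<^esub> x) = \<sigma> r \<odot>\<^bsub>N\<^esub> f x)}"

definition module_iso ::
  "('r, 'x) ring_scheme \<Rightarrow> ('r, 'm, 'y) module_scheme \<Rightarrow> ('r, 'k, 'z) module_scheme
    \<Rightarrow> ('m \<Rightarrow> 'k) set"
  where "module_iso R M N =
    {f \<in> semilinear R id M N. bij_betw f (carrier M) (carrier N)}"

text \<open>Isomorphisms \<open>(\<sigma>, \<phi>)\<close> from the pair \<open>(R, A)\<close> to the pair \<open>(R', A')\<close>, each consisting of a
  ring and an algebra over it.\<close>

definition algebra_iso ::
  "('r, 'x) ring_scheme \<Rightarrow> ('r, 'a, 'y) module_scheme \<Rightarrow> ('s, 'x2) ring_scheme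
    \<Rightarrow> ('s, 'b, 'z) module_scheme \<Rightarrow> (('r \<Rightarrow> 's) \<times> ('a \<Rightarrow> 'b)) set"
  where "algebra_iso R A R' A' =
    {(\<sigma>, \<phi>). \<sigma> \<in> ring_iso R R' \<and> \<phi> \<in> ring_iso A A' \<and> \<phi> \<in> semilinear R \<sigma> A A'}"

definition self_module :: "('r, 'x) ring_scheme \<Rightarrow> ('r, 'r) module"
  where "self_module R =
    \<lparr>carrier = carrier R, mult = mult R, one = one R, zero = zero R, add = add R, smult = mult R\<rparr>"


section \<open>Localization and algebras of rank n\<close>

text \<open>The fraction \<open>fst x / snd x\<close>, as an equivalence class of pairs. Here \<open>S\<close> is a
  multiplicative subset of \<open>R\<close>.\<close>

definition frac_class ::
  "('r, 'x) ring_scheme \<Rightarrow> 'r set \<Rightarrow> ('r, 'm, 'y) module_scheme \<Rightarrow> 'm \<times> 'r \<Rightarrow> ('m \<times> 'r) set"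
  where "frac_class R S M x =
    {y \<in> carrier M \<times> S. \<exists>t\<in>S. t \<odot>\<^bsub>M\<^esub> (snd x \<odot>\<^bsub>M\<^esub> fst y) = t \<odot>\<^bsub>M\<^esub> (snd y \<odot>\<^bsub>M\<^esub> fst x)}"

text \<open>The operations are computed on representatives; the unions are over families of equal
  classes. The operations \<open>mult\<close> and \<open>one\<close> are meaningful if \<open>M\<close> is an algebra.\<close>

definition localization ::
  "('r, 'x) ring_scheme \<Rightarrow> 'r set \<Rightarrow> ('r, 'm, 'y) module_scheme
    \<Rightarrow> (('r \<times> 'r) set, ('m \<times> 'r) set) module"
  where "localization R S M =
    \<lparr>carrier = frac_class R S M ` (carrier M \<times> S),
     mult = (\<lambda>X Y. \<Union>x\<in>X. \<Union>y\<in>Y. frac_class R S M (fst x \<otimes>\<^bsub>M\<^esub> fst y, snd x \<otimes>\<^bsub>R\<^esub> snd y)),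
     one = frac_class R S M (\<one>\<^bsub>M\<^esub>, \<one>\<^bsub>R\<^esub>),
     zero = frac_class R S M (\<zero>\<^bsub>M\<^esub>, \<one>\<^bsub>R\<^esub>),
     add = (\<lambda>X Y. \<Union>x\<in>X. \<Union>y\<in>Y. frac_class R S M
       ((snd y \<odot>\<^bsub>M\<^esub> fst x) \<oplus>\<^bsub>M\<^esub> (snd x \<odot>\<^bsub>M\<^esub> fst y), snd x \<otimes>\<^bsub>R\<^esub> snd y)),
     smult = (\<lambda>P X. \<Union>p\<in>P. \<Union>x\<in>X. frac_class R S M (fst p \<odot>\<^bsub>M\<^esub> fst x, snd p \<otimes>\<^bsub>R\<^esub> snd x))\<rparr>"

definition powers :: "('r, 'x) ring_scheme \<Rightarrow> 'r \<Rightarrow> 'r set"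
  where "powers R r = range (\<lambda>k::nat. r [^]\<^bsub>R\<^esub> k)"

definition free_of_rank ::
  "('r, 'x) ring_scheme \<Rightarrow> nat \<Rightarrow> ('r, 'm, 'y) module_scheme \<Rightarrow> bool"
  where "free_of_rank R n M \<longleftrightarrow>
    (\<exists>e \<in> {..<n} \<rightarrow> carrier M. \<forall>x\<in>carrier M.
       \<exists>!c. c \<in> {..<n} \<rightarrow>\<^sub>E carrier R \<and> x = (\<Oplus>\<^bsub>M\<^esub>i\<in>{..<n}. c i \<odot>\<^bsub>M\<^esub> e i))"

definition locally_free_of_rank ::
  "('r, 'x) ring_scheme \<Rightarrow> nat \<Rightarrow> ('r, 'm, 'y) module_scheme \<Rightarrow> bool"
  where "locally_free_of_rank R n M \<longleftrightarrow>
    (\<exists>F. finite F \<and> F \<subseteq> carrier R \<and> Idl\<^bsub>R\<^esub> F = carrier R \<and>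
       (\<forall>r\<in>F. free_of_rank (localization R (powers R r) (self_module R)) n
                (localization R (powers R r) M)))"

definition rank_algebra ::
  "('r, 'x) ring_scheme \<Rightarrow> nat \<Rightarrow> ('r, 'a, 'y) module_scheme \<Rightarrow> bool"
  where "rank_algebra R n A \<longleftrightarrow> algebra R A \<and> locally_free_of_rank R n A"


section \<open>Exterior powers\<close>

definition free_module :: "('r, 'y) ring_scheme \<Rightarrow> 'x set \<Rightarrow> ('r, 'x \<Rightarrow> 'r) module"
  where "free_module R B =
    \<lparr>carrier = {c. (\<forall>x\<in>B. c x \<in> carrier R) \<and> (\<forall>x. x \<notin> B \<longrightarrow> c x = \<zero>\<^bsub>R\<^esub>) \<and> finite {x. c x \<noteq> \<zero>\<^bsub>R\<^esub>}},
     mult = undefined, one = undefined,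
     zero = (\<lambda>x. \<zero>\<^bsub>R\<^esub>), add = (\<lambda>c d x. c x \<oplus>\<^bsub>R\<^esub> d x), smult = (\<lambda>r c x. r \<otimes>\<^bsub>R\<^esub> c x)\<rparr>"

definition single :: "('r, 'y) ring_scheme \<Rightarrow> 'x \<Rightarrow> 'x \<Rightarrow> 'r"
  where "single R x = (\<lambda>y. if y = x then \<one>\<^bsub>R\<^esub> else \<zero>\<^bsub>R\<^esub>)"

definition quotient_module ::
  "('r, 'm, 'y) module_scheme \<Rightarrow> 'm set \<Rightarrow> ('r, 'm set) module"
  where "quotient_module M N =
    \<lparr>carrier = a_rcosets\<^bsub>M\<^esub> N,
     mult = undefined, one = undefined,
     zero = N, add = (<+>\<^bsub>M\<^esub>), smult = (\<lambda>r X. \<Union>x\<in>X. N +>\<^bsub>M\<^esub> (r \<odot>\<^bsub>M\<^esub> x))\<rparr>"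

definition tuples :: "('m, 'y) ring_scheme \<Rightarrow> nat \<Rightarrow> 'm list set"
  where "tuples M k = {xs. length xs = k \<and> set xs \<subseteq> carrier M}"

abbreviation tuple_module ::
  "('r, 'x) ring_scheme \<Rightarrow> nat \<Rightarrow> ('r, 'm, 'y) module_scheme \<Rightarrow> ('r, 'm list \<Rightarrow> 'r) module"
  where "tuple_module R k M \<equiv> free_module R (tuples M k)"

text \<open>The \<open>k\<close>-th exterior power is the free module on \<open>k\<close>-tuples, modulo the relations saying
  that the tuple depends linearly on each entry and vanishes when two entries agree.\<close>

definition wedge_relators ::
  "('r, 'x) ring_scheme \<Rightarrow> nat \<Rightarrow> ('r, 'm, 'y) module_scheme \<Rightarrow> ('m list \<Rightarrow> 'r) set"
  where "wedge_relators R k M =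
    {single R (xs[i := a \<oplus>\<^bsub>M\<^esub> b]) \<ominus>\<^bsub>tuple_module R k M\<^esub>
        (single R (xs[i := a]) \<oplus>\<^bsub>tuple_module R k M\<^esub> single R (xs[i := b])) | xs i a b.
      xs \<in> tuples M k \<and> i < k \<and> a \<in> carrier M \<and> b \<in> carrier M} \<union>
    {single R (xs[i := r \<odot>\<^bsub>M\<^esub> a]) \<ominus>\<^bsub>tuple_module R k M\<^esub>
        (r \<odot>\<^bsub>tuple_module R k M\<^esub> single R (xs[i := a])) | xs i r a.
      xs \<in> tuples M k \<and> i < k \<and> r \<in> carrier R \<and> a \<in> carrier M} \<union>
    {single R xs | xs i j. xs \<in> tuples M k \<and> i < j \<and> j < k \<and> xs ! i = xs ! j}"

definition wedge_kernel ::
  "('r, 'x) ring_scheme \<Rightarrow> nat \<Rightarrow> ('r, 'm, 'y) module_scheme \<Rightarrow> ('m list \<Rightarrow> 'r) set"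
  where "wedge_kernel R k M =
    \<Inter>{N. submodule N R (tuple_module R k M) \<and> wedge_relators R k M \<subseteq> N}"

definition ext_power ::
  "('r, 'x) ring_scheme \<Rightarrow> nat \<Rightarrow> ('r, 'm, 'y) module_scheme \<Rightarrow> ('r, ('m list \<Rightarrow> 'r) set) module"
  where "ext_power R k M = quotient_module (tuple_module R k M) (wedge_kernel R k M)"

definition wedge ::
  "('r, 'x) ring_scheme \<Rightarrow> nat \<Rightarrow> ('r, 'm, 'y) module_scheme \<Rightarrow> 'm list \<Rightarrow> ('m list \<Rightarrow> 'r) set"
  where "wedge R k M xs = wedge_kernel R k M +>\<^bsub>tuple_module R k M\<^esub> single R xs"

text \<open>The map that a \<open>\<sigma>\<close>-semilinear map \<open>\<phi>\<close> induces on \<open>k\<close>-th exterior powers, for a ring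
  homomorphism \<open>\<sigma>\<close>.\<close>

definition ext_map ::
  "('r, 'x) ring_scheme \<Rightarrow> ('r, 'm, 'y) module_scheme \<Rightarrow> ('s, 'x2) ring_scheme
    \<Rightarrow> ('s, 'k, 'z) module_scheme \<Rightarrow> nat \<Rightarrow> ('r \<Rightarrow> 's) \<Rightarrow> ('m \<Rightarrow> 'k)
    \<Rightarrow> ('m list \<Rightarrow> 'r) set \<Rightarrow> ('k list \<Rightarrow> 's) set"
  where "ext_map R M R' M' k \<sigma> \<phi> =
    (THE f. f \<in> extensional (carrier (ext_power R k M)) \<and>
       f \<in> semilinear R \<sigma> (ext_power R k M) (ext_power R' k M') \<and>
       (\<forall>xs\<in>tuples M k. f (wedge R k M xs) = wedge R' k M' (map \<phi> xs)))"


section \<open>Traces and the discriminant form\<close>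

text \<open>For a finitely generated projective module \<open>M\<close>, the trace is the image under evaluation
  \<open>M\<^sup>* \<otimes> M \<rightarrow> R\<close> of the element corresponding to the endomorphism \<open>f\<close>: it is computed from a
  finite dual basis and does not depend on its choice. For free \<open>M\<close>, a basis together with its
  coordinate functions is a dual basis, so this is the usual trace of a matrix.\<close>

definition dual_basis ::
  "('r, 'x) ring_scheme \<Rightarrow> ('r, 'm, 'y) module_scheme \<Rightarrow> nat \<Rightarrow> (nat \<Rightarrow> 'm) \<Rightarrow> (nat \<Rightarrow> 'm \<Rightarrow> 'r) \<Rightarrow> bool"
  where "dual_basis R M k e \<xi> \<longleftrightarrow>
    (\<forall>i<k. e i \<in> carrier M \<and> \<xi> i \<in> semilinear R id M (self_module R)) \<and>
    (\<forall>x\<in>carrier M. x = (\<Oplus>\<^bsub>M\<^esub>i\<in>{..<k}. \<xi> i x \<odot>\<^bsub>M\<^esub> e i))"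

definition module_trace ::
  "('r, 'x) ring_scheme \<Rightarrow> ('r, 'm, 'y) module_scheme \<Rightarrow> ('m \<Rightarrow> 'm) \<Rightarrow> 'r"
  where "module_trace R M f =
    (THE t. \<exists>k e \<xi>. dual_basis R M k e \<xi> \<and> t = (\<Oplus>\<^bsub>R\<^esub>i\<in>{..<k}. \<xi> i (f (e i))))"

definition algebra_trace ::
  "('r, 'x) ring_scheme \<Rightarrow> ('r, 'a, 'y) module_scheme \<Rightarrow> 'a \<Rightarrow> 'r"
  where "algebra_trace R A a = module_trace R A (\<lambda>x. a \<otimes>\<^bsub>A\<^esub> x)"

definition ring_det :: "('r, 'x) ring_scheme \<Rightarrow> nat \<Rightarrow> (nat \<Rightarrow> nat \<Rightarrow> 'r) \<Rightarrow> 'r"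
  where "ring_det R n m =
    (\<Oplus>\<^bsub>R\<^esub>p\<in>{p. p permutes {..<n}}.
       if evenperm p then (\<Otimes>\<^bsub>R\<^esub>i\<in>{..<n}. m i (p i)) else \<ominus>\<^bsub>R\<^esub> (\<Otimes>\<^bsub>R\<^esub>i\<in>{..<n}. m i (p i)))"

definition bilinear_forms ::
  "('r, 'x) ring_scheme \<Rightarrow> ('r, 'm, 'y) module_scheme \<Rightarrow> ('m \<times> 'm \<Rightarrow> 'r) set"
  where "bilinear_forms R M =
    {d \<in> extensional (carrier M \<times> carrier M).
       \<forall>x\<in>carrier M. (\<lambda>y. d (x, y)) \<in> semilinear R id M (self_module R) \<and>
                     (\<lambda>y. d (y, x)) \<in> semilinear R id M (self_module R)}"

definition disc_form ::
  "('r, 'x) ring_scheme \<Rightarrow> nat \<Rightarrow> ('r, 'a, 'y) module_scheme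
    \<Rightarrow> ('a list \<Rightarrow> 'r) set \<times> ('a list \<Rightarrow> 'r) set \<Rightarrow> 'r"
  where "disc_form R n A =
    (THE d. d \<in> bilinear_forms R (ext_power R n A) \<and>
       (\<forall>as\<in>tuples A n. \<forall>bs\<in>tuples A n. d (wedge R n A as, wedge R n A bs) =
          ring_det R n (\<lambda>i j. algebra_trace R A (as ! i \<otimes>\<^bsub>A\<^esub> bs ! j))))"

definition identifies_disc_forms ::
  "('r, 'x) ring_scheme \<Rightarrow> nat \<Rightarrow> ('r, 'a, 'y) module_scheme \<Rightarrow> nat \<Rightarrow> ('r, 'b, 'z) module_scheme
    \<Rightarrow> (('a list \<Rightarrow> 'r) set \<Rightarrow> ('b list \<Rightarrow> 'r) set) \<Rightarrow> bool"
  where "identifies_disc_forms R m A n B \<theta> \<longleftrightarrow>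
    (\<forall>X\<in>carrier (ext_power R m A). \<forall>Y\<in>carrier (ext_power R m A).
       disc_form R n B (\<theta> X, \<theta> Y) = disc_form R m A (X, Y))"


section \<open>Functoriality for isomorphisms\<close>

text \<open>An assignment \<open>\<Delta>\<close> of algebras to pairs \<open>(R, A)\<close> of a ring and a rank-\<open>n\<close> algebra is
  functorial for isomorphisms of such pairs via \<open>\<Phi>\<close>. Maps matter only on carriers, hence the
  pointwise formulation of preservation of identities and composition.\<close>

definition iso_functorial ::
  "nat \<Rightarrow> ('r ring \<Rightarrow> ('r, 'a) module \<Rightarrow> ('r, 'd) module)
    \<Rightarrow> ('r ring \<Rightarrow> ('r, 'a) module \<Rightarrow> 'r ring \<Rightarrow> ('r, 'a) module
          \<Rightarrow> ('r \<Rightarrow> 'r) \<times> ('a \<Rightarrow> 'a) \<Rightarrow> 'd \<Rightarrow> 'd) \<Rightarrow> bool"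
  where "iso_functorial n \<Delta> \<Phi> \<longleftrightarrow>
    (\<forall>R A R' A' \<sigma> \<phi>. rank_algebra R n A \<longrightarrow> rank_algebra R' n A' \<longrightarrow>
       (\<sigma>, \<phi>) \<in> algebra_iso R A R' A' \<longrightarrow>
       (\<sigma>, \<Phi> R A R' A' (\<sigma>, \<phi>)) \<in> algebra_iso R (\<Delta> R A) R' (\<Delta> R' A')) \<and>
    (\<forall>R A \<sigma> \<phi>. rank_algebra R n A \<longrightarrow>
       (\<forall>r\<in>carrier R. \<sigma> r = r) \<longrightarrow> (\<forall>a\<in>carrier A. \<phi> a = a) \<longrightarrow>
       (\<forall>x\<in>carrier (\<Delta> R A). \<Phi> R A R A (\<sigma>, \<phi>) x = x)) \<and>
    (\<forall>R A R' A' R'' A'' \<sigma> \<phi> \<sigma>' \<phi>' \<sigma>'' \<phi>''.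
       rank_algebra R n A \<longrightarrow> rank_algebra R' n A' \<longrightarrow> rank_algebra R'' n A'' \<longrightarrow>
       (\<sigma>, \<phi>) \<in> algebra_iso R A R' A' \<longrightarrow> (\<sigma>', \<phi>') \<in> algebra_iso R' A' R'' A'' \<longrightarrow>
       (\<forall>r\<in>carrier R. \<sigma>'' r = \<sigma>' (\<sigma> r)) \<longrightarrow> (\<forall>a\<in>carrier A. \<phi>'' a = \<phi>' (\<phi> a)) \<longrightarrow>
       (\<forall>x\<in>carrier (\<Delta> R A).
          \<Phi> R A R'' A'' (\<sigma>'', \<phi>'') x = \<Phi> R' A' R'' A'' (\<sigma>', \<phi>') (\<Phi> R A R' A' (\<sigma>, \<phi>) x)))"

text \<open>The maps \<open>\<theta>\<close> from the second exterior power of \<open>\<Delta>\<close> to the \<open>n\<close>-th exterior power of the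
  given algebra commute with the maps induced by isomorphisms.\<close>

definition iso_natural ::
  "nat \<Rightarrow> ('r ring \<Rightarrow> ('r, 'a) module \<Rightarrow> ('r, 'd) module)
    \<Rightarrow> ('r ring \<Rightarrow> ('r, 'a) module \<Rightarrow> 'r ring \<Rightarrow> ('r, 'a) module
          \<Rightarrow> ('r \<Rightarrow> 'r) \<times> ('a \<Rightarrow> 'a) \<Rightarrow> 'd \<Rightarrow> 'd)
    \<Rightarrow> ('r ring \<Rightarrow> ('r, 'a) module \<Rightarrow> ('d list \<Rightarrow> 'r) set \<Rightarrow> ('a list \<Rightarrow> 'r) set) \<Rightarrow> bool"
  where "iso_natural n \<Delta> \<Phi> \<theta> \<longleftrightarrow>
    (\<forall>R A R' A' \<sigma> \<phi>. rank_algebra R n A \<longrightarrow> rank_algebra R' n A' \<longrightarrow>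
       (\<sigma>, \<phi>) \<in> algebra_iso R A R' A' \<longrightarrow>
       (\<forall>X\<in>carrier (ext_power R 2 (\<Delta> R A)).
          \<theta> R' A' (ext_map R (\<Delta> R A) R' (\<Delta> R' A') 2 \<sigma> (\<Phi> R A R' A' (\<sigma>, \<phi>)) X) =
          ext_map R A R' A' n \<sigma> \<phi> (\<theta> R A X)))"

end

theory Submission
  imports Defs "HOL-Algebra.AbelCoset" "HOL-Algebra.Ideal"
begin

text \<open>Write \<open>W\<close> for the wedge map to \<open>L = \<Lambda>\<^sup>n A\<close> and \<open>a \<cdot> v\<close> for the componentwise product of tuples.
  Since \<open>L\<close> is locally free of rank one, there are tuples \<open>e s\<close> and linear forms \<open>cf s\<close> on \<open>L\<close>
  with \<open>\<Sum>s. cf s (W (e s)) = 1\<close>; such a chart turns the sum of \<open>W ((a \<circ> p) \<cdot> v)\<close> over all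
  even (odd) permutations \<open>p\<close> into a scalar \<open>G a\<close> (\<open>G' a\<close>). The sum \<open>G + G'\<close> is the polarized
  norm form of \<open>A\<close>. The functions \<open>\<tau> a = G' a - G a\<close> and
  \<open>\<kappa> a b = G a * G b - (\<Sum>q even. G (a \<cdot> (b \<circ> q)))\<close> are alternating, so they live on \<open>L\<close>, and
  \<open>R \<times> L\<close> becomes a rank 2 algebra through \<open>x * y = - \<kappa> x y + \<tau> x y\<close> for \<open>x\<close>, \<open>y\<close> in \<open>L\<close>; its
  discriminant form is \<open>\<tau> x * \<tau> y - 4 * \<kappa> x y\<close>. On the other side
  \<open>Tr a W v = \<Sum>j. W (v(j := a * v j))\<close>, and expanding products of traces turns \<open>det (Tr (a i * b j))\<close>
  into the sum of \<open>sgn q * (G + G') (a \<cdot> (b \<circ> q))\<close>, which is the same form. Two choices of \<open>G\<close>, or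
  the two sides of an isomorphism \<open>A \<cong> A'\<close>, differ by an alternating function, hence by a linear
  form \<open>\<lambda>\<close> on \<open>L\<close>, and \<open>(r, x) \<mapsto> (r + \<lambda> x, x)\<close> is the transition isomorphism of algebras.\<close>

section \<open>Calculus of maps that are linear along a homomorphism of base rings\<close>

section \<open>Semilinear maps\<close>

text \<open>The formula for \<kappa> comes from the orbit sum of a(p 0) \<otimes> ... \<otimes> a(p
  (n-1)) over even p in the n-th tensor power of A, for which the pair (G a, W a) stands. Two orbit
  sums multiply to the sum over even q of those of a \<cdot> (b \<circ> q); comparing first
  coordinates in the product of (G a, W a) and (G b, W b) forces \<kappa>, and the second coordinate
  has to be G' a W b + G b W a. The trace of the pair is G a + G' a, the norm form. The obstacle is
  that G is not canonical: the sum of W ((a \<circ> p) \<cdot> v) over even p is in general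
  alternating in v, hence a multiple of W v, only when a has two equal entries. For such a all
  choices of G agree, which is why the difference of two choices is alternating. The transition maps
  are those that preserve the pairs (G a, W a); this fixes the shift by \<lambda>. No division by 2
  occurs, A is given only local bases, and n = 0 and n = 1, where odd permutations do not exist,
  follow the general pattern.\<close>

lemma semilinearI:
  assumes "\<And>x. x \<in> carrier M \<Longrightarrow> f x \<in> carrier N"
    and "\<And>x y. x \<in> carrier M \<Longrightarrow> y \<in> carrier M \<Longrightarrow> f (x \<oplus>\<^bsub>M\<^esub> y) = f x \<oplus>\<^bsub>N\<^esub> f y"
    and "\<And>r x. r \<in> carrier R \<Longrightarrow> x \<in> carrier M \<Longrightarrow> f (r \<odot>\<^bsub>M\<^esub> x) = \<sigma> r \<odot>\<^bsub>N\<^esub> f x"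
  shows "f \<in> semilinear R \<sigma> M N"
  using assms by (auto simp: semilinear_def)

lemma semilinear_closed: "f \<in> semilinear R \<sigma> M N \<Longrightarrow> x \<in> carrier M \<Longrightarrow> f x \<in> carrier N"
  by (auto simp: semilinear_def)

lemma semilinear_add:
  "f \<in> semilinear R \<sigma> M N \<Longrightarrow> x \<in> carrier M \<Longrightarrow> y \<in> carrier M \<Longrightarrow> f (x \<oplus>\<^bsub>M\<^esub> y) = f x \<oplus>\<^bsub>N\<^esub> f y"
  by (auto simp: semilinear_def)

lemma semilinear_smult:
  "f \<in> semilinear R \<sigma> M N \<Longrightarrow> r \<in> carrier R \<Longrightarrow> x \<in> carrier M \<Longrightarrow> f (r \<odot>\<^bsub>M\<^esub> x) = \<sigma> r \<odot>\<^bsub>N\<^esub> f x"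
  by (auto simp: semilinear_def)

lemma semilinear_zero:
  assumes "abelian_group M" "abelian_group N" "f \<in> semilinear R \<sigma> M N"
  shows "f \<zero>\<^bsub>M\<^esub> = \<zero>\<^bsub>N\<^esub>"
proof -
  interpret M: abelian_group M by fact
  interpret N: abelian_group N by fact
  have "f (\<zero>\<^bsub>M\<^esub> \<oplus>\<^bsub>M\<^esub> \<zero>\<^bsub>M\<^esub>) = f \<zero>\<^bsub>M\<^esub> \<oplus>\<^bsub>N\<^esub> f \<zero>\<^bsub>M\<^esub>"
    by (rule semilinear_add[OF assms(3)]) auto
  then show ?thesis
    using semilinear_closed[OF assms(3) M.zero_closed]
    by (metis M.l_zero M.zero_closed N.add.r_cancel_one')
qed

lemma semilinear_minus:
  assumes "abelian_group M" "abelian_group N" "f \<in> semilinear R \<sigma> M N" "x \<in> carrier M"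
  shows "f (\<ominus>\<^bsub>M\<^esub> x) = \<ominus>\<^bsub>N\<^esub> f x"
proof -
  interpret M: abelian_group M by fact
  interpret N: abelian_group N by fact
  have "f (\<ominus>\<^bsub>M\<^esub> x) \<oplus>\<^bsub>N\<^esub> f x = f (\<ominus>\<^bsub>M\<^esub> x \<oplus>\<^bsub>M\<^esub> x)"
    using assms by (simp add: semilinear_add[OF assms(3)])
  also have "\<dots> = \<zero>\<^bsub>N\<^esub>"
    using assms by (simp add: M.l_neg semilinear_zero[OF assms(1-3)])
  finally show ?thesis
    using assms semilinear_closed[OF assms(3)] by (metis M.a_inv_closed N.minus_equality)
qed

lemma semilinear_diff:
  assumes "abelian_group M" "abelian_group N" "f \<in> semilinear R \<sigma> M N" "x \<in> carrier M" "y \<in> carrier M"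
  shows "f (x \<ominus>\<^bsub>M\<^esub> y) = f x \<ominus>\<^bsub>N\<^esub> f y"
  using assms
  by (simp add: a_minus_def semilinear_add[OF assms(3)] semilinear_minus[OF assms(1-3)]
      abelian_group.a_inv_closed)

lemma semilinear_finsum:
  assumes "abelian_group M" "abelian_group N" "f \<in> semilinear R \<sigma> M N" "x \<in> I \<rightarrow> carrier M"
  shows "f (\<Oplus>\<^bsub>M\<^esub>i\<in>I. x i) = (\<Oplus>\<^bsub>N\<^esub>i\<in>I. f (x i))"
proof -
  interpret M: abelian_group M by fact
  interpret N: abelian_group N by fact
  show ?thesis
  proof (cases "finite I")
    case True
    then show ?thesis using assms(4)
    proof induction
      case empty
      then show ?case by (simp add: semilinear_zero[OF assms(1-3)])
    next
      case (insert i I)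
      then have "x i \<in> carrier M" "x \<in> I \<rightarrow> carrier M" by auto
      with insert show ?case
        by (simp add: semilinear_add[OF assms(3)] semilinear_closed[OF assms(3)] Pi_def)
    qed
  qed (simp add: semilinear_zero[OF assms(1-3)])
qed

lemma semilinear_comp:
  assumes "f \<in> semilinear R \<sigma> M N" "g \<in> semilinear S \<tau> N K" "\<And>r. r \<in> carrier R \<Longrightarrow> \<sigma> r \<in> carrier S"
  shows "(\<lambda>x. g (f x)) \<in> semilinear R (\<lambda>r. \<tau> (\<sigma> r)) M K"
  using assms by (auto simp: semilinear_def Pi_iff)

lemma self_module_simps [simp]:
  "carrier (self_module R) = carrier R" "zero (self_module R) = zero R"
  "add (self_module R) = add R" "smult (self_module R) = mult R"
  "mult (self_module R) = mult R" "one (self_module R) = one R"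
  by (auto simp: self_module_def)

lemma self_module_module:
  assumes "cring R"
  shows "module R (self_module R)"
proof -
  interpret cring R by fact
  show ?thesis
    by (rule moduleI, fact, rule abelian_groupI)
      (auto simp: a_ac l_distr r_distr m_assoc intro: bexI[of _ "\<ominus>\<^bsub>R\<^esub> _"] simp: l_neg)
qed

lemma finsum_self_module [simp]: "finsum (self_module R) f I = finsum R f I"
  by (simp add: finsum_def finprod_def self_module_def)

lemma a_inv_self_module [simp]: "\<ominus>\<^bsub>self_module R\<^esub> x = \<ominus>\<^bsub>R\<^esub> x"
  by (simp add: a_inv_def self_module_def m_inv_def)

lemma a_minus_self_module [simp]: "x \<ominus>\<^bsub>self_module R\<^esub> y = x \<ominus>\<^bsub>R\<^esub> y"
  by (simp add: a_minus_def)

lemma semilinear_ring_hom: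
  "\<sigma> \<in> ring_hom R S \<Longrightarrow> \<sigma> \<in> semilinear R \<sigma> (self_module R) (self_module S)"
  by (rule semilinearI) (auto simp: ring_hom_def)

section \<open>Universal properties of free modules and of quotient modules\<close>

section \<open>Free modules and quotients\<close>

lemma free_module_simps [simp]:
  "zero (free_module R B) = (\<lambda>x. \<zero>\<^bsub>R\<^esub>)"
  "add (free_module R B) = (\<lambda>c d x. c x \<oplus>\<^bsub>R\<^esub> d x)"
  "smult (free_module R B) = (\<lambda>r c x. r \<otimes>\<^bsub>R\<^esub> c x)"
  by (auto simp: free_module_def)

lemma carrier_free_module:
  "c \<in> carrier (free_module R B) \<longleftrightarrow>
    (\<forall>x\<in>B. c x \<in> carrier R) \<and> (\<forall>x. x \<notin> B \<longrightarrow> c x = \<zero>\<^bsub>R\<^esub>) \<and> finite {x. c x \<noteq> \<zero>\<^bsub>R\<^esub>}"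
  by (simp add: free_module_def)

lemma (in cring) free_module_closed: "c \<in> carrier (free_module R B) \<Longrightarrow> c x \<in> carrier R"
  by (metis carrier_free_module zero_closed)

lemma (in cring) free_module_module: "module R (free_module R B)"
proof -
  have fc: "c \<in> carrier (free_module R B) \<Longrightarrow> c x \<in> carrier R" for c x
    by (rule free_module_closed)
  have a: "c \<in> carrier (free_module R B) \<Longrightarrow> d \<in> carrier (free_module R B) \<Longrightarrow>
      (\<lambda>x. c x \<oplus> d x) \<in> carrier (free_module R B)" for c d
    unfolding carrier_free_module
    by (auto intro: rev_finite_subset[of "{x. c x \<noteq> \<zero>} \<union> {x. d x \<noteq> \<zero>}"])
  have s: "r \<in> carrier R \<Longrightarrow> c \<in> carrier (free_module R B) \<Longrightarrow>
      (\<lambda>x. r \<otimes> c x) \<in> carrier (free_module R B)" for r c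
    unfolding carrier_free_module
    by (auto intro: rev_finite_subset[of "{x. c x \<noteq> \<zero>}"])
  show ?thesis
  proof (rule moduleI)
    show "abelian_group (free_module R B)"
    proof (rule abelian_groupI)
      fix c assume c: "c \<in> carrier (free_module R B)"
      show "\<exists>d\<in>carrier (free_module R B). d \<oplus>\<^bsub>free_module R B\<^esub> c = \<zero>\<^bsub>free_module R B\<^esub>"
        using s[of "\<ominus> \<one>" c] c free_module_closed[OF c]
        by (intro bexI[of _ "\<lambda>x. \<ominus> \<one> \<otimes> c x"]) (auto simp: l_minus l_neg)
      show "\<zero>\<^bsub>free_module R B\<^esub> \<oplus>\<^bsub>free_module R B\<^esub> c = c"
        using free_module_closed[OF c] by auto
    next
      fix c d e assume c: "c \<in> carrier (free_module R B)" "d \<in> carrier (free_module R B)" 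
        "e \<in> carrier (free_module R B)"
      show "c \<oplus>\<^bsub>free_module R B\<^esub> d \<oplus>\<^bsub>free_module R B\<^esub> e = c \<oplus>\<^bsub>free_module R B\<^esub> (d \<oplus>\<^bsub>free_module R B\<^esub> e)"
        using free_module_closed[OF c(1)] free_module_closed[OF c(2)] free_module_closed[OF c(3)]
        by (auto simp: a_assoc)
    next
      fix c d assume c: "c \<in> carrier (free_module R B)" "d \<in> carrier (free_module R B)" 
      show "c \<oplus>\<^bsub>free_module R B\<^esub> d = d \<oplus>\<^bsub>free_module R B\<^esub> c"
        using free_module_closed[OF c(1)] free_module_closed[OF c(2)] 
        by (auto simp: a_comm)
    qed (use a in \<open>auto simp: carrier_free_module\<close>)
  qed (use s in \<open>auto simp: r_distr l_distr m_assoc fun_eq_iff is_cring fc\<close>)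
qed

lemma (in cring) single_closed [simp, intro]: "x \<in> B \<Longrightarrow> single R x \<in> carrier (free_module R B)"
  by (auto simp: carrier_free_module single_def intro: rev_finite_subset[of "{x}"])

text \<open>Induction on a finite set containing the support: overwriting one coefficient with zero
  shrinks it, and the difference is a multiple of a basis element.\<close>

lemma (in cring) free_module_induct [consumes 1, case_names zero add single]:
  assumes "c \<in> carrier (free_module R B)"
    and z: "Q (\<lambda>x. \<zero>)"
    and a: "\<And>c d. c \<in> carrier (free_module R B) \<Longrightarrow> d \<in> carrier (free_module R B) \<Longrightarrow> Q c \<Longrightarrow> Q d \<Longrightarrow> Q (\<lambda>x. c x \<oplus> d x)"
    and s: "\<And>r x. r \<in> carrier R \<Longrightarrow> x \<in> B \<Longrightarrow> Q (\<lambda>y. r \<otimes> single R x y)"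
  shows "Q c"
proof -
  have "finite X \<Longrightarrow> c \<in> carrier (free_module R B) \<Longrightarrow> {x. c x \<noteq> \<zero>} \<subseteq> X \<Longrightarrow> Q c" for X c
  proof (induction arbitrary: c rule: finite_induct)
    case empty
    then have "c = (\<lambda>x. \<zero>)" by auto
    then show ?case using z by simp
  next
    case (insert x X)
    show ?case
    proof (cases "x \<in> B")
      case True
      let ?d = "c(x := \<zero>)"
      have d: "?d \<in> carrier (free_module R B)" "{y. ?d y \<noteq> \<zero>} \<subseteq> X"
        using insert.prems by (auto simp: carrier_free_module intro: rev_finite_subset[of "{x. c x \<noteq> \<zero>}"])
      have cx: "c y \<in> carrier R" for y by (rule free_module_closed[OF insert.prems(1)])
      have "c = (\<lambda>y. ?d y \<oplus> c x \<otimes> single R x y)"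
        using cx by (intro ext) (simp add: single_def)
      moreover have "Q (\<lambda>y. ?d y \<oplus> c x \<otimes> single R x y)"
        using a[OF d(1), of "\<lambda>y. c x \<otimes> single R x y"] insert.IH[OF d] s[OF cx True]
          module.smult_closed[OF free_module_module, OF cx[of x] single_closed[OF True]] by simp
      ultimately show ?thesis by metis
    next
      case False
      then have "{x. c x \<noteq> \<zero>} \<subseteq> X" using insert.prems by (auto simp: carrier_free_module)
      then show ?thesis using insert by auto
    qed
  qed
  then show ?thesis using assms(1) by (auto simp: carrier_free_module)
qed

text \<open>The \<sigma>-semilinear extension of \<open>g\<close> from the basis. Summing over the
  support keeps the sum finite although the basis, later the set of all tuples of a module, need not
  be.\<close>

definition free_lift ::
  "('r, 'x) ring_scheme \<Rightarrow> ('r \<Rightarrow> 's) \<Rightarrow> ('s, 'k, 'z) module_scheme \<Rightarrow> ('x2 \<Rightarrow> 'k) \<Rightarrow> ('x2 \<Rightarrow> 'r) \<Rightarrow> 'k"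
  where "free_lift R \<sigma> N g c = (\<Oplus>\<^bsub>N\<^esub>x\<in>{x. c x \<noteq> \<zero>\<^bsub>R\<^esub>}. \<sigma> (c x) \<odot>\<^bsub>N\<^esub> g x)"

lemma free_lift:
  assumes "cring R" "module S N" and \<sigma>: "\<sigma> \<in> ring_hom R S" and g: "\<And>x. x \<in> B \<Longrightarrow> g x \<in> carrier N"
  shows "free_lift R \<sigma> N g \<in> semilinear R \<sigma> (free_module R B) N"
    and "x \<in> B \<Longrightarrow> free_lift R \<sigma> N g (single R x) = g x"
proof -
  interpret R: cring R by fact
  interpret N: module S N by fact
  have s0: "\<sigma> \<zero>\<^bsub>R\<^esub> = \<zero>\<^bsub>S\<^esub>" 
    using ring_hom_zero[OF \<sigma>] R.ring_axioms N.R.ring_axioms by blast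
  have \<sigma>c: "r \<in> carrier R \<Longrightarrow> \<sigma> r \<in> carrier S" for r using ring_hom_closed[OF \<sigma>] by auto
  \<comment> \<open>The support changes under addition and scaling, so the sum is freed from it:
    every finite \<open>X\<close> between the support and \<open>B\<close> gives the same
    value.\<close>
  have fl: "free_lift R \<sigma> N g c = (\<Oplus>\<^bsub>N\<^esub>x\<in>X. \<sigma> (c x) \<odot>\<^bsub>N\<^esub> g x)"
    if "c \<in> carrier (free_module R B)" "finite X" "{x. c x \<noteq> \<zero>\<^bsub>R\<^esub>} \<subseteq> X" "X \<subseteq> B" for c X
    unfolding free_lift_def
    by (rule N.add.finprod_mono_neutral_cong_left)
      (use that s0 g R.free_module_closed[OF that(1)] \<sigma>c in \<open>auto intro!: N.smult_closed\<close>)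
  have sub: "{x. c x \<noteq> \<zero>\<^bsub>R\<^esub>} \<subseteq> B" "finite {x. c x \<noteq> \<zero>\<^bsub>R\<^esub>}" if "c \<in> carrier (free_module R B)" for c
    using that by (auto simp: carrier_free_module)
  show "free_lift R \<sigma> N g \<in> semilinear R \<sigma> (free_module R B) N"
  proof (rule semilinearI)
    fix c assume c: "c \<in> carrier (free_module R B)"
    then show "free_lift R \<sigma> N g c \<in> carrier N"
      unfolding free_lift_def using g sub[OF c] R.free_module_closed[OF c] \<sigma>c
      by (intro N.M.finsum_closed) auto
    fix r assume r: "r \<in> carrier R"
    have rc: "r \<odot>\<^bsub>free_module R B\<^esub> c \<in> carrier (free_module R B)"
      by (rule module.smult_closed[OF R.free_module_module r c])
    have "free_lift R \<sigma> N g (r \<odot>\<^bsub>free_module R B\<^esub> c) = (\<Oplus>\<^bsub>N\<^esub>x\<in>{x. c x \<noteq> \<zero>\<^bsub>R\<^esub>}. \<sigma> (r \<otimes>\<^bsub>R\<^esub> c x) \<odot>\<^bsub>N\<^esub> g x)"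
      using sub[OF c] r by (subst fl[OF rc, of "{x. c x \<noteq> \<zero>\<^bsub>R\<^esub>}"]) auto
    also have "\<dots> = (\<Oplus>\<^bsub>N\<^esub>x\<in>{x. c x \<noteq> \<zero>\<^bsub>R\<^esub>}. \<sigma> r \<odot>\<^bsub>N\<^esub> (\<sigma> (c x) \<odot>\<^bsub>N\<^esub> g x))"
      using sub[OF c] g r R.free_module_closed[OF c] \<sigma>c
      by (intro N.M.finsum_cong') (auto simp: ring_hom_mult[OF \<sigma>] N.smult_assoc1 subset_iff)
    also have "\<dots> = \<sigma> r \<odot>\<^bsub>N\<^esub> free_lift R \<sigma> N g c"
      unfolding free_lift_def using sub[OF c] g r R.free_module_closed[OF c] \<sigma>c
      by (intro N.finsum_smult_ldistr[symmetric]) (auto simp: subset_iff)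
    finally show "free_lift R \<sigma> N g (r \<odot>\<^bsub>free_module R B\<^esub> c) = \<sigma> r \<odot>\<^bsub>N\<^esub> free_lift R \<sigma> N g c" .
  next
    fix c d assume c: "c \<in> carrier (free_module R B)" and d: "d \<in> carrier (free_module R B)"
    let ?X = "{x. c x \<noteq> \<zero>\<^bsub>R\<^esub>} \<union> {x. d x \<noteq> \<zero>\<^bsub>R\<^esub>}"
    have cd: "c \<oplus>\<^bsub>free_module R B\<^esub> d \<in> carrier (free_module R B)"
      using module.axioms(2)[OF R.free_module_module, of B, THEN abelian_groupE(1)] c d by auto
    have X: "finite ?X" "?X \<subseteq> B" using sub[OF c] sub[OF d] by auto
    have "free_lift R \<sigma> N g (c \<oplus>\<^bsub>free_module R B\<^esub> d) = (\<Oplus>\<^bsub>N\<^esub>x\<in>?X. \<sigma> (c x \<oplus>\<^bsub>R\<^esub> d x) \<odot>\<^bsub>N\<^esub> g x)"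
      using X by (subst fl[OF cd X(1)]) auto
    also have "\<dots> = (\<Oplus>\<^bsub>N\<^esub>x\<in>?X. \<sigma> (c x) \<odot>\<^bsub>N\<^esub> g x \<oplus>\<^bsub>N\<^esub> \<sigma> (d x) \<odot>\<^bsub>N\<^esub> g x)"
      using X g R.free_module_closed[OF c] R.free_module_closed[OF d] \<sigma>c
      by (intro N.M.finsum_cong') (auto simp: ring_hom_add[OF \<sigma>] N.smult_l_distr subset_iff)
    also have "\<dots> = free_lift R \<sigma> N g c \<oplus>\<^bsub>N\<^esub> free_lift R \<sigma> N g d"
      using X g R.free_module_closed[OF c] R.free_module_closed[OF d] \<sigma>c
      by (subst (1 2) fl[OF _ X(1)]) (auto simp: subset_iff c d intro!: N.M.finsum_addf)
    finally show "free_lift R \<sigma> N g (c \<oplus>\<^bsub>free_module R B\<^esub> d) = free_lift R \<sigma> N g c \<oplus>\<^bsub>N\<^esub> free_lift R \<sigma> N g d" .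
  qed
  assume x: "x \<in> B"
  show "free_lift R \<sigma> N g (single R x) = g x"
    using x g ring_hom_one[OF \<sigma>]
    by (subst fl[of _ "{x}"]) (auto simp: single_def R.single_closed[OF x, unfolded single_def])
qed

lemma quotient_module_simps [simp]:
  "carrier (quotient_module M N) = a_rcosets\<^bsub>M\<^esub> N"
  "zero (quotient_module M N) = N"
  "add (quotient_module M N) = (<+>\<^bsub>M\<^esub>)"
  by (auto simp: quotient_module_def)

locale module_quotient = module + fixes N assumes sub: "submodule N R M"
begin

lemma abelian_subgroup: "abelian_subgroup N M"
  by (rule abelian_subgroupI3)
    (auto intro!: additive_subgroup.intro submodule.axioms(1)[OF sub] abelian_group_axioms)

sublocale abelian_subgroup N M by (rule abelian_subgroup)

lemma coset_in: "x \<in> carrier M \<Longrightarrow> N +>\<^bsub>M\<^esub> x \<in> carrier (quotient_module M N)"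
  by (auto simp: A_RCOSETS_def')

lemma coset_eq: 
  assumes "x \<in> carrier M" "y \<in> carrier M"
  shows "N +>\<^bsub>M\<^esub> x = N +>\<^bsub>M\<^esub> y \<longleftrightarrow> x \<ominus>\<^bsub>M\<^esub> y \<in> N"
  using assms a_rcos_self[of x] a_repr_independence'[of x y] a_rcos_module[of y x]
  by (auto simp: a_minus_def)

lemma coset_zero: "x \<in> carrier M \<Longrightarrow> N +>\<^bsub>M\<^esub> x = N \<longleftrightarrow> x \<in> N"
  using a_rcos_const a_rcos_self[of x] by auto

text \<open>The union in \<open>quotient_module\<close> runs over all representatives; they
  contribute the same coset, because \<open>N\<close> is closed under multiplication by
  \<open>r\<close>.\<close>

lemma smult_coset:
  assumes "r \<in> carrier R" "x \<in> carrier M"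
  shows "r \<odot>\<^bsub>quotient_module M N\<^esub> (N +>\<^bsub>M\<^esub> x) = N +>\<^bsub>M\<^esub> (r \<odot>\<^bsub>M\<^esub> x)"
proof -
  have "N +>\<^bsub>M\<^esub> (r \<odot>\<^bsub>M\<^esub> y) = N +>\<^bsub>M\<^esub> (r \<odot>\<^bsub>M\<^esub> x)" if y: "y \<in> N +>\<^bsub>M\<^esub> x" for y
  proof -
    have yc: "y \<in> carrier M" using y assms a_elemrcos_carrier by blast
    have "y \<ominus>\<^bsub>M\<^esub> x \<in> N" using y assms yc a_rcos_module[of x y] by (auto simp: a_minus_def)
    then have "r \<odot>\<^bsub>M\<^esub> (y \<ominus>\<^bsub>M\<^esub> x) \<in> N" by (rule submodule.smult_closed[OF sub assms(1)])
    then have "r \<odot>\<^bsub>M\<^esub> y \<ominus>\<^bsub>M\<^esub> r \<odot>\<^bsub>M\<^esub> x \<in> N"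
      using assms yc by (simp add: a_minus_def smult_r_distr smult_r_minus)
    then show ?thesis using assms yc coset_eq[of "r \<odot>\<^bsub>M\<^esub> y" "r \<odot>\<^bsub>M\<^esub> x"] by simp
  qed
  then have "(\<Union>y\<in>N +>\<^bsub>M\<^esub> x. N +>\<^bsub>M\<^esub> (r \<odot>\<^bsub>M\<^esub> y)) = N +>\<^bsub>M\<^esub> (r \<odot>\<^bsub>M\<^esub> x)"
    using a_rcos_self[OF assms(2)] by blast
  then show ?thesis by (simp add: quotient_module_def)
qed

lemma add_coset:
  assumes "x \<in> carrier M" "y \<in> carrier M"
  shows "(N +>\<^bsub>M\<^esub> x) \<oplus>\<^bsub>quotient_module M N\<^esub> (N +>\<^bsub>M\<^esub> y) = N +>\<^bsub>M\<^esub> (x \<oplus>\<^bsub>M\<^esub> y)"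
  using assms a_rcos_sum by auto

lemma carrier_quotientE:
  assumes "X \<in> carrier (quotient_module M N)"
  obtains x where "x \<in> carrier M" "X = N +>\<^bsub>M\<^esub> x"
  using assms by (auto simp: A_RCOSETS_def')

lemma quotient_module: "module R (quotient_module M N)"
proof (rule moduleI)
  show "cring R" by (rule R.is_cring)
  have z: "\<zero>\<^bsub>quotient_module M N\<^esub> = N +>\<^bsub>M\<^esub> \<zero>\<^bsub>M\<^esub>"
    using coset_zero[of "\<zero>\<^bsub>M\<^esub>"] additive_subgroup.zero_closed[OF is_additive_subgroup] by simp
  show "abelian_group (quotient_module M N)"
  proof (rule abelian_groupI)
    fix X assume "X \<in> carrier (quotient_module M N)"
    then obtain x where x: "x \<in> carrier M" "X = N +>\<^bsub>M\<^esub> x" by (rule carrier_quotientE)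
    then show "\<exists>Y\<in>carrier (quotient_module M N). Y \<oplus>\<^bsub>quotient_module M N\<^esub> X = \<zero>\<^bsub>quotient_module M N\<^esub>"
      by (intro bexI[of _ "N +>\<^bsub>M\<^esub> (\<ominus>\<^bsub>M\<^esub> x)"])
        (simp_all add: z add_coset coset_in M.l_neg del: quotient_module_simps)
  qed (auto elim!: carrier_quotientE simp: z add_coset coset_in M.a_ac simp del: quotient_module_simps)
qed (auto elim!: carrier_quotientE simp: smult_coset add_coset coset_in smult_l_distr smult_r_distr
       smult_assoc1 simp del: quotient_module_simps)

lemma coset_linear: "(\<lambda>x. N +>\<^bsub>M\<^esub> x) \<in> semilinear R id M (quotient_module M N)"
  by (rule semilinearI) (simp_all add: coset_in add_coset smult_coset del: quotient_module_simps)

text \<open>The lift applies \<open>g\<close> to a chosen representative; two representatives differ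
  by an element of \<open>N\<close>, where \<open>g\<close> vanishes.\<close>

lemma quotient_lift:
  assumes K: "abelian_group K" and g: "g \<in> semilinear R \<sigma> M K" and z: "\<And>x. x \<in> N \<Longrightarrow> g x = \<zero>\<^bsub>K\<^esub>"
  shows "\<exists>h\<in>semilinear R \<sigma> (quotient_module M N) K. \<forall>x\<in>carrier M. h (N +>\<^bsub>M\<^esub> x) = g x"
proof -
  interpret K: abelian_group K by fact
  let ?h = "\<lambda>X. g (SOME x. x \<in> carrier M \<and> X = N +>\<^bsub>M\<^esub> x)"
  have h: "?h (N +>\<^bsub>M\<^esub> x) = g x" if x: "x \<in> carrier M" for x
  proof -
    let ?y = "SOME y. y \<in> carrier M \<and> N +>\<^bsub>M\<^esub> x = N +>\<^bsub>M\<^esub> y"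
    have y: "?y \<in> carrier M \<and> N +>\<^bsub>M\<^esub> x = N +>\<^bsub>M\<^esub> ?y" by (rule someI[of _ x]) (use x in auto)
    then have "x \<ominus>\<^bsub>M\<^esub> ?y \<in> N" using x coset_eq by blast
    then have "g (x \<ominus>\<^bsub>M\<^esub> ?y) = \<zero>\<^bsub>K\<^esub>" by (rule z)
    then have "g x \<ominus>\<^bsub>K\<^esub> g ?y = \<zero>\<^bsub>K\<^esub>"
      using semilinear_diff[OF abelian_group_axioms K g x] y by simp
    then have "(g x \<ominus>\<^bsub>K\<^esub> g ?y) \<oplus>\<^bsub>K\<^esub> g ?y = g ?y" using semilinear_closed[OF g] y by simp
    then show ?thesis using semilinear_closed[OF g] x y by (simp add: a_minus_def K.a_assoc K.l_neg)
  qed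
  show ?thesis
  proof (intro bexI[of _ ?h] ballI h)
    show "?h \<in> semilinear R \<sigma> (quotient_module M N) K"
      by (rule semilinearI; (elim carrier_quotientE; hypsubst)?)
        (simp_all add: h smult_coset add_coset semilinear_closed[OF g] semilinear_add[OF g]
           semilinear_smult[OF g] del: quotient_module_simps)
  qed
qed

end

section \<open>Rearranging and cancelling finite sums\<close>

section \<open>Finite sums\<close>

lemma (in abelian_monoid) finsum_bij:
  assumes "bij_betw h A B" "f \<in> B \<rightarrow> carrier G"
  shows "(\<Oplus>x\<in>B. f x) = (\<Oplus>x\<in>A. f (h x))"
  using assms finsum_reindex[of f h A] by (auto simp: bij_betw_def)

lemma (in abelian_monoid) finsum_swap:
  assumes "finite I" "finite J" "\<And>i j. i \<in> I \<Longrightarrow> j \<in> J \<Longrightarrow> F i j \<in> carrier G"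
  shows "(\<Oplus>i\<in>I. \<Oplus>j\<in>J. F i j) = (\<Oplus>j\<in>J. \<Oplus>i\<in>I. F i j)"
  using assms(1,3)
proof (induction I)
  case (insert i I)
  then have "(\<Oplus>i\<in>insert i I. \<Oplus>j\<in>J. F i j) = (\<Oplus>j\<in>J. F i j) \<oplus> (\<Oplus>j\<in>J. \<Oplus>i\<in>I. F i j)"
    by (subst finsum_insert) (auto intro!: finsum_closed)
  also have "\<dots> = (\<Oplus>j\<in>J. F i j \<oplus> (\<Oplus>i\<in>I. F i j))"
    using insert by (intro finsum_addf[symmetric]) (auto intro!: finsum_closed)
  also have "\<dots> = (\<Oplus>j\<in>J. \<Oplus>i\<in>insert i I. F i j)"
    using insert by (intro finsum_cong') (auto intro!: finsum_closed)
  finally show ?case .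
qed simp

lemma (in abelian_monoid) finsum_times:
  assumes "finite I" "finite J" "\<And>i j. i \<in> I \<Longrightarrow> j \<in> J \<Longrightarrow> F i j \<in> carrier G"
  shows "(\<Oplus>i\<in>I. \<Oplus>j\<in>J. F i j) = (\<Oplus>p\<in>I \<times> J. F (fst p) (snd p))"
  using assms(1,3)
proof (induction I)
  case (insert i I)
  have eq: "insert i I \<times> J = Pair i ` J \<union> I \<times> J" by auto
  have "(\<Oplus>p\<in>insert i I \<times> J. F (fst p) (snd p))
      = (\<Oplus>p\<in>Pair i ` J. F (fst p) (snd p)) \<oplus> (\<Oplus>p\<in>I \<times> J. F (fst p) (snd p))"
    unfolding eq by (rule finsum_Un_disjoint) (use insert assms(2) in auto)
  also have "(\<Oplus>p\<in>Pair i ` J. F (fst p) (snd p)) = (\<Oplus>j\<in>J. F i j)"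
    by (subst finsum_reindex) (use insert in \<open>auto simp: inj_on_def\<close>)
  finally show ?case
    using insert by (auto intro!: finsum_closed)
qed simp

lemma (in abelian_group) a_inv_zero [simp]: "\<ominus> \<zero> = \<zero>"
  by (rule minus_equality) simp_all

lemma (in abelian_group) finsum_minus:
  assumes "f \<in> A \<rightarrow> carrier G"
  shows "(\<Oplus>x\<in>A. \<ominus> f x) = \<ominus> (\<Oplus>x\<in>A. f x)"
proof (cases "finite A")
  case True
  then show ?thesis using assms
    by (induction A) (simp_all add: minus_add Pi_def finsum_closed)
qed simp

text \<open>The orbits \<open>{x, p x}\<close> are removed one by one, each contributing zero. Fixed
  points have a hypothesis of their own, since \<open>h x = \<ominus> h x\<close> would not give
  \<open>h x = \<zero>\<close> in the presence of 2-torsion.\<close>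

lemma (in abelian_group) finsum_involution:
  assumes "finite X" "h \<in> X \<rightarrow> carrier G"
    and "\<And>x. x \<in> X \<Longrightarrow> p x \<in> X" "\<And>x. x \<in> X \<Longrightarrow> p (p x) = x"
    and "\<And>x. x \<in> X \<Longrightarrow> p x \<noteq> x \<Longrightarrow> h (p x) = \<ominus> h x"
    and "\<And>x. x \<in> X \<Longrightarrow> p x = x \<Longrightarrow> h x = \<zero>"
  shows "(\<Oplus>x\<in>X. h x) = \<zero>"
  using assms
proof (induction "card X" arbitrary: X rule: less_induct)
  case less
  show ?case
  proof (cases "X = {}")
    case False
    then obtain x where x: "x \<in> X" by auto
    let ?Y = "X - {x, p x}"
    have px: "p x \<in> X" using less.prems x by auto
    have "card ?Y < card X" using x less.prems(1) by (intro psubset_card_mono) auto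
    moreover have "p y \<in> ?Y" if "y \<in> ?Y" for y
      using that less.prems(3,4) x px by (metis Diff_iff insertE insertI1 insertI2 singletonD)
    ultimately have Y: "(\<Oplus>x\<in>?Y. h x) = \<zero>"
      using less.prems by (intro less.hyps) auto
    have X: "X = insert x (insert (p x) ?Y)" using x px by auto
    have hx: "h x \<in> carrier G" "h (p x) \<in> carrier G" using x px less.prems by auto
    have hY: "h \<in> ?Y \<rightarrow> carrier G" using less.prems by auto
    show ?thesis
    proof (cases "p x = x")
      case True
      then have "(\<Oplus>x\<in>insert x ?Y. h x) = h x \<oplus> (\<Oplus>x\<in>?Y. h x)"
        using less.prems(1) hx hY by (intro finsum_insert) auto
      then have "(\<Oplus>x\<in>insert x ?Y. h x) = \<zero>" using Y True less.prems x by simp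
      then show ?thesis using X True by (metis insert_absorb2)
    next
      case False
      then have "(\<Oplus>x\<in>insert x (insert (p x) ?Y). h x) = h x \<oplus> (h (p x) \<oplus> (\<Oplus>x\<in>?Y. h x))"
        using less.prems(1) hx hY
        by (subst finsum_insert, simp, simp, simp, simp, subst finsum_insert) auto
      then have "(\<Oplus>x\<in>insert x (insert (p x) ?Y). h x) = \<zero>"
        using Y False less.prems x hx by (simp add: r_neg)
      then show ?thesis using X by metis
    qed
  qed simp
qed

lemma (in abelian_group) eqI_minus: "x \<in> carrier G \<Longrightarrow> y \<in> carrier G \<Longrightarrow> x \<ominus> y = \<zero> \<Longrightarrow> x = y"
  by (metis a_minus_def a_inv_closed minus_equality minus_minus)

lemma (in abelian_group) minus_self [simp]: "x \<in> carrier G \<Longrightarrow> x \<ominus> x = \<zero>"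
  by (simp add: a_minus_def r_neg)

section \<open>Alternating maps and their behaviour under permutations\<close>

section \<open>Alternating maps\<close>

text \<open>Tuples are functions on all of \<open>nat\<close>, so the clause on \<open>h\<close>
  says that only the first \<open>n\<close> values count. The last clause asks for vanishing on
  equal entries; a change of sign under transpositions can be a weaker condition if 2 is a zero
  divisor. The map \<sigma> makes room for modules over different rings.\<close>

definition alternating ::
  "('r, 'x) ring_scheme \<Rightarrow> ('r, 'm, 'y) module_scheme \<Rightarrow> ('r \<Rightarrow> 's) \<Rightarrow> ('s, 'k, 'z) module_scheme
    \<Rightarrow> nat \<Rightarrow> ((nat \<Rightarrow> 'm) \<Rightarrow> 'k) \<Rightarrow> bool"
  where "alternating R M \<sigma> N n g \<longleftrightarrow>
    (\<forall>f\<in>{..<n} \<rightarrow> carrier M. g f \<in> carrier N \<and>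
      (\<forall>h. (\<forall>i<n. h i = f i) \<longrightarrow> g h = g f) \<and>
      (\<forall>i<n. \<forall>a\<in>carrier M. \<forall>b\<in>carrier M. g (f(i := a \<oplus>\<^bsub>M\<^esub> b)) = g (f(i := a)) \<oplus>\<^bsub>N\<^esub> g (f(i := b))) \<and>
      (\<forall>i<n. \<forall>r\<in>carrier R. \<forall>a\<in>carrier M. g (f(i := r \<odot>\<^bsub>M\<^esub> a)) = \<sigma> r \<odot>\<^bsub>N\<^esub> g (f(i := a))) \<and>
      (\<forall>i<n. \<forall>j<n. i \<noteq> j \<longrightarrow> f i = f j \<longrightarrow> g f = \<zero>\<^bsub>N\<^esub>))"

lemma alternatingI:
  assumes "\<And>f. f \<in> {..<n} \<rightarrow> carrier M \<Longrightarrow> g f \<in> carrier N"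
    and "\<And>f h. f \<in> {..<n} \<rightarrow> carrier M \<Longrightarrow> (\<And>i. i < n \<Longrightarrow> h i = f i) \<Longrightarrow> g h = g f"
    and "\<And>f i a b. f \<in> {..<n} \<rightarrow> carrier M \<Longrightarrow> i < n \<Longrightarrow> a \<in> carrier M \<Longrightarrow> b \<in> carrier M \<Longrightarrow>
      g (f(i := a \<oplus>\<^bsub>M\<^esub> b)) = g (f(i := a)) \<oplus>\<^bsub>N\<^esub> g (f(i := b))"
    and "\<And>f i r a. f \<in> {..<n} \<rightarrow> carrier M \<Longrightarrow> i < n \<Longrightarrow> r \<in> carrier R \<Longrightarrow> a \<in> carrier M \<Longrightarrow>
      g (f(i := r \<odot>\<^bsub>M\<^esub> a)) = \<sigma> r \<odot>\<^bsub>N\<^esub> g (f(i := a))"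
    and "\<And>f i j. f \<in> {..<n} \<rightarrow> carrier M \<Longrightarrow> i < n \<Longrightarrow> j < n \<Longrightarrow> i \<noteq> j \<Longrightarrow> f i = f j \<Longrightarrow> g f = \<zero>\<^bsub>N\<^esub>"
  shows "alternating R M \<sigma> N n g"
  unfolding alternating_def
  apply (intro ballI conjI allI impI)
  subgoal by (rule assms(1))
  subgoal for f h by (rule assms(2)[of f h]) auto
  subgoal by (rule assms(3))
  subgoal by (rule assms(4))
  subgoal for f i j by (rule assms(5)[of f i j])
  done

lemma
  assumes "alternating R M \<sigma> N n g" "f \<in> {..<n} \<rightarrow> carrier M"
  shows alternating_closed: "g f \<in> carrier N"
    and alternating_cong: "(\<And>i. i < n \<Longrightarrow> h i = f i) \<Longrightarrow> g h = g f"
    and alternating_add: "i < n \<Longrightarrow> a \<in> carrier M \<Longrightarrow> b \<in> carrier M \<Longrightarrow>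
      g (f(i := a \<oplus>\<^bsub>M\<^esub> b)) = g (f(i := a)) \<oplus>\<^bsub>N\<^esub> g (f(i := b))"
    and alternating_smult: "i < n \<Longrightarrow> r \<in> carrier R \<Longrightarrow> a \<in> carrier M \<Longrightarrow>
      g (f(i := r \<odot>\<^bsub>M\<^esub> a)) = \<sigma> r \<odot>\<^bsub>N\<^esub> g (f(i := a))"
    and alternating_repeated: "i < n \<Longrightarrow> j < n \<Longrightarrow> i \<noteq> j \<Longrightarrow> f i = f j \<Longrightarrow> g f = \<zero>\<^bsub>N\<^esub>"
  using assms(1)[unfolded alternating_def, THEN bspec, OF assms(2)] by blast+

lemma upd_Pi: "f \<in> {..<n::nat} \<rightarrow> X \<Longrightarrow> a \<in> X \<Longrightarrow> f(i := a) \<in> {..<n} \<rightarrow> X"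
  by auto

lemma alternating_semilinear:
  assumes "alternating R M \<sigma> N n g" "f \<in> {..<n} \<rightarrow> carrier M" "i < n"
  shows "(\<lambda>a. g (f(i := a))) \<in> semilinear R \<sigma> M N"
  using alternating_closed[OF assms(1) upd_Pi[OF assms(2)]] 
    alternating_add[OF assms] alternating_smult[OF assms]
  by (intro semilinearI) auto

lemma alternating_comp:
  assumes "alternating R M \<sigma> N n g" "h \<in> semilinear S \<tau> N K" "abelian_group N" "abelian_group K"
    "\<And>r. r \<in> carrier R \<Longrightarrow> \<sigma> r \<in> carrier S"
  shows "alternating R M (\<lambda>r. \<tau> (\<sigma> r)) K n (\<lambda>f. h (g f))"
proof (rule alternatingI)
  fix f assume f: "f \<in> {..<n} \<rightarrow> carrier M"
  note c = alternating_closed[OF assms(1)]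
  show "h (g f) \<in> carrier K" using c[OF f] semilinear_closed[OF assms(2)] by auto
  show "h (g f') = h (g f)" if "\<And>i. i < n \<Longrightarrow> f' i = f i" for f'
    using alternating_cong[OF assms(1) f that] by simp
  show "h (g f) = \<zero>\<^bsub>K\<^esub>" if "i < n" "j < n" "i \<noteq> j" "f i = f j" for i j
    using alternating_repeated[OF assms(1) f that] semilinear_zero[OF assms(3,4,2)] by simp
  fix i a assume i: "i < n" and a: "a \<in> carrier M"
  show "h (g (f(i := a \<oplus>\<^bsub>M\<^esub> b))) = h (g (f(i := a))) \<oplus>\<^bsub>K\<^esub> h (g (f(i := b)))" if b: "b \<in> carrier M" for b
    using semilinear_add[OF assms(2) c[OF upd_Pi[OF f a]] c[OF upd_Pi[OF f b]]]
      alternating_add[OF assms(1) f i a b] by simp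
  show "h (g (f(i := r \<odot>\<^bsub>M\<^esub> a))) = \<tau> (\<sigma> r) \<odot>\<^bsub>K\<^esub> h (g (f(i := a)))" if r: "r \<in> carrier R" for r
    using semilinear_smult[OF assms(2) assms(5)[OF r] c[OF upd_Pi[OF f a]]]
      alternating_smult[OF assms(1) f i r a] by simp
qed

locale alternating_map = M: module R M + N: module S N
  for R (structure) and M (structure) and S and N +
  fixes \<sigma> n g
  assumes \<sigma>: "\<sigma> \<in> ring_hom R S"
    and alt: "alternating R M \<sigma> N n g"
begin

text \<open>Evaluates \<open>g\<close> with \<open>f i \<oplus> f j\<close> in both places
  \<open>i\<close> and \<open>j\<close>: this value and the two terms with a repeated entry vanish,
  so the two mixed terms cancel.\<close>

lemma transpose:
  assumes f: "f \<in> {..<n} \<rightarrow> carrier M" and ij: "i < n" "j < n" "i \<noteq> j"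
  shows "g (f \<circ> Transposition.transpose i j) = \<ominus>\<^bsub>N\<^esub> g f"
proof -
  define F where "F a b = g (f(i := a, j := b))" for a b
  have c: "a \<in> carrier M \<Longrightarrow> b \<in> carrier M \<Longrightarrow> F a b \<in> carrier N" for a b
    unfolding F_def using f by (intro alternating_closed[OF alt]) auto
  have a1: "F (a \<oplus>\<^bsub>M\<^esub> b) x = F a x \<oplus>\<^bsub>N\<^esub> F b x" if "a \<in> carrier M" "b \<in> carrier M" "x \<in> carrier M" for a b x
    unfolding F_def using alternating_add[OF alt upd_Pi[OF f that(3), of j] ij(1) that(1,2)] ij
    by (simp add: fun_upd_twist)
  have a2: "F x (a \<oplus>\<^bsub>M\<^esub> b) = F x a \<oplus>\<^bsub>N\<^esub> F x b" if "a \<in> carrier M" "b \<in> carrier M" "x \<in> carrier M" for a b x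
    unfolding F_def using alternating_add[OF alt upd_Pi[OF f that(3), of i] ij(2) that(1,2)] by simp
  have z: "F a a = \<zero>\<^bsub>N\<^esub>" if "a \<in> carrier M" for a
    unfolding F_def using f that ij by (intro alternating_repeated[OF alt _ ij]) auto
  have fi: "f i \<in> carrier M" "f j \<in> carrier M" using f ij by auto
  have "F (f i \<oplus>\<^bsub>M\<^esub> f j) (f i \<oplus>\<^bsub>M\<^esub> f j) =
      (F (f i) (f i) \<oplus>\<^bsub>N\<^esub> F (f j) (f i)) \<oplus>\<^bsub>N\<^esub> (F (f i) (f j) \<oplus>\<^bsub>N\<^esub> F (f j) (f j))"
    by (simp only: a1 a2 M.M.a_closed fi)
  then have "F (f j) (f i) \<oplus>\<^bsub>N\<^esub> F (f i) (f j) = \<zero>\<^bsub>N\<^esub>"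
    using fi z[OF fi(1)] z[OF fi(2)] z[OF M.M.a_closed[OF fi]] by (simp add: N.M.a_comm c)
  moreover have "F (f i) (f j) = g f" by (simp add: F_def)
  moreover have "F (f j) (f i) = g (f \<circ> Transposition.transpose i j)"
    unfolding F_def using ij by (intro arg_cong[of _ _ g]) (auto simp: Transposition.transpose_def)
  ultimately show ?thesis using c fi by (metis N.M.minus_equality)
qed

text \<open>Induction on a product of transpositions. The claim is first generalized over
  \<open>f\<close>, because peeling off a transposition changes the tuple.\<close>

lemma permute:
  assumes p: "p permutes {..<n}" and f: "f \<in> {..<n} \<rightarrow> carrier M"
  shows "g (f \<circ> p) = (if evenperm p then g f else \<ominus>\<^bsub>N\<^esub> g f)"
proof -
  have "\<forall>f\<in>{..<n} \<rightarrow> carrier M. g (f \<circ> p) = (if evenperm p then g f else \<ominus>\<^bsub>N\<^esub> g f)"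
    using p finite_lessThan
  proof (induction rule: permutes_induct)
    case id
    then show ?case by simp
  next
    case (swap a b p)
    show ?case
    proof
      fix f assume f: "f \<in> {..<n} \<rightarrow> carrier M"
      let ?t = "Transposition.transpose a b"
      have t: "?t permutes {..<n}" using swap by (intro permutes_swap_id) auto
      have ft: "f \<circ> ?t \<in> {..<n} \<rightarrow> carrier M" using f permutes_in_image[OF t] by auto
      have "evenperm (?t \<circ> p) \<longleftrightarrow> \<not> evenperm p"
        using swap by (subst evenperm_comp) (auto simp: evenperm_swap permutation_swap_id intro: permutation_permutes[THEN iffD2])
      moreover have "g (f \<circ> ?t) = \<ominus>\<^bsub>N\<^esub> g f" using swap by (intro transpose f) auto
      moreover have "g (f \<circ> ?t \<circ> p) = (if evenperm p then g (f \<circ> ?t) else \<ominus>\<^bsub>N\<^esub> g (f \<circ> ?t))"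
        using swap(5) ft by blast
      ultimately show "g (f \<circ> (?t \<circ> p)) = (if evenperm (?t \<circ> p) then g f else \<ominus>\<^bsub>N\<^esub> g f)"
        using alternating_closed[OF alt f] unfolding o_assoc by simp
    qed
  qed
  then show ?thesis using f by blast
qed

end

section \<open>Exterior powers and their universal property\<close>

section \<open>Exterior powers\<close>

lemma tuples_conv: "xs \<in> tuples M n \<longleftrightarrow> (\<exists>f\<in>{..<n} \<rightarrow> carrier M. xs = map f [0..<n])"
proof
  assume xs: "xs \<in> tuples M n"
  then have "xs = map ((!) xs) [0..<n]" by (intro nth_equalityI) (auto simp: tuples_def)
  moreover have "(!) xs \<in> {..<n} \<rightarrow> carrier M" using xs by (auto simp: tuples_def)
  ultimately show "\<exists>f\<in>{..<n} \<rightarrow> carrier M. xs = map f [0..<n]" by blast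
qed (auto simp: tuples_def Pi_iff)

text \<open>Exterior powers are built on lists, while permuting and updating entries is easier for
  functions on \<open>nat\<close>; this is the wedge in the second form.\<close>

definition wedge_fun ::
  "('r, 'x) ring_scheme \<Rightarrow> nat \<Rightarrow> ('r, 'm, 'y) module_scheme \<Rightarrow> (nat \<Rightarrow> 'm) \<Rightarrow> ('m list \<Rightarrow> 'r) set"
  where "wedge_fun R n M f = wedge R n M (map f [0..<n])"

lemma map_upd_upt: "i < n \<Longrightarrow> map (f(i := a)) [0..<n] = (map f [0..<n])[i := a]"
  by (intro nth_equalityI) auto

locale exterior_power = M: module R M for R (structure) and M (structure) + fixes n :: nat
begin

abbreviation "F \<equiv> tuple_module R n M"
abbreviation "K \<equiv> wedge_kernel R n M"
abbreviation "L \<equiv> ext_power R n M"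
abbreviation "W \<equiv> wedge_fun R n M"
abbreviation "vecs \<equiv> {..<n} \<rightarrow> carrier M"

sublocale F: module R F by (rule M.R.free_module_module)

lemma tuples_upd: "xs \<in> tuples M n \<Longrightarrow> a \<in> carrier M \<Longrightarrow> xs[i := a] \<in> tuples M n"
  by (auto simp: tuples_def dest: set_update_subset_insert[THEN subsetD])

lemma relators_closed: "wedge_relators R n M \<subseteq> carrier F"
  unfolding wedge_relators_def
  by (auto intro!: F.M.minus_closed F.M.a_closed F.smult_closed M.R.single_closed tuples_upd
      simp del: free_module_simps)

lemma kernel_submodule: "submodule K R F"
proof (rule F.submoduleI)
  have "submodule (carrier F) R F \<and> wedge_relators R n M \<subseteq> carrier F"
    using F.carrier_is_submodule relators_closed by blast
  then show "K \<subseteq> carrier F" unfolding wedge_kernel_def by blast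
  show "\<zero>\<^bsub>F\<^esub> \<in> K"
    unfolding wedge_kernel_def by (auto dest!: submodule.axioms(1) subgroup.one_closed)
  fix a assume "a \<in> K"
  then show "\<ominus>\<^bsub>F\<^esub> a \<in> K" unfolding wedge_kernel_def using F.submoduleE(3) by blast
  show "a \<oplus>\<^bsub>F\<^esub> b \<in> K" if "b \<in> K" for b
    using \<open>a \<in> K\<close> that unfolding wedge_kernel_def using F.submoduleE(5) by blast
  show "r \<odot>\<^bsub>F\<^esub> a \<in> K" if "r \<in> carrier R" for r
    using \<open>a \<in> K\<close> that unfolding wedge_kernel_def using F.submoduleE(4) by blast
qed

sublocale Q: module_quotient R F K
  by (rule module_quotient.intro[OF F.module_axioms module_quotient_axioms.intro[OF kernel_submodule]])

lemma L_eq: "L = quotient_module F K" by (simp add: ext_power_def)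

sublocale L: module R L unfolding L_eq by (rule Q.quotient_module)

lemma W_eq: "W f = K +>\<^bsub>F\<^esub> single R (map f [0..<n])"
  by (simp add: wedge_fun_def wedge_def)

lemma relators_sub: "wedge_relators R n M \<subseteq> K" unfolding wedge_kernel_def by blast

lemma W_alternating: "alternating R M id L n W"
proof (rule alternatingI)
  fix f assume f: "f \<in> vecs"
  let ?xs = "map f [0..<n]"
  have xs: "?xs \<in> tuples M n" using f tuples_conv by blast
  show "W f \<in> carrier L" unfolding L_eq W_eq
    by (intro Q.coset_in M.R.single_closed xs)
  show "W h = W f" if "\<And>i. i < n \<Longrightarrow> h i = f i" for h
    unfolding W_eq using that by (metis (no_types, lifting) atLeastLessThan_iff atLeastLessThan_upt map_cong)
  show "W f = \<zero>\<^bsub>L\<^esub>" if ij: "i < n" "j < n" "i \<noteq> j" "f i = f j" for i j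
  proof -
    have *: "single R ?xs \<in> wedge_relators R n M" if "i < j" "j < n" "f i = f j" for i j
      unfolding wedge_relators_def using xs that by fastforce
    have "single R ?xs \<in> K"
      using *[of i j] *[of j i] ij relators_sub by (metis linorder_neqE_nat subsetD)
    then show ?thesis
      unfolding W_eq L_eq using Q.coset_zero[OF M.R.single_closed[OF xs]] by simp
  qed
  fix i a assume i: "i < n" and a: "a \<in> carrier M"
  have sc: "single R (?xs[i := b]) \<in> carrier F" if "b \<in> carrier M" for b
    using xs that by (intro M.R.single_closed tuples_upd)
  show "W (f(i := a \<oplus>\<^bsub>M\<^esub> b)) = W (f(i := a)) \<oplus>\<^bsub>L\<^esub> W (f(i := b))" if b: "b \<in> carrier M" for b
  proof -
    have "single R (?xs[i := a \<oplus>\<^bsub>M\<^esub> b]) \<ominus>\<^bsub>F\<^esub> (single R (?xs[i := a]) \<oplus>\<^bsub>F\<^esub> single R (?xs[i := b])) \<in> wedge_relators R n M"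
      unfolding wedge_relators_def using xs i a b by blast
    then have "single R (?xs[i := a \<oplus>\<^bsub>M\<^esub> b]) \<ominus>\<^bsub>F\<^esub> (single R (?xs[i := a]) \<oplus>\<^bsub>F\<^esub> single R (?xs[i := b])) \<in> K"
      using relators_sub by blast
    then have "K +>\<^bsub>F\<^esub> single R (?xs[i := a \<oplus>\<^bsub>M\<^esub> b]) = K +>\<^bsub>F\<^esub> (single R (?xs[i := a]) \<oplus>\<^bsub>F\<^esub> single R (?xs[i := b]))"
      by (subst Q.coset_eq) (intro sc F.M.a_closed M.M.a_closed a b | assumption)+
    also have "\<dots> = (K +>\<^bsub>F\<^esub> single R (?xs[i := a])) \<oplus>\<^bsub>L\<^esub> (K +>\<^bsub>F\<^esub> single R (?xs[i := b]))"
      unfolding L_eq by (rule Q.add_coset[symmetric]) (intro sc a b)+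
    finally show ?thesis unfolding W_eq map_upd_upt[OF i] .
  qed
  show "W (f(i := r \<odot>\<^bsub>M\<^esub> a)) = id r \<odot>\<^bsub>L\<^esub> W (f(i := a))" if r: "r \<in> carrier R" for r
  proof -
    have "single R (?xs[i := r \<odot>\<^bsub>M\<^esub> a]) \<ominus>\<^bsub>F\<^esub> (r \<odot>\<^bsub>F\<^esub> single R (?xs[i := a])) \<in> wedge_relators R n M"
      unfolding wedge_relators_def using xs i a r by blast
    then have "single R (?xs[i := r \<odot>\<^bsub>M\<^esub> a]) \<ominus>\<^bsub>F\<^esub> (r \<odot>\<^bsub>F\<^esub> single R (?xs[i := a])) \<in> K"
      using relators_sub by blast
    then have "K +>\<^bsub>F\<^esub> single R (?xs[i := r \<odot>\<^bsub>M\<^esub> a]) = K +>\<^bsub>F\<^esub> (r \<odot>\<^bsub>F\<^esub> single R (?xs[i := a]))"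
      by (subst Q.coset_eq) (intro sc F.smult_closed M.smult_closed a r | assumption)+
    also have "\<dots> = r \<odot>\<^bsub>L\<^esub> (K +>\<^bsub>F\<^esub> single R (?xs[i := a]))"
      unfolding L_eq by (rule Q.smult_coset[symmetric]) (intro sc a r)+
    finally show ?thesis unfolding W_eq map_upd_upt[OF i] id_def .
  qed
qed

lemmas W_closed [simp, intro] = alternating_closed[OF W_alternating]

lemma L_induct [consumes 1, case_names zero add smult]:
  assumes X: "X \<in> carrier L"
    and z: "P \<zero>\<^bsub>L\<^esub>"
    and a: "\<And>X Y. X \<in> carrier L \<Longrightarrow> Y \<in> carrier L \<Longrightarrow> P X \<Longrightarrow> P Y \<Longrightarrow> P (X \<oplus>\<^bsub>L\<^esub> Y)"
    and s: "\<And>r f. r \<in> carrier R \<Longrightarrow> f \<in> vecs \<Longrightarrow> P (r \<odot>\<^bsub>L\<^esub> W f)"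
  shows "P X"
proof -
  obtain c where c: "c \<in> carrier F" "X = K +>\<^bsub>F\<^esub> c"
    using X unfolding L_eq by (rule Q.carrier_quotientE)
  note lin = Q.coset_linear[folded L_eq]
  have "P (K +>\<^bsub>F\<^esub> c)" using c(1)
  proof (induction rule: M.R.free_module_induct)
    case zero
    have "K +>\<^bsub>F\<^esub> \<zero>\<^bsub>F\<^esub> = \<zero>\<^bsub>L\<^esub>" by (rule semilinear_zero[OF F.abelian_group_axioms L.abelian_group_axioms lin])
    then show ?case using z by simp
  next
    case (add c d)
    have "K +>\<^bsub>F\<^esub> (c \<oplus>\<^bsub>F\<^esub> d) = (K +>\<^bsub>F\<^esub> c) \<oplus>\<^bsub>L\<^esub> (K +>\<^bsub>F\<^esub> d)" 
      by (rule semilinear_add[OF lin]) (use add in auto)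
    then show ?case using a[of "K +>\<^bsub>F\<^esub> c" "K +>\<^bsub>F\<^esub> d"] add semilinear_closed[OF lin] by simp
  next
    case (single r xs)
    have "K +>\<^bsub>F\<^esub> (r \<odot>\<^bsub>F\<^esub> single R xs) = r \<odot>\<^bsub>L\<^esub> (K +>\<^bsub>F\<^esub> single R xs)" 
      using semilinear_smult[OF lin, of r "single R xs"] single by simp
    moreover obtain f where "f \<in> vecs" "xs = map f [0..<n]" using single(2) unfolding tuples_conv by blast
    ultimately show ?case using s[of r f] single by (simp add: W_eq)
  qed
  then show ?thesis using c by simp
qed

text \<open>Semilinear maps on an exterior power are compared on wedges; most identities on
  \<open>L\<close> below are obtained in this way.\<close>

lemma L_ext:
  assumes "abelian_group N" "h \<in> semilinear R \<sigma> L N" "k \<in> semilinear R \<sigma> L N"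
    and "\<And>f. f \<in> vecs \<Longrightarrow> h (W f) = k (W f)" and X: "X \<in> carrier L"
  shows "h X = k X"
  using X
proof (induction rule: L_induct)
  case zero
  then show ?case using assms(1-3) L.abelian_group_axioms by (simp add: semilinear_zero)
next
  case (add X Y)
  then show ?case by (simp add: semilinear_add[OF assms(2)] semilinear_add[OF assms(3)])
next
  case (smult r f)
  then show ?case by (simp add: semilinear_smult[OF assms(2)] semilinear_smult[OF assms(3)] assms(4))
qed

text \<open>The linear extension of \<open>g\<close> to the free module on tuples kills the three
  kinds of relators by the three algebraic clauses of \<open>alternating\<close>. Its zero set is a
  submodule, hence contains the kernel, and the extension descends.\<close>

lemma L_lift:
  assumes N: "module S N" and \<sigma>: "\<sigma> \<in> ring_hom R S" and g: "alternating R M \<sigma> N n g"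
  shows "\<exists>h\<in>semilinear R \<sigma> L N. \<forall>f\<in>vecs. h (W f) = g f"
proof -
  interpret N: module S N by fact
  \<comment> \<open>\<open>(!) xs\<close> is arbitrary from position \<open>n\<close> on, which is
    harmless because \<open>g\<close> looks at the first \<open>n\<close> entries only.\<close>
  define g' where "g' xs = g ((!) xs)" for xs
  have g': "g' (map f [0..<n]) = g f" if "f \<in> vecs" for f
    unfolding g'_def by (rule alternating_cong[OF g that]) simp
  have g'c: "g' xs \<in> carrier N" if "xs \<in> tuples M n" for xs
    unfolding g'_def by (rule alternating_closed[OF g]) (use that in \<open>auto simp: tuples_def\<close>)
  let ?h = "free_lift R \<sigma> N g'"
  have h: "?h \<in> semilinear R \<sigma> F N" and hs: "\<And>xs. xs \<in> tuples M n \<Longrightarrow> ?h (single R xs) = g' xs"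
    using free_lift[OF M.R.is_cring N \<sigma>, of "tuples M n" g'] g'c by auto
  note hd = semilinear_diff[OF F.abelian_group_axioms N.abelian_group_axioms h]
  let ?Z = "{c \<in> carrier F. ?h c = \<zero>\<^bsub>N\<^esub>}"
  have Z: "submodule ?Z R F"
  proof (rule F.submoduleI)
    show "\<zero>\<^bsub>F\<^esub> \<in> ?Z" using semilinear_zero[OF F.abelian_group_axioms N.abelian_group_axioms h] F.M.zero_closed by blast
    show "\<ominus>\<^bsub>F\<^esub> c \<in> ?Z" if "c \<in> ?Z" for c
      using that semilinear_minus[OF F.abelian_group_axioms N.abelian_group_axioms h, of c] by auto
    show "c \<oplus>\<^bsub>F\<^esub> d \<in> ?Z" if "c \<in> ?Z" "d \<in> ?Z" for c d
      using that semilinear_add[OF h, of c d] F.M.a_closed[of c d] by (simp del: free_module_simps)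
    show "r \<odot>\<^bsub>F\<^esub> d \<in> ?Z" if "r \<in> carrier R" "d \<in> ?Z" for r d
      using that semilinear_smult[OF h, of r d] F.smult_closed[of r d] ring_hom_closed[OF \<sigma>] by (simp del: free_module_simps)
  qed auto
  have "wedge_relators R n M \<subseteq> ?Z"
  proof
    fix c assume c: "c \<in> wedge_relators R n M"
    then have cF: "c \<in> carrier F" using relators_closed by blast
    consider (add) xs i a b where "c = single R (xs[i := a \<oplus>\<^bsub>M\<^esub> b]) \<ominus>\<^bsub>F\<^esub> (single R (xs[i := a]) \<oplus>\<^bsub>F\<^esub> single R (xs[i := b]))" 
        "xs \<in> tuples M n" "i < n" "a \<in> carrier M" "b \<in> carrier M"
      | (smult) xs i r a where "c = single R (xs[i := r \<odot>\<^bsub>M\<^esub> a]) \<ominus>\<^bsub>F\<^esub> (r \<odot>\<^bsub>F\<^esub> single R (xs[i := a]))" 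
        "xs \<in> tuples M n" "i < n" "a \<in> carrier M" "r \<in> carrier R"
      | (eq) xs i j where "c = single R xs" "xs \<in> tuples M n" "i < j" "j < n" "xs ! i = xs ! j"
      using c unfolding wedge_relators_def by (elim UnE CollectE exE conjE) (rule that, assumption+)+
    then have "?h c = \<zero>\<^bsub>N\<^esub>"
    proof cases
      case add
      obtain f where f: "f \<in> vecs" "xs = map f [0..<n]" using add(2) unfolding tuples_conv by blast
      have s: "\<And>a. a \<in> carrier M \<Longrightarrow> xs[i := a] \<in> tuples M n \<and> g' (xs[i := a]) = g (f(i := a))"
        using f add by (metis g' map_upd_upt tuples_upd upd_Pi)
      have "?h c = g (f(i := a \<oplus>\<^bsub>M\<^esub> b)) \<ominus>\<^bsub>N\<^esub> (g (f(i := a)) \<oplus>\<^bsub>N\<^esub> g (f(i := b)))"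
        using s add unfolding add(1)
        by (subst hd) (simp_all add: hs s semilinear_add[OF h] F.M.a_closed del: free_module_simps)
      also have "\<dots> = \<zero>\<^bsub>N\<^esub>" using alternating_add[OF g f(1) add(3-5)]
        alternating_closed[OF g upd_Pi[OF f(1)]] add by simp
      finally show ?thesis .
    next
      case smult
      obtain f where f: "f \<in> vecs" "xs = map f [0..<n]" using smult(2) unfolding tuples_conv by blast
      have s: "\<And>a. a \<in> carrier M \<Longrightarrow> xs[i := a] \<in> tuples M n \<and> g' (xs[i := a]) = g (f(i := a))"
        using f smult by (metis g' map_upd_upt tuples_upd upd_Pi)
      have "?h c = g (f(i := r \<odot>\<^bsub>M\<^esub> a)) \<ominus>\<^bsub>N\<^esub> (\<sigma> r \<odot>\<^bsub>N\<^esub> g (f(i := a)))"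
        using s smult unfolding smult(1)
        by (subst hd) (simp_all add: hs s semilinear_smult[OF h] F.smult_closed del: free_module_simps)
      also have "\<dots> = \<zero>\<^bsub>N\<^esub>" using alternating_smult[OF g f(1) smult(3,5,4)]
        alternating_closed[OF g upd_Pi[OF f(1)]] smult ring_hom_closed[OF \<sigma>] by simp
      finally show ?thesis .
    next
      case eq
      obtain f where f: "f \<in> vecs" "xs = map f [0..<n]" using eq(2) unfolding tuples_conv by blast
      then show ?thesis using alternating_repeated[OF g f(1), of i j] eq hs[OF eq(2)] g'[OF f(1)] by auto
    qed
    then show "c \<in> ?Z" using cF by blast
  qed
  then have KZ: "K \<subseteq> ?Z" using Z unfolding wedge_kernel_def by blast
  then have "\<exists>k\<in>semilinear R \<sigma> (quotient_module F K) N. \<forall>x\<in>carrier F. k (K +>\<^bsub>F\<^esub> x) = ?h x"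
    by (intro Q.quotient_lift h N.abelian_group_axioms) auto
  then obtain k where k: "k \<in> semilinear R \<sigma> L N" "\<And>x. x \<in> carrier F \<Longrightarrow> k (K +>\<^bsub>F\<^esub> x) = ?h x"
    unfolding L_eq by blast
  have "k (W f) = g f" if f: "f \<in> vecs" for f
  proof -
    have "map f [0..<n] \<in> tuples M n" using f tuples_conv by blast
    then show ?thesis by (simp add: W_eq k(2) hs g' f)
  qed
  then show ?thesis using k(1) by blast
qed

end

section \<open>Multilinear maps: sums, differences, compositions, permuted arguments\<close>

section \<open>Multilinear maps\<close>

definition multilinear ::
  "('r, 'x) ring_scheme \<Rightarrow> ('r, 'm, 'y) module_scheme \<Rightarrow> ('r \<Rightarrow> 's) \<Rightarrow> ('s, 'k, 'z) module_scheme
    \<Rightarrow> nat \<Rightarrow> ((nat \<Rightarrow> 'm) \<Rightarrow> 'k) \<Rightarrow> bool"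
  where "multilinear R M \<sigma> N n g \<longleftrightarrow>
    (\<forall>f\<in>{..<n} \<rightarrow> carrier M.
      (\<forall>h. (\<forall>i<n. h i = f i) \<longrightarrow> g h = g f) \<and> g f \<in> carrier N \<and>
      (\<forall>i<n. (\<lambda>a. g (f(i := a))) \<in> semilinear R \<sigma> M N))"

lemma multilinearI:
  assumes "\<And>f. f \<in> {..<n} \<rightarrow> carrier M \<Longrightarrow> g f \<in> carrier N"
    and "\<And>f h. f \<in> {..<n} \<rightarrow> carrier M \<Longrightarrow> (\<And>i. i < n \<Longrightarrow> h i = f i) \<Longrightarrow> g h = g f"
    and "\<And>f i. f \<in> {..<n} \<rightarrow> carrier M \<Longrightarrow> i < n \<Longrightarrow> (\<lambda>a. g (f(i := a))) \<in> semilinear R \<sigma> M N"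
  shows "multilinear R M \<sigma> N n g"
  unfolding multilinear_def
  apply (intro ballI conjI allI impI)
  subgoal for f h by (rule assms(2)[of f h]) auto
  subgoal by (rule assms(1))
  subgoal by (rule assms(3))
  done

lemma
  assumes "multilinear R M \<sigma> N n g" "f \<in> {..<n} \<rightarrow> carrier M"
  shows multilinear_closed: "g f \<in> carrier N"
    and multilinear_cong: "(\<And>i. i < n \<Longrightarrow> h i = f i) \<Longrightarrow> g h = g f"
    and multilinear_semilinear: "i < n \<Longrightarrow> (\<lambda>a. g (f(i := a))) \<in> semilinear R \<sigma> M N"
  using assms(1)[unfolded multilinear_def, THEN bspec, OF assms(2)] by blast+

lemma alternating_multilinear: "alternating R M \<sigma> N n g \<Longrightarrow> multilinear R M \<sigma> N n g"
  by (rule multilinearI) (rule alternating_closed alternating_cong alternating_semilinear, assumption+)+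

lemma multilinear_alternating:
  assumes m: "multilinear R M \<sigma> N n g"
    and r: "\<And>f i j. f \<in> {..<n} \<rightarrow> carrier M \<Longrightarrow> i < n \<Longrightarrow> j < n \<Longrightarrow> i \<noteq> j \<Longrightarrow> f i = f j \<Longrightarrow> g f = \<zero>\<^bsub>N\<^esub>"
  shows "alternating R M \<sigma> N n g"
proof (rule alternatingI)
  fix f assume f: "f \<in> {..<n} \<rightarrow> carrier M"
  show "g f \<in> carrier N" by (rule multilinear_closed[OF m f])
  show "g h = g f" if "\<And>i. i < n \<Longrightarrow> h i = f i" for h by (rule multilinear_cong[OF m f that])
  fix i assume i: "i < n"
  note s = multilinear_semilinear[OF m f i]
  show "g (f(i := a \<oplus>\<^bsub>M\<^esub> b)) = g (f(i := a)) \<oplus>\<^bsub>N\<^esub> g (f(i := b))" if "a \<in> carrier M" "b \<in> carrier M" for a b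
    by (rule semilinear_add[OF s that])
  show "g (f(i := r \<odot>\<^bsub>M\<^esub> a)) = \<sigma> r \<odot>\<^bsub>N\<^esub> g (f(i := a))" if "r \<in> carrier R" "a \<in> carrier M" for r a
    by (rule semilinear_smult[OF s that])
qed (rule r)

lemma semilinear_sum:
  assumes "module S N" "\<And>r. r \<in> carrier R \<Longrightarrow> \<sigma> r \<in> carrier S"
    and h: "\<And>i. i \<in> I \<Longrightarrow> h i \<in> semilinear R \<sigma> M N"
  shows "(\<lambda>x. \<Oplus>\<^bsub>N\<^esub>i\<in>I. h i x) \<in> semilinear R \<sigma> M N"
proof -
  interpret N: module S N by fact
  show ?thesis
  proof (cases "finite I")
    case True
    show ?thesis
    proof (rule semilinearI)
      fix x assume x: "x \<in> carrier M"
      note c = semilinear_closed[OF h]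
      show "(\<Oplus>\<^bsub>N\<^esub>i\<in>I. h i x) \<in> carrier N" using c x by (intro N.M.finsum_closed) auto
      show "(\<Oplus>\<^bsub>N\<^esub>i\<in>I. h i (x \<oplus>\<^bsub>M\<^esub> y)) = (\<Oplus>\<^bsub>N\<^esub>i\<in>I. h i x) \<oplus>\<^bsub>N\<^esub> (\<Oplus>\<^bsub>N\<^esub>i\<in>I. h i y)" if y: "y \<in> carrier M" for y
      proof -
        have "(\<Oplus>\<^bsub>N\<^esub>i\<in>I. h i (x \<oplus>\<^bsub>M\<^esub> y)) = (\<Oplus>\<^bsub>N\<^esub>i\<in>I. h i x \<oplus>\<^bsub>N\<^esub> h i y)"
          using x y by (intro N.M.finsum_cong') (auto simp: semilinear_add[OF h] intro!: c)
        then show ?thesis using x y c by (simp add: N.M.finsum_addf Pi_iff)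
      qed
      show "(\<Oplus>\<^bsub>N\<^esub>i\<in>I. h i (r \<odot>\<^bsub>M\<^esub> x)) = \<sigma> r \<odot>\<^bsub>N\<^esub> (\<Oplus>\<^bsub>N\<^esub>i\<in>I. h i x)" if r: "r \<in> carrier R" for r
      proof -
        have "(\<Oplus>\<^bsub>N\<^esub>i\<in>I. h i (r \<odot>\<^bsub>M\<^esub> x)) = (\<Oplus>\<^bsub>N\<^esub>i\<in>I. \<sigma> r \<odot>\<^bsub>N\<^esub> h i x)"
          using x r assms(2) by (intro N.M.finsum_cong') (auto simp: semilinear_smult[OF h] intro!: c N.smult_closed)
        then show ?thesis using x r c assms(2) True by (simp add: N.finsum_smult_ldistr Pi_iff)
      qed
    qed
  next
    case False
    then show ?thesis using assms(2) by (intro semilinearI) auto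
  qed
qed

lemma semilinear_diff_fun:
  assumes "module S N" "\<And>r. r \<in> carrier R \<Longrightarrow> \<sigma> r \<in> carrier S"
    and h: "h \<in> semilinear R \<sigma> M N" and k: "k \<in> semilinear R \<sigma> M N"
  shows "(\<lambda>x. h x \<ominus>\<^bsub>N\<^esub> k x) \<in> semilinear R \<sigma> M N"
proof -
  interpret N: module S N by fact
  note hc = semilinear_closed[OF h] and kc = semilinear_closed[OF k]
  show ?thesis
    by (rule semilinearI)
      (simp_all add: hc kc semilinear_add[OF h] semilinear_add[OF k] semilinear_smult[OF h] semilinear_smult[OF k]
        a_minus_def N.M.minus_add N.M.a_ac N.smult_r_distr N.smult_r_minus assms(2))
qed

lemma semilinear_add_fun:
  assumes "module S N" "\<And>r. r \<in> carrier R \<Longrightarrow> \<sigma> r \<in> carrier S"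
    and h: "h \<in> semilinear R \<sigma> M N" and k: "k \<in> semilinear R \<sigma> M N"
  shows "(\<lambda>x. h x \<oplus>\<^bsub>N\<^esub> k x) \<in> semilinear R \<sigma> M N"
proof -
  interpret N: module S N by fact
  note hc = semilinear_closed[OF h] and kc = semilinear_closed[OF k]
  show ?thesis
    by (rule semilinearI)
      (simp_all add: hc kc semilinear_add[OF h] semilinear_add[OF k] semilinear_smult[OF h] semilinear_smult[OF k]
        N.M.a_ac N.smult_r_distr assms(2))
qed

lemma semilinear_scale:
  assumes "module S N" "\<And>r. r \<in> carrier R \<Longrightarrow> \<sigma> r \<in> carrier S"
    and h: "h \<in> semilinear R \<sigma> M N" and c: "c \<in> carrier S"
  shows "(\<lambda>x. c \<odot>\<^bsub>N\<^esub> h x) \<in> semilinear R \<sigma> M N"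
proof -
  interpret N: module S N by fact
  note hc = semilinear_closed[OF h]
  show ?thesis
  proof (rule semilinearI)
    fix r x assume "r \<in> carrier R" "x \<in> carrier M"
    then have "c \<odot>\<^bsub>N\<^esub> (\<sigma> r \<odot>\<^bsub>N\<^esub> h x) = \<sigma> r \<odot>\<^bsub>N\<^esub> (c \<odot>\<^bsub>N\<^esub> h x)"
      using hc assms(2) c by (simp add: N.smult_assoc1[symmetric] N.R.m_comm)
    then show "c \<odot>\<^bsub>N\<^esub> h (r \<odot>\<^bsub>M\<^esub> x) = \<sigma> r \<odot>\<^bsub>N\<^esub> (c \<odot>\<^bsub>N\<^esub> h x)"
      using \<open>r \<in> carrier R\<close> \<open>x \<in> carrier M\<close> by (simp add: semilinear_smult[OF h])
  qed (simp_all add: hc c semilinear_add[OF h] N.smult_r_distr)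
qed

lemma semilinear_smult_left:
  assumes "module S N" "\<And>r. r \<in> carrier R \<Longrightarrow> \<sigma> r \<in> carrier S"
    and h: "h \<in> semilinear R \<sigma> M (self_module S)" and y: "y \<in> carrier N"
  shows "(\<lambda>x. h x \<odot>\<^bsub>N\<^esub> y) \<in> semilinear R \<sigma> M N"
proof -
  interpret N: module S N by fact
  have hc: "x \<in> carrier M \<Longrightarrow> h x \<in> carrier S" for x using semilinear_closed[OF h] by auto
  show ?thesis
    by (rule semilinearI)
      (simp_all add: hc y semilinear_add[OF h] semilinear_smult[OF h] N.smult_l_distr N.smult_assoc1 assms(2))
qed

text \<open>One scheme for sums, differences and compositions: an operation \<open>opr\<close> on
  families indexed by \<open>I\<close> that respects carriers and takes semilinear maps to a
  semilinear map can be applied to multilinear maps.\<close>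

lemma multilinear_lift_op:
  assumes m: "\<And>i. i \<in> I \<Longrightarrow> multilinear R M \<sigma> N n (g i)"
    and c: "\<And>h. (\<And>i. i \<in> I \<Longrightarrow> h i \<in> carrier N) \<Longrightarrow> opr h \<in> carrier N'"
    and s: "\<And>h. (\<And>i. i \<in> I \<Longrightarrow> h i \<in> semilinear R \<sigma> M N) \<Longrightarrow> (\<lambda>x. opr (\<lambda>i. h i x)) \<in> semilinear R \<sigma>' M N'"
    and e: "\<And>h k. (\<And>i. i \<in> I \<Longrightarrow> h i = k i) \<Longrightarrow> (\<And>i. i \<in> I \<Longrightarrow> h i \<in> carrier N) \<Longrightarrow> opr h = opr k"
  shows "multilinear R M \<sigma>' N' n (\<lambda>f. opr (\<lambda>i. g i f))"
proof (rule multilinearI)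
  fix f assume f: "f \<in> {..<n} \<rightarrow> carrier M"
  show "opr (\<lambda>i. g i f) \<in> carrier N'"
    by (rule c) (rule multilinear_closed[OF m f])
  show "opr (\<lambda>i. g i h) = opr (\<lambda>i. g i f)" if h: "\<And>i. i < n \<Longrightarrow> h i = f i" for h
  proof (rule e)
    fix i assume i: "i \<in> I"
    show "g i h = g i f" by (rule multilinear_cong[OF m[OF i] f h])
    then show "g i h \<in> carrier N" using multilinear_closed[OF m[OF i] f] by simp
  qed
  show "(\<lambda>a. opr (\<lambda>i. g i (f(j := a)))) \<in> semilinear R \<sigma>' M N'" if "j < n" for j
    by (rule s) (rule multilinear_semilinear[OF m f that])
qed

lemma multilinear_sum:
  assumes "module S N" "\<And>r. r \<in> carrier R \<Longrightarrow> \<sigma> r \<in> carrier S"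
    and "\<And>i. i \<in> I \<Longrightarrow> multilinear R M \<sigma> N n (g i)"
  shows "multilinear R M \<sigma> N n (\<lambda>f. \<Oplus>\<^bsub>N\<^esub>i\<in>I. g i f)"
proof -
  interpret N: module S N by fact
  show ?thesis
  proof (rule multilinear_lift_op[where I = I and opr = "\<lambda>h. \<Oplus>\<^bsub>N\<^esub>i\<in>I. h i", OF assms(3)])
    show "(\<Oplus>\<^bsub>N\<^esub>i\<in>I. h i) = (\<Oplus>\<^bsub>N\<^esub>i\<in>I. k i)" if "\<And>i. i \<in> I \<Longrightarrow> h i = k i" "\<And>i. i \<in> I \<Longrightarrow> h i \<in> carrier N" for h k
      using that by (intro N.M.finsum_cong') auto
  qed (auto intro!: N.M.finsum_closed semilinear_sum[OF assms(1,2)])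
qed

lemma multilinear_diff:
  assumes "module S N" "\<And>r. r \<in> carrier R \<Longrightarrow> \<sigma> r \<in> carrier S"
    and "multilinear R M \<sigma> N n g" "multilinear R M \<sigma> N n h"
  shows "multilinear R M \<sigma> N n (\<lambda>f. g f \<ominus>\<^bsub>N\<^esub> h f)"
proof -
  interpret N: module S N by fact
  have "multilinear R M \<sigma> N n (\<lambda>f. (if True then g else h) f \<ominus>\<^bsub>N\<^esub> (if False then g else h) f)"
    by (rule multilinear_lift_op[where I = UNIV and opr = "\<lambda>k. k True \<ominus>\<^bsub>N\<^esub> k False" 
      and g = "\<lambda>b. if b then g else h" and N = N])
      (use assms(3,4) in \<open>auto intro!: N.M.minus_closed semilinear_diff_fun[OF assms(1,2)]\<close>)
  then show ?thesis by simp
qed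

lemma multilinear_comp:
  assumes "multilinear R M \<sigma> N n g" "h \<in> semilinear S \<tau> N K" "\<And>r. r \<in> carrier R \<Longrightarrow> \<sigma> r \<in> carrier S"
  shows "multilinear R M (\<lambda>r. \<tau> (\<sigma> r)) K n (\<lambda>f. h (g f))"
  by (rule multilinear_lift_op[where I = UNIV and opr = "\<lambda>k. h (k ())" and g = "\<lambda>_. g" and N = N])
    (use assms semilinear_closed[OF assms(2)] in \<open>auto intro!: semilinear_comp[where N = N and S = S]\<close>)

text \<open>Updating \<open>f\<close> at \<open>i\<close> changes only the argument at the index
  \<open>j\<close> with \<open>p j = i\<close>, so linearity in the \<open>i\<close>-th entry is
  that of \<open>g\<close> in the \<open>j\<close>-th one, preceded by \<open>h j\<close>.\<close>

lemma multilinear_permuted: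
  assumes m: "multilinear R M \<sigma> N n g" and p: "p permutes {..<n}"
    and h: "\<And>j. j < n \<Longrightarrow> h j \<in> semilinear R id K M"
  shows "multilinear R K \<sigma> N n (\<lambda>f. g (\<lambda>j. h j (f (p j))))"
proof (rule multilinearI)
  fix f assume f: "f \<in> {..<n} \<rightarrow> carrier K"
  have pn: "p j < n \<longleftrightarrow> j < n" for j using permutes_in_image[OF p, of j] by simp
  have hf: "(\<lambda>j. h j (f (p j))) \<in> {..<n} \<rightarrow> carrier M"
    using f pn semilinear_closed[OF h] by (auto simp: Pi_iff)
  show "g (\<lambda>j. h j (f (p j))) \<in> carrier N" by (rule multilinear_closed[OF m hf])
  show "g (\<lambda>j. h j (f' (p j))) = g (\<lambda>j. h j (f (p j)))" if "\<And>i. i < n \<Longrightarrow> f' i = f i" for f'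
    by (rule multilinear_cong[OF m hf]) (simp add: that pn)
  show "(\<lambda>a. g (\<lambda>j. h j ((f(i := a)) (p j)))) \<in> semilinear R \<sigma> K N" if i: "i < n" for i
  proof -
    define j where "j = inv_into UNIV p i"
    have j: "j < n" "p j = i" 
      using i permutes_inv[OF p, THEN permutes_in_image, of i] permutes_inverses(1)[OF p] by (auto simp: j_def)
    have "p k = i \<longleftrightarrow> k = j" for k using j permutes_inj[OF p, THEN injD, of k j] by auto
    then have "(\<lambda>k. h k ((f(i := a)) (p k))) = (\<lambda>k. h k (f (p k)))(j := h j a)" for a
      by (auto simp: fun_eq_iff)
    then show ?thesis
      using semilinear_comp[OF h[OF j(1)] multilinear_semilinear[OF m hf j(1)]] by simp
  qed
qed

section \<open>The symmetric group and its even and odd halves\<close>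

section \<open>Permutation sums\<close>

definition "perms n = {p. p permutes {..<n::nat}}"
definition "even_perms n = {p. p permutes {..<n::nat} \<and> evenperm p}"
definition "odd_perms n = {p. p permutes {..<n::nat} \<and> \<not> evenperm p}"

lemma perms_finite: "finite (perms n)" "finite (even_perms n)" "finite (odd_perms n)"
proof -
  show "finite (perms n)" using finite_permutations[of "{..<n}"] by (simp add: perms_def)
  then show "finite (even_perms n)" "finite (odd_perms n)"
    by (auto intro: finite_subset simp: perms_def even_perms_def odd_perms_def)
qed

lemma perms_split: "perms n = even_perms n \<union> odd_perms n" "even_perms n \<inter> odd_perms n = {}"
  by (auto simp: perms_def even_perms_def odd_perms_def)

lemma perms_sub: "even_perms n \<subseteq> perms n" "odd_perms n \<subseteq> perms n" "perms n \<subseteq> perms n"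
  by (auto simp: perms_def even_perms_def odd_perms_def)

lemma perms_memI [intro]: "p \<in> even_perms n \<Longrightarrow> p \<in> perms n" "p \<in> odd_perms n \<Longrightarrow> p \<in> perms n"
  using perms_sub by auto

lemma perms_less: "p \<in> perms n \<Longrightarrow> p j < n \<longleftrightarrow> j < n"
  using permutes_in_image[of p "{..<n}" j] by (simp add: perms_def)

lemma permutes_evenperm_comp: "p permutes {..<n::nat} \<Longrightarrow> q permutes {..<n} \<Longrightarrow> evenperm (p \<circ> q) = (evenperm p = evenperm q)"
  by (rule evenperm_comp) (auto simp: permutation_permutes)

lemma permutes_evenperm_inv: "p permutes {..<n::nat} \<Longrightarrow> evenperm (inv_into UNIV p) = evenperm p"
  by (rule evenperm_inv) (auto simp: permutation_permutes)

lemma bij_inv_perms: 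
  "bij_betw (inv_into UNIV) (perms n) (perms n)"
  "bij_betw (inv_into UNIV) (even_perms n) (even_perms n)"
  "bij_betw (inv_into UNIV) (odd_perms n) (odd_perms n)"
  by (rule bij_betwI[where g = "inv_into UNIV"];
      auto simp: perms_def even_perms_def odd_perms_def permutes_inv permutes_inv_inv permutes_evenperm_inv)+

lemma bij_comp_aux:
  assumes p: "p permutes {..<n::nat}" 
    and XY: "\<And>q. q \<in> X \<Longrightarrow> q \<circ> p \<in> Y" "\<And>q. q \<in> Y \<Longrightarrow> q \<circ> inv_into UNIV p \<in> X"
  shows "bij_betw (\<lambda>q. q \<circ> p) X Y"
  by (rule bij_betwI[where g = "\<lambda>q. q \<circ> inv_into UNIV p"])
    (use XY permutes_inv_o[OF p] in \<open>auto simp: comp_assoc\<close>)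

lemma bij_comp_aux':
  assumes p: "p permutes {..<n::nat}" 
    and XY: "\<And>q. q \<in> X \<Longrightarrow> p \<circ> q \<in> Y" "\<And>q. q \<in> Y \<Longrightarrow> inv_into UNIV p \<circ> q \<in> X"
  shows "bij_betw (\<lambda>q. p \<circ> q) X Y"
  by (rule bij_betwI[where g = "\<lambda>q. inv_into UNIV p \<circ> q"])
    (use XY permutes_inv_o[OF p] in \<open>auto simp: o_assoc\<close>)

lemma bij_comp_perms:
  "p \<in> perms n \<Longrightarrow> bij_betw (\<lambda>q. q \<circ> p) (perms n) (perms n)"
  "p \<in> even_perms n \<Longrightarrow> bij_betw (\<lambda>q. q \<circ> p) (even_perms n) (even_perms n)"
  "p \<in> even_perms n \<Longrightarrow> bij_betw (\<lambda>q. p \<circ> q) (even_perms n) (even_perms n)"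
  "p \<in> odd_perms n \<Longrightarrow> bij_betw (\<lambda>q. p \<circ> q) (even_perms n) (odd_perms n)"
  by (rule bij_comp_aux[where n = n] bij_comp_aux'[where n = n];
      auto simp: perms_def even_perms_def odd_perms_def permutes_inv permutes_compose
        permutes_evenperm_comp[where n = n] permutes_evenperm_inv[where n = n])+

lemma transpose_perms: "i < n \<Longrightarrow> j < n \<Longrightarrow> Transposition.transpose i j \<in> perms n"
  "i < n \<Longrightarrow> j < n \<Longrightarrow> i \<noteq> j \<Longrightarrow> Transposition.transpose i j \<in> odd_perms n"
  by (auto simp: perms_def odd_perms_def evenperm_swap intro!: permutes_swap_id)

lemma transpose_same: "a i = a j \<Longrightarrow> a (Transposition.transpose i j k) = a k"
  by (auto simp: Transposition.transpose_def)

section \<open>Sums of wedges of permuted products\<close>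

locale wedge_algebra = A: algebra R A + exterior_power R A n for R (structure) and A (structure) and n
begin

text \<open>The tensors a(p 0) \<otimes> ... \<otimes> a(p (n-1)) for \<open>p\<close> in
  \<open>X\<close>, summed and acting entrywise on the wedge of \<open>v\<close>. For all
  permutations this descends to an operator on \<open>L\<close>, multiplication by the polarized
  norm; for the even ones alone it does not in general.\<close>

definition Gam where "Gam X a v = (\<Oplus>\<^bsub>L\<^esub>p\<in>X. W (\<lambda>j. a (p j) \<otimes>\<^bsub>A\<^esub> v j))"

lemma prod_Pi: "p \<in> perms n \<Longrightarrow> a \<in> vecs \<Longrightarrow> v \<in> vecs \<Longrightarrow>
    (\<lambda>j. a (p j) \<otimes>\<^bsub>A\<^esub> v j) \<in> vecs"
  by (auto simp: Pi_iff perms_less)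

lemma perm_Pi: "p \<in> perms n \<Longrightarrow> a \<in> vecs \<Longrightarrow> (\<lambda>j. a (p j)) \<in> vecs"
  by (auto simp: Pi_iff perms_less)

lemma W_prod [intro]: "p \<in> perms n \<Longrightarrow> a \<in> vecs \<Longrightarrow> v \<in> vecs \<Longrightarrow>
    W (\<lambda>j. a (p j) \<otimes>\<^bsub>A\<^esub> v j) \<in> carrier L"
  by (rule W_closed[OF prod_Pi])

lemma Gam_closed:
  "X \<subseteq> perms n \<Longrightarrow> a \<in> vecs \<Longrightarrow> v \<in> vecs \<Longrightarrow> Gam X a v \<in> carrier L"
  unfolding Gam_def by (intro L.M.finsum_closed) (auto intro!: W_prod)

lemma mult_semilinear: "b \<in> carrier A \<Longrightarrow> (\<lambda>x. b \<otimes>\<^bsub>A\<^esub> x) \<in> semilinear R id A A"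
  "b \<in> carrier A \<Longrightarrow> (\<lambda>x. x \<otimes>\<^bsub>A\<^esub> b) \<in> semilinear R id A A"
  by (rule semilinearI; simp add: A.r_distr A.l_distr A.smult_assoc2 A.m_comm[of b])+

lemma Gam_multilinear:
  assumes "X \<subseteq> perms n" "a \<in> vecs"
  shows "multilinear R A id L n (Gam X a)" "multilinear R A id L n (\<lambda>v. Gam X v a)"
proof -
  have ap: "a (p j) \<in> carrier A" if "p \<in> X" "j < n" for p j
    using assms that perms_less[of p n j] by (auto simp: Pi_iff)
  have aj: "a j \<in> carrier A" if "j < n" for j using assms(2) that by auto
  have "multilinear R A id L n (\<lambda>v. W (\<lambda>j. a (p j) \<otimes>\<^bsub>A\<^esub> v (id j)))" if "p \<in> X" for p
    by (rule multilinear_permuted[OF alternating_multilinear[OF W_alternating]])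
      (use ap that mult_semilinear permutes_id in \<open>auto simp: id_def\<close>)
  then have "multilinear R A id L n (\<lambda>v. \<Oplus>\<^bsub>L\<^esub>p\<in>X. W (\<lambda>j. a (p j) \<otimes>\<^bsub>A\<^esub> v (id j)))"
    by (intro multilinear_sum[OF L.module_axioms]) auto
  then show "multilinear R A id L n (Gam X a)" by (simp add: Gam_def[abs_def])
  have "multilinear R A id L n (\<lambda>v. W (\<lambda>j. v (p j) \<otimes>\<^bsub>A\<^esub> a j))" if "p \<in> X" for p
    by (rule multilinear_permuted[OF alternating_multilinear[OF W_alternating]])
      (use aj that mult_semilinear assms in \<open>auto simp: perms_def\<close>)
  then have "multilinear R A id L n (\<lambda>v. \<Oplus>\<^bsub>L\<^esub>p\<in>X. W (\<lambda>j. v (p j) \<otimes>\<^bsub>A\<^esub> a j))"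
    by (intro multilinear_sum[OF L.module_axioms]) auto
  then show "multilinear R A id L n (\<lambda>v. Gam X v a)" by (simp add: Gam_def[abs_def])
qed

sublocale W: alternating_map R A R L id n W
  by unfold_locales (auto simp: W_alternating ring_hom_def)

lemma W_permute:
  assumes "p \<in> perms n" "f \<in> vecs"
  shows "W (\<lambda>j. f (p j)) = (if evenperm p then W f else \<ominus>\<^bsub>L\<^esub> W f)"
  using W.permute[of p f] assms by (simp add: perms_def o_def)

text \<open>Composing \<open>p\<close> with the transposition \<open>t\<close> of two equal entries
  of \<open>v\<close> amounts to permuting the factors of the wedge by \<open>t\<close>, which flips
  the sign. The involution \<open>p \<mapsto> p \<circ> t\<close> has no fixed points, so the terms
  cancel in pairs.\<close>

lemma Gam_perms_repeated:
  assumes a: "a \<in> vecs" and v: "v \<in> vecs" and ij: "i < n" "j < n" "i \<noteq> j" "v i = v j"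
  shows "Gam (perms n) a v = \<zero>\<^bsub>L\<^esub>"
  unfolding Gam_def
proof (rule L.M.finsum_involution[where p = "\<lambda>p. p \<circ> Transposition.transpose i j"])
  fix p assume p: "p \<in> perms n"
  let ?t = "Transposition.transpose i j"
  have t: "?t \<in> perms n" "\<not> evenperm ?t" using ij by (auto simp: transpose_perms evenperm_swap)
  show "p \<circ> ?t \<in> perms n" using p t by (auto simp: perms_def permutes_compose)
  show "p \<circ> ?t \<circ> ?t = p" by (simp add: comp_assoc)
  show "W (\<lambda>k. a ((p \<circ> ?t) k) \<otimes>\<^bsub>A\<^esub> v k) = \<ominus>\<^bsub>L\<^esub> W (\<lambda>k. a (p k) \<otimes>\<^bsub>A\<^esub> v k)"
    using W_permute[OF t(1) prod_Pi[OF p a v]] t(2) transpose_same[of v i j, OF ij(4)] by simp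
  show "W (\<lambda>k. a (p k) \<otimes>\<^bsub>A\<^esub> v k) = \<zero>\<^bsub>L\<^esub>" if "p \<circ> ?t = p"
    using fun_cong[OF that, of i] p ij by (auto simp: perms_def dest: permutes_inj injD)
qed (use a v in \<open>auto simp: perms_finite intro!: W_prod\<close>)

text \<open>Composing with one transposition would leave the even permutations. A second one,
  exchanging equal entries of \<open>a\<close>, is therefore composed on the other side: it restores
  the parity and does not change \<open>a\<close>.\<close>

lemma Gam_even_repeated:
  assumes a: "a \<in> vecs" and v: "v \<in> vecs" and ij: "i < n" "j < n" "i \<noteq> j" "v i = v j"
    and kl: "k < n" "l < n" "k \<noteq> l" "a k = a l"
  shows "Gam (even_perms n) a v = \<zero>\<^bsub>L\<^esub>"
  unfolding Gam_def
proof (rule L.M.finsum_involution[where p = "\<lambda>p. Transposition.transpose k l \<circ> p \<circ> Transposition.transpose i j"])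
  fix p assume pe: "p \<in> even_perms n"
  then have p: "p \<in> perms n" using perms_sub by auto
  let ?t = "Transposition.transpose i j" and ?u = "Transposition.transpose k l"
  have t: "?t \<in> perms n" "\<not> evenperm ?t" using ij by (auto simp: transpose_perms evenperm_swap)
  have u: "?u \<in> perms n" "\<not> evenperm ?u" using kl by (auto simp: transpose_perms evenperm_swap)
  show "?u \<circ> p \<circ> ?t \<in> even_perms n"
    using pe t u by (auto simp: perms_def even_perms_def permutes_compose permutes_evenperm_comp[where n = n])
  have "?u \<circ> (?u \<circ> p \<circ> ?t) \<circ> ?t = (?u \<circ> ?u) \<circ> p \<circ> (?t \<circ> ?t)" by (simp only: comp_assoc)
  then show "?u \<circ> (?u \<circ> p \<circ> ?t) \<circ> ?t = p" by simp
  have au: "a (?u x) = a x" for x by (rule transpose_same[of a k l, OF kl(4)])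
  show "W (\<lambda>k. a ((?u \<circ> p \<circ> ?t) k) \<otimes>\<^bsub>A\<^esub> v k) = \<ominus>\<^bsub>L\<^esub> W (\<lambda>k. a (p k) \<otimes>\<^bsub>A\<^esub> v k)"
    using W_permute[OF t(1) prod_Pi[OF p a v]] t(2) transpose_same[of v i j, OF ij(4)] by (simp add: au)
  \<comment> \<open>This involution may have fixed points. They satisfy
    \<open>?u (p j) = p i\<close>, so the product has equal entries at \<open>i\<close> and
    \<open>j\<close>.\<close>
  show "W (\<lambda>k. a (p k) \<otimes>\<^bsub>A\<^esub> v k) = \<zero>\<^bsub>L\<^esub>" if "?u \<circ> p \<circ> ?t = p"
  proof -
    have "?u (p j) = p i" using fun_cong[OF that, of i] by simp
    then have "a (p i) = a (p j)" using au by metis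
    then show ?thesis by (intro alternating_repeated[OF W_alternating prod_Pi[OF p a v], of i j]) (simp_all add: ij)
  qed
qed (use a v perms_sub in \<open>auto simp: perms_finite intro!: W_prod\<close>)

text \<open>Permuting the factors by the inverse of \<open>p\<close> exchanges the roles of
  \<open>a\<close> and \<open>v\<close> at the cost of the sign of \<open>p\<close>. This makes the
  even sum symmetric and the odd sum antisymmetric.\<close>

lemma Gam_sym_aux:
  assumes a: "a \<in> vecs" and v: "v \<in> vecs" and p: "p \<in> perms n"
  shows "W (\<lambda>j. a (inv_into UNIV p j) \<otimes>\<^bsub>A\<^esub> v j) =
    (if evenperm p then W (\<lambda>j. v (p j) \<otimes>\<^bsub>A\<^esub> a j) else \<ominus>\<^bsub>L\<^esub> W (\<lambda>j. v (p j) \<otimes>\<^bsub>A\<^esub> a j))"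
proof -
  have q: "inv_into UNIV p \<in> perms n" "evenperm (inv_into UNIV p) = evenperm p" 
    using p by (auto simp: perms_def permutes_inv permutes_evenperm_inv)
  have pv: "(\<lambda>j. v (p j) \<otimes>\<^bsub>A\<^esub> a j) \<in> vecs" by (rule prod_Pi[OF p v a])
  have "W (\<lambda>j. a (inv_into UNIV p j) \<otimes>\<^bsub>A\<^esub> v j) = W (\<lambda>j. v (p (inv_into UNIV p j)) \<otimes>\<^bsub>A\<^esub> a (inv_into UNIV p j))"
  proof (rule alternating_cong[OF W_alternating])
    show "(\<lambda>j. v (p (inv_into UNIV p j)) \<otimes>\<^bsub>A\<^esub> a (inv_into UNIV p j)) \<in> vecs"
      using perm_Pi[OF q(1) pv] .
    fix i assume i: "i < n"
    have "p (inv_into UNIV p i) = i" using p permutes_inverses(1) by (auto simp: perms_def)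
    then show "a (inv_into UNIV p i) \<otimes>\<^bsub>A\<^esub> v i = v (p (inv_into UNIV p i)) \<otimes>\<^bsub>A\<^esub> a (inv_into UNIV p i)"
      using a v i perms_less[OF q(1), of i] by (simp add: A.m_comm Pi_iff)
  qed
  then show ?thesis using W_permute[OF q(1) pv] q(2) by simp
qed

lemma Gam_even_sym:
  assumes a: "a \<in> vecs" and v: "v \<in> vecs"
  shows "Gam (even_perms n) a v = Gam (even_perms n) v a"
proof -
  have "Gam (even_perms n) a v = (\<Oplus>\<^bsub>L\<^esub>p\<in>even_perms n. W (\<lambda>j. a (inv_into UNIV p j) \<otimes>\<^bsub>A\<^esub> v j))"
    unfolding Gam_def using perms_sub a v
    by (intro L.M.finsum_bij[OF bij_inv_perms(2)]) (auto intro!: W_prod)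
  also have "\<dots> = Gam (even_perms n) v a"
    unfolding Gam_def using perms_sub a v Gam_sym_aux[OF a v]
    by (intro L.M.finsum_cong') (auto intro!: W_prod simp: even_perms_def perms_def)
  finally show ?thesis .
qed

lemma Gam_odd_antisym:
  assumes a: "a \<in> vecs" and v: "v \<in> vecs"
  shows "Gam (odd_perms n) a v = \<ominus>\<^bsub>L\<^esub> Gam (odd_perms n) v a"
proof -
  have "Gam (odd_perms n) a v = (\<Oplus>\<^bsub>L\<^esub>p\<in>odd_perms n. W (\<lambda>j. a (inv_into UNIV p j) \<otimes>\<^bsub>A\<^esub> v j))"
    unfolding Gam_def using perms_sub a v
    by (intro L.M.finsum_bij[OF bij_inv_perms(3)]) (auto intro!: W_prod)
  also have "\<dots> = (\<Oplus>\<^bsub>L\<^esub>p\<in>odd_perms n. \<ominus>\<^bsub>L\<^esub> W (\<lambda>j. v (p j) \<otimes>\<^bsub>A\<^esub> a j))"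
    using perms_sub a v Gam_sym_aux[OF a v]
    by (intro L.M.finsum_cong') (auto intro!: W_prod L.M.a_inv_closed simp: odd_perms_def perms_def)
  also have "\<dots> = \<ominus>\<^bsub>L\<^esub> Gam (odd_perms n) v a"
    unfolding Gam_def using perms_sub a v by (intro L.M.finsum_minus) (auto intro!: W_prod)
  finally show ?thesis .
qed

text \<open>Antisymmetry only shows that twice the sum vanishes. Pairing \<open>p\<close> with its
  inverse cancels exactly, and an odd \<open>p\<close> that is its own inverse moves some
  \<open>i\<close>, so that the entries \<open>i\<close> and \<open>p i\<close> of the product
  coincide by commutativity of \<open>A\<close>.\<close>

lemma Gam_odd_self:
  assumes a: "a \<in> vecs"
  shows "Gam (odd_perms n) a a = \<zero>\<^bsub>L\<^esub>"
  unfolding Gam_def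
proof (rule L.M.finsum_involution[where p = "inv_into UNIV"])
  fix p assume po: "p \<in> odd_perms n"
  then have p: "p \<in> perms n" "\<not> evenperm p" "p permutes {..<n}" by (auto simp: perms_def odd_perms_def)
  show "inv_into UNIV p \<in> odd_perms n" using po by (auto simp: odd_perms_def permutes_inv permutes_evenperm_inv)
  show "inv_into UNIV (inv_into UNIV p) = p" using p(3) by (rule permutes_inv_inv)
  show "W (\<lambda>j. a (inv_into UNIV p j) \<otimes>\<^bsub>A\<^esub> a j) = \<ominus>\<^bsub>L\<^esub> W (\<lambda>j. a (p j) \<otimes>\<^bsub>A\<^esub> a j)"
    using Gam_sym_aux[OF a a p(1)] p(2) by simp
  show "W (\<lambda>j. a (p j) \<otimes>\<^bsub>A\<^esub> a j) = \<zero>\<^bsub>L\<^esub>" if "inv_into UNIV p = p"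
  proof -
    have "p \<noteq> id" using p(2) by auto
    then obtain i where i: "p i \<noteq> i" by (auto simp: fun_eq_iff)
    then have "i < n" using p(3) by (metis lessThan_iff permutes_not_in)
    moreover have pp: "p (p i) = i" using permutes_inverses(1)[OF p(3), of i] that by simp
    moreover have "p i < n" using perms_less[OF p(1)] \<open>i < n\<close> by simp
    ultimately show ?thesis using i a
      by (intro alternating_repeated[OF W_alternating prod_Pi[OF p(1) a a], of i "p i"]) (auto simp: A.m_comm Pi_iff)
  qed
qed (use a perms_sub in \<open>auto simp: perms_finite intro!: W_prod\<close>)

text \<open>Left composition with the transposition of two equal entries of \<open>a\<close> maps
  the even permutations bijectively to the odd ones and leaves \<open>a \<circ> p\<close>
  alone.\<close>

lemma Gam_odd_eq_even:
  assumes a: "a \<in> vecs" and v: "v \<in> vecs"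
    and kl: "k < n" "l < n" "k \<noteq> l" "a k = a l"
  shows "Gam (odd_perms n) a v = Gam (even_perms n) a v"
proof -
  let ?u = "Transposition.transpose k l"
  have "Gam (odd_perms n) a v = (\<Oplus>\<^bsub>L\<^esub>p\<in>even_perms n. W (\<lambda>j. a ((?u \<circ> p) j) \<otimes>\<^bsub>A\<^esub> v j))"
    unfolding Gam_def using perms_sub a v kl
    by (intro L.M.finsum_bij[OF bij_comp_perms(4)]) (auto intro!: W_prod transpose_perms)
  then show ?thesis using transpose_same[of a k l, OF kl(4)] by (simp add: Gam_def)
qed

lemma Gam_split:
  assumes a: "a \<in> vecs" and v: "v \<in> vecs"
  shows "Gam (perms n) a v = Gam (even_perms n) a v \<oplus>\<^bsub>L\<^esub> Gam (odd_perms n) a v"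
  unfolding Gam_def perms_split(1) using perms_sub a v
  by (intro L.M.finsum_Un_disjoint) (auto simp: perms_finite perms_split intro!: W_prod)

lemma Gam_even_invariant:
  assumes a: "a \<in> vecs" and v: "v \<in> vecs" and p: "p \<in> even_perms n"
  shows "Gam (even_perms n) (\<lambda>j. a (p j)) v = Gam (even_perms n) a v"
proof -
  have "Gam (even_perms n) a v = (\<Oplus>\<^bsub>L\<^esub>q\<in>even_perms n. W (\<lambda>j. a ((p \<circ> q) j) \<otimes>\<^bsub>A\<^esub> v j))"
    unfolding Gam_def using perms_sub a v 
    by (intro L.M.finsum_bij[OF bij_comp_perms(3)[OF p]]) (auto intro!: W_prod)
  then show ?thesis by (simp add: Gam_def)
qed

text \<open>Both sides are double sums of wedges with entries \<open>a (p j)\<close> times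
  \<open>b (q' j)\<close> times \<open>v j\<close>, for \<open>p\<close> and \<open>q'\<close> in
  \<open>Y\<close>: on the left \<open>q'\<close> is \<open>q \<circ> p\<close>, and right
  composition with \<open>p\<close> is a bijection of \<open>Y\<close>. This is the multiplication
  rule of orbit sums.\<close>

lemma Gam_product:
  assumes a: "a \<in> vecs" and b: "b \<in> vecs" and v: "v \<in> vecs"
    and Y: "Y \<subseteq> perms n" "\<And>p. p \<in> Y \<Longrightarrow> bij_betw (\<lambda>q. q \<circ> p) Y Y"
  shows "(\<Oplus>\<^bsub>L\<^esub>q\<in>Y. Gam Y (\<lambda>j. a j \<otimes>\<^bsub>A\<^esub> b (q j)) v) = (\<Oplus>\<^bsub>L\<^esub>q\<in>Y. Gam Y a (\<lambda>j. b (q j) \<otimes>\<^bsub>A\<^esub> v j))"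
proof -
  have fin: "finite Y" using Y perms_finite finite_subset by blast
  have pq: "\<And>p q j. p \<in> Y \<Longrightarrow> q \<in> Y \<Longrightarrow> j < n \<Longrightarrow> p j < n \<and> q (p j) < n" using Y perms_less by blast
  have w: "W (\<lambda>j. a (p j) \<otimes>\<^bsub>A\<^esub> b (q j) \<otimes>\<^bsub>A\<^esub> v j) \<in> carrier L" if "p \<in> Y" "q \<in> Y" for p q
    by (rule W_closed) (use that pq a b v in \<open>auto simp: Pi_iff\<close>)
  have w': "W (\<lambda>j. a (p j) \<otimes>\<^bsub>A\<^esub> b (q (p j)) \<otimes>\<^bsub>A\<^esub> v j) \<in> carrier L" if "p \<in> Y" "q \<in> Y" for p q
    by (rule W_closed) (use that pq a b v in \<open>auto simp: Pi_iff\<close>)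
  have "(\<Oplus>\<^bsub>L\<^esub>q\<in>Y. Gam Y (\<lambda>j. a j \<otimes>\<^bsub>A\<^esub> b (q j)) v)
      = (\<Oplus>\<^bsub>L\<^esub>p\<in>Y. \<Oplus>\<^bsub>L\<^esub>q\<in>Y. W (\<lambda>j. a (p j) \<otimes>\<^bsub>A\<^esub> b (q (p j)) \<otimes>\<^bsub>A\<^esub> v j))"
    unfolding Gam_def by (rule L.M.finsum_swap) (use fin w' in auto)
  also have "\<dots> = (\<Oplus>\<^bsub>L\<^esub>p\<in>Y. \<Oplus>\<^bsub>L\<^esub>q\<in>Y. W (\<lambda>j. a (p j) \<otimes>\<^bsub>A\<^esub> b (q j) \<otimes>\<^bsub>A\<^esub> v j))"
  proof (rule L.M.finsum_cong'[OF refl])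
    fix p assume p: "p \<in> Y"
    have "(\<Oplus>\<^bsub>L\<^esub>q\<in>Y. W (\<lambda>j. a (p j) \<otimes>\<^bsub>A\<^esub> b (q j) \<otimes>\<^bsub>A\<^esub> v j))
       = (\<Oplus>\<^bsub>L\<^esub>q\<in>Y. W (\<lambda>j. a (p j) \<otimes>\<^bsub>A\<^esub> b ((q \<circ> p) j) \<otimes>\<^bsub>A\<^esub> v j))"
      by (rule L.M.finsum_bij[OF Y(2)[OF p]]) (use w p in auto)
    then show "(\<Oplus>\<^bsub>L\<^esub>q\<in>Y. W (\<lambda>j. a (p j) \<otimes>\<^bsub>A\<^esub> b (q (p j)) \<otimes>\<^bsub>A\<^esub> v j)) = (\<Oplus>\<^bsub>L\<^esub>q\<in>Y. W (\<lambda>j. a (p j) \<otimes>\<^bsub>A\<^esub> b (q j) \<otimes>\<^bsub>A\<^esub> v j))"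
      by simp
  qed (use w in \<open>auto intro!: L.M.finsum_closed\<close>)
  also have "\<dots> = (\<Oplus>\<^bsub>L\<^esub>q\<in>Y. \<Oplus>\<^bsub>L\<^esub>p\<in>Y. W (\<lambda>j. a (p j) \<otimes>\<^bsub>A\<^esub> b (q j) \<otimes>\<^bsub>A\<^esub> v j))"
    by (rule L.M.finsum_swap) (use fin w in auto)
  also have "\<dots> = (\<Oplus>\<^bsub>L\<^esub>q\<in>Y. Gam Y a (\<lambda>j. b (q j) \<otimes>\<^bsub>A\<^esub> v j))"
    unfolding Gam_def
  proof (intro L.M.finsum_cong'[OF refl])
    fix p q assume pq': "q \<in> Y" "p \<in> Y"
    show "W (\<lambda>j. a (p j) \<otimes>\<^bsub>A\<^esub> b (q j) \<otimes>\<^bsub>A\<^esub> v j) = W (\<lambda>j. a (p j) \<otimes>\<^bsub>A\<^esub> (b (q j) \<otimes>\<^bsub>A\<^esub> v j))"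
      by (rule alternating_cong[OF W_alternating]) (use pq' pq a b v in \<open>auto simp: Pi_iff A.m_assoc\<close>)
  qed (use a b v pq in \<open>auto intro!: L.M.finsum_closed W_closed simp: Pi_iff\<close>)
  finally show ?thesis .
qed

end

section \<open>Charts of the top exterior power, norm and half norms\<close>

section \<open>Half norms\<close>

lemma (in module) finsum_smult_rdistr:
  assumes "c \<in> I \<rightarrow> carrier R" "x \<in> carrier M"
  shows "(\<Oplus>\<^bsub>R\<^esub>i\<in>I. c i) \<odot>\<^bsub>M\<^esub> x = (\<Oplus>\<^bsub>M\<^esub>i\<in>I. c i \<odot>\<^bsub>M\<^esub> x)"
proof -
  have "(\<lambda>r. r \<odot>\<^bsub>M\<^esub> x) \<in> semilinear R id (self_module R) M"
    by (rule semilinearI) (use assms in \<open>auto simp: smult_l_distr smult_assoc1\<close>)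
  from semilinear_finsum[OF _ _ this, of c I] show ?thesis
    using assms self_module_module[OF R.is_cring] by (simp add: module_def abelian_group_axioms)
qed

lemma id_semilinear: "(\<lambda>x. x) \<in> semilinear R id M M"
  by (rule semilinearI) auto

context exterior_power
begin

text \<open>Lifts in the first variable for each \<open>b\<close>, shows by comparison on wedges
  that these lifts depend on \<open>b\<close> in an alternating way, and lifts once more.\<close>

lemma bilinear_lift:
  assumes N: "module R N"
    and g1: "\<And>b. b \<in> vecs \<Longrightarrow> alternating R M id N n (\<lambda>a. g a b)"
    and g2: "\<And>a. a \<in> vecs \<Longrightarrow> alternating R M id N n (g a)"
  shows "\<exists>B. (\<forall>x\<in>carrier L. B x \<in> semilinear R id L N) \<and> (\<forall>y\<in>carrier L. (\<lambda>x. B x y) \<in> semilinear R id L N) \<and>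
    (\<forall>a\<in>vecs. \<forall>b\<in>vecs. B (W a) (W b) = g a b)"
proof -
  interpret N: module R N by fact
  have idh: "id \<in> ring_hom R R" by simp
  have "\<forall>b\<in>vecs. \<exists>h. h \<in> semilinear R id L N \<and> (\<forall>a\<in>vecs. h (W a) = g a b)"
    using L_lift[OF N idh g1] by blast
  then obtain h where h: "\<And>b. b \<in> vecs \<Longrightarrow> h b \<in> semilinear R id L N"
    and hW: "\<And>a b. b \<in> vecs \<Longrightarrow> a \<in> vecs \<Longrightarrow> h b (W a) = g a b"
    by metis
  note hc = semilinear_closed[OF h]
  have N': "abelian_group N" ..
  have alt: "alternating R M id N n (\<lambda>b. h b x)" if x: "x \<in> carrier L" for x
  proof (rule alternatingI)
    fix f assume f: "f \<in> vecs"
    show "h f x \<in> carrier N" using hc f x by blast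
    show "h f' x = h f x" if ff: "\<And>i. i < n \<Longrightarrow> f' i = f i" for f'
    proof -
      have f': "f' \<in> vecs" using f ff by auto
      show ?thesis
        by (rule L_ext[OF N' h[OF f'] h[OF f] _ x])
          (simp add: hW f f' alternating_cong[OF g2 f ff])
    qed
    show "h f x = \<zero>\<^bsub>N\<^esub>" if "i < n" "j < n" "i \<noteq> j" "f i = f j" for i j
    proof -
      have z: "(\<lambda>_. \<zero>\<^bsub>N\<^esub>) \<in> semilinear R id L N" by (rule semilinearI) auto
      show ?thesis by (rule L_ext[OF N' h[OF f] z _ x]) (simp add: hW f alternating_repeated[OF g2 f that])
    qed
    fix i a assume i: "i < n" and a: "a \<in> carrier M"
    show "h (f(i := a \<oplus>\<^bsub>M\<^esub> b)) x = h (f(i := a)) x \<oplus>\<^bsub>N\<^esub> h (f(i := b)) x" if b: "b \<in> carrier M" for b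
    proof -
      have u: "f(i := a \<oplus>\<^bsub>M\<^esub> b) \<in> vecs" "f(i := a) \<in> vecs" "f(i := b) \<in> vecs"
        using f a b by auto
      have s: "(\<lambda>x. h (f(i := a)) x \<oplus>\<^bsub>N\<^esub> h (f(i := b)) x) \<in> semilinear R id L N"
        by (rule semilinear_add_fun[OF N]) (use h u in auto)
      show ?thesis by (rule L_ext[OF N' h[OF u(1)] s _ x]) (simp add: hW u alternating_add[OF g2 f i a b])
    qed
    show "h (f(i := r \<odot>\<^bsub>M\<^esub> a)) x = id r \<odot>\<^bsub>N\<^esub> h (f(i := a)) x" if r: "r \<in> carrier R" for r
    proof -
      have u: "f(i := r \<odot>\<^bsub>M\<^esub> a) \<in> vecs" "f(i := a) \<in> vecs"
        using f a r by auto
      have s: "(\<lambda>x. id r \<odot>\<^bsub>N\<^esub> h (f(i := a)) x) \<in> semilinear R id L N"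
        by (rule semilinear_scale[OF N]) (use h u r in auto)
      show ?thesis by (rule L_ext[OF N' h[OF u(1)] s _ x]) (simp add: hW u alternating_smult[OF g2 f i r a])
    qed
  qed
  have "\<forall>x\<in>carrier L. \<exists>B. B \<in> semilinear R id L N \<and> (\<forall>b\<in>vecs. B (W b) = h b x)"
    using L_lift[OF N idh alt] by blast
  then obtain B where B: "\<And>x. x \<in> carrier L \<Longrightarrow> B x \<in> semilinear R id L N"
    and BW: "\<And>b x. b \<in> vecs \<Longrightarrow> x \<in> carrier L \<Longrightarrow> B x (W b) = h b x"
    by metis
  have lin: "(\<lambda>x. B x y) \<in> semilinear R id L N" if y: "y \<in> carrier L" for y
  proof (rule semilinearI)
    fix x assume x: "x \<in> carrier L"
    show "B x y \<in> carrier N" by (rule semilinear_closed[OF B[OF x] y])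
    show "B (x \<oplus>\<^bsub>L\<^esub> z) y = B x y \<oplus>\<^bsub>N\<^esub> B z y" if z: "z \<in> carrier L" for z
    proof -
      have s: "(\<lambda>y. B x y \<oplus>\<^bsub>N\<^esub> B z y) \<in> semilinear R id L N"
        by (rule semilinear_add_fun[OF N]) (use B x z in auto)
      show ?thesis
        by (rule L_ext[OF N' B s _ y]) (use x z in \<open>auto simp: BW semilinear_add[OF h]\<close>)
    qed
    show "B (r \<odot>\<^bsub>L\<^esub> x) y = id r \<odot>\<^bsub>N\<^esub> B x y" if r: "r \<in> carrier R" for r
    proof -
      have s: "(\<lambda>y. id r \<odot>\<^bsub>N\<^esub> B x y) \<in> semilinear R id L N"
        by (rule semilinear_scale[OF N]) (use B x r in auto)
      show ?thesis
        by (rule L_ext[OF N' B s _ y]) (use x r in \<open>auto simp: BW semilinear_smult[OF h]\<close>)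
    qed
  qed
  show ?thesis
  proof (intro exI[of _ B] conjI ballI)
    show "B (W a) (W b) = g a b" if "a \<in> vecs" "b \<in> vecs" for a b
      using BW[OF that(2) W_closed[OF that(1)]] hW[OF that(2,1)] by simp
  qed (fact B lin)+
qed

end

text \<open>A chart replaces a generator of \<open>L\<close>, which need not exist globally. The
  values \<open>cf s (W (e s))\<close> form a partition of unity, and the last assumption expresses
  that \<open>L\<close> has rank one: two elements are proportional, with coefficients given by
  \<open>cf s\<close>.\<close>

locale disc_chart = wedge_algebra R A n for R (structure) and A (structure) and n +
  fixes m :: nat and e and cf
  assumes e: "s < m \<Longrightarrow> e s \<in> vecs"
    and cf: "s < m \<Longrightarrow> cf s \<in> semilinear R id L (self_module R)"
    and cf_sum: "(\<Oplus>s\<in>{..<m}. cf s (W (e s))) = \<one>"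
    and cf_rank1: "s < m \<Longrightarrow> x \<in> carrier L \<Longrightarrow> y \<in> carrier L \<Longrightarrow> cf s x \<odot>\<^bsub>L\<^esub> y = cf s y \<odot>\<^bsub>L\<^esub> x"
begin

lemma cf_closed [simp, intro]: "s < m \<Longrightarrow> x \<in> carrier L \<Longrightarrow> cf s x \<in> carrier R"
  using semilinear_closed[OF cf] by simp

lemma We_closed [simp, intro]: "s < m \<Longrightarrow> W (e s) \<in> carrier L"
  by (rule W_closed[OF e])

lemma expand:
  assumes x: "x \<in> carrier L"
  shows "(\<Oplus>\<^bsub>L\<^esub>s\<in>{..<m}. cf s x \<odot>\<^bsub>L\<^esub> W (e s)) = x"
proof -
  have "(\<Oplus>\<^bsub>L\<^esub>s\<in>{..<m}. cf s x \<odot>\<^bsub>L\<^esub> W (e s)) = (\<Oplus>\<^bsub>L\<^esub>s\<in>{..<m}. cf s (W (e s)) \<odot>\<^bsub>L\<^esub> x)"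
    by (rule L.M.finsum_cong') (use x in \<open>auto simp: cf_rank1[of _ x]\<close>)
  also have "\<dots> = (\<Oplus>s\<in>{..<m}. cf s (W (e s))) \<odot>\<^bsub>L\<^esub> x"
    by (rule L.finsum_smult_rdistr[symmetric]) (use x in auto)
  finally show ?thesis using x by (simp add: cf_sum)
qed

lemma cf_scale:
  assumes c: "c \<in> carrier R"
  shows "(\<Oplus>s\<in>{..<m}. cf s (c \<odot>\<^bsub>L\<^esub> W (e s))) = c"
proof -
  have "(\<Oplus>s\<in>{..<m}. cf s (c \<odot>\<^bsub>L\<^esub> W (e s))) = (\<Oplus>s\<in>{..<m}. c \<otimes> cf s (W (e s)))"
    by (rule A.R.finsum_cong') (use c in \<open>auto simp: semilinear_smult[OF cf]\<close>)
  also have "\<dots> = c" by (subst A.R.finsum_rdistr[symmetric]) (use c in \<open>auto simp: cf_sum\<close>)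
  finally show ?thesis .
qed

text \<open>The forms of the chart recover a scalar from its action on the wedges
  \<open>W (e s)\<close>. Identities in \<open>R\<close> can therefore be tested by acting on
  wedges.\<close>

lemma scalar_cancel:
  assumes "c \<in> carrier R" "d \<in> carrier R" "\<And>v. v \<in> vecs \<Longrightarrow> c \<odot>\<^bsub>L\<^esub> W v = d \<odot>\<^bsub>L\<^esub> W v"
  shows "c = d"
proof -
  have "(\<Oplus>s\<in>{..<m}. cf s (c \<odot>\<^bsub>L\<^esub> W (e s))) = (\<Oplus>s\<in>{..<m}. cf s (d \<odot>\<^bsub>L\<^esub> W (e s)))"
    by (rule A.R.finsum_cong') (use assms(1,2) assms(3)[OF e] in auto)
  then show ?thesis using assms cf_scale by simp
qed

text \<open>Expands \<open>x\<close> in the chart, moves its coefficients from \<open>f\<close> to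
  \<open>y\<close> inside \<open>g\<close>, and exchanges \<open>x\<close> and \<open>y\<close>
  there by the rank one assumption. A general \<sigma> serves the comparison of charts across an
  isomorphism.\<close>

lemma rank1:
  assumes N: "module S N" and \<sigma>: "\<sigma> \<in> ring_hom R S" 
    and f: "f \<in> semilinear R \<sigma> L (self_module S)" and g: "g \<in> semilinear R \<sigma> L N"
    and x: "x \<in> carrier L" and y: "y \<in> carrier L"
  shows "f x \<odot>\<^bsub>N\<^esub> g y = f y \<odot>\<^bsub>N\<^esub> g x"
proof -
  interpret N: module S N by fact
  have \<sigma>c: "r \<in> carrier R \<Longrightarrow> \<sigma> r \<in> carrier S" for r by (rule ring_hom_closed[OF \<sigma>])
  have fc: "x \<in> carrier L \<Longrightarrow> f x \<in> carrier S" for x using semilinear_closed[OF f] by simp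
  note gc = semilinear_closed[OF g]
  have SS: "abelian_group (self_module S)" using self_module_module[OF N.R.is_cring] by (simp add: module_def)
  have *: "f x \<odot>\<^bsub>N\<^esub> g y = (\<Oplus>\<^bsub>N\<^esub>s\<in>{..<m}. f (W (e s)) \<odot>\<^bsub>N\<^esub> g (cf s x \<odot>\<^bsub>L\<^esub> y))"
    if x: "x \<in> carrier L" and y: "y \<in> carrier L" for x y
  proof -
    have "f x = f (\<Oplus>\<^bsub>L\<^esub>s\<in>{..<m}. cf s x \<odot>\<^bsub>L\<^esub> W (e s))" by (simp add: expand x)
    also have "\<dots> = (\<Oplus>\<^bsub>S\<^esub>s\<in>{..<m}. f (cf s x \<odot>\<^bsub>L\<^esub> W (e s)))"
      using semilinear_finsum[OF L.abelian_group_axioms SS f, of "\<lambda>s. cf s x \<odot>\<^bsub>L\<^esub> W (e s)" "{..<m}"] x by auto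
    finally have "f x \<odot>\<^bsub>N\<^esub> g y = (\<Oplus>\<^bsub>N\<^esub>s\<in>{..<m}. f (cf s x \<odot>\<^bsub>L\<^esub> W (e s)) \<odot>\<^bsub>N\<^esub> g y)"
      using x y fc gc by (simp add: N.finsum_smult_rdistr Pi_iff)
    also have "\<dots> = (\<Oplus>\<^bsub>N\<^esub>s\<in>{..<m}. f (W (e s)) \<odot>\<^bsub>N\<^esub> g (cf s x \<odot>\<^bsub>L\<^esub> y))"
      by (rule N.M.finsum_cong')
        (use x y fc gc \<sigma>c in \<open>auto simp: semilinear_smult[OF f] semilinear_smult[OF g] N.smult_assoc1[symmetric] N.R.m_comm\<close>)
    finally show ?thesis .
  qed
  have "(\<Oplus>\<^bsub>N\<^esub>s\<in>{..<m}. f (W (e s)) \<odot>\<^bsub>N\<^esub> g (cf s x \<odot>\<^bsub>L\<^esub> y)) = (\<Oplus>\<^bsub>N\<^esub>s\<in>{..<m}. f (W (e s)) \<odot>\<^bsub>N\<^esub> g (cf s y \<odot>\<^bsub>L\<^esub> x))"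
    by (rule N.M.finsum_cong') (use x y fc gc in \<open>auto simp: cf_rank1[of _ x y]\<close>)
  then show ?thesis by (simp only: *[OF x y] *[OF y x])
qed

lemma rank1_id:
  assumes "f \<in> semilinear R id L (self_module R)" "g \<in> semilinear R id L N" "module R N" "x \<in> carrier L" "y \<in> carrier L"
  shows "f x \<odot>\<^bsub>N\<^esub> g y = f y \<odot>\<^bsub>N\<^esub> g x"
  using rank1[OF assms(3) _ assms(1,2,4,5)] by simp

text \<open>\<open>g\<close> induces an endomorphism of \<open>L\<close>. Rank one turns
  \<open>cf s (g (e s))\<close> times \<open>W v\<close> into \<open>cf s (W v)\<close> times
  \<open>g (e s)\<close>, and the sum of the latter is the image of the expansion of
  \<open>W v\<close>. The scalar is the trace of the endomorphism.\<close>

lemma scalar: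
  assumes g: "alternating R A id L n g" and v: "v \<in> vecs"
  shows "g v = (\<Oplus>s\<in>{..<m}. cf s (g (e s))) \<odot>\<^bsub>L\<^esub> W v"
proof -
  obtain h where h: "h \<in> semilinear R id L L" "\<And>f. f \<in> vecs \<Longrightarrow> h (W f) = g f"
    using L_lift[OF L.module_axioms _ g] by auto
  have Wv: "W v \<in> carrier L" using v by (rule W_closed)
  have hc: "x \<in> carrier L \<Longrightarrow> h x \<in> carrier L" for x by (rule semilinear_closed[OF h(1)])
  have gc: "s < m \<Longrightarrow> g (e s) \<in> carrier L" for s by (rule alternating_closed[OF g e])
  have "(\<Oplus>s\<in>{..<m}. cf s (g (e s))) \<odot>\<^bsub>L\<^esub> W v = (\<Oplus>\<^bsub>L\<^esub>s\<in>{..<m}. cf s (g (e s)) \<odot>\<^bsub>L\<^esub> W v)"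
    by (rule L.finsum_smult_rdistr) (use Wv gc in auto)
  also have "\<dots> = (\<Oplus>\<^bsub>L\<^esub>s\<in>{..<m}. h (cf s (W v) \<odot>\<^bsub>L\<^esub> W (e s)))"
    by (rule L.M.finsum_cong') 
      (use Wv gc hc in \<open>auto simp: cf_rank1[OF _ gc Wv] semilinear_smult[OF h(1)] h(2)[OF e]\<close>)
  also have "\<dots> = h (\<Oplus>\<^bsub>L\<^esub>s\<in>{..<m}. cf s (W v) \<odot>\<^bsub>L\<^esub> W (e s))"
    by (rule semilinear_finsum[OF _ _ h(1), symmetric]) (use Wv L.abelian_group_axioms in auto)
  also have "\<dots> = g v" using h(2)[OF v] by (simp add: expand Wv)
  finally show ?thesis by simp
qed

text \<open>The trace of \<open>W v \<mapsto> Gam X a v\<close> as computed in the chart. For all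
  permutations it is the scalar by which this operator acts; for the even or the odd ones it is the
  half norm G or G', whose value may depend on the chart.\<close>

definition pol where "pol X a = (\<Oplus>s\<in>{..<m}. cf s (Gam X a (e s)))"

lemma self_module_R: "module R (self_module R)" by (rule self_module_module[OF A.R.is_cring])

lemma self_group_R: "abelian_group (self_module R)" using self_module_R by (simp add: module_def)

lemma pol_multilinear:
  assumes "X \<subseteq> perms n"
  shows "multilinear R A id (self_module R) n (pol X)"
proof -
  have "multilinear R A (\<lambda>r. id (id r)) (self_module R) n (\<lambda>a. cf s (Gam X a (e s)))" if "s < m" for s
    by (rule multilinear_comp[OF Gam_multilinear(2)[OF assms e[OF that]] cf[OF that]]) simp
  then have "multilinear R A id (self_module R) n (\<lambda>a. \<Oplus>\<^bsub>self_module R\<^esub>s\<in>{..<m}. cf s (Gam X a (e s)))"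
    by (intro multilinear_sum[OF self_module_R]) (auto simp: id_def)
  then show ?thesis by (simp add: pol_def[abs_def])
qed

lemma pol_closed: "X \<subseteq> perms n \<Longrightarrow> a \<in> vecs \<Longrightarrow> pol X a \<in> carrier R"
  using multilinear_closed[OF pol_multilinear] by simp

lemma pol_closed' [simp, intro]: 
  "a \<in> vecs \<Longrightarrow> pol (perms n) a \<in> carrier R"
  "a \<in> vecs \<Longrightarrow> pol (even_perms n) a \<in> carrier R"
  "a \<in> vecs \<Longrightarrow> pol (odd_perms n) a \<in> carrier R"
  by (simp_all add: pol_closed perms_sub)

lemma Gam_closed' [simp, intro]:
  "a \<in> vecs \<Longrightarrow> v \<in> vecs \<Longrightarrow> Gam (perms n) a v \<in> carrier L"
  "a \<in> vecs \<Longrightarrow> v \<in> vecs \<Longrightarrow> Gam (even_perms n) a v \<in> carrier L"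
  "a \<in> vecs \<Longrightarrow> v \<in> vecs \<Longrightarrow> Gam (odd_perms n) a v \<in> carrier L"
  by (simp_all add: Gam_closed perms_sub)

lemma norm_scalar:
  assumes a: "a \<in> vecs" and v: "v \<in> vecs"
  shows "Gam (perms n) a v = pol (perms n) a \<odot>\<^bsub>L\<^esub> W v"
  unfolding pol_def
  by (rule scalar[OF multilinear_alternating[OF Gam_multilinear(1)] v])
    (use a perms_sub Gam_perms_repeated in auto)

text \<open>A repetition in \<open>a\<close> makes the sum over even permutations alternating in
  \<open>v\<close>, so the half norm becomes a true scalar on \<open>L\<close>. This is what makes
  it independent of the chart on such tuples.\<close>

lemma half_norm_scalar:
  assumes a: "a \<in> vecs" and v: "v \<in> vecs"
    and kl: "k < n" "l < n" "k \<noteq> l" "a k = a l"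
  shows "Gam (even_perms n) a v = pol (even_perms n) a \<odot>\<^bsub>L\<^esub> W v"
  unfolding pol_def
  by (rule scalar[OF multilinear_alternating[OF Gam_multilinear(1)] v])
    (use a kl perms_sub Gam_even_repeated in auto)

lemma pol_odd_eq_even:
  assumes a: "a \<in> vecs" and kl: "k < n" "l < n" "k \<noteq> l" "a k = a l"
  shows "pol (odd_perms n) a = pol (even_perms n) a"
  unfolding pol_def
  by (rule A.R.finsum_cong') (use a Gam_odd_eq_even[OF a e kl] e in auto)

lemma pol_split:
  assumes a: "a \<in> vecs"
  shows "pol (perms n) a = pol (even_perms n) a \<oplus> pol (odd_perms n) a"
proof -
  have "pol (perms n) a = (\<Oplus>s\<in>{..<m}. cf s (Gam (even_perms n) a (e s)) \<oplus> cf s (Gam (odd_perms n) a (e s)))"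
    unfolding pol_def
    by (rule A.R.finsum_cong') (use a e in \<open>auto simp: Gam_split[OF a e] semilinear_add[OF cf]\<close>)
  also have "\<dots> = pol (even_perms n) a \<oplus> pol (odd_perms n) a"
    unfolding pol_def by (rule A.R.finsum_addf) (use a e in auto)
  finally show ?thesis .
qed

lemma pol_even_invariant:
  assumes a: "a \<in> vecs" and p: "p \<in> even_perms n"
  shows "pol (even_perms n) (\<lambda>j. a (p j)) = pol (even_perms n) a"
  unfolding pol_def
  by (rule A.R.finsum_cong') (use a e in \<open>auto simp: Gam_even_invariant[OF a e p]\<close>)

text \<open>The first coordinate of the product of the even orbit sums of \<open>a\<close> and
  \<open>b\<close>.\<close>

definition dual_sum where "dual_sum a b = (\<Oplus>q\<in>even_perms n. pol (even_perms n) (\<lambda>j. a j \<otimes>\<^bsub>A\<^esub> b (q j)))"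

lemma prod_Pi': "q \<in> perms n \<Longrightarrow> a \<in> vecs \<Longrightarrow> b \<in> vecs \<Longrightarrow>
    (\<lambda>j. a j \<otimes>\<^bsub>A\<^esub> b (q j)) \<in> vecs"
  by (auto simp: Pi_iff perms_less)

lemma pol_prod_closed [intro]:
  assumes "q \<in> perms n" "a \<in> vecs" "b \<in> vecs" "X \<subseteq> perms n"
  shows "pol X (\<lambda>j. a j \<otimes>\<^bsub>A\<^esub> b (q j)) \<in> carrier R"
  by (rule pol_closed[OF assms(4) prod_Pi'[OF assms(1-3)]])

lemma inv_perms: "q \<in> even_perms n \<Longrightarrow> inv_into UNIV q \<in> even_perms n"
  using bij_betwE[OF bij_inv_perms(2)] by blast

lemma pol_sum_scalar:
  assumes a: "a \<in> vecs" and b: "b \<in> vecs" and Y: "Y \<subseteq> perms n" "Z \<subseteq> perms n"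
  shows "(\<Oplus>q\<in>Y. pol Z (\<lambda>j. a j \<otimes>\<^bsub>A\<^esub> b (q j))) =
    (\<Oplus>s\<in>{..<m}. cf s (\<Oplus>\<^bsub>L\<^esub>q\<in>Y. Gam Z (\<lambda>j. a j \<otimes>\<^bsub>A\<^esub> b (q j)) (e s)))"
proof -
  have fin: "finite Y" using Y perms_finite finite_subset by blast
  have c: "q \<in> Y \<Longrightarrow> s < m \<Longrightarrow> Gam Z (\<lambda>j. a j \<otimes>\<^bsub>A\<^esub> b (q j)) (e s) \<in> carrier L" for q s
    by (rule Gam_closed[OF Y(2) prod_Pi'[OF _ a b] e]) (use Y in auto)
  have "(\<Oplus>q\<in>Y. pol Z (\<lambda>j. a j \<otimes>\<^bsub>A\<^esub> b (q j))) =
    (\<Oplus>s\<in>{..<m}. \<Oplus>q\<in>Y. cf s (Gam Z (\<lambda>j. a j \<otimes>\<^bsub>A\<^esub> b (q j)) (e s)))"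
    unfolding pol_def by (rule A.R.finsum_swap[OF fin]) (use c in auto)
  also have "\<dots> = (\<Oplus>s\<in>{..<m}. cf s (\<Oplus>\<^bsub>L\<^esub>q\<in>Y. Gam Z (\<lambda>j. a j \<otimes>\<^bsub>A\<^esub> b (q j)) (e s)))"
  proof (rule A.R.finsum_cong'[OF refl])
    fix s assume "s \<in> {..<m}"
    then show "(\<Oplus>q\<in>Y. cf s (Gam Z (\<lambda>j. a j \<otimes>\<^bsub>A\<^esub> b (q j)) (e s))) = cf s (\<Oplus>\<^bsub>L\<^esub>q\<in>Y. Gam Z (\<lambda>j. a j \<otimes>\<^bsub>A\<^esub> b (q j)) (e s))"
      using semilinear_finsum[OF L.abelian_group_axioms self_group_R cf[of s], of "\<lambda>q. Gam Z (\<lambda>j. a j \<otimes>\<^bsub>A\<^esub> b (q j)) (e s)" Y] c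
      by simp
  qed (use c in \<open>auto intro!: cf_closed L.M.finsum_closed\<close>)
  finally show ?thesis .
qed

text \<open>By \<open>Gam_product\<close> the operators of the tuples a \<cdot> (b \<circ> q) add up
  to the composite of those of \<open>a\<close> and \<open>b\<close>, that is, to multiplication by
  the product of both norms; the chart then reads off the scalar.\<close>

lemma norm_mult:
  assumes a: "a \<in> vecs" and b: "b \<in> vecs"
  shows "(\<Oplus>q\<in>perms n. pol (perms n) (\<lambda>j. a j \<otimes>\<^bsub>A\<^esub> b (q j))) = pol (perms n) a \<otimes> pol (perms n) b"
proof -
  have "(\<Oplus>\<^bsub>L\<^esub>q\<in>perms n. Gam (perms n) (\<lambda>j. a j \<otimes>\<^bsub>A\<^esub> b (q j)) v) = (pol (perms n) a \<otimes> pol (perms n) b) \<odot>\<^bsub>L\<^esub> W v"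
    if v: "v \<in> vecs" for v
  proof -
    have "(\<Oplus>\<^bsub>L\<^esub>q\<in>perms n. Gam (perms n) (\<lambda>j. a j \<otimes>\<^bsub>A\<^esub> b (q j)) v) = (\<Oplus>\<^bsub>L\<^esub>q\<in>perms n. Gam (perms n) a (\<lambda>j. b (q j) \<otimes>\<^bsub>A\<^esub> v j))"
      by (rule Gam_product[OF a b v]) (auto simp: bij_comp_perms)
    also have "\<dots> = (\<Oplus>\<^bsub>L\<^esub>q\<in>perms n. pol (perms n) a \<odot>\<^bsub>L\<^esub> W (\<lambda>j. b (q j) \<otimes>\<^bsub>A\<^esub> v j))"
      by (rule L.M.finsum_cong'[OF refl]) (use norm_scalar[OF a prod_Pi[OF _ b v]] a b v in \<open>auto intro!: L.smult_closed W_prod\<close>)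
    also have "\<dots> = pol (perms n) a \<odot>\<^bsub>L\<^esub> Gam (perms n) b v"
      unfolding Gam_def by (rule L.finsum_smult_ldistr[symmetric]) (use a b v perms_finite in auto)
    finally show ?thesis using norm_scalar[OF b v] a b v by (simp add: L.smult_assoc1)
  qed
  note * = this
  have "(\<Oplus>q\<in>perms n. pol (perms n) (\<lambda>j. a j \<otimes>\<^bsub>A\<^esub> b (q j))) =
      (\<Oplus>s\<in>{..<m}. cf s (\<Oplus>\<^bsub>L\<^esub>q\<in>perms n. Gam (perms n) (\<lambda>j. a j \<otimes>\<^bsub>A\<^esub> b (q j)) (e s)))"
    by (rule pol_sum_scalar[OF a b perms_sub(3) perms_sub(3)])
  also have "\<dots> = (\<Oplus>s\<in>{..<m}. cf s ((pol (perms n) a \<otimes> pol (perms n) b) \<odot>\<^bsub>L\<^esub> W (e s)))"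
    by (rule A.R.finsum_cong'[OF refl]) (use a b in \<open>simp_all add: *[OF e]\<close>)
  also have "\<dots> = pol (perms n) a \<otimes> pol (perms n) b"
    by (rule cf_scale) (use a b in auto)
  finally show ?thesis .
qed

text \<open>Replaces \<open>q\<close> by its inverse and then shifts the entries by
  \<open>q\<close>, which is even and so does not affect the even half norm.\<close>

lemma dual_sum_sym:
  assumes a: "a \<in> vecs" and b: "b \<in> vecs"
  shows "dual_sum a b = dual_sum b a"
proof -
  have "dual_sum a b = (\<Oplus>q\<in>even_perms n. pol (even_perms n) (\<lambda>j. a j \<otimes>\<^bsub>A\<^esub> b (inv_into UNIV q j)))"
    unfolding dual_sum_def
    by (rule A.R.finsum_bij[OF bij_inv_perms(2)]) (use a b in \<open>auto intro!: pol_prod_closed perms_sub(1)\<close>)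
  also have "\<dots> = dual_sum b a"
    unfolding dual_sum_def
  proof (rule A.R.finsum_cong'[OF refl])
    fix q assume q: "q \<in> even_perms n"
    have iq: "inv_into UNIV q \<in> even_perms n" using q by (rule inv_perms)
    have qq: "q permutes {..<n}" using q by (auto simp: even_perms_def)
    have ab: "(\<lambda>j. a j \<otimes>\<^bsub>A\<^esub> b (inv_into UNIV q j)) \<in> vecs" 
      by (rule prod_Pi'[OF _ a b]) (use iq in auto)
    have ba: "(\<lambda>j. b j \<otimes>\<^bsub>A\<^esub> a (q j)) \<in> vecs" 
      by (rule prod_Pi'[OF _ b a]) (use q in auto)
    have "pol (even_perms n) (\<lambda>j. a j \<otimes>\<^bsub>A\<^esub> b (inv_into UNIV q j)) = pol (even_perms n) (\<lambda>j. a (q j) \<otimes>\<^bsub>A\<^esub> b (inv_into UNIV q (q j)))"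
      using pol_even_invariant[OF ab q] by simp
    also have "\<dots> = pol (even_perms n) (\<lambda>j. b j \<otimes>\<^bsub>A\<^esub> a (q j))"
      by (rule multilinear_cong[OF pol_multilinear ba])
        (use a b perms_less[OF perms_memI(1)[OF q]] q in \<open>auto simp: perms_sub permutes_inverses(2)[OF qq] A.m_comm Pi_iff\<close>)
    finally show "pol (even_perms n) (\<lambda>j. a j \<otimes>\<^bsub>A\<^esub> b (inv_into UNIV q j)) = pol (even_perms n) (\<lambda>j. b j \<otimes>\<^bsub>A\<^esub> a (q j))" .
  qed (use a b in \<open>auto intro!: pol_prod_closed perms_sub(1)\<close>)
  finally show ?thesis .
qed

text \<open>With a repetition in \<open>a\<close> its even operator is a scalar and can be pulled
  out of the sum. This is what makes \<kappa> alternating.\<close>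

lemma dual_sum_repeated:
  assumes a: "a \<in> vecs" and b: "b \<in> vecs"
    and kl: "k < n" "l < n" "k \<noteq> l" "a k = a l"
  shows "dual_sum a b = pol (even_perms n) a \<otimes> pol (even_perms n) b"
proof -
  have "(\<Oplus>\<^bsub>L\<^esub>q\<in>even_perms n. Gam (even_perms n) (\<lambda>j. a j \<otimes>\<^bsub>A\<^esub> b (q j)) v) = pol (even_perms n) a \<odot>\<^bsub>L\<^esub> Gam (even_perms n) b v"
    if v: "v \<in> vecs" for v
  proof -
    have "(\<Oplus>\<^bsub>L\<^esub>q\<in>even_perms n. Gam (even_perms n) (\<lambda>j. a j \<otimes>\<^bsub>A\<^esub> b (q j)) v) = (\<Oplus>\<^bsub>L\<^esub>q\<in>even_perms n. Gam (even_perms n) a (\<lambda>j. b (q j) \<otimes>\<^bsub>A\<^esub> v j))"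
      by (rule Gam_product[OF a b v]) (auto simp: bij_comp_perms)
    also have "\<dots> = (\<Oplus>\<^bsub>L\<^esub>q\<in>even_perms n. pol (even_perms n) a \<odot>\<^bsub>L\<^esub> W (\<lambda>j. b (q j) \<otimes>\<^bsub>A\<^esub> v j))"
      by (rule L.M.finsum_cong'[OF refl]) (use half_norm_scalar[OF a prod_Pi[OF _ b v] kl] a b v in \<open>auto intro!: L.smult_closed W_prod\<close>)
    also have "\<dots> = pol (even_perms n) a \<odot>\<^bsub>L\<^esub> Gam (even_perms n) b v"
      unfolding Gam_def by (rule L.finsum_smult_ldistr[symmetric]) (use a b v perms_finite in auto)
    finally show ?thesis .
  qed
  note * = this
  have "dual_sum a b = (\<Oplus>s\<in>{..<m}. cf s (\<Oplus>\<^bsub>L\<^esub>q\<in>even_perms n. Gam (even_perms n) (\<lambda>j. a j \<otimes>\<^bsub>A\<^esub> b (q j)) (e s)))"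
    unfolding dual_sum_def by (rule pol_sum_scalar[OF a b perms_sub(1) perms_sub(1)])
  also have "\<dots> = (\<Oplus>s\<in>{..<m}. cf s (pol (even_perms n) a \<odot>\<^bsub>L\<^esub> Gam (even_perms n) b (e s)))"
    by (rule A.R.finsum_cong'[OF refl]) (use a b e in \<open>simp_all add: *[OF e]\<close>)
  also have "\<dots> = (\<Oplus>s\<in>{..<m}. pol (even_perms n) a \<otimes> cf s (Gam (even_perms n) b (e s)))"
    by (rule A.R.finsum_cong'[OF refl]) (use a b e in \<open>auto simp: semilinear_smult[OF cf]\<close>)
  also have "\<dots> = pol (even_perms n) a \<otimes> pol (even_perms n) b"
    unfolding pol_def[of _ b] by (rule A.R.finsum_rdistr[symmetric]) (use a b e in auto)
  finally show ?thesis .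
qed

end

lemma (in abelian_group) minus_eqD:
  assumes "x \<in> carrier G" "y \<in> carrier G" "x \<ominus> y = z"
  shows "x = y \<oplus> z"
  using assms(1,2) unfolding assms(3)[symmetric] by (simp add: a_minus_def a_lcomm[of y] r_neg)

text \<open>To be read with \<open>g\<close>, \<open>g'\<close> and \<open>h\<close>,
  \<open>h'\<close> the even and odd half norms of two tuples, and \<open>k\<close>,
  \<open>k'\<close> the sums of the even and of the odd half norms of a \<cdot> (b \<circ> q) over
  even \<open>q\<close>. The norms multiply to the sum over all \<open>q\<close>, so the bracket
  subtracted on the left is the sum over odd \<open>q\<close>.\<close>

lemma (in cring) discriminant_identity:
  assumes "g \<in> carrier R" "g' \<in> carrier R" "h \<in> carrier R" "h' \<in> carrier R" "k \<in> carrier R" "k' \<in> carrier R"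
    and k': "k' = k \<oplus> (g' \<otimes> (h' \<ominus> h) \<oplus> h \<otimes> (g' \<ominus> g))"
  shows "(k \<oplus> k') \<ominus> ((g \<oplus> g') \<otimes> (h \<oplus> h') \<ominus> (k \<oplus> k')) =
    (g' \<ominus> g) \<otimes> (h' \<ominus> h) \<ominus>
      (((g \<otimes> h \<ominus> k) \<oplus> (g \<otimes> h \<ominus> k)) \<oplus> ((g \<otimes> h \<ominus> k) \<oplus> (g \<otimes> h \<ominus> k)))"
  unfolding k' using assms(1-5) by algebra

lemma alternating_eqI:
  assumes M: "module R M" and g: "alternating R M \<sigma> N n g"
    and eq: "\<And>f. f \<in> {..<n} \<rightarrow> carrier M \<Longrightarrow> g' f = g f"
  shows "alternating R M \<sigma> N n g'"
proof -
  interpret M: module R M by fact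
  show ?thesis
  proof (rule alternatingI)
    fix f assume f: "f \<in> {..<n} \<rightarrow> carrier M"
    show "g' f \<in> carrier N" using alternating_closed[OF g f] eq[OF f] by simp
    show "g' h = g' f" if h: "\<And>i. i < n \<Longrightarrow> h i = f i" for h
    proof -
      have "h \<in> {..<n} \<rightarrow> carrier M" using f h by auto
      then show ?thesis using alternating_cong[OF g f h] eq f by simp
    qed
    show "g' f = \<zero>\<^bsub>N\<^esub>" if "i < n" "j < n" "i \<noteq> j" "f i = f j" for i j
      using alternating_repeated[OF g f that] eq[OF f] by simp
    fix i assume i: "i < n"
    have e: "g' (f(i := a)) = g (f(i := a))" if "a \<in> carrier M" for a
      by (rule eq[OF upd_Pi[OF f that]])
    show "g' (f(i := a \<oplus>\<^bsub>M\<^esub> b)) = g' (f(i := a)) \<oplus>\<^bsub>N\<^esub> g' (f(i := b))"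
      if "a \<in> carrier M" "b \<in> carrier M" for a b
      using alternating_add[OF g f i that] that by (simp add: e)
    show "g' (f(i := r \<odot>\<^bsub>M\<^esub> a)) = \<sigma> r \<odot>\<^bsub>N\<^esub> g' (f(i := a))"
      if "r \<in> carrier R" "a \<in> carrier M" for r a
      using alternating_smult[OF g f i that] that by (simp add: e)
  qed
qed

section \<open>The linear form \<tau> and the bilinear form \<kappa> on the top exterior
  power\<close>

context disc_chart
begin

lemma pol_self_multilinear: "X \<subseteq> perms n \<Longrightarrow> b \<in> vecs \<Longrightarrow> q \<in> perms n \<Longrightarrow>
    multilinear R A id (self_module R) n (\<lambda>a. pol X (\<lambda>j. a j \<otimes>\<^bsub>A\<^esub> b (q j)))"
  by (rule multilinear_permuted[OF pol_multilinear, where p = id, simplified])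
    (use mult_semilinear permutes_id[of "{..<n}"] in \<open>auto simp: id_def Pi_iff perms_less\<close>)

lemma tau_alternating: "alternating R A id (self_module R) n (\<lambda>a. pol (odd_perms n) a \<ominus> pol (even_perms n) a)"
proof (rule multilinear_alternating)
  show "multilinear R A id (self_module R) n (\<lambda>a. pol (odd_perms n) a \<ominus> pol (even_perms n) a)"
    using multilinear_diff[OF self_module_R _ pol_multilinear[OF perms_sub(2)] pol_multilinear[OF perms_sub(1)]] by simp
  fix f i j assume "f \<in> vecs" "i < n" "j < n" "i \<noteq> j" "f i = f j"
  then show "pol (odd_perms n) f \<ominus> pol (even_perms n) f = \<zero>\<^bsub>self_module R\<^esub>"
    using pol_odd_eq_even[of f i j] by simp
qed

text \<open>For the first variable this is \<open>dual_sum_repeated\<close>; the second follows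
  because the expression is symmetric in the two tuples.\<close>

lemma kap_alternating:
  assumes b: "b \<in> vecs"
  shows "alternating R A id (self_module R) n (\<lambda>a. pol (even_perms n) a \<otimes> pol (even_perms n) b \<ominus> dual_sum a b)"
    and "alternating R A id (self_module R) n (\<lambda>a. pol (even_perms n) b \<otimes> pol (even_perms n) a \<ominus> dual_sum b a)"
proof -
  have s: "(\<lambda>r. r \<otimes> pol (even_perms n) b) \<in> semilinear R id (self_module R) (self_module R)"
    by (rule semilinearI) (use b in \<open>auto simp: A.R.l_distr A.R.m_assoc\<close>)
  have "multilinear R A (\<lambda>r. id (id r)) (self_module R) n (\<lambda>a. pol (even_perms n) a \<otimes> pol (even_perms n) b)"
    by (rule multilinear_comp[OF pol_multilinear[OF perms_sub(1)] s]) simp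
  then have m1: "multilinear R A id (self_module R) n (\<lambda>a. pol (even_perms n) a \<otimes> pol (even_perms n) b)"
    by (simp add: id_def)
  have "multilinear R A id (self_module R) n (\<lambda>a. \<Oplus>\<^bsub>self_module R\<^esub>q\<in>even_perms n. pol (even_perms n) (\<lambda>j. a j \<otimes>\<^bsub>A\<^esub> b (q j)))"
    by (rule multilinear_sum[OF self_module_R]) (use b in \<open>auto intro!: pol_self_multilinear perms_sub\<close>)
  then have m2: "multilinear R A id (self_module R) n (\<lambda>a. dual_sum a b)"
    by (simp add: dual_sum_def[abs_def])
  show 1: "alternating R A id (self_module R) n (\<lambda>a. pol (even_perms n) a \<otimes> pol (even_perms n) b \<ominus> dual_sum a b)"
  proof (rule multilinear_alternating)
    show "multilinear R A id (self_module R) n (\<lambda>a. pol (even_perms n) a \<otimes> pol (even_perms n) b \<ominus> dual_sum a b)"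
      using multilinear_diff[OF self_module_R _ m1 m2] by simp
    fix f i j assume "f \<in> vecs" "i < n" "j < n" "i \<noteq> j" "f i = f j"
    then show "pol (even_perms n) f \<otimes> pol (even_perms n) b \<ominus> dual_sum f b = \<zero>\<^bsub>self_module R\<^esub>"
      using dual_sum_repeated[of f b i j] b by simp
  qed
  have eq: "pol (even_perms n) b \<otimes> pol (even_perms n) a \<ominus> dual_sum b a =
      pol (even_perms n) a \<otimes> pol (even_perms n) b \<ominus> dual_sum a b" if "a \<in> vecs" for a
    using that b dual_sum_sym[of a b] by (simp add: A.R.m_comm)
  show "alternating R A id (self_module R) n (\<lambda>a. pol (even_perms n) b \<otimes> pol (even_perms n) a \<ominus> dual_sum b a)"
    by (rule alternating_eqI[OF A.module_axioms 1]) (rule eq)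
qed

text \<open>The condition determines the map on the carrier of \<open>L\<close>, so the choice
  concerns only arguments outside; likewise for \<open>kap\<close> below.\<close>

definition tau where "tau = (SOME h. h \<in> semilinear R id L (self_module R) \<and>
    (\<forall>a\<in>vecs. h (W a) = pol (odd_perms n) a \<ominus> pol (even_perms n) a))"

definition kap where "kap = (SOME B. (\<forall>x\<in>carrier L. B x \<in> semilinear R id L (self_module R)) \<and>
    (\<forall>y\<in>carrier L. (\<lambda>x. B x y) \<in> semilinear R id L (self_module R)) \<and>
    (\<forall>a\<in>vecs. \<forall>b\<in>vecs.
      B (W a) (W b) = pol (even_perms n) a \<otimes> pol (even_perms n) b \<ominus> dual_sum a b))"

lemma tau: "tau \<in> semilinear R id L (self_module R)"
  and tau_W: "a \<in> vecs \<Longrightarrow> tau (W a) = pol (odd_perms n) a \<ominus> pol (even_perms n) a"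
proof -
  have "\<exists>h. h \<in> semilinear R id L (self_module R) \<and>
    (\<forall>a\<in>vecs. h (W a) = pol (odd_perms n) a \<ominus> pol (even_perms n) a)"
    using L_lift[OF self_module_R _ tau_alternating] by auto
  from someI_ex[OF this, folded tau_def]
  show "tau \<in> semilinear R id L (self_module R)"
    "a \<in> vecs \<Longrightarrow> tau (W a) = pol (odd_perms n) a \<ominus> pol (even_perms n) a" by blast+
qed

lemma kap: "x \<in> carrier L \<Longrightarrow> kap x \<in> semilinear R id L (self_module R)"
  and kap': "y \<in> carrier L \<Longrightarrow> (\<lambda>x. kap x y) \<in> semilinear R id L (self_module R)"
  and kap_W: "a \<in> vecs \<Longrightarrow> b \<in> vecs \<Longrightarrow> 
    kap (W a) (W b) = pol (even_perms n) a \<otimes> pol (even_perms n) b \<ominus> dual_sum a b"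
proof -
  note someI_ex[OF bilinear_lift[OF self_module_R kap_alternating], folded kap_def]
  then show "x \<in> carrier L \<Longrightarrow> kap x \<in> semilinear R id L (self_module R)"
    "y \<in> carrier L \<Longrightarrow> (\<lambda>x. kap x y) \<in> semilinear R id L (self_module R)"
    "a \<in> vecs \<Longrightarrow> b \<in> vecs \<Longrightarrow> 
    kap (W a) (W b) = pol (even_perms n) a \<otimes> pol (even_perms n) b \<ominus> dual_sum a b" by blast+
qed

lemma tau_closed [simp, intro]: "x \<in> carrier L \<Longrightarrow> tau x \<in> carrier R"
  using semilinear_closed[OF tau] by simp

lemma kap_closed [simp, intro]: "x \<in> carrier L \<Longrightarrow> y \<in> carrier L \<Longrightarrow> kap x y \<in> carrier R"
  using semilinear_closed[OF kap] by simp

text \<open>Expanding the half norms gives a double sum of \<open>cf s x\<close> times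
  \<open>cf t (Gam (odd_perms n) (e s) (e t))\<close>. Exchanging \<open>s\<close> and
  \<open>t\<close> is absorbed by rank one in the forms and produces a sign by antisymmetry; the
  diagonal terms vanish by themselves. Without this cancellation the next product formula would
  carry a correction term.\<close>

lemma odd_sum_zero:
  assumes x: "x \<in> carrier L"
  shows "(\<Oplus>s\<in>{..<m}. cf s x \<otimes> pol (odd_perms n) (e s)) = \<zero>"
proof -
  have c: "Gam (odd_perms n) (e s) (e t) \<in> carrier L" if "s < m" "t < m" for s t using e that by auto
  have sw: "cf s x \<otimes> cf t y = cf t x \<otimes> cf s y" if "s < m" "t < m" "y \<in> carrier L" for s t y
    using rank1_id[OF cf[OF that(1)] cf[OF that(2)] self_module_R x that(3)] that x
    by (simp add: A.R.m_comm)
  have "(\<Oplus>s\<in>{..<m}. cf s x \<otimes> pol (odd_perms n) (e s)) =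
      (\<Oplus>s\<in>{..<m}. \<Oplus>t\<in>{..<m}. cf s x \<otimes> cf t (Gam (odd_perms n) (e s) (e t)))"
    unfolding pol_def
    by (rule A.R.finsum_cong'[OF refl])
      (use x c in \<open>auto intro!: A.R.finsum_rdistr A.R.finsum_closed A.R.m_closed\<close>)
  also have "\<dots> = (\<Oplus>p\<in>{..<m} \<times> {..<m}. cf (fst p) x \<otimes> cf (snd p) (Gam (odd_perms n) (e (fst p)) (e (snd p))))"
    by (rule A.R.finsum_times) (use x c in auto)
  also have "\<dots> = \<zero>"
  proof (rule A.R.finsum_involution[where p = prod.swap])
    fix p assume p: "p \<in> {..<m} \<times> {..<m}"
    obtain s t where st: "p = (s, t)" "s < m" "t < m" using p by (cases p) auto
    have "cf t x \<otimes> cf s (Gam (odd_perms n) (e t) (e s)) = cf s x \<otimes> cf t (Gam (odd_perms n) (e t) (e s))"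
      by (rule sw) (use st c in auto)
    also have "\<dots> = cf s x \<otimes> (\<ominus> cf t (Gam (odd_perms n) (e s) (e t)))"
      using Gam_odd_antisym[OF e[OF st(3)] e[OF st(2)]] c[OF st(2,3)] 
        semilinear_minus[OF L.abelian_group_axioms self_group_R cf[OF st(3)]] by simp
    also have "\<dots> = \<ominus> (cf s x \<otimes> cf t (Gam (odd_perms n) (e s) (e t)))"
      using st x c by (simp add: A.R.r_minus)
    finally have fin: "cf t x \<otimes> cf s (Gam (odd_perms n) (e t) (e s)) = \<ominus> (cf s x \<otimes> cf t (Gam (odd_perms n) (e s) (e t)))" .
    show "cf (fst (prod.swap p)) x \<otimes> cf (snd (prod.swap p)) (Gam (odd_perms n) (e (fst (prod.swap p))) (e (snd (prod.swap p))))
      = \<ominus> (cf (fst p) x \<otimes> cf (snd p) (Gam (odd_perms n) (e (fst p)) (e (snd p))))"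
      unfolding st(1) prod.swap_def fst_conv snd_conv by (rule fin)
    show "cf (fst p) x \<otimes> cf (snd p) (Gam (odd_perms n) (e (fst p)) (e (snd p))) = \<zero>" if "prod.swap p = p"
    proof -
      have "t = s" using that unfolding st(1) prod.swap_def fst_conv snd_conv prod.inject by (rule conjunct1)
      then have "Gam (odd_perms n) (e s) (e t) = \<zero>\<^bsub>L\<^esub>" using Gam_odd_self[OF e[OF st(2)]] by simp
      then show ?thesis
        using semilinear_zero[OF L.abelian_group_axioms self_group_R cf[OF st(3)]] x st(2)
        unfolding st(1) fst_conv snd_conv by simp
    qed
  qed (use x c in auto)
  finally show ?thesis .
qed

text \<open>Subtracting the term in \<open>W a\<close> leaves a map alternating in \<open>b\<close>:
  if \<open>b\<close> has equal entries, the even sum is symmetric in \<open>a\<close> and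
  \<open>b\<close> and acts on \<open>W a\<close> as the half norm of \<open>b\<close>. Such a map
  is a multiple of \<open>W b\<close>, and its scalar is read off in the chart.\<close>

lemma even_half_product:
  assumes a: "a \<in> vecs" and b: "b \<in> vecs"
  shows "Gam (even_perms n) a b = pol (odd_perms n) a \<odot>\<^bsub>L\<^esub> W b \<oplus>\<^bsub>L\<^esub> pol (even_perms n) b \<odot>\<^bsub>L\<^esub> W a"
proof -
  have Wa: "W a \<in> carrier L" "W b \<in> carrier L" using a b by auto
  have s: "(\<lambda>r. r \<odot>\<^bsub>L\<^esub> W a) \<in> semilinear R id (self_module R) L"
    by (rule semilinearI) (use Wa in \<open>auto simp: L.smult_l_distr L.smult_assoc1\<close>)
  have "multilinear R A (\<lambda>r. id (id r)) L n (\<lambda>b. pol (even_perms n) b \<odot>\<^bsub>L\<^esub> W a)"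
    by (rule multilinear_comp[OF pol_multilinear[OF perms_sub(1)] s]) simp
  then have m1: "multilinear R A id L n (\<lambda>b. pol (even_perms n) b \<odot>\<^bsub>L\<^esub> W a)" by (simp add: id_def)
  let ?g = "\<lambda>b. Gam (even_perms n) a b \<ominus>\<^bsub>L\<^esub> pol (even_perms n) b \<odot>\<^bsub>L\<^esub> W a"
  have g: "alternating R A id L n ?g"
  proof (rule multilinear_alternating)
    show "multilinear R A id L n ?g"
      by (rule multilinear_diff[OF L.module_axioms _ Gam_multilinear(1)[OF perms_sub(1) a] m1]) simp
    fix f i j assume f: "f \<in> vecs" and "i < n" "j < n" "i \<noteq> j" "f i = f j"
    then show "?g f = \<zero>\<^bsub>L\<^esub>"
      using half_norm_scalar[OF f a] Gam_even_sym[OF a f] Wa by simp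
  qed
  have p: "pol (even_perms n) (e s) \<in> carrier R" "pol (odd_perms n) (e s) \<in> carrier R" if "s < m" for s using e that by auto
  have tl: "tau (W a) = (\<Oplus>s\<in>{..<m}. cf s (W a) \<otimes> (pol (odd_perms n) (e s) \<ominus> pol (even_perms n) (e s)))"
  proof -
    have "tau (W a) = tau (\<Oplus>\<^bsub>L\<^esub>s\<in>{..<m}. cf s (W a) \<odot>\<^bsub>L\<^esub> W (e s))" using Wa by (simp add: expand)
    also have "\<dots> = (\<Oplus>s\<in>{..<m}. tau (cf s (W a) \<odot>\<^bsub>L\<^esub> W (e s)))"
      using semilinear_finsum[OF L.abelian_group_axioms self_group_R tau, of "\<lambda>s. cf s (W a) \<odot>\<^bsub>L\<^esub> W (e s)" "{..<m}"] Wa by auto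
    also have "\<dots> = (\<Oplus>s\<in>{..<m}. cf s (W a) \<otimes> (pol (odd_perms n) (e s) \<ominus> pol (even_perms n) (e s)))"
      by (rule A.R.finsum_cong'[OF refl]) (use Wa p in \<open>auto simp: semilinear_smult[OF tau] tau_W[OF e]\<close>)
    finally show ?thesis .
  qed
  \<comment> \<open>The combination of the even half norms of the chart tuples with the coefficients
    of \<open>W a\<close>. By \<open>odd_sum_zero\<close> it is minus \<tau> of
    \<open>W a\<close>.\<close>
  let ?E = "\<Oplus>s\<in>{..<m}. cf s (W a) \<otimes> pol (even_perms n) (e s)"
  have Ec: "?E \<in> carrier R" using Wa p by (intro A.R.finsum_closed) auto
  have "tau (W a) = (\<Oplus>s\<in>{..<m}. cf s (W a) \<otimes> pol (odd_perms n) (e s) \<oplus> \<ominus> (cf s (W a) \<otimes> pol (even_perms n) (e s)))"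
    unfolding tl by (rule A.R.finsum_cong'[OF refl]) (use Wa p in \<open>auto simp: a_minus_def A.R.r_distr A.R.r_minus\<close>)
  also have "\<dots> = (\<Oplus>s\<in>{..<m}. cf s (W a) \<otimes> pol (odd_perms n) (e s)) \<oplus> (\<Oplus>s\<in>{..<m}. \<ominus> (cf s (W a) \<otimes> pol (even_perms n) (e s)))"
    by (rule A.R.finsum_addf) (use Wa p in auto)
  also have "\<dots> = \<ominus> ?E"
    using A.R.finsum_minus[of "\<lambda>s. cf s (W a) \<otimes> pol (even_perms n) (e s)" "{..<m}"] Wa p Ec
    by (simp add: odd_sum_zero Pi_iff)
  finally have tE: "tau (W a) = \<ominus> ?E" .
  \<comment> \<open>The scalar belonging to \<open>?g\<close> is the even half norm of
    \<open>a\<close> plus \<tau> of \<open>W a\<close>, that is, the odd half norm.\<close>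
  have "(\<Oplus>s\<in>{..<m}. cf s (?g (e s))) = (\<Oplus>s\<in>{..<m}. cf s (Gam (even_perms n) a (e s)) \<oplus> \<ominus> (cf s (W a) \<otimes> pol (even_perms n) (e s)))"
    by (rule A.R.finsum_cong'[OF refl])
      (use Wa p a e in \<open>auto simp: semilinear_add[OF cf] semilinear_minus[OF L.abelian_group_axioms self_group_R cf] semilinear_smult[OF cf] a_minus_def A.R.m_comm\<close>)
  also have "\<dots> = pol (even_perms n) a \<oplus> (\<Oplus>s\<in>{..<m}. \<ominus> (cf s (W a) \<otimes> pol (even_perms n) (e s)))"
    unfolding pol_def[of _ a] by (rule A.R.finsum_addf) (use Wa p a e in auto)
  also have "\<dots> = pol (even_perms n) a \<oplus> tau (W a)"
    using A.R.finsum_minus[of "\<lambda>s. cf s (W a) \<otimes> pol (even_perms n) (e s)" "{..<m}"] Wa p Ec tE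
    by (simp add: Pi_iff)
  also have "\<dots> = pol (odd_perms n) a"
    using a by (simp add: tau_W a_minus_def A.R.a_comm A.R.a_assoc A.R.l_neg A.R.a_lcomm[of "pol (even_perms n) a"] A.R.r_neg)
  finally have "?g b = pol (odd_perms n) a \<odot>\<^bsub>L\<^esub> W b" using scalar[OF g b] by simp
  then have "?g b \<oplus>\<^bsub>L\<^esub> pol (even_perms n) b \<odot>\<^bsub>L\<^esub> W a = pol (odd_perms n) a \<odot>\<^bsub>L\<^esub> W b \<oplus>\<^bsub>L\<^esub> pol (even_perms n) b \<odot>\<^bsub>L\<^esub> W a"
    by simp
  then show ?thesis using a b Wa by (simp add: a_minus_def L.M.a_assoc L.M.l_neg)
qed

lemma semilinear_even_sum:
  assumes h: "h \<in> semilinear R \<sigma> L N" and N: "abelian_group N"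
    and a: "a \<in> vecs" and b: "b \<in> vecs"
  shows "(\<Oplus>\<^bsub>N\<^esub>q\<in>even_perms n. h (W (\<lambda>j. a j \<otimes>\<^bsub>A\<^esub> b (q j)))) = h (Gam (even_perms n) a b)"
proof -
  have eq: "W (\<lambda>j. a j \<otimes>\<^bsub>A\<^esub> b (q j)) = W (\<lambda>j. b (q j) \<otimes>\<^bsub>A\<^esub> a j)" if "q \<in> even_perms n" for q
    by (rule alternating_cong[OF W_alternating prod_Pi[OF perms_memI(1)[OF that] b a]])
      (use a b perms_less[OF perms_memI(1)[OF that]] in \<open>auto simp: A.m_comm Pi_iff\<close>)
  interpret N: abelian_group N by fact
  have "(\<Oplus>\<^bsub>N\<^esub>q\<in>even_perms n. h (W (\<lambda>j. a j \<otimes>\<^bsub>A\<^esub> b (q j)))) = (\<Oplus>\<^bsub>N\<^esub>q\<in>even_perms n. h (W (\<lambda>j. b (q j) \<otimes>\<^bsub>A\<^esub> a j)))"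
    by (rule N.finsum_cong'[OF refl]) (use a b eq in \<open>auto intro!: semilinear_closed[OF h]\<close>)
  also have "\<dots> = h (Gam (even_perms n) b a)"
    unfolding Gam_def by (rule semilinear_finsum[OF L.abelian_group_axioms N h, symmetric]) (use a b in auto)
  finally show ?thesis using Gam_even_sym[OF a b] by simp
qed

text \<open>The sums over even and odd \<open>q\<close> add up to the product of the norms. Within
  the even one, the odd half norms exceed the even ones by \<tau> of the even sum of wedges, which
  \<open>even_half_product\<close> evaluates; the rest is
  \<open>discriminant_identity\<close>.\<close>

lemma signed_norm_sum:
  assumes a: "a \<in> vecs" and b: "b \<in> vecs"
  defines "D X \<equiv> \<Oplus>q\<in>X. pol (perms n) (\<lambda>j. a j \<otimes>\<^bsub>A\<^esub> b (q j))"
  defines "k \<equiv> kap (W a) (W b)"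
  shows "D (even_perms n) \<ominus> D (odd_perms n) =
    tau (W a) \<otimes> tau (W b) \<ominus> ((k \<oplus> k) \<oplus> (k \<oplus> k))"
proof -
  let ?G = "pol (even_perms n)" and ?H = "pol (odd_perms n)"
  let ?c = "\<lambda>q j. a j \<otimes>\<^bsub>A\<^esub> b (q j)"
  have c: "?c q \<in> vecs" if "q \<in> perms n" for q by (rule prod_Pi'[OF that a b])
  have Pc: "pol X (?c q) \<in> carrier R" if "q \<in> perms n" "X \<subseteq> perms n" for q X by (rule pol_closed[OF that(2) c[OF that(1)]])
  have cl: "D X \<in> carrier R" if "X \<subseteq> perms n" for X
    unfolding D_def by (rule A.R.finsum_closed) (use that Pc in \<open>auto simp: perms_sub\<close>)
  have cE: "D (even_perms n) \<in> carrier R" "D (odd_perms n) \<in> carrier R" by (simp_all add: cl perms_sub)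
  have "D (even_perms n) \<oplus> D (odd_perms n) = D (perms n)"
    unfolding D_def perms_split(1)
    by (rule A.R.finsum_Un_disjoint[symmetric]) (use Pc perms_sub in \<open>auto simp: perms_finite perms_split(2) perms_split(1)[symmetric]\<close>)
  also have "\<dots> = pol (perms n) a \<otimes> pol (perms n) b" unfolding D_def by (rule norm_mult[OF a b])
  also have "\<dots> = (?G a \<oplus> ?H a) \<otimes> (?G b \<oplus> ?H b)" using pol_split a b by simp
  finally have DO: "D (odd_perms n) = (?G a \<oplus> ?H a) \<otimes> (?G b \<oplus> ?H b) \<ominus> D (even_perms n)"
    using cE by (metis A.R.a_comm A.R.add.inv_solve_right' A.R.a_closed a_minus_def)
  let ?K' = "\<Oplus>q\<in>even_perms n. ?H (?c q)"
  have K'c: "?K' \<in> carrier R" by (rule A.R.finsum_closed) (use Pc perms_sub in auto)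
  have Kc: "dual_sum a b \<in> carrier R" unfolding dual_sum_def by (rule A.R.finsum_closed) (use Pc perms_sub in auto)
  have DE: "D (even_perms n) = dual_sum a b \<oplus> ?K'"
  proof -
    have "D (even_perms n) = (\<Oplus>q\<in>even_perms n. ?G (?c q) \<oplus> ?H (?c q))"
      unfolding D_def by (rule A.R.finsum_cong'[OF refl]) (use Pc perms_sub pol_split[OF c[OF perms_memI(1)]] in auto)
    also have "\<dots> = dual_sum a b \<oplus> ?K'"
      unfolding dual_sum_def by (rule A.R.finsum_addf) (use Pc perms_sub in auto)
    finally show ?thesis .
  qed
  have "(\<Oplus>q\<in>even_perms n. tau (W (?c q))) = (\<Oplus>q\<in>even_perms n. ?H (?c q) \<oplus> \<ominus> ?G (?c q))"
    by (rule A.R.finsum_cong'[OF refl]) (use Pc perms_sub tau_W[OF c[OF perms_memI(1)]] in \<open>auto simp: a_minus_def intro!: A.R.a_closed A.R.a_inv_closed\<close>)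
  also have "\<dots> = ?K' \<oplus> (\<Oplus>q\<in>even_perms n. \<ominus> ?G (?c q))"
    by (rule A.R.finsum_addf) (use Pc perms_sub in auto)
  also have "\<dots> = ?K' \<ominus> dual_sum a b"
    unfolding dual_sum_def a_minus_def by (subst A.R.finsum_minus) (use Pc perms_sub in auto)
  finally have "?K' \<ominus> dual_sum a b = tau (Gam (even_perms n) a b)"
    using semilinear_even_sum[OF tau self_group_R a b] by simp
  also have "\<dots> = ?H a \<otimes> (?H b \<ominus> ?G b) \<oplus> ?G b \<otimes> (?H a \<ominus> ?G a)"
    using a b by (simp add: even_half_product semilinear_add[OF tau] semilinear_smult[OF tau] tau_W W_closed)
  finally have "?K' = dual_sum a b \<oplus> (?H a \<otimes> (?H b \<ominus> ?G b) \<oplus> ?G b \<otimes> (?H a \<ominus> ?G a))"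
    by (rule A.R.minus_eqD[OF K'c Kc])
  from A.R.discriminant_identity[OF _ _ _ _ Kc K'c this] show ?thesis
    unfolding DO k_def using a b by (simp add: DE tau_W kap_W)
qed

end

section \<open>Determinants of traces as signed sums of norms\<close>

lemma (in abelian_monoid) finsum_perms:
  assumes "f \<in> perms n \<rightarrow> carrier G"
  shows "(\<Oplus>p\<in>perms n. f p) = (\<Oplus>p\<in>even_perms n. f p) \<oplus> (\<Oplus>p\<in>odd_perms n. f p)"
  unfolding perms_split(1)
  by (rule finsum_Un_disjoint) (use assms in \<open>auto simp: perms_finite perms_split(2)\<close>)

lemma bij_PiE_Suc:
  "bij_betw (\<lambda>p. (fst p)(k := snd p)) (({..<k} \<rightarrow>\<^sub>E Y) \<times> Y) ({..<Suc k} \<rightarrow>\<^sub>E Y)"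
proof (rule bij_betwI[where g = "\<lambda>g. (g(k := undefined), g k)"])
  show "(\<lambda>p. (fst p)(k := snd p)) \<in> ({..<k} \<rightarrow>\<^sub>E Y) \<times> Y \<rightarrow> ({..<Suc k} \<rightarrow>\<^sub>E Y)"
    by (auto simp: PiE_def Pi_def extensional_def)
  show "(\<lambda>g. (g(k := undefined), g k)) \<in> ({..<Suc k} \<rightarrow>\<^sub>E Y) \<rightarrow> ({..<k} \<rightarrow>\<^sub>E Y) \<times> Y"
    by (auto simp: PiE_def Pi_def extensional_def)
  fix p assume "p \<in> ({..<k} \<rightarrow>\<^sub>E Y) \<times> Y"
  then have "fst p k = undefined" by (auto simp: PiE_def extensional_def)
  then have "(fst p)(k := undefined) = fst p" by (metis fun_upd_triv)
  then show "(((fst p)(k := snd p))(k := undefined), ((fst p)(k := snd p)) k) = p" by (simp add: prod_eq_iff)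
qed simp

text \<open>An injective \<open>h\<close> records for each factor the entry it goes to, while a
  permutation in \<open>Gam\<close> records for each entry its factor; hence the inverse.\<close>

lemma bij_inj_PiE:
  "bij_betw (\<lambda>p. restrict (inv_into UNIV p) {..<n}) (perms n) {h \<in> {..<n} \<rightarrow>\<^sub>E {..<n}. inj_on h {..<n}}"
proof (rule bij_betw_imageI)
  show "inj_on (\<lambda>p. restrict (inv_into UNIV p) {..<n}) (perms n)"
  proof (rule inj_onI)
    fix p q assume p: "p \<in> perms n" and q: "q \<in> perms n"
      and eq: "restrict (inv_into UNIV p) {..<n} = restrict (inv_into UNIV q) {..<n}"
    have pq: "p permutes {..<n}" "q permutes {..<n}" using p q by (auto simp: perms_def)
    have "inv_into UNIV p i = inv_into UNIV q i" for i
    proof (cases "i \<in> {..<n}")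
      case True
      then show ?thesis using fun_cong[OF eq, of i] by simp
    next
      case False
      then show ?thesis using permutes_not_in[OF permutes_inv[OF pq(1)]] permutes_not_in[OF permutes_inv[OF pq(2)]] by simp
    qed
    then have "inv_into UNIV p = inv_into UNIV q" by auto
    then show "p = q" using permutes_inv_inv[OF pq(1)] permutes_inv_inv[OF pq(2)] by metis
  qed
  show "(\<lambda>p. restrict (inv_into UNIV p) {..<n}) ` perms n = {h \<in> {..<n} \<rightarrow>\<^sub>E {..<n}. inj_on h {..<n}}"
  proof (intro equalityI subsetI)
    fix h assume "h \<in> (\<lambda>p. restrict (inv_into UNIV p) {..<n}) ` perms n"
    then obtain p where p: "p \<in> perms n" and hp: "h = restrict (inv_into UNIV p) {..<n}" by blast
    then have ip: "inv_into UNIV p permutes {..<n}" using permutes_inv by (auto simp: perms_def)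
    have "restrict (inv_into UNIV p) {..<n} \<in> {..<n} \<rightarrow>\<^sub>E {..<n}"
      using permutes_in_image[OF ip] by auto
    moreover have "inj_on (restrict (inv_into UNIV p) {..<n}) {..<n}"
      using permutes_inj_on[OF ip] by (simp add: inj_on_def)
    ultimately show "h \<in> {h \<in> {..<n} \<rightarrow>\<^sub>E {..<n}. inj_on h {..<n}}" unfolding hp by blast
  next
    fix h assume "h \<in> {h \<in> {..<n} \<rightarrow>\<^sub>E {..<n}. inj_on h {..<n}}"
    then have h: "h \<in> {..<n} \<rightarrow>\<^sub>E {..<n}" "inj_on h {..<n}" by auto
    define p where "p i = (if i < n then h i else i)" for i
    have "h ` {..<n} = {..<n}" using h by (intro endo_inj_surj) auto
    then have "bij_betw h {..<n} {..<n}" using h(2) by (simp add: bij_betw_def)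
    then have "bij_betw p {..<n} {..<n}" by (rule bij_betw_cong[THEN iffD1, rotated]) (simp add: p_def)
    then have pp: "p permutes {..<n}" by (rule bij_imp_permutes) (simp add: p_def)
    have "h = restrict p {..<n}" using h(1) by (auto simp: p_def PiE_def extensional_def restrict_def)
    then have "h = restrict (inv_into UNIV (inv_into UNIV p)) {..<n}" using permutes_inv_inv[OF pp] by simp
    then show "h \<in> (\<lambda>p. restrict (inv_into UNIV p) {..<n}) ` perms n"
      using permutes_inv[OF pp] by (auto simp: perms_def intro!: image_eqI[of _ _ "inv_into UNIV p"])
  qed
qed

text \<open>\<open>T\<close> stands for the trace. The assumption describes it by its action on
  \<open>L\<close>: multiplication by \<open>x\<close> extended as a derivation, which multiplies
  one entry at a time.\<close>

locale traced_chart = disc_chart R A n m e cf for R (structure) and A (structure) and n m e cf +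
  fixes T
  assumes T_closed [simp, intro]: "x \<in> carrier A \<Longrightarrow> T x \<in> carrier R"
    and T_W: "x \<in> carrier A \<Longrightarrow> v \<in> vecs \<Longrightarrow>
      T x \<odot>\<^bsub>L\<^esub> W v = (\<Oplus>\<^bsub>L\<^esub>j\<in>{..<n}. W (v(j := x \<otimes>\<^bsub>A\<^esub> v j)))"
begin

abbreviation fibprod where "fibprod x h k j \<equiv> (\<Otimes>\<^bsub>A\<^esub>i\<in>{i \<in> {..<k}. h i = j}. x i)"

lemma fibprod_closed: "x \<in> {..<k} \<rightarrow> carrier A \<Longrightarrow> fibprod x h k j \<in> carrier A"
  by (rule A.finprod_closed) auto

lemma fib_Pi: "x \<in> {..<k} \<rightarrow> carrier A \<Longrightarrow> v \<in> vecs \<Longrightarrow>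
    (\<lambda>j. fibprod x h k j \<otimes>\<^bsub>A\<^esub> v j) \<in> vecs"
  by (intro Pi_I A.m_closed fibprod_closed) auto

text \<open>Each trace multiplies one entry of the wedge by its argument, so a product of
  \<open>k\<close> traces is a sum over all ways \<open>h\<close> of distributing the
  \<open>k\<close> arguments to the \<open>n\<close> entries; entry \<open>j\<close> collects the
  arguments in the fibre of \<open>h\<close> over \<open>j\<close>.\<close>

lemma prod_T:
  assumes v: "v \<in> vecs" and x: "x \<in> {..<k::nat} \<rightarrow> carrier A"
  shows "(\<Otimes>i\<in>{..<k}. T (x i)) \<odot>\<^bsub>L\<^esub> W v =
    (\<Oplus>\<^bsub>L\<^esub>h\<in>({..<k} \<rightarrow>\<^sub>E {..<n}). W (\<lambda>j. fibprod x h k j \<otimes>\<^bsub>A\<^esub> v j))"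
  using x
proof (induction k)
  case 0
  have "W (\<lambda>j. \<one>\<^bsub>A\<^esub> \<otimes>\<^bsub>A\<^esub> v j) = W v"
    by (rule alternating_cong[OF W_alternating v]) (rule A.l_one, use v in auto)
  then show ?case using v by simp
next
  case (Suc k)
  have x: "x \<in> {..<k} \<rightarrow> carrier A" and xk: "x k \<in> carrier A" using Suc.prems by auto
  let ?u = "\<lambda>h j. fibprod x h k j \<otimes>\<^bsub>A\<^esub> v j"
  have u: "?u h \<in> vecs" for h by (rule fib_Pi[OF x v])
  let ?U = "\<lambda>h j. fibprod x h (Suc k) j \<otimes>\<^bsub>A\<^esub> v j"
  have U: "?U h \<in> vecs" for h by (rule fib_Pi[OF Suc.prems v])
  \<comment> \<open>Letting the last argument \<open>x k\<close> go to entry \<open>j\<close>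
    extends the distribution \<open>h\<close> to \<open>h(k := j)\<close>.\<close>
  have upd: "W ((?u h)(j := x k \<otimes>\<^bsub>A\<^esub> ?u h j)) = W (?U (h(k := j)))" if j: "j < n" for h j
  proof (rule alternating_cong[OF W_alternating U])
    fix i assume i: "i < n"
    have vi: "v i \<in> carrier A" using v i by auto
    have fib: "{i' \<in> {..<Suc k}. (h(k := j)) i' = i} = (if i = j then insert k {i' \<in> {..<k}. h i' = i} else {i' \<in> {..<k}. h i' = i})"
      by auto
    show "((?u h)(j := x k \<otimes>\<^bsub>A\<^esub> ?u h j)) i = ?U (h(k := j)) i"
    proof (cases "i = j")
      case True
      have "(\<Otimes>\<^bsub>A\<^esub>i'\<in>insert k {i' \<in> {..<k}. h i' = j}. x i') = x k \<otimes>\<^bsub>A\<^esub> fibprod x h k j"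
        by (rule A.finprod_insert) (use x xk in auto)
      then show ?thesis unfolding fib using True A.m_assoc[OF xk fibprod_closed[OF x] vi, of h j] by simp
    next
      case False
      then show ?thesis unfolding fib by simp
    qed
  qed
  have fin: "finite ({..<k} \<rightarrow>\<^sub>E {..<n})" by (simp add: finite_PiE)
  have Tc: "(\<Otimes>i\<in>{..<k}. T (x i)) \<in> carrier R" by (rule A.R.finprod_closed) (use x in auto)
  have "(\<Otimes>i\<in>{..<Suc k}. T (x i)) \<odot>\<^bsub>L\<^esub> W v = T (x k) \<odot>\<^bsub>L\<^esub> ((\<Otimes>i\<in>{..<k}. T (x i)) \<odot>\<^bsub>L\<^esub> W v)"
    unfolding lessThan_Suc using x xk v Tc by (subst A.R.finprod_insert) (auto simp: L.smult_assoc1)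
  also have "\<dots> = T (x k) \<odot>\<^bsub>L\<^esub> (\<Oplus>\<^bsub>L\<^esub>h\<in>({..<k} \<rightarrow>\<^sub>E {..<n}). W (?u h))" by (simp only: Suc.IH[OF x])
  also have "\<dots> = (\<Oplus>\<^bsub>L\<^esub>h\<in>({..<k} \<rightarrow>\<^sub>E {..<n}). T (x k) \<odot>\<^bsub>L\<^esub> W (?u h))"
    by (rule L.finsum_smult_ldistr[OF fin]) (use xk W_closed[OF u] in auto)
  also have "\<dots> = (\<Oplus>\<^bsub>L\<^esub>h\<in>({..<k} \<rightarrow>\<^sub>E {..<n}). \<Oplus>\<^bsub>L\<^esub>j\<in>{..<n}. W (?U (h(k := j))))"
  proof (rule L.M.finsum_cong'[OF refl])
    fix h
    have "T (x k) \<odot>\<^bsub>L\<^esub> W (?u h) = (\<Oplus>\<^bsub>L\<^esub>j\<in>{..<n}. W ((?u h)(j := x k \<otimes>\<^bsub>A\<^esub> ?u h j)))" by (rule T_W[OF xk u])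
    also have "\<dots> = (\<Oplus>\<^bsub>L\<^esub>j\<in>{..<n}. W (?U (h(k := j))))"
      by (rule L.M.finsum_cong'[OF refl _ upd]) (use W_closed[OF U] in auto)
    finally show "T (x k) \<odot>\<^bsub>L\<^esub> W (?u h) = (\<Oplus>\<^bsub>L\<^esub>j\<in>{..<n}. W (?U (h(k := j))))" .
  qed (use W_closed[OF U] in auto)
  also have "\<dots> = (\<Oplus>\<^bsub>L\<^esub>p\<in>({..<k} \<rightarrow>\<^sub>E {..<n}) \<times> {..<n}. W (?U ((fst p)(k := snd p))))"
    by (rule L.M.finsum_times) (use fin W_closed[OF U] in auto)
  also have "\<dots> = (\<Oplus>\<^bsub>L\<^esub>h\<in>({..<Suc k} \<rightarrow>\<^sub>E {..<n}). W (?U h))"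
    by (rule L.M.finsum_bij[OF bij_PiE_Suc, symmetric]) (use W_closed[OF U] in auto)
  finally show ?case .
qed

abbreviation sg where "sg q y \<equiv> (if evenperm q then y else \<ominus>\<^bsub>L\<^esub> y)"

lemma sg_sum:
  "finite I \<Longrightarrow> f \<in> I \<rightarrow> carrier L \<Longrightarrow> sg q (\<Oplus>\<^bsub>L\<^esub>i\<in>I. f i) = (\<Oplus>\<^bsub>L\<^esub>i\<in>I. sg q (f i))"
  using L.M.finsum_minus[of f I] by simp

lemma perms_conv: "{p. p permutes {..<n}} = perms n" by (simp add: perms_def)

text \<open>If \<open>k\<close> and \<open>l\<close> go to the same entry, exchanging
  \<open>b (q k)\<close> and \<open>b (q l)\<close> does not affect the product collected there, so
  \<open>q\<close> and its composite with the transposition of \<open>k\<close> and \<open>l\<close>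
  cancel by their signs.\<close>

lemma noninjective_zero:
  assumes a: "a \<in> vecs" and b: "b \<in> vecs" and v: "v \<in> vecs"
    and kl: "k < n" "l < n" "k \<noteq> l" "h k = h l"
  shows "(\<Oplus>\<^bsub>L\<^esub>q\<in>perms n. sg q (W (\<lambda>j. fibprod (\<lambda>i. a i \<otimes>\<^bsub>A\<^esub> b (q i)) h n j \<otimes>\<^bsub>A\<^esub> v j))) = \<zero>\<^bsub>L\<^esub>"
proof (rule L.M.finsum_involution[where p = "\<lambda>q. q \<circ> Transposition.transpose k l"])
  fix q assume q: "q \<in> perms n"
  let ?t = "Transposition.transpose k l"
  have t: "?t \<in> perms n" "\<not> evenperm ?t" using kl by (auto simp: transpose_perms evenperm_swap)
  have qt: "q \<circ> ?t \<in> perms n" using q t by (auto simp: perms_def permutes_compose)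
  then show "q \<circ> ?t \<in> perms n" .
  show "q \<circ> ?t \<circ> ?t = q" by (simp add: comp_assoc)
  have cq: "(\<lambda>i. a i \<otimes>\<^bsub>A\<^esub> b (q i)) \<in> vecs" if "q \<in> perms n" for q by (rule prod_Pi'[OF that a b])
  have Wc: "W (\<lambda>j. fibprod (\<lambda>i. a i \<otimes>\<^bsub>A\<^esub> b (q i)) h n j \<otimes>\<^bsub>A\<^esub> v j) \<in> carrier L" by (rule W_closed[OF fib_Pi[OF cq[OF q] v]])
  have fp: "fibprod (\<lambda>i. a i \<otimes>\<^bsub>A\<^esub> b ((q \<circ> ?t) i)) h n j = fibprod (\<lambda>i. a i \<otimes>\<^bsub>A\<^esub> b (q i)) h n j" for j
  proof -
    let ?F = "{i \<in> {..<n}. h i = j}"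
    have bj: "bij_betw ?t ?F ?F"
      by (rule bij_betwI[where g = ?t])
        (use transpose_same[of h k l, OF kl(4)] perms_less[OF t(1)] in auto)
    have am: "a \<in> ?F \<rightarrow> carrier A" "(\<lambda>i. b (q i)) \<in> ?F \<rightarrow> carrier A" "(\<lambda>i. b ((q \<circ> ?t) i)) \<in> ?F \<rightarrow> carrier A"
      using a b perms_less[OF q] perms_less[OF qt] by (auto simp: Pi_iff)
    have "fibprod (\<lambda>i. a i \<otimes>\<^bsub>A\<^esub> b ((q \<circ> ?t) i)) h n j = (\<Otimes>\<^bsub>A\<^esub>i\<in>?F. a i) \<otimes>\<^bsub>A\<^esub> (\<Otimes>\<^bsub>A\<^esub>i\<in>?F. b ((q \<circ> ?t) i))"
      by (rule A.finprod_multf) (use am in auto)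
    also have "(\<Otimes>\<^bsub>A\<^esub>i\<in>?F. b ((q \<circ> ?t) i)) = (\<Otimes>\<^bsub>A\<^esub>i\<in>?t ` ?F. b (q i))"
      by (subst A.finprod_reindex) (use bj am in \<open>auto simp: bij_betw_def\<close>)
    also have "?t ` ?F = ?F" using bj by (simp add: bij_betw_def)
    also have "(\<Otimes>\<^bsub>A\<^esub>i\<in>?F. a i) \<otimes>\<^bsub>A\<^esub> (\<Otimes>\<^bsub>A\<^esub>i\<in>?F. b (q i)) = fibprod (\<lambda>i. a i \<otimes>\<^bsub>A\<^esub> b (q i)) h n j"
      by (rule A.finprod_multf[symmetric]) (use am in auto)
    finally show ?thesis .
  qed
  have ev: "evenperm (q \<circ> ?t) \<longleftrightarrow> \<not> evenperm q"
    using permutes_evenperm_comp[of q n ?t] q t by (auto simp: perms_def)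
  show "sg (q \<circ> ?t) (W (\<lambda>j. fibprod (\<lambda>i. a i \<otimes>\<^bsub>A\<^esub> b ((q \<circ> ?t) i)) h n j \<otimes>\<^bsub>A\<^esub> v j)) =
     \<ominus>\<^bsub>L\<^esub> sg q (W (\<lambda>j. fibprod (\<lambda>i. a i \<otimes>\<^bsub>A\<^esub> b (q i)) h n j \<otimes>\<^bsub>A\<^esub> v j))"
    unfolding fp using ev Wc by simp
  show "sg q (W (\<lambda>j. fibprod (\<lambda>i. a i \<otimes>\<^bsub>A\<^esub> b (q i)) h n j \<otimes>\<^bsub>A\<^esub> v j)) = \<zero>\<^bsub>L\<^esub>" if "q \<circ> ?t = q"
    using fun_cong[OF that, of k] q kl by (auto simp: perms_def dest: permutes_inj injD)
next
  show "(\<lambda>q. sg q (W (\<lambda>j. fibprod (\<lambda>i. a i \<otimes>\<^bsub>A\<^esub> b (q i)) h n j \<otimes>\<^bsub>A\<^esub> v j))) \<in> perms n \<rightarrow> carrier L"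
    using W_closed[OF fib_Pi[OF prod_Pi'[OF _ a b] v]] by auto
qed (rule perms_finite)

text \<open>Both sides are compared by their action on a wedge. Once the determinant is expanded,
  only the bijective distributions survive, and for fixed \<open>q\<close> these make up the
  operator of a \<cdot> (b \<circ> q) over all permutations, which acts as the norm.\<close>

lemma trace_det:
  assumes a: "a \<in> vecs" and b: "b \<in> vecs"
  shows "ring_det R n (\<lambda>i j. T (a i \<otimes>\<^bsub>A\<^esub> b j)) =
    (\<Oplus>q\<in>even_perms n. pol (perms n) (\<lambda>j. a j \<otimes>\<^bsub>A\<^esub> b (q j))) \<ominus>
    (\<Oplus>q\<in>odd_perms n. pol (perms n) (\<lambda>j. a j \<otimes>\<^bsub>A\<^esub> b (q j)))" (is "?det = ?E \<ominus> ?O")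
proof -
  let ?H = "{..<n} \<rightarrow>\<^sub>E {..<n}" and ?I = "{h \<in> {..<n} \<rightarrow>\<^sub>E {..<n}. inj_on h {..<n}}"
  let ?c = "\<lambda>q i. a i \<otimes>\<^bsub>A\<^esub> b (q i)"
  have fin: "finite ?H" by (simp add: finite_PiE)
  have c: "?c q \<in> vecs" if "q \<in> perms n" for q by (rule prod_Pi'[OF that a b])
  have cc: "?c q i \<in> carrier A" if "q \<in> perms n" "i < n" for q i using c[OF that(1)] that(2) by auto
  have pc: "pol (perms n) (?c q) \<in> carrier R" if "q \<in> perms n" for q using c[OF that] by simp
  let ?p = "\<lambda>q. \<Otimes>i\<in>{..<n}. T (?c q i)"
  have pr: "?p q \<in> carrier R" if "q \<in> perms n" for q
    by (rule A.R.finprod_closed) (use cc that in auto)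
  have detc: "?det \<in> carrier R"
    unfolding ring_det_def perms_conv by (rule A.R.finsum_closed) (use pr in auto)
  have EOc: "?E \<in> carrier R" "?O \<in> carrier R"
    by (rule A.R.finsum_closed, use pc in auto)+
  show ?thesis
  proof (rule scalar_cancel[OF detc])
    show "?E \<ominus> ?O \<in> carrier R" using EOc by simp
    fix v assume v: "v \<in> vecs"
    have Wv: "W v \<in> carrier L" using v by auto
    let ?w = "\<lambda>h q. W (\<lambda>j. fibprod (?c q) h n j \<otimes>\<^bsub>A\<^esub> v j)"
    have w: "?w h q \<in> carrier L" if "q \<in> perms n" for h q by (rule W_closed[OF fib_Pi[OF c[OF that] v]])
    have "?det \<odot>\<^bsub>L\<^esub> W v = (\<Oplus>\<^bsub>L\<^esub>q\<in>perms n. (if evenperm q then ?p q else \<ominus> ?p q) \<odot>\<^bsub>L\<^esub> W v)"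
      unfolding ring_det_def perms_conv by (rule L.finsum_smult_rdistr) (use pr Wv in auto)
    also have "\<dots> = (\<Oplus>\<^bsub>L\<^esub>q\<in>perms n. \<Oplus>\<^bsub>L\<^esub>h\<in>?H. sg q (?w h q))"
    proof (rule L.M.finsum_cong'[OF refl])
      fix q assume q: "q \<in> perms n"
      have "(if evenperm q then ?p q else \<ominus> ?p q) \<odot>\<^bsub>L\<^esub> W v = sg q (?p q \<odot>\<^bsub>L\<^esub> W v)"
        using pr[OF q] Wv by (simp add: L.smult_l_minus)
      also have "?p q \<odot>\<^bsub>L\<^esub> W v = (\<Oplus>\<^bsub>L\<^esub>h\<in>?H. ?w h q)" by (rule prod_T[OF v c[OF q]])
      also have "sg q (\<Oplus>\<^bsub>L\<^esub>h\<in>?H. ?w h q) = (\<Oplus>\<^bsub>L\<^esub>h\<in>?H. sg q (?w h q))"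
        by (rule sg_sum[OF fin]) (use w q in auto)
      finally show "(if evenperm q then ?p q else \<ominus> ?p q) \<odot>\<^bsub>L\<^esub> W v = (\<Oplus>\<^bsub>L\<^esub>h\<in>?H. sg q (?w h q))" .
    qed (use w in \<open>auto intro!: L.M.finsum_closed\<close>)
    also have "\<dots> = (\<Oplus>\<^bsub>L\<^esub>h\<in>?H. \<Oplus>\<^bsub>L\<^esub>q\<in>perms n. sg q (?w h q))"
      by (rule L.M.finsum_swap[OF perms_finite(1) fin]) (use w in auto)
    also have "\<dots> = (\<Oplus>\<^bsub>L\<^esub>h\<in>?I. \<Oplus>\<^bsub>L\<^esub>q\<in>perms n. sg q (?w h q))"
    proof (rule L.M.add.finprod_mono_neutral_cong_left[symmetric, OF fin])
      fix h assume "h \<in> ?H - ?I"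
      then obtain k l where "k < n" "l < n" "k \<noteq> l" "h k = h l" by (auto simp: inj_on_def)
      then show "(\<Oplus>\<^bsub>L\<^esub>q\<in>perms n. sg q (?w h q)) = \<zero>\<^bsub>L\<^esub>" by (rule noninjective_zero[OF a b v])
    qed (use w in \<open>auto intro!: L.M.finsum_closed\<close>)
    also have "\<dots> = (\<Oplus>\<^bsub>L\<^esub>p\<in>perms n. \<Oplus>\<^bsub>L\<^esub>q\<in>perms n. sg q (?w (restrict (inv_into UNIV p) {..<n}) q))"
      by (rule L.M.finsum_bij[OF bij_inj_PiE]) (use w in \<open>auto intro!: L.M.finsum_closed\<close>)
    also have "\<dots> = (\<Oplus>\<^bsub>L\<^esub>p\<in>perms n. \<Oplus>\<^bsub>L\<^esub>q\<in>perms n. sg q (W (\<lambda>j. ?c q (p j) \<otimes>\<^bsub>A\<^esub> v j)))"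
    proof (intro L.M.finsum_cong'[OF refl])
      fix p q assume p: "p \<in> perms n" and q: "q \<in> perms n"
      have pp: "p permutes {..<n}" using p by (simp add: perms_def)
      have "W (\<lambda>j. fibprod (?c q) (restrict (inv_into UNIV p) {..<n}) n j \<otimes>\<^bsub>A\<^esub> v j) = W (\<lambda>j. ?c q (p j) \<otimes>\<^bsub>A\<^esub> v j)"
      proof (rule alternating_cong[OF W_alternating prod_Pi[OF p c[OF q] v]])
        fix j assume j: "j < n"
        have pj: "p j < n" using perms_less[OF p] j by simp
        have "{i \<in> {..<n}. restrict (inv_into UNIV p) {..<n} i = j} = {p j}"
          using pj permutes_inverses[OF pp] by (auto simp: restrict_def)
        then show "fibprod (?c q) (restrict (inv_into UNIV p) {..<n}) n j \<otimes>\<^bsub>A\<^esub> v j = ?c q (p j) \<otimes>\<^bsub>A\<^esub> v j"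
          using cc[OF q pj] by simp
      qed
      then show "sg q (?w (restrict (inv_into UNIV p) {..<n}) q) = sg q (W (\<lambda>j. ?c q (p j) \<otimes>\<^bsub>A\<^esub> v j))" by simp
    qed (use W_prod[OF _ c v] in \<open>auto intro!: L.M.finsum_closed\<close>)
    also have "\<dots> = (\<Oplus>\<^bsub>L\<^esub>q\<in>perms n. \<Oplus>\<^bsub>L\<^esub>p\<in>perms n. sg q (W (\<lambda>j. ?c q (p j) \<otimes>\<^bsub>A\<^esub> v j)))"
      by (rule L.M.finsum_swap[OF perms_finite(1) perms_finite(1)]) (use W_prod[OF _ c v] in auto)
    also have "\<dots> = (\<Oplus>\<^bsub>L\<^esub>q\<in>perms n. sg q (pol (perms n) (?c q) \<odot>\<^bsub>L\<^esub> W v))"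
    proof (rule L.M.finsum_cong'[OF refl])
      fix q assume q: "q \<in> perms n"
      have "(\<Oplus>\<^bsub>L\<^esub>p\<in>perms n. sg q (W (\<lambda>j. ?c q (p j) \<otimes>\<^bsub>A\<^esub> v j))) = sg q (Gam (perms n) (?c q) v)"
        unfolding Gam_def by (rule sg_sum[symmetric]) (use W_prod[OF _ c[OF q] v] perms_finite in auto)
      then show "(\<Oplus>\<^bsub>L\<^esub>p\<in>perms n. sg q (W (\<lambda>j. ?c q (p j) \<otimes>\<^bsub>A\<^esub> v j))) = sg q (pol (perms n) (?c q) \<odot>\<^bsub>L\<^esub> W v)"
        using norm_scalar[OF c[OF q] v] by simp
    qed (use pc Wv in auto)
    also have "\<dots> = (\<Oplus>\<^bsub>L\<^esub>q\<in>even_perms n. sg q (pol (perms n) (?c q) \<odot>\<^bsub>L\<^esub> W v)) \<oplus>\<^bsub>L\<^esub> (\<Oplus>\<^bsub>L\<^esub>q\<in>odd_perms n. sg q (pol (perms n) (?c q) \<odot>\<^bsub>L\<^esub> W v))"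
      by (rule L.M.finsum_perms) (use pc Wv in auto)
    also have "(\<Oplus>\<^bsub>L\<^esub>q\<in>even_perms n. sg q (pol (perms n) (?c q) \<odot>\<^bsub>L\<^esub> W v)) = (\<Oplus>\<^bsub>L\<^esub>q\<in>even_perms n. pol (perms n) (?c q) \<odot>\<^bsub>L\<^esub> W v)"
      by (rule L.M.finsum_cong'[OF refl]) (use pc Wv in \<open>auto simp: even_perms_def perms_def\<close>)
    also have "\<dots> = ?E \<odot>\<^bsub>L\<^esub> W v"
      by (rule L.finsum_smult_rdistr[symmetric]) (use pc Wv in auto)
    also have "(\<Oplus>\<^bsub>L\<^esub>q\<in>odd_perms n. sg q (pol (perms n) (?c q) \<odot>\<^bsub>L\<^esub> W v)) = (\<Oplus>\<^bsub>L\<^esub>q\<in>odd_perms n. \<ominus>\<^bsub>L\<^esub> (pol (perms n) (?c q) \<odot>\<^bsub>L\<^esub> W v))"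
      by (rule L.M.finsum_cong'[OF refl]) (use pc Wv in \<open>auto simp: odd_perms_def perms_def\<close>)
    also have "\<dots> = \<ominus>\<^bsub>L\<^esub> (?O \<odot>\<^bsub>L\<^esub> W v)"
      by (subst L.M.finsum_minus, use pc Wv in force, subst L.finsum_smult_rdistr) (use pc Wv in auto)
    finally show "?det \<odot>\<^bsub>L\<^esub> W v = (?E \<ominus> ?O) \<odot>\<^bsub>L\<^esub> W v"
      using EOc Wv by (simp add: a_minus_def L.smult_l_distr L.smult_l_minus)
  qed
qed

lemma discriminant_formula:
  assumes a: "a \<in> vecs" and b: "b \<in> vecs"
  defines "k \<equiv> kap (W a) (W b)"
  shows "ring_det R n (\<lambda>i j. T (a i \<otimes>\<^bsub>A\<^esub> b j)) =
    tau (W a) \<otimes> tau (W b) \<ominus> ((k \<oplus> k) \<oplus> (k \<oplus> k))"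
  unfolding trace_det[OF a b] k_def by (rule signed_norm_sum[OF a b])

end

lemma (in abelian_group) a_diff_zero [simp]: "x \<in> carrier G \<Longrightarrow> x \<ominus> \<zero> = x"
  by (simp add: a_minus_def)

section \<open>Independence of the trace from the dual basis\<close>

section \<open>Traces\<close>

lemma dual_basisD:
  assumes "dual_basis R M k e \<xi>"
  shows "i < k \<Longrightarrow> e i \<in> carrier M" "i < k \<Longrightarrow> \<xi> i \<in> semilinear R id M (self_module R)"
    "x \<in> carrier M \<Longrightarrow> (\<Oplus>\<^bsub>M\<^esub>i\<in>{..<k}. \<xi> i x \<odot>\<^bsub>M\<^esub> e i) = x"
  using assms unfolding dual_basis_def by auto

text \<open>For dual bases \<open>(e, \<xi>)\<close> and \<open>(u, \<eta>)\<close>, the double sum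
  of \<open>\<eta> j (e i)\<close> times \<open>\<xi> i (f (u j))\<close> can be contracted over
  \<open>j\<close> or over \<open>i\<close>, which gives the one trace or the other.\<close>

lemma module_trace_eq:
  assumes M: "module R M" and d: "dual_basis R M k e \<xi>" and f: "f \<in> semilinear R id M M"
  shows "module_trace R M f = (\<Oplus>\<^bsub>R\<^esub>i\<in>{..<k}. \<xi> i (f (e i)))"
proof -
  interpret M: module R M by fact
  have Mg: "abelian_group M" ..
  have Rg: "abelian_group (self_module R)" using self_module_module[OF M.R.is_cring] by (simp add: module_def)
  have *: "(\<Oplus>\<^bsub>R\<^esub>i\<in>{..<k}. \<xi> i (f (e i))) = (\<Oplus>\<^bsub>R\<^esub>i\<in>{..<k}. \<Oplus>\<^bsub>R\<^esub>j\<in>{..<l}. \<eta> j (e i) \<otimes>\<^bsub>R\<^esub> \<xi> i (f (u j)))"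
    if d: "dual_basis R M k e \<xi>" and d': "dual_basis R M l u \<eta>" for k e \<xi> l u \<eta>
  proof (rule M.R.finsum_cong'[OF refl])
    note D = dual_basisD[OF d] and D' = dual_basisD[OF d']
    have hc: "i < l \<Longrightarrow> x \<in> carrier M \<Longrightarrow> \<eta> i x \<in> carrier R" for i x using semilinear_closed[OF D'(2)] by simp
    have xc: "i < k \<Longrightarrow> x \<in> carrier M \<Longrightarrow> \<xi> i x \<in> carrier R" for i x using semilinear_closed[OF D(2)] by simp
    note fc = semilinear_closed[OF f]
    show "(\<lambda>i. \<Oplus>\<^bsub>R\<^esub>j\<in>{..<l}. \<eta> j (e i) \<otimes>\<^bsub>R\<^esub> \<xi> i (f (u j))) \<in> {..<k} \<rightarrow> carrier R"
      using hc xc fc D D' by (auto intro!: M.R.finsum_closed)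
    fix i assume "i \<in> {..<k}"
    then have i: "i < k" by simp
    note g = semilinear_comp[OF f D(2)[OF i]]
    have g: "(\<lambda>x. \<xi> i (f x)) \<in> semilinear R id M (self_module R)"
      using semilinear_comp[OF f D(2)[OF i]] by (simp add: id_def)
    have "\<xi> i (f (e i)) = \<xi> i (f (\<Oplus>\<^bsub>M\<^esub>j\<in>{..<l}. \<eta> j (e i) \<odot>\<^bsub>M\<^esub> u j))" using D'(3)[OF D(1)[OF i]] by simp
    also have "\<dots> = (\<Oplus>\<^bsub>R\<^esub>j\<in>{..<l}. \<xi> i (f (\<eta> j (e i) \<odot>\<^bsub>M\<^esub> u j)))"
      using semilinear_finsum[OF Mg Rg g, of "\<lambda>j. \<eta> j (e i) \<odot>\<^bsub>M\<^esub> u j" "{..<l}"] hc D'(1) D(1)[OF i] by (auto simp: Pi_iff)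
    also have "\<dots> = (\<Oplus>\<^bsub>R\<^esub>j\<in>{..<l}. \<eta> j (e i) \<otimes>\<^bsub>R\<^esub> \<xi> i (f (u j)))"
      by (rule M.R.finsum_cong'[OF refl])
        (use hc D'(1) D(1)[OF i] semilinear_smult[OF g] xc[OF i] fc in auto)
    finally show "\<xi> i (f (e i)) = (\<Oplus>\<^bsub>R\<^esub>j\<in>{..<l}. \<eta> j (e i) \<otimes>\<^bsub>R\<^esub> \<xi> i (f (u j)))" .
  qed
  have uniq: "(\<Oplus>\<^bsub>R\<^esub>i\<in>{..<k}. \<xi> i (f (e i))) = (\<Oplus>\<^bsub>R\<^esub>j\<in>{..<l}. \<eta> j (f (u j)))"
    if d': "dual_basis R M l u \<eta>" for l u \<eta>
  proof -
    note D = dual_basisD[OF d] and D' = dual_basisD[OF d']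
    have hc: "i < l \<Longrightarrow> x \<in> carrier M \<Longrightarrow> \<eta> i x \<in> carrier R" for i x using semilinear_closed[OF D'(2)] by simp
    have xc: "i < k \<Longrightarrow> x \<in> carrier M \<Longrightarrow> \<xi> i x \<in> carrier R" for i x using semilinear_closed[OF D(2)] by simp
    note fc = semilinear_closed[OF f]
    have "(\<Oplus>\<^bsub>R\<^esub>i\<in>{..<k}. \<xi> i (f (e i))) = (\<Oplus>\<^bsub>R\<^esub>j\<in>{..<l}. \<Oplus>\<^bsub>R\<^esub>i\<in>{..<k}. \<eta> j (e i) \<otimes>\<^bsub>R\<^esub> \<xi> i (f (u j)))"
      unfolding *[OF d d'] by (rule M.R.finsum_swap) (use hc xc fc D D' in auto)
    also have "\<dots> = (\<Oplus>\<^bsub>R\<^esub>j\<in>{..<l}. \<eta> j (f (u j)))"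
    proof (rule M.R.finsum_cong'[OF refl])
      show "(\<lambda>j. \<eta> j (f (u j))) \<in> {..<l} \<rightarrow> carrier R" using hc fc D' by auto
      fix j assume "j \<in> {..<l}"
      then have j: "j < l" by simp
      have "(\<Oplus>\<^bsub>R\<^esub>i\<in>{..<k}. \<eta> j (e i) \<otimes>\<^bsub>R\<^esub> \<xi> i (f (u j))) = (\<Oplus>\<^bsub>R\<^esub>i\<in>{..<k}. \<eta> j (\<xi> i (f (u j)) \<odot>\<^bsub>M\<^esub> e i))"
        by (rule M.R.finsum_cong'[OF refl])
          (use hc[OF j] xc fc D'(1)[OF j] D(1) in \<open>auto simp: semilinear_smult[OF D'(2)[OF j]] M.R.m_comm\<close>)
      also have "\<dots> = \<eta> j (\<Oplus>\<^bsub>M\<^esub>i\<in>{..<k}. \<xi> i (f (u j)) \<odot>\<^bsub>M\<^esub> e i)"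
        using semilinear_finsum[OF Mg Rg D'(2)[OF j], of "\<lambda>i. \<xi> i (f (u j)) \<odot>\<^bsub>M\<^esub> e i" "{..<k}"] xc D(1) D'(1)[OF j] fc
        by (simp add: Pi_iff)
      also have "\<dots> = \<eta> j (f (u j))" using D(3)[OF fc[OF D'(1)[OF j]]] by simp
      finally show "(\<Oplus>\<^bsub>R\<^esub>i\<in>{..<k}. \<eta> j (e i) \<otimes>\<^bsub>R\<^esub> \<xi> i (f (u j))) = \<eta> j (f (u j))" .
    qed
    finally show ?thesis .
  qed
  show ?thesis
    unfolding module_trace_def
  proof (rule the_equality)
    show "\<exists>k' e' \<xi>'. dual_basis R M k' e' \<xi>' \<and> (\<Oplus>\<^bsub>R\<^esub>i\<in>{..<k}. \<xi> i (f (e i))) = (\<Oplus>\<^bsub>R\<^esub>i\<in>{..<k'}. \<xi>' i (f (e' i)))"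
      using d by blast
    fix t assume "\<exists>k e \<xi>. dual_basis R M k e \<xi> \<and> t = (\<Oplus>\<^bsub>R\<^esub>i\<in>{..<k}. \<xi> i (f (e i)))"
    then show "t = (\<Oplus>\<^bsub>R\<^esub>i\<in>{..<k}. \<xi> i (f (e i)))" using uniq by metis
  qed
qed

section \<open>The ring of pairs of a scalar and a top wedge, and its trace\<close>

section \<open>The discriminant algebra\<close>

text \<open>The pairs have to live in a type that the final statement can name, so they are stored
  through an injection \<open>enc\<close>, which is left open here.\<close>

locale disc_algebra = traced_chart R A n m e cf T for R (structure) and A (structure) and n m e cf T +
  fixes enc :: "'a \<times> ('c list \<Rightarrow> 'a) set \<Rightarrow> 'delta"
  assumes enc_inj: "inj_on enc (carrier R \<times> carrier L)"
begin

definition dec where "dec X = inv_into (carrier R \<times> carrier L) enc X"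

text \<open>The term with \<open>tau\<close> in the second coordinate looks one-sided; it is
  symmetric in the two factors because \<open>L\<close> has rank one.\<close>

definition Delta :: "('a, 'delta) module" where "Delta =
  \<lparr>carrier = enc ` (carrier R \<times> carrier L),
   mult = (\<lambda>X Y. enc (fst (dec X) \<otimes> fst (dec Y) \<ominus> kap (snd (dec X)) (snd (dec Y)),
     (fst (dec X) \<odot>\<^bsub>L\<^esub> snd (dec Y) \<oplus>\<^bsub>L\<^esub> fst (dec Y) \<odot>\<^bsub>L\<^esub> snd (dec X)) \<oplus>\<^bsub>L\<^esub> tau (snd (dec X)) \<odot>\<^bsub>L\<^esub> snd (dec Y))),
   one = enc (\<one>, \<zero>\<^bsub>L\<^esub>), zero = enc (\<zero>, \<zero>\<^bsub>L\<^esub>),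
   add = (\<lambda>X Y. enc (fst (dec X) \<oplus> fst (dec Y), snd (dec X) \<oplus>\<^bsub>L\<^esub> snd (dec Y))),
   smult = (\<lambda>r X. enc (r \<otimes> fst (dec X), r \<odot>\<^bsub>L\<^esub> snd (dec X)))\<rparr>"

lemma dec_enc [simp]: "r \<in> carrier R \<Longrightarrow> x \<in> carrier L \<Longrightarrow> dec (enc (r, x)) = (r, x)"
  unfolding dec_def by (rule inv_into_f_f[OF enc_inj]) simp

lemma DeltaE:
  assumes "X \<in> carrier Delta"
  obtains r x where "X = enc (r, x)" "r \<in> carrier R" "x \<in> carrier L"
  using assms by (auto simp: Delta_def)

lemma Delta_closed [simp, intro]: "r \<in> carrier R \<Longrightarrow> x \<in> carrier L \<Longrightarrow> enc (r, x) \<in> carrier Delta"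
  by (simp add: Delta_def)

lemma Delta_simps [simp]:
  "\<one>\<^bsub>Delta\<^esub> = enc (\<one>, \<zero>\<^bsub>L\<^esub>)" "\<zero>\<^bsub>Delta\<^esub> = enc (\<zero>, \<zero>\<^bsub>L\<^esub>)"
  by (simp_all add: Delta_def)

lemma Delta_ops [simp]:
  assumes "r \<in> carrier R" "x \<in> carrier L" "s \<in> carrier R" 
  shows "y \<in> carrier L \<Longrightarrow> enc (r, x) \<oplus>\<^bsub>Delta\<^esub> enc (s, y) = enc (r \<oplus> s, x \<oplus>\<^bsub>L\<^esub> y)"
    and "s \<odot>\<^bsub>Delta\<^esub> enc (r, x) = enc (s \<otimes> r, s \<odot>\<^bsub>L\<^esub> x)"
    and "y \<in> carrier L \<Longrightarrow> enc (r, x) \<otimes>\<^bsub>Delta\<^esub> enc (s, y) = 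
      enc (r \<otimes> s \<ominus> kap x y, (r \<odot>\<^bsub>L\<^esub> y \<oplus>\<^bsub>L\<^esub> s \<odot>\<^bsub>L\<^esub> x) \<oplus>\<^bsub>L\<^esub> tau x \<odot>\<^bsub>L\<^esub> y)"
  using assms by (simp_all add: Delta_def)

lemma tau_swap: "x \<in> carrier L \<Longrightarrow> y \<in> carrier L \<Longrightarrow> tau x \<odot>\<^bsub>L\<^esub> y = tau y \<odot>\<^bsub>L\<^esub> x"
  using rank1_id[OF tau id_semilinear L.module_axioms] by simp

lemma kap_swap: "x \<in> carrier L \<Longrightarrow> y \<in> carrier L \<Longrightarrow> z \<in> carrier L \<Longrightarrow> kap x y \<odot>\<^bsub>L\<^esub> z = kap x z \<odot>\<^bsub>L\<^esub> y"
  using rank1_id[OF kap id_semilinear L.module_axioms] by simp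

lemma tau_kap_swap: "x \<in> carrier L \<Longrightarrow> y \<in> carrier L \<Longrightarrow> z \<in> carrier L \<Longrightarrow> tau y \<otimes> kap x z = tau z \<otimes> kap x y"
  using rank1_id[OF tau kap self_module_R] by simp

lemma kap_sym: 
  assumes "x \<in> carrier L" "y \<in> carrier L"
  shows "kap x y = kap y x"
proof -
  have *: "kap (W a) y = kap y (W a)" if a: "a \<in> vecs" for a
  proof (rule L_ext[OF self_group_R kap kap' _ assms(2)])
    fix b assume b: "b \<in> vecs"
    show "kap (W a) (W b) = kap (W b) (W a)"
      using a b dual_sum_sym[OF a b] by (simp add: kap_W A.R.m_comm)
  qed (use a in auto)
  show ?thesis
    by (rule L_ext[OF self_group_R kap' kap _ assms(1)]) (use assms * in auto)
qed

lemmas tau_lin = semilinear_add[OF tau, simplified] semilinear_smult[OF tau, simplified]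
lemmas kap_lin = semilinear_add[OF kap, simplified] semilinear_smult[OF kap, simplified]
  semilinear_add[OF kap', simplified] semilinear_smult[OF kap', simplified]

lemma tau_zero [simp]: "tau \<zero>\<^bsub>L\<^esub> = \<zero>"
  using semilinear_zero[OF L.abelian_group_axioms self_group_R tau] by simp

lemma kap_zero [simp]: "x \<in> carrier L \<Longrightarrow> kap x \<zero>\<^bsub>L\<^esub> = \<zero>" "x \<in> carrier L \<Longrightarrow> kap \<zero>\<^bsub>L\<^esub> x = \<zero>"
  using semilinear_zero[OF L.abelian_group_axioms self_group_R kap] 
    semilinear_zero[OF L.abelian_group_axioms self_group_R kap'] by simp_all

lemma Delta_group: "abelian_group Delta"
proof (rule abelian_groupI)
  fix X assume "X \<in> carrier Delta"
  then obtain r x where "X = enc (r, x)" "r \<in> carrier R" "x \<in> carrier L" by (rule DeltaE)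
  then show "\<exists>Y\<in>carrier Delta. Y \<oplus>\<^bsub>Delta\<^esub> X = \<zero>\<^bsub>Delta\<^esub>"
    by (intro bexI[of _ "enc (\<ominus> r, \<ominus>\<^bsub>L\<^esub> x)"]) (simp_all add: A.R.l_neg L.M.l_neg)
qed (auto elim!: DeltaE simp: A.R.a_ac L.M.a_ac)

lemma Delta_mult_comm:
  assumes "X \<in> carrier Delta" "Y \<in> carrier Delta"
  shows "X \<otimes>\<^bsub>Delta\<^esub> Y = Y \<otimes>\<^bsub>Delta\<^esub> X"
proof -
  obtain r x s y where X: "X = enc (r, x)" "r \<in> carrier R" "x \<in> carrier L"
    and Y: "Y = enc (s, y)" "s \<in> carrier R" "y \<in> carrier L" using assms by (metis DeltaE)
  then show ?thesis
    using kap_sym[OF X(3) Y(3)] tau_swap[OF X(3) Y(3)] by (simp add: A.R.m_comm L.M.a_comm)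
qed

text \<open>For elements of \<open>L\<close>, associativity rests on two exchanges allowed by rank
  one and symmetry: \<kappa>(x,y) z = \<kappa>(y,z) x and \<tau>(x) \<kappa>(y,z) = \<tau>(y)
  \<kappa>(x,z). The first settles the second coordinate, the other one the first.\<close>

lemma Delta_mult_assoc:
  assumes "X \<in> carrier Delta" "Y \<in> carrier Delta" "Z \<in> carrier Delta"
  shows "X \<otimes>\<^bsub>Delta\<^esub> Y \<otimes>\<^bsub>Delta\<^esub> Z = X \<otimes>\<^bsub>Delta\<^esub> (Y \<otimes>\<^bsub>Delta\<^esub> Z)"
proof -
  obtain r x where X: "X = enc (r, x)" "r \<in> carrier R" "x \<in> carrier L" using assms(1) by (rule DeltaE)
  obtain s y where Y: "Y = enc (s, y)" "s \<in> carrier R" "y \<in> carrier L" using assms(2) by (rule DeltaE)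
  obtain u z where Z: "Z = enc (u, z)" "u \<in> carrier R" "z \<in> carrier L" using assms(3) by (rule DeltaE)
  note c = X(2,3) Y(2,3) Z(2,3)
  have 1: "(r \<otimes> s \<ominus> kap x y) \<otimes> u \<ominus> kap ((r \<odot>\<^bsub>L\<^esub> y \<oplus>\<^bsub>L\<^esub> s \<odot>\<^bsub>L\<^esub> x) \<oplus>\<^bsub>L\<^esub> tau x \<odot>\<^bsub>L\<^esub> y) z =
    r \<otimes> (s \<otimes> u \<ominus> kap y z) \<ominus> kap x ((s \<odot>\<^bsub>L\<^esub> z \<oplus>\<^bsub>L\<^esub> u \<odot>\<^bsub>L\<^esub> y) \<oplus>\<^bsub>L\<^esub> tau y \<odot>\<^bsub>L\<^esub> z)"
  proof -
    have t: "tau x \<otimes> kap y z = tau y \<otimes> kap x z"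
      using tau_kap_swap[of z x y] kap_sym c by simp
    have k: "kap ((r \<odot>\<^bsub>L\<^esub> y \<oplus>\<^bsub>L\<^esub> s \<odot>\<^bsub>L\<^esub> x) \<oplus>\<^bsub>L\<^esub> tau x \<odot>\<^bsub>L\<^esub> y) z = (r \<otimes> kap y z \<oplus> s \<otimes> kap x z) \<oplus> tau y \<otimes> kap x z"
      "kap x ((s \<odot>\<^bsub>L\<^esub> z \<oplus>\<^bsub>L\<^esub> u \<odot>\<^bsub>L\<^esub> y) \<oplus>\<^bsub>L\<^esub> tau y \<odot>\<^bsub>L\<^esub> z) = (s \<otimes> kap x z \<oplus> u \<otimes> kap x y) \<oplus> tau y \<otimes> kap x z"
      using c by (simp_all add: kap_lin t)
    have "kap x y \<in> carrier R" "kap y z \<in> carrier R" "kap x z \<in> carrier R" "tau y \<in> carrier R" using c by auto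
    then show ?thesis unfolding k using c by algebra
  qed
  have 2: "((r \<otimes> s \<ominus> kap x y) \<odot>\<^bsub>L\<^esub> z \<oplus>\<^bsub>L\<^esub> u \<odot>\<^bsub>L\<^esub> ((r \<odot>\<^bsub>L\<^esub> y \<oplus>\<^bsub>L\<^esub> s \<odot>\<^bsub>L\<^esub> x) \<oplus>\<^bsub>L\<^esub> tau x \<odot>\<^bsub>L\<^esub> y)) \<oplus>\<^bsub>L\<^esub>
      tau ((r \<odot>\<^bsub>L\<^esub> y \<oplus>\<^bsub>L\<^esub> s \<odot>\<^bsub>L\<^esub> x) \<oplus>\<^bsub>L\<^esub> tau x \<odot>\<^bsub>L\<^esub> y) \<odot>\<^bsub>L\<^esub> z =
    (r \<odot>\<^bsub>L\<^esub> ((s \<odot>\<^bsub>L\<^esub> z \<oplus>\<^bsub>L\<^esub> u \<odot>\<^bsub>L\<^esub> y) \<oplus>\<^bsub>L\<^esub> tau y \<odot>\<^bsub>L\<^esub> z) \<oplus>\<^bsub>L\<^esub> (s \<otimes> u \<ominus> kap y z) \<odot>\<^bsub>L\<^esub> x) \<oplus>\<^bsub>L\<^esub>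
      tau x \<odot>\<^bsub>L\<^esub> ((s \<odot>\<^bsub>L\<^esub> z \<oplus>\<^bsub>L\<^esub> u \<odot>\<^bsub>L\<^esub> y) \<oplus>\<^bsub>L\<^esub> tau y \<odot>\<^bsub>L\<^esub> z)"
  proof -
    have k: "kap x y \<odot>\<^bsub>L\<^esub> z = kap y z \<odot>\<^bsub>L\<^esub> x"
      using kap_swap[of y x z] kap_sym[of x y] c by simp
    show ?thesis
      using c k
      by (simp add: tau_lin L.smult_l_distr L.smult_r_distr L.smult_assoc1[symmetric] a_minus_def L.smult_l_minus
          L.M.a_ac A.R.m_ac)
  qed
  show ?thesis unfolding X Y Z using c by (simp add: 1 2)
qed

lemma Delta_algebra: "algebra R Delta"
proof (rule algebraI)
  show "cring R" by (rule A.R.is_cring)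
  show "cring Delta"
  proof (rule cringI)
    show "abelian_group Delta" by (rule Delta_group)
    show "comm_monoid Delta"
    proof (rule comm_monoidI)
      show "X \<otimes>\<^bsub>Delta\<^esub> Y \<in> carrier Delta" if "X \<in> carrier Delta" "Y \<in> carrier Delta" for X Y
        using that by (elim DeltaE) simp
      show "\<one>\<^bsub>Delta\<^esub> \<otimes>\<^bsub>Delta\<^esub> X = X" if "X \<in> carrier Delta" for X
        using that by (elim DeltaE) simp
    qed (auto intro: Delta_mult_assoc Delta_mult_comm)
    fix X Y Z assume "X \<in> carrier Delta" "Y \<in> carrier Delta" "Z \<in> carrier Delta"
    then obtain r x s y u z where c: "X = enc (r, x)" "r \<in> carrier R" "x \<in> carrier L"
      "Y = enc (s, y)" "s \<in> carrier R" "y \<in> carrier L" "Z = enc (u, z)" "u \<in> carrier R" "z \<in> carrier L"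
      by (metis DeltaE)
    have 1: "(r \<oplus> s) \<otimes> u \<ominus> kap (x \<oplus>\<^bsub>L\<^esub> y) z = (r \<otimes> u \<ominus> kap x z) \<oplus> (s \<otimes> u \<ominus> kap y z)"
      using c by (simp add: kap_lin A.R.l_distr a_minus_def A.R.minus_add A.R.a_ac)
    have 2: "((r \<oplus> s) \<odot>\<^bsub>L\<^esub> z \<oplus>\<^bsub>L\<^esub> u \<odot>\<^bsub>L\<^esub> (x \<oplus>\<^bsub>L\<^esub> y)) \<oplus>\<^bsub>L\<^esub> tau (x \<oplus>\<^bsub>L\<^esub> y) \<odot>\<^bsub>L\<^esub> z =
      ((r \<odot>\<^bsub>L\<^esub> z \<oplus>\<^bsub>L\<^esub> u \<odot>\<^bsub>L\<^esub> x) \<oplus>\<^bsub>L\<^esub> tau x \<odot>\<^bsub>L\<^esub> z) \<oplus>\<^bsub>L\<^esub> ((s \<odot>\<^bsub>L\<^esub> z \<oplus>\<^bsub>L\<^esub> u \<odot>\<^bsub>L\<^esub> y) \<oplus>\<^bsub>L\<^esub> tau y \<odot>\<^bsub>L\<^esub> z)"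
      using c by (simp add: tau_lin L.smult_l_distr L.smult_r_distr L.M.a_ac)
    show "(X \<oplus>\<^bsub>Delta\<^esub> Y) \<otimes>\<^bsub>Delta\<^esub> Z = X \<otimes>\<^bsub>Delta\<^esub> Z \<oplus>\<^bsub>Delta\<^esub> Y \<otimes>\<^bsub>Delta\<^esub> Z"
      unfolding c(1,4,7) using c(2,3,5,6,8,9) by (simp add: 1 2)
  qed
  fix r X Y assume r: "r \<in> carrier R" and "X \<in> carrier Delta" "Y \<in> carrier Delta"
  then obtain s x u y where c: "X = enc (s, x)" "s \<in> carrier R" "x \<in> carrier L"
      "Y = enc (u, y)" "u \<in> carrier R" "y \<in> carrier L" by (metis DeltaE)
  have 1: "r \<otimes> s \<otimes> u \<ominus> kap (r \<odot>\<^bsub>L\<^esub> x) y = r \<otimes> (s \<otimes> u \<ominus> kap x y)"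
    using c r by (simp add: kap_lin a_minus_def A.R.r_distr A.R.r_minus A.R.m_assoc)
  have 2: "((r \<otimes> s) \<odot>\<^bsub>L\<^esub> y \<oplus>\<^bsub>L\<^esub> u \<odot>\<^bsub>L\<^esub> (r \<odot>\<^bsub>L\<^esub> x)) \<oplus>\<^bsub>L\<^esub> tau (r \<odot>\<^bsub>L\<^esub> x) \<odot>\<^bsub>L\<^esub> y =
    r \<odot>\<^bsub>L\<^esub> ((s \<odot>\<^bsub>L\<^esub> y \<oplus>\<^bsub>L\<^esub> u \<odot>\<^bsub>L\<^esub> x) \<oplus>\<^bsub>L\<^esub> tau x \<odot>\<^bsub>L\<^esub> y)"
    using c r by (simp add: tau_lin L.smult_r_distr L.smult_assoc1[symmetric] A.R.m_ac)
  show "r \<odot>\<^bsub>Delta\<^esub> X \<otimes>\<^bsub>Delta\<^esub> Y = r \<odot>\<^bsub>Delta\<^esub> (X \<otimes>\<^bsub>Delta\<^esub> Y)"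
    unfolding c(1,4) using c(2,3,5,6) r by (simp add: 1 2)
qed (auto elim!: DeltaE simp: A.R.l_distr A.R.r_distr L.smult_l_distr L.smult_r_distr A.R.m_assoc L.smult_assoc1)

sublocale D: algebra R Delta by (rule Delta_algebra)

lemma fst_dec: "(\<lambda>X. fst (dec X)) \<in> semilinear R id Delta (self_module R)"
  by (rule semilinearI) (auto elim!: DeltaE)

lemma snd_dec: "(\<lambda>X. snd (dec X)) \<in> semilinear R id Delta L"
  by (rule semilinearI) (auto elim!: DeltaE)

lemma enc_snd: "(\<lambda>x. enc (\<zero>, x)) \<in> semilinear R id L Delta"
  by (rule semilinearI) auto

text \<open>The unit together with the chart of \<open>L\<close>, shifted by one index. The chart
  provides a dual basis of \<open>L\<close> and not a basis, which is enough for
  \<open>module_trace\<close>.\<close>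

lemma Delta_dual_basis:
  "dual_basis R Delta (Suc m) (case_nat (enc (\<one>, \<zero>\<^bsub>L\<^esub>)) (\<lambda>s. enc (\<zero>, W (e s))))
    (case_nat (\<lambda>X. fst (dec X)) (\<lambda>s X. cf s (snd (dec X))))"
  unfolding dual_basis_def
proof (intro conjI allI impI ballI)
  fix i assume i: "i < Suc m"
  show "case_nat (enc (\<one>, \<zero>\<^bsub>L\<^esub>)) (\<lambda>s. enc (\<zero>, W (e s))) i \<in> carrier Delta"
    using i by (auto split: nat.split)
  have "(\<lambda>X. cf s (snd (dec X))) \<in> semilinear R id Delta (self_module R)" if "s < m" for s
    using semilinear_comp[OF snd_dec cf[OF that]] by (simp add: id_def)
  then show "case_nat (\<lambda>X. fst (dec X)) (\<lambda>s X. cf s (snd (dec X))) i \<in> semilinear R id Delta (self_module R)"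
    using i fst_dec by (auto split: nat.split)
next
  fix X assume "X \<in> carrier Delta"
  then obtain r x where X: "X = enc (r, x)" "r \<in> carrier R" "x \<in> carrier L" by (rule DeltaE)
  let ?f = "\<lambda>i. case_nat (\<lambda>X. fst (dec X)) (\<lambda>s X. cf s (snd (dec X))) i X \<odot>\<^bsub>Delta\<^esub>
         case_nat (enc (\<one>, \<zero>\<^bsub>L\<^esub>)) (\<lambda>s. enc (\<zero>, W (e s))) i"
  have "(\<Oplus>\<^bsub>Delta\<^esub>i\<in>{..<Suc m}. ?f i) = ?f 0 \<oplus>\<^bsub>Delta\<^esub> (\<Oplus>\<^bsub>Delta\<^esub>i\<in>Suc ` {..<m}. ?f i)"
    unfolding lessThan_Suc_eq_insert_0
    by (rule D.M.finsum_insert) (use X in auto)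
  also have "(\<Oplus>\<^bsub>Delta\<^esub>i\<in>Suc ` {..<m}. ?f i) = (\<Oplus>\<^bsub>Delta\<^esub>s\<in>{..<m}. ?f (Suc s))"
    by (rule D.M.finsum_reindex) (use X in auto)
  also have "\<dots> = (\<Oplus>\<^bsub>Delta\<^esub>s\<in>{..<m}. enc (\<zero>, cf s x \<odot>\<^bsub>L\<^esub> W (e s)))"
    by (rule D.M.finsum_cong'[OF refl]) (use X in auto)
  also have "\<dots> = enc (\<zero>, \<Oplus>\<^bsub>L\<^esub>s\<in>{..<m}. cf s x \<odot>\<^bsub>L\<^esub> W (e s))"
    by (rule semilinear_finsum[OF L.abelian_group_axioms Delta_group enc_snd, symmetric]) (use X in auto)
  also have "\<dots> = enc (\<zero>, x)" using X by (simp add: expand)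
  also have "?f 0 \<oplus>\<^bsub>Delta\<^esub> enc (\<zero>, x) = X" using X by simp
  finally show "X = (\<Oplus>\<^bsub>Delta\<^esub>i\<in>{..<Suc m}. ?f i)" by simp
qed

text \<open>Multiplication contributes \<open>r\<close> on the unit. On \<open>L\<close> it acts by
  the scalar \<open>r \<oplus> tau x\<close>, up to a part in \<open>R\<close> that the forms
  \<open>cf s\<close> do not see, and the chart computes the trace of a scalar on \<open>L\<close>
  as that scalar.\<close>

lemma Delta_trace:
  assumes r: "r \<in> carrier R" and x: "x \<in> carrier L"
  shows "algebra_trace R Delta (enc (r, x)) = (r \<oplus> r) \<oplus> tau x"
proof -
  let ?X = "enc (r, x)"
  have f: "(\<lambda>Y. ?X \<otimes>\<^bsub>Delta\<^esub> Y) \<in> semilinear R id Delta Delta"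
    by (rule semilinearI) (use r x in \<open>simp_all add: D.r_distr D.smult_assoc2 D.m_comm[of ?X]\<close>)
  let ?f = "\<lambda>i. case_nat (\<lambda>X. fst (dec X)) (\<lambda>s X. cf s (snd (dec X))) i (?X \<otimes>\<^bsub>Delta\<^esub>
         case_nat (enc (\<one>, \<zero>\<^bsub>L\<^esub>)) (\<lambda>s. enc (\<zero>, W (e s))) i)"
  have tx: "(r \<oplus> tau x) \<in> carrier R" using r x by simp
  have "algebra_trace R Delta ?X = (\<Oplus>i\<in>{..<Suc m}. ?f i)"
    unfolding algebra_trace_def by (rule module_trace_eq[OF D.module_axioms Delta_dual_basis f])
  also have "\<dots> = ?f 0 \<oplus> (\<Oplus>i\<in>Suc ` {..<m}. ?f i)"
    unfolding lessThan_Suc_eq_insert_0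
    by (rule A.R.finsum_insert) (use r x in auto)
  also have "(\<Oplus>i\<in>Suc ` {..<m}. ?f i) = (\<Oplus>s\<in>{..<m}. ?f (Suc s))"
    by (rule A.R.finsum_reindex) (use r x in auto)
  also have "\<dots> = (\<Oplus>s\<in>{..<m}. cf s ((r \<oplus> tau x) \<odot>\<^bsub>L\<^esub> W (e s)))"
    by (rule A.R.finsum_cong'[OF refl]) (use r x in \<open>auto simp: L.smult_l_distr\<close>)
  also have "\<dots> = r \<oplus> tau x" by (rule cf_scale[OF tx])
  also have "?f 0 = r" using r x by simp
  finally show ?thesis using r x by (simp add: A.R.a_assoc)
qed

end

section \<open>Small determinants and the characterization of discriminant forms\<close>

lemma ring_det_cong:
  assumes R: "cring R" and c: "\<And>i j. i < n \<Longrightarrow> j < n \<Longrightarrow> m' i j \<in> carrier R" 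
    and eq: "\<And>i j. i < n \<Longrightarrow> j < n \<Longrightarrow> m i j = m' i j"
  shows "ring_det R n m = ring_det R n m'"
proof -
  interpret cring R by fact
  have p: "(\<Otimes>\<^bsub>R\<^esub>i\<in>{..<n}. m i (p i)) = (\<Otimes>\<^bsub>R\<^esub>i\<in>{..<n}. m' i (p i))"
    "(\<Otimes>\<^bsub>R\<^esub>i\<in>{..<n}. m' i (p i)) \<in> carrier R" if "p permutes {..<n}" for p
    using c eq permutes_in_image[OF that] by (auto intro!: finprod_cong' finprod_closed)
  show ?thesis unfolding ring_det_def
    by (rule finsum_cong'[OF refl]) (use p in auto)
qed

lemma ring_det_2:
  assumes R: "cring R" and c: "\<And>i j. m i j \<in> carrier R" 
  shows "ring_det R 2 m = m 0 0 \<otimes>\<^bsub>R\<^esub> m 1 1 \<ominus>\<^bsub>R\<^esub> m 0 1 \<otimes>\<^bsub>R\<^esub> m 1 0"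
proof -
  interpret cring R by fact
  have two: "{..<2::nat} = {0, 1}" by auto
  have set: "{p. p permutes {..<2::nat}} = {id, Transposition.transpose 0 1}"
    unfolding two by (auto simp: permutes_doubleton_iff)
  have ne: "id \<noteq> Transposition.transpose (0::nat) 1"
    by (metis evenperm_id evenperm_swap zero_neq_one)
  let ?f = "\<lambda>p::nat \<Rightarrow> nat. if evenperm p then (\<Otimes>\<^bsub>R\<^esub>i\<in>{..<2}. m i (p i)) else \<ominus>\<^bsub>R\<^esub> (\<Otimes>\<^bsub>R\<^esub>i\<in>{..<2}. m i (p i))"
  have pr: "(\<Otimes>\<^bsub>R\<^esub>i\<in>{..<2}. m i (p i)) = m 0 (p 0) \<otimes>\<^bsub>R\<^esub> m 1 (p 1)" for p :: "nat \<Rightarrow> nat"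
    unfolding two by (subst finprod_insert) (use c in auto)
  have f1: "?f id = m 0 0 \<otimes>\<^bsub>R\<^esub> m 1 1" by (simp add: pr)
  have f2: "?f (Transposition.transpose 0 1) = \<ominus>\<^bsub>R\<^esub> (m 0 1 \<otimes>\<^bsub>R\<^esub> m 1 0)" by (simp add: pr evenperm_swap)
  have "ring_det R 2 m = (\<Oplus>\<^bsub>R\<^esub>p\<in>{id, Transposition.transpose 0 1}. ?f p)"
    unfolding ring_det_def set ..
  also have "\<dots> = ?f id \<oplus>\<^bsub>R\<^esub> ?f (Transposition.transpose 0 1)"
    by (subst finsum_insert) (use ne c in \<open>auto simp: pr\<close>)
  finally show ?thesis unfolding f1 f2 by (simp add: a_minus_def)
qed

lemma alternating2I:
  assumes M: "module R M" and N: "module R N"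
    and B1: "\<And>y. y \<in> carrier M \<Longrightarrow> (\<lambda>x. B x y) \<in> semilinear R id M N"
    and B2: "\<And>x. x \<in> carrier M \<Longrightarrow> B x \<in> semilinear R id M N"
    and B0: "\<And>x. x \<in> carrier M \<Longrightarrow> B x x = \<zero>\<^bsub>N\<^esub>"
  shows "alternating R M id N 2 (\<lambda>f. B (f 0) (f 1))"
proof -
  have f01: "f 0 \<in> carrier M" "f 1 \<in> carrier M" if "f \<in> {..<2} \<rightarrow> carrier M" for f :: "nat \<Rightarrow> _"
    using that by auto
  show ?thesis
  proof (rule multilinear_alternating[OF multilinearI])
    fix f :: "nat \<Rightarrow> 'c" assume f: "f \<in> {..<2} \<rightarrow> carrier M"
    show "B (f 0) (f 1) \<in> carrier N" using semilinear_closed[OF B2] f01[OF f] by blast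
    show "B (h 0) (h 1) = B (f 0) (f 1)" if "\<And>i. i < 2 \<Longrightarrow> h i = f i" for h using that by simp
    show "(\<lambda>a. B ((f(i := a)) 0) ((f(i := a)) 1)) \<in> semilinear R id M N" if i: "i < 2" for i
      using B1[OF f01(2)[OF f]] B2[OF f01(1)[OF f]] i by (cases "i = 0") (auto simp: less_2_cases_iff)
    show "B (f 0) (f 1) = \<zero>\<^bsub>N\<^esub>" if "i < 2" "j < 2" "i \<noteq> j" "f i = f j" for i j
    proof -
      have "f 0 = f 1" using that by (auto simp: less_2_cases_iff)
      then show ?thesis using B0 f01[OF f] by simp
    qed
  qed
qed

context exterior_power
begin

text \<open>\<open>disc_form\<close> is a definite description. Uniqueness follows by comparison on
  wedges in one variable after the other; existence is supplied by \<open>D\<close>, cut down to the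
  carrier because bilinear forms are extensional here.\<close>

lemma disc_form_eq:
  assumes D1: "\<And>x. x \<in> carrier L \<Longrightarrow> D x \<in> semilinear R id L (self_module R)"
    and D2: "\<And>y. y \<in> carrier L \<Longrightarrow> (\<lambda>x. D x y) \<in> semilinear R id L (self_module R)"
    and D: "\<And>a b. a \<in> vecs \<Longrightarrow> b \<in> vecs \<Longrightarrow>
      D (W a) (W b) = ring_det R n (\<lambda>i j. algebra_trace R M (a i \<otimes>\<^bsub>M\<^esub> b j))"
    and X: "X \<in> carrier L" and Y: "Y \<in> carrier L"
  shows "disc_form R n M (X, Y) = D X Y"
proof -
  let ?d = "restrict (\<lambda>(x, y). D x y) (carrier L \<times> carrier L)"
  have Rg: "abelian_group (self_module R)" using self_module_module[OF M.R.is_cring] by (simp add: module_def)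
  have nth: "wedge R n M xs = W ((!) xs)" "(!) xs \<in> vecs" if "xs \<in> tuples M n" for xs
  proof -
    have "map ((!) xs) [0..<n] = xs" using that by (intro nth_equalityI) (auto simp: tuples_def)
    then show "wedge R n M xs = W ((!) xs)" by (simp add: wedge_fun_def)
    show "(!) xs \<in> vecs" using that by (auto simp: tuples_def)
  qed
  have res: "f \<in> semilinear R id L (self_module R)" if "g \<in> semilinear R id L (self_module R)"
      "\<And>x. x \<in> carrier L \<Longrightarrow> f x = g x" for f g
    using that by (auto simp: semilinear_def)
  have "disc_form R n M = ?d"
    unfolding disc_form_def
  proof (rule the_equality)
    show "?d \<in> bilinear_forms R L \<and> (\<forall>as\<in>tuples M n. \<forall>bs\<in>tuples M n. ?d (wedge R n M as, wedge R n M bs) =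
          ring_det R n (\<lambda>i j. algebra_trace R M (as ! i \<otimes>\<^bsub>M\<^esub> bs ! j)))"
      unfolding bilinear_forms_def
      by (auto simp: nth D W_closed[OF nth(2)] intro: res[OF D1] res[OF D2])
    fix d assume d: "d \<in> bilinear_forms R L \<and> (\<forall>as\<in>tuples M n. \<forall>bs\<in>tuples M n. d (wedge R n M as, wedge R n M bs) =
          ring_det R n (\<lambda>i j. algebra_trace R M (as ! i \<otimes>\<^bsub>M\<^esub> bs ! j)))"
    have d1: "(\<lambda>y. d (x, y)) \<in> semilinear R id L (self_module R)" "(\<lambda>y. d (y, x)) \<in> semilinear R id L (self_module R)"
      if "x \<in> carrier L" for x using d that by (auto simp: bilinear_forms_def)
    have dW: "d (W a, W b) = D (W a) (W b)" if a: "a \<in> vecs" and b: "b \<in> vecs" for a b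
    proof -
      let ?a = "map a [0..<n]" and ?b = "map b [0..<n]"
      have t: "?a \<in> tuples M n" "?b \<in> tuples M n" using a b tuples_conv by blast+
      have "d (W a, W b) = ring_det R n (\<lambda>i j. algebra_trace R M (?a ! i \<otimes>\<^bsub>M\<^esub> ?b ! j))"
        using d t unfolding wedge_fun_def by blast
      also have "\<dots> = D (W ((!) ?a)) (W ((!) ?b))"
        by (rule D[OF nth(2)[OF t(1)] nth(2)[OF t(2)], symmetric])
      also have "W ((!) ?a) = W a" by (rule alternating_cong[OF W_alternating a]) simp
      also have "W ((!) ?b) = W b" by (rule alternating_cong[OF W_alternating b]) simp
      finally show ?thesis .
    qed
    have 1: "d (W a, y) = D (W a) y" if a: "a \<in> vecs" and y: "y \<in> carrier L" for a y
      by (rule L_ext[OF Rg d1(1)[OF W_closed[OF a]] D1[OF W_closed[OF a]] dW[OF a] y])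
    have "d (x, y) = D x y" if "x \<in> carrier L" "y \<in> carrier L" for x y
      by (rule L_ext[OF Rg d1(2)[OF that(2)] D2[OF that(2)] 1[OF _ that(2)] that(1)])
    then show "d = ?d"
      using d by (auto simp: bilinear_forms_def extensional_def)
  qed
  then show ?thesis using X Y by simp
qed

end

context disc_chart
begin

text \<open>This is the vanishing of the second exterior power of a module of rank one. When both
  arguments are expanded, the coefficients \<open>cf s x \<otimes> cf t y\<close> are symmetric in
  \<open>s\<close> and \<open>t\<close>, while the values of \<open>B\<close> change sign and vanish
  on the diagonal.\<close>

lemma alt_bilinear_zero:
  assumes N: "module R N"
    and B1: "\<And>y. y \<in> carrier L \<Longrightarrow> (\<lambda>x. B x y) \<in> semilinear R id L N"
    and B2: "\<And>x. x \<in> carrier L \<Longrightarrow> B x \<in> semilinear R id L N"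
    and B0: "\<And>x. x \<in> carrier L \<Longrightarrow> B x x = \<zero>\<^bsub>N\<^esub>"
    and x: "x \<in> carrier L" and y: "y \<in> carrier L"
  shows "B x y = \<zero>\<^bsub>N\<^esub>"
proof -
  interpret N: module R N by fact
  have Bc: "x \<in> carrier L \<Longrightarrow> y \<in> carrier L \<Longrightarrow> B x y \<in> carrier N" for x y using semilinear_closed[OF B2] .
  have anti: "B x y = \<ominus>\<^bsub>N\<^esub> B y x" if c: "x \<in> carrier L" "y \<in> carrier L" for x y
  proof -
    have "B (x \<oplus>\<^bsub>L\<^esub> y) (x \<oplus>\<^bsub>L\<^esub> y) = (B x x \<oplus>\<^bsub>N\<^esub> B y x) \<oplus>\<^bsub>N\<^esub> (B x y \<oplus>\<^bsub>N\<^esub> B y y)"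
      using semilinear_add[OF B2[of "x \<oplus>\<^bsub>L\<^esub> y"], of x y] semilinear_add[OF B1[of x], of x y] 
        semilinear_add[OF B1[of y], of x y] c by simp
    then have "B x y \<oplus>\<^bsub>N\<^esub> B y x = \<zero>\<^bsub>N\<^esub>"
      using B0[of "x \<oplus>\<^bsub>L\<^esub> y"] B0[of x] B0[of y] c Bc by (simp add: N.M.a_comm)
    then show ?thesis using c Bc by (metis N.M.minus_equality)
  qed
  have "B x y = B (\<Oplus>\<^bsub>L\<^esub>s\<in>{..<m}. cf s x \<odot>\<^bsub>L\<^esub> W (e s)) y" using x by (simp add: expand)
  also have "\<dots> = (\<Oplus>\<^bsub>N\<^esub>s\<in>{..<m}. B (cf s x \<odot>\<^bsub>L\<^esub> W (e s)) y)"
    by (rule semilinear_finsum[OF L.abelian_group_axioms N.abelian_group_axioms B1[OF y]]) (use x in auto)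
  also have "\<dots> = (\<Oplus>\<^bsub>N\<^esub>s\<in>{..<m}. \<Oplus>\<^bsub>N\<^esub>t\<in>{..<m}. (cf s x \<otimes> cf t y) \<odot>\<^bsub>N\<^esub> B (W (e s)) (W (e t)))"
  proof (rule N.M.finsum_cong'[OF refl])
    fix s assume "s \<in> {..<m}"
    then have s: "s < m" by simp
    have "B (cf s x \<odot>\<^bsub>L\<^esub> W (e s)) y = B (cf s x \<odot>\<^bsub>L\<^esub> W (e s)) (\<Oplus>\<^bsub>L\<^esub>t\<in>{..<m}. cf t y \<odot>\<^bsub>L\<^esub> W (e t))" using y by (simp add: expand)
    also have "\<dots> = (\<Oplus>\<^bsub>N\<^esub>t\<in>{..<m}. B (cf s x \<odot>\<^bsub>L\<^esub> W (e s)) (cf t y \<odot>\<^bsub>L\<^esub> W (e t)))"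
      by (rule semilinear_finsum[OF L.abelian_group_axioms N.abelian_group_axioms B2]) (use x y s in auto)
    also have "\<dots> = (\<Oplus>\<^bsub>N\<^esub>t\<in>{..<m}. (cf s x \<otimes> cf t y) \<odot>\<^bsub>N\<^esub> B (W (e s)) (W (e t)))"
      by (rule N.M.finsum_cong'[OF refl]) 
        (use x y s Bc in \<open>auto simp: semilinear_smult[OF B1] semilinear_smult[OF B2] N.smult_assoc1[symmetric] A.R.m_comm\<close>)
    finally show "B (cf s x \<odot>\<^bsub>L\<^esub> W (e s)) y = (\<Oplus>\<^bsub>N\<^esub>t\<in>{..<m}. (cf s x \<otimes> cf t y) \<odot>\<^bsub>N\<^esub> B (W (e s)) (W (e t)))" .
  qed (use x y Bc in \<open>auto intro!: N.M.finsum_closed\<close>)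
  also have "\<dots> = (\<Oplus>\<^bsub>N\<^esub>p\<in>{..<m} \<times> {..<m}. (cf (fst p) x \<otimes> cf (snd p) y) \<odot>\<^bsub>N\<^esub> B (W (e (fst p))) (W (e (snd p))))"
    by (rule N.M.finsum_times) (use x y Bc in auto)
  also have "\<dots> = \<zero>\<^bsub>N\<^esub>"
  proof (rule N.M.finsum_involution[where p = prod.swap])
    fix p assume "p \<in> {..<m} \<times> {..<m}"
    then obtain s t where st: "p = (s, t)" "s < m" "t < m" by (cases p) auto
    have "cf t x \<otimes> cf s y = cf s x \<otimes> cf t y"
      using rank1_id[OF cf[OF st(3)] cf[OF st(2)] self_module_R x y] st x y by (simp add: A.R.m_comm)
    moreover have "B (W (e t)) (W (e s)) = \<ominus>\<^bsub>N\<^esub> B (W (e s)) (W (e t))" by (rule anti) (use st in auto)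
    ultimately have "(cf t x \<otimes> cf s y) \<odot>\<^bsub>N\<^esub> B (W (e t)) (W (e s)) = \<ominus>\<^bsub>N\<^esub> ((cf s x \<otimes> cf t y) \<odot>\<^bsub>N\<^esub> B (W (e s)) (W (e t)))"
      using st x y Bc by (simp add: N.smult_r_minus)
    then show "(cf (fst (prod.swap p)) x \<otimes> cf (snd (prod.swap p)) y) \<odot>\<^bsub>N\<^esub> B (W (e (fst (prod.swap p)))) (W (e (snd (prod.swap p))))
      = \<ominus>\<^bsub>N\<^esub> ((cf (fst p) x \<otimes> cf (snd p) y) \<odot>\<^bsub>N\<^esub> B (W (e (fst p))) (W (e (snd p))))"
      unfolding st(1) prod.swap_def fst_conv snd_conv .
    show "(cf (fst p) x \<otimes> cf (snd p) y) \<odot>\<^bsub>N\<^esub> B (W (e (fst p))) (W (e (snd p))) = \<zero>\<^bsub>N\<^esub>" if "prod.swap p = p"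
    proof -
      have "t = s" using that unfolding st(1) prod.swap_def fst_conv snd_conv prod.inject by (rule conjunct1)
      then show ?thesis using B0[OF We_closed[OF st(2)]] st(2) x y unfolding st(1) fst_conv snd_conv by simp
    qed
  qed (use x y Bc in auto)
  finally show ?thesis .
qed

definition disc where "disc x y = tau x \<otimes> tau y \<ominus> ((kap x y \<oplus> kap x y) \<oplus> (kap x y \<oplus> kap x y))"

lemma disc_semilinear:
  assumes x: "x \<in> carrier L"
  shows "disc x \<in> semilinear R id L (self_module R)" "(\<lambda>y. disc y x) \<in> semilinear R id L (self_module R)"
proof -
  have 1: "(\<lambda>y. tau x \<odot>\<^bsub>self_module R\<^esub> tau y) \<in> semilinear R id L (self_module R)"
    by (rule semilinear_scale[OF self_module_R _ tau]) (use x in auto)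
  have 2: "(\<lambda>y. tau y \<odot>\<^bsub>self_module R\<^esub> tau x) \<in> semilinear R id L (self_module R)"
    by (rule semilinear_smult_left[OF self_module_R _ tau]) (use x in auto)
  note a = semilinear_add_fun[OF self_module_R, where \<sigma> = id and R = R, OF _ kap[OF x] kap[OF x], simplified]
  note a' = semilinear_add_fun[OF self_module_R, where \<sigma> = id and R = R, OF _ kap'[OF x] kap'[OF x], simplified]
  note b = semilinear_add_fun[OF self_module_R, where \<sigma> = id and R = R, OF _ a a, simplified]
  note b' = semilinear_add_fun[OF self_module_R, where \<sigma> = id and R = R, OF _ a' a', simplified]
  show "disc x \<in> semilinear R id L (self_module R)"
    using semilinear_diff_fun[OF self_module_R, where \<sigma> = id and R = R, OF _ 1 b, simplified] 
    by (simp add: disc_def[abs_def])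
  show "(\<lambda>y. disc y x) \<in> semilinear R id L (self_module R)"
    using semilinear_diff_fun[OF self_module_R, where \<sigma> = id and R = R, OF _ 2 b', simplified]
    by (simp add: disc_def[abs_def])
qed

end

section \<open>The second exterior power of the discriminant algebra\<close>

context disc_algebra
begin

sublocale D2: exterior_power R Delta 2 by (intro exterior_power.intro D.module_axioms)

definition wedge2 where "wedge2 X Y = D2.W ((\<lambda>_. X)(1 := Y))"

text \<open>The minor r y - s x of the pairs (r, x) and (s, y); in particular the wedge of 1 and
  \<open>x\<close> goes to \<open>x\<close>.\<close>

definition theta where "theta = (SOME h. h \<in> semilinear R id D2.L L \<and> (\<forall>f\<in>{..<2} \<rightarrow> carrier Delta.
  h (D2.W f) = fst (dec (f 0)) \<odot>\<^bsub>L\<^esub> snd (dec (f 1)) \<ominus>\<^bsub>L\<^esub> fst (dec (f 1)) \<odot>\<^bsub>L\<^esub> snd (dec (f 0))))"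

lemma dec_closed: "X \<in> carrier Delta \<Longrightarrow> fst (dec X) \<in> carrier R" "X \<in> carrier Delta \<Longrightarrow> snd (dec X) \<in> carrier L"
  by (auto elim!: DeltaE)

lemma theta: "theta \<in> semilinear R id D2.L L"
  and theta_W: "f \<in> {..<2} \<rightarrow> carrier Delta \<Longrightarrow>
    theta (D2.W f) = fst (dec (f 0)) \<odot>\<^bsub>L\<^esub> snd (dec (f 1)) \<ominus>\<^bsub>L\<^esub> fst (dec (f 1)) \<odot>\<^bsub>L\<^esub> snd (dec (f 0))"
proof -
  have 1: "(\<lambda>X. fst (dec X) \<odot>\<^bsub>L\<^esub> snd (dec Y)) \<in> semilinear R id Delta L" if "Y \<in> carrier Delta" for Y
    by (rule semilinear_smult_left[OF L.module_axioms _ fst_dec]) (use that dec_closed in auto)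
  have 2: "(\<lambda>Y. fst (dec X) \<odot>\<^bsub>L\<^esub> snd (dec Y)) \<in> semilinear R id Delta L" if "X \<in> carrier Delta" for X
    by (rule semilinear_scale[OF L.module_axioms _ snd_dec]) (use that dec_closed in auto)
  have "alternating R Delta id L 2 (\<lambda>f. fst (dec (f 0)) \<odot>\<^bsub>L\<^esub> snd (dec (f 1)) \<ominus>\<^bsub>L\<^esub> fst (dec (f 1)) \<odot>\<^bsub>L\<^esub> snd (dec (f 0)))"
    by (rule alternating2I[OF D.module_axioms L.module_axioms])
      (use 1 2 dec_closed in \<open>auto intro!: semilinear_diff_fun[OF L.module_axioms]\<close>)
  then have "\<exists>h. h \<in> semilinear R id D2.L L \<and> (\<forall>f\<in>{..<2} \<rightarrow> carrier Delta.
      h (D2.W f) = fst (dec (f 0)) \<odot>\<^bsub>L\<^esub> snd (dec (f 1)) \<ominus>\<^bsub>L\<^esub> fst (dec (f 1)) \<odot>\<^bsub>L\<^esub> snd (dec (f 0)))"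
    using D2.L_lift[OF L.module_axioms id_ring_hom] by blast
  from someI_ex[OF this, folded theta_def]
  show "theta \<in> semilinear R id D2.L L"
    "f \<in> {..<2} \<rightarrow> carrier Delta \<Longrightarrow>
    theta (D2.W f) = fst (dec (f 0)) \<odot>\<^bsub>L\<^esub> snd (dec (f 1)) \<ominus>\<^bsub>L\<^esub> fst (dec (f 1)) \<odot>\<^bsub>L\<^esub> snd (dec (f 0))"
    by blast+
qed

lemma theta_closed [simp, intro]: "Z \<in> carrier D2.L \<Longrightarrow> theta Z \<in> carrier L"
  by (rule semilinear_closed[OF theta])

lemma pair_Pi: "X \<in> carrier Delta \<Longrightarrow> Y \<in> carrier Delta \<Longrightarrow> (\<lambda>_. X)(1 := Y) \<in> {..<2::nat} \<rightarrow> carrier Delta"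
  by auto

lemma wedge2_closed: "X \<in> carrier Delta \<Longrightarrow> Y \<in> carrier Delta \<Longrightarrow> wedge2 X Y \<in> carrier D2.L"
  unfolding wedge2_def by (rule D2.W_closed[OF pair_Pi])

lemma wedge2_right: "X \<in> carrier Delta \<Longrightarrow> wedge2 X \<in> semilinear R id Delta D2.L"
  unfolding wedge2_def[abs_def] by (rule alternating_semilinear[OF D2.W_alternating]) auto

lemma wedge2_left:
  assumes Y: "Y \<in> carrier Delta"
  shows "(\<lambda>X. wedge2 X Y) \<in> semilinear R id Delta D2.L"
proof -
  have 1: "(\<lambda>X. D2.W ((\<lambda>_. Y)(0 := X))) \<in> semilinear R id Delta D2.L"
    by (rule alternating_semilinear[OF D2.W_alternating]) (use Y in auto)
  have "D2.W ((\<lambda>_. Y)(0 := X)) = wedge2 X Y" if "X \<in> carrier Delta" for X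
    unfolding wedge2_def by (rule alternating_cong[OF D2.W_alternating pair_Pi[OF that Y]]) (auto simp: less_2_cases_iff)
  with 1 show ?thesis by (simp add: semilinear_def Pi_iff)
qed

lemma wedge2_same: "X \<in> carrier Delta \<Longrightarrow> wedge2 X X = \<zero>\<^bsub>D2.L\<^esub>"
  unfolding wedge2_def by (rule alternating_repeated[OF D2.W_alternating pair_Pi, of _ _ 0 1]) auto

text \<open>This will be the inverse of \<open>theta\<close>.\<close>

definition iota where "iota x = wedge2 (enc (\<one>, \<zero>\<^bsub>L\<^esub>)) (enc (\<zero>, x))"

lemma iota: "iota \<in> semilinear R id L D2.L"
  using semilinear_comp[OF enc_snd wedge2_right[of "enc (\<one>, \<zero>\<^bsub>L\<^esub>)"]] by (simp add: iota_def[abs_def] id_def)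

lemma iota_closed [simp, intro]: "x \<in> carrier L \<Longrightarrow> iota x \<in> carrier D2.L"
  by (rule semilinear_closed[OF iota])

lemma theta_iota: "x \<in> carrier L \<Longrightarrow> theta (iota x) = x"
  unfolding iota_def wedge2_def by (subst theta_W) auto

lemma D2_group: "abelian_group D2.L" ..

lemma W2_eq:
  assumes f: "f \<in> {..<2} \<rightarrow> carrier Delta"
  shows "D2.W f = wedge2 (f 0) (f 1)"
  unfolding wedge2_def
  by (rule alternating_cong[OF D2.W_alternating pair_Pi]) (use f in \<open>auto simp: less_2_cases_iff\<close>)

text \<open>Splits both elements into a multiple of 1 and an element of \<open>L\<close>. The wedge
  of the two multiples of 1 vanishes, and so does that of the two elements of \<open>L\<close> by
  rank one; the mixed terms are the image of the minor.\<close>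

lemma iota_theta_W:
  assumes f: "f \<in> {..<2} \<rightarrow> carrier Delta"
  shows "iota (theta (D2.W f)) = D2.W f"
proof -
  have f01: "f 0 \<in> carrier Delta" "f 1 \<in> carrier Delta" using f by auto
  obtain r x where X: "f 0 = enc (r, x)" "r \<in> carrier R" "x \<in> carrier L" using f01(1) by (rule DeltaE)
  obtain s y where Y: "f 1 = enc (s, y)" "s \<in> carrier R" "y \<in> carrier L" using f01(2) by (rule DeltaE)
  let ?one = "enc (\<one>, \<zero>\<^bsub>L\<^esub>)" and ?x = "enc (\<zero>, x)" and ?y = "enc (\<zero>, y)"
  have o: "?one \<in> carrier Delta" "?x \<in> carrier Delta" "?y \<in> carrier Delta" using X Y by auto
  have so: "s \<odot>\<^bsub>Delta\<^esub> ?one \<in> carrier Delta" "r \<odot>\<^bsub>Delta\<^esub> ?one \<in> carrier Delta" using X Y by auto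
  have fe: "f 0 = r \<odot>\<^bsub>Delta\<^esub> ?one \<oplus>\<^bsub>Delta\<^esub> ?x" "f 1 = s \<odot>\<^bsub>Delta\<^esub> ?one \<oplus>\<^bsub>Delta\<^esub> ?y" using X Y by simp_all
  have z: "wedge2 ?x ?y = \<zero>\<^bsub>D2.L\<^esub>"
  proof (rule alt_bilinear_zero[OF D2.L.module_axioms, where B = "\<lambda>x y. wedge2 (enc (\<zero>, x)) (enc (\<zero>, y))"])
    show "(\<lambda>x. wedge2 (enc (\<zero>, x)) (enc (\<zero>, y))) \<in> semilinear R id L D2.L" if "y \<in> carrier L" for y
      using semilinear_comp[OF enc_snd wedge2_left[of "enc (\<zero>, y)"]] that by (simp add: id_def)
    show "(\<lambda>y. wedge2 (enc (\<zero>, x)) (enc (\<zero>, y))) \<in> semilinear R id L D2.L" if "x \<in> carrier L" for x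
      using semilinear_comp[OF enc_snd wedge2_right[of "enc (\<zero>, x)"]] that by (simp add: id_def)
  qed (use X Y wedge2_same in auto)
  have anti: "wedge2 ?x ?one = \<ominus>\<^bsub>D2.L\<^esub> wedge2 ?one ?x"
  proof -
    have "wedge2 (?x \<oplus>\<^bsub>Delta\<^esub> ?one) (?x \<oplus>\<^bsub>Delta\<^esub> ?one) = (wedge2 ?x ?x \<oplus>\<^bsub>D2.L\<^esub> wedge2 ?one ?x) \<oplus>\<^bsub>D2.L\<^esub> (wedge2 ?x ?one \<oplus>\<^bsub>D2.L\<^esub> wedge2 ?one ?one)"
      using semilinear_add[OF wedge2_right o(2) o(1)] semilinear_add[OF wedge2_left o(2) o(1)] o D.M.a_closed
      by (simp del: Delta_ops)
    then have "wedge2 ?x ?one \<oplus>\<^bsub>D2.L\<^esub> wedge2 ?one ?x = \<zero>\<^bsub>D2.L\<^esub>"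
      using wedge2_same o D.M.a_closed[OF o(2,1)] wedge2_closed by (simp add: D2.L.M.a_comm del: Delta_ops)
    then show ?thesis using o wedge2_closed by (metis D2.L.M.minus_equality)
  qed
  have "D2.W f = wedge2 (r \<odot>\<^bsub>Delta\<^esub> ?one \<oplus>\<^bsub>Delta\<^esub> ?x) (s \<odot>\<^bsub>Delta\<^esub> ?one \<oplus>\<^bsub>Delta\<^esub> ?y)"
    unfolding W2_eq[OF f] fe ..
  also have "\<dots> = (r \<odot>\<^bsub>D2.L\<^esub> wedge2 ?one (s \<odot>\<^bsub>Delta\<^esub> ?one \<oplus>\<^bsub>Delta\<^esub> ?y)) \<oplus>\<^bsub>D2.L\<^esub> wedge2 ?x (s \<odot>\<^bsub>Delta\<^esub> ?one \<oplus>\<^bsub>Delta\<^esub> ?y)"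
    using semilinear_add[OF wedge2_left so(2) o(2)] semilinear_smult[OF wedge2_left X(2) o(1)] D.M.a_closed[OF so(1) o(3)] by (simp del: Delta_ops)
  also have "wedge2 ?one (s \<odot>\<^bsub>Delta\<^esub> ?one \<oplus>\<^bsub>Delta\<^esub> ?y) = wedge2 ?one ?y"
    using semilinear_add[OF wedge2_right[OF o(1)] so(1) o(3)] semilinear_smult[OF wedge2_right[OF o(1)] Y(2) o(1)] o wedge2_closed wedge2_same Y
    by (simp del: Delta_ops)
  also have "wedge2 ?x (s \<odot>\<^bsub>Delta\<^esub> ?one \<oplus>\<^bsub>Delta\<^esub> ?y) = \<ominus>\<^bsub>D2.L\<^esub> (s \<odot>\<^bsub>D2.L\<^esub> wedge2 ?one ?x)"
    using semilinear_add[OF wedge2_right[OF o(2)] so(1) o(3)] semilinear_smult[OF wedge2_right[OF o(2)] Y(2) o(1)] o wedge2_closed anti z Y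
    by (simp add: D2.L.smult_r_minus del: Delta_ops)
  finally have "D2.W f = r \<odot>\<^bsub>D2.L\<^esub> iota y \<ominus>\<^bsub>D2.L\<^esub> s \<odot>\<^bsub>D2.L\<^esub> iota x"
    by (simp add: a_minus_def iota_def)
  also have "\<dots> = iota (r \<odot>\<^bsub>L\<^esub> y \<ominus>\<^bsub>L\<^esub> s \<odot>\<^bsub>L\<^esub> x)"
    using X Y by (simp add: semilinear_diff[OF L.abelian_group_axioms D2_group iota] semilinear_smult[OF iota])
  also have "\<dots> = iota (theta (D2.W f))" using X Y by (simp add: theta_W[OF f])
  finally show ?thesis by simp
qed

lemma iota_theta:
  assumes Z: "Z \<in> carrier D2.L"
  shows "iota (theta Z) = Z"
proof -
  have "(\<lambda>Z. iota (theta Z)) \<in> semilinear R id D2.L D2.L"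
    using semilinear_comp[OF theta iota] by (simp add: id_def)
  from D2.L_ext[OF D2_group this id_semilinear iota_theta_W Z] show ?thesis .
qed

lemma theta_iso: "theta \<in> module_iso R D2.L L"
  unfolding module_iso_def
  using theta by (auto intro!: bij_betwI[where g = iota] simp: iota_theta theta_iota)

lemma Delta_trace_semilinear: "algebra_trace R Delta \<in> semilinear R id Delta (self_module R)"
  by (rule semilinearI)
    (auto elim!: DeltaE simp: Delta_trace tau_lin A.R.a_ac A.R.r_distr)

lemma det2_alternating:
  assumes u: "u \<in> semilinear R id Delta (self_module R)" and v: "v \<in> semilinear R id Delta (self_module R)"
  shows "alternating R Delta id (self_module R) 2 (\<lambda>f. u (f 0) \<otimes> v (f 1) \<ominus> u (f 1) \<otimes> v (f 0))"
proof -
  have uc: "X \<in> carrier Delta \<Longrightarrow> u X \<in> carrier R" for X using semilinear_closed[OF u] by simp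
  have vc: "X \<in> carrier Delta \<Longrightarrow> v X \<in> carrier R" for X using semilinear_closed[OF v] by simp
  have 1: "(\<lambda>X. w X \<otimes> c) \<in> semilinear R id Delta (self_module R)"
     "(\<lambda>X. c \<otimes> w X) \<in> semilinear R id Delta (self_module R)" 
    if "c \<in> carrier R" "w \<in> semilinear R id Delta (self_module R)" for c w
    using semilinear_smult_left[OF self_module_R _ that(2), of c] semilinear_scale[OF self_module_R _ that(2,1)] that by simp_all
  show ?thesis
    by (rule alternating2I[OF D.module_axioms self_module_R])
      (use uc vc u v in \<open>auto intro!: 1 semilinear_diff_fun[OF self_module_R, where \<sigma> = id and R = R, simplified]\<close>)
qed

text \<open>The wedge of \<open>f\<close> equals that of 1 and its image under \<open>theta\<close>,
  so an alternating form may be evaluated on this special pair.\<close>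

lemma alternating2_eval:
  assumes g: "alternating R Delta id (self_module R) 2 g" and f: "f \<in> {..<2} \<rightarrow> carrier Delta"
  shows "g f = g ((\<lambda>_. enc (\<one>, \<zero>\<^bsub>L\<^esub>))(1 := enc (\<zero>, theta (D2.W f))))"
proof -
  obtain h where h: "\<And>f. f \<in> {..<2} \<rightarrow> carrier Delta \<Longrightarrow> h (D2.W f) = g f"
    using D2.L_lift[OF self_module_R id_ring_hom g] by auto
  have Wf: "D2.W f \<in> carrier D2.L" using f by (rule D2.W_closed)
  let ?p = "(\<lambda>_. enc (\<one>, \<zero>\<^bsub>L\<^esub>))(1 := enc (\<zero>, theta (D2.W f)))"
  have p: "?p \<in> {..<2::nat} \<rightarrow> carrier Delta" using Wf by auto
  have "D2.W ?p = D2.W f" using iota_theta_W[OF f] by (simp add: iota_def wedge2_def)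
  then show ?thesis using h[OF f] h[OF p] by simp
qed

text \<open>Reduces \<open>b\<close> to the tuple of 1 and \<open>y\<close>, and then
  \<open>a\<close> to that of 1 and \<open>x\<close> by symmetry of the determinant. The entries are
  then the traces 2, \<tau>(y), \<tau>(x) and \<tau>(x) \<tau>(y) - 2 \<kappa>(x,y).\<close>

lemma Delta_disc:
  assumes a: "a \<in> {..<2} \<rightarrow> carrier Delta" and b: "b \<in> {..<2} \<rightarrow> carrier Delta"
  shows "ring_det R 2 (\<lambda>i j. algebra_trace R Delta (a i \<otimes>\<^bsub>Delta\<^esub> b j)) = disc (theta (D2.W a)) (theta (D2.W b))"
proof -
  let ?t = "algebra_trace R Delta"
  have tc: "X \<in> carrier Delta \<Longrightarrow> ?t X \<in> carrier R" for X using semilinear_closed[OF Delta_trace_semilinear] by simp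
  have mr: "(\<lambda>Y. X \<otimes>\<^bsub>Delta\<^esub> Y) \<in> semilinear R id Delta Delta" if "X \<in> carrier Delta" for X
    by (rule semilinearI) (use that in \<open>simp_all add: D.r_distr D.smult_assoc2 D.m_comm[of X]\<close>)
  have t: "(\<lambda>Y. ?t (X \<otimes>\<^bsub>Delta\<^esub> Y)) \<in> semilinear R id Delta (self_module R)" if "X \<in> carrier Delta" for X
    using semilinear_comp[OF mr[OF that] Delta_trace_semilinear] by (simp add: id_def)
  define d where "d a b = ?t (a 0 \<otimes>\<^bsub>Delta\<^esub> b 0) \<otimes> ?t (a 1 \<otimes>\<^bsub>Delta\<^esub> b 1) \<ominus> ?t (a 0 \<otimes>\<^bsub>Delta\<^esub> b 1) \<otimes> ?t (a 1 \<otimes>\<^bsub>Delta\<^esub> b 0)"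
    for a b :: "nat \<Rightarrow> 'delta"
  have f01: "f 0 \<in> carrier Delta" "f 1 \<in> carrier Delta" if "f \<in> {..<2::nat} \<rightarrow> carrier Delta" for f using that by auto
  have d: "alternating R Delta id (self_module R) 2 (d a)" if "a \<in> {..<2} \<rightarrow> carrier Delta" for a
    unfolding d_def[abs_def] by (rule det2_alternating[OF t t]) (use f01[OF that] in auto)
  have dsym: "d a b = d b a" if "a \<in> {..<2} \<rightarrow> carrier Delta" "b \<in> {..<2} \<rightarrow> carrier Delta" for a b
  proof -
    note aa = f01[OF that(1)] and bb = f01[OF that(2)]
    note ab = D.m_comm[OF aa(1) bb(1)] D.m_comm[OF aa(1) bb(2)] D.m_comm[OF aa(2) bb(1)] D.m_comm[OF aa(2) bb(2)]
    show ?thesis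
      unfolding d_def ab
      using A.R.m_comm[OF tc[OF D.m_closed[OF bb(2) aa(1)]] tc[OF D.m_closed[OF bb(1) aa(2)]]] by simp
  qed
  define p :: "_ \<Rightarrow> nat \<Rightarrow> 'delta" where "p x = (\<lambda>_. enc (\<one>, \<zero>\<^bsub>L\<^esub>))(1 := enc (\<zero>, x))" for x
  have p: "p x \<in> {..<2::nat} \<rightarrow> carrier Delta" if "x \<in> carrier L" for x using that by (auto simp: p_def)
  let ?x = "theta (D2.W a)" and ?y = "theta (D2.W b)"
  have xy: "?x \<in> carrier L" "?y \<in> carrier L" using a b by (auto intro!: D2.W_closed)
  \<comment> \<open>\<open>ring_det_2\<close> asks for all entries in the carrier, so those outside
    the range of the tuples are set to zero.\<close>
  let ?m = "\<lambda>i j. if i < 2 \<and> j < 2 then ?t (a i \<otimes>\<^bsub>Delta\<^esub> b j) else \<zero>"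
  have mc: "?m i j \<in> carrier R" for i j using a b tc by (auto simp: Pi_iff)
  have "ring_det R 2 (\<lambda>i j. ?t (a i \<otimes>\<^bsub>Delta\<^esub> b j)) = ring_det R 2 ?m"
    by (rule ring_det_cong[OF A.R.is_cring mc]) simp
  also have "\<dots> = d a b" unfolding d_def by (subst ring_det_2[OF A.R.is_cring mc]) simp
  also have "\<dots> = d a (p ?y)" using alternating2_eval[OF d[OF a] b] by (simp add: p_def)
  also have "\<dots> = d (p ?y) a" by (rule dsym[OF a p[OF xy(2)]])
  also have "\<dots> = d (p ?y) (p ?x)" using alternating2_eval[OF d[OF p[OF xy(2)]] a] by (simp add: p_def)
  also have "\<dots> = d (p ?x) (p ?y)" by (rule dsym[OF p[OF xy(2)] p[OF xy(1)]])
  also have "\<dots> = disc ?x ?y"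
    using xy A.R.m_comm[OF tau_closed[OF xy(2)] tau_closed[OF xy(1)]]
    by (simp add: d_def p_def disc_def Delta_trace tau_lin A.R.l_distr A.R.r_distr a_minus_def A.R.minus_add A.R.a_ac A.R.r_neg A.R.r_neg1 A.R.r_neg2)
  finally show ?thesis .
qed

lemma disc_forms_identified:
  assumes T: "\<And>x. x \<in> carrier A \<Longrightarrow> algebra_trace R A x = T x"
  shows "identifies_disc_forms R 2 Delta n A theta"
  unfolding identifies_disc_forms_def
proof (intro ballI)
  fix X Y assume X: "X \<in> carrier D2.L" and Y: "Y \<in> carrier D2.L"
  have "disc_form R n A (theta X, theta Y) = disc (theta X) (theta Y)"
  proof (rule disc_form_eq)
    fix a b assume a: "a \<in> vecs" and b: "b \<in> vecs"
    have "ring_det R n (\<lambda>i j. algebra_trace R A (a i \<otimes>\<^bsub>A\<^esub> b j)) = ring_det R n (\<lambda>i j. T (a i \<otimes>\<^bsub>A\<^esub> b j))"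
      by (rule ring_det_cong[OF A.R.is_cring]) (use a b T in \<open>auto simp: Pi_iff\<close>)
    then show "disc (W a) (W b) = ring_det R n (\<lambda>i j. algebra_trace R A (a i \<otimes>\<^bsub>A\<^esub> b j))"
      using discriminant_formula[OF a b] by (simp add: disc_def)
  qed (use X Y disc_semilinear in auto)
  moreover have "disc_form R 2 Delta (X, Y) = disc (theta X) (theta Y)"
  proof (rule D2.disc_form_eq[where D = "\<lambda>X Y. disc (theta X) (theta Y)"])
    show "(\<lambda>Y. disc (theta X) (theta Y)) \<in> semilinear R id D2.L (self_module R)" if "X \<in> carrier D2.L" for X
      using semilinear_comp[OF theta disc_semilinear(1)[OF theta_closed[OF that]]] by (simp add: id_def)
    show "(\<lambda>Y. disc (theta Y) (theta X)) \<in> semilinear R id D2.L (self_module R)" if "X \<in> carrier D2.L" for X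
      using semilinear_comp[OF theta disc_semilinear(2)[OF theta_closed[OF that]]] by (simp add: id_def)
  qed (use X Y Delta_disc in auto)
  ultimately show "disc_form R n A (theta X, theta Y) = disc_form R 2 Delta (X, Y)" by simp
qed

end

section \<open>Fractions, and local freeness in terms of numerators\<close>

section \<open>Localization\<close>

lemma ex1_eq: "\<exists>!x. P x \<Longrightarrow> P a \<Longrightarrow> P b \<Longrightarrow> a = b"
  by blast

locale mult_localization = module R M for R (structure) and M (structure) + fixes S
  assumes S_sub: "S \<subseteq> carrier R" and S_one: "\<one> \<in> S" and S_mult: "s \<in> S \<Longrightarrow> t \<in> S \<Longrightarrow> s \<otimes> t \<in> S"
begin

abbreviation frac where "frac x s \<equiv> frac_class R S M (x, s)"
abbreviation M_loc where "M_loc \<equiv> localization R S M"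

lemma S_closed [simp, intro]: "s \<in> S \<Longrightarrow> s \<in> carrier R"
  using S_sub by auto

lemma smult_lcomm: "a \<in> carrier R \<Longrightarrow> b \<in> carrier R \<Longrightarrow> x \<in> carrier M \<Longrightarrow> a \<odot>\<^bsub>M\<^esub> (b \<odot>\<^bsub>M\<^esub> x) = b \<odot>\<^bsub>M\<^esub> (a \<odot>\<^bsub>M\<^esub> x)"
  by (simp add: smult_assoc1[symmetric] R.m_comm)

lemma frac_mem: "(y, t) \<in> frac x s \<longleftrightarrow> y \<in> carrier M \<and> t \<in> S \<and> (\<exists>u\<in>S. u \<odot>\<^bsub>M\<^esub> (s \<odot>\<^bsub>M\<^esub> y) = u \<odot>\<^bsub>M\<^esub> (t \<odot>\<^bsub>M\<^esub> x))"
  by (simp add: frac_class_def conj_assoc)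

text \<open>The witness is \<open>u \<otimes> v \<otimes> t\<close>: besides the two given
  multipliers it has to contain the middle denominator.\<close>

lemma frac_trans:
  assumes x: "x \<in> carrier M" "s \<in> S" and y: "(y, t) \<in> frac x s" and z: "(z, w) \<in> frac y t"
  shows "(z, w) \<in> frac x s"
proof -
  obtain u where u: "u \<in> S" "u \<odot>\<^bsub>M\<^esub> (s \<odot>\<^bsub>M\<^esub> y) = u \<odot>\<^bsub>M\<^esub> (t \<odot>\<^bsub>M\<^esub> x)" and yt: "y \<in> carrier M" "t \<in> S" 
    using y by (auto simp: frac_mem)
  obtain v where v: "v \<in> S" "v \<odot>\<^bsub>M\<^esub> (t \<odot>\<^bsub>M\<^esub> z) = v \<odot>\<^bsub>M\<^esub> (w \<odot>\<^bsub>M\<^esub> y)" and zw: "z \<in> carrier M" "w \<in> S" 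
    using z by (auto simp: frac_mem)
  note c = x yt zw u(1) v(1)
  have "(u \<otimes> v \<otimes> t) \<odot>\<^bsub>M\<^esub> (s \<odot>\<^bsub>M\<^esub> z) = u \<odot>\<^bsub>M\<^esub> (s \<odot>\<^bsub>M\<^esub> (v \<odot>\<^bsub>M\<^esub> (t \<odot>\<^bsub>M\<^esub> z)))"
    using c by (simp add: smult_assoc1[symmetric] R.m_ac)
  also have "\<dots> = v \<odot>\<^bsub>M\<^esub> (w \<odot>\<^bsub>M\<^esub> (u \<odot>\<^bsub>M\<^esub> (s \<odot>\<^bsub>M\<^esub> y)))"
    unfolding v(2) using c by (simp add: smult_assoc1[symmetric] R.m_ac)
  also have "\<dots> = (u \<otimes> v \<otimes> t) \<odot>\<^bsub>M\<^esub> (w \<odot>\<^bsub>M\<^esub> x)"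
    unfolding u(2) using c by (simp add: smult_assoc1[symmetric] R.m_ac)
  finally show ?thesis using c S_mult by (auto simp: frac_mem intro!: bexI[of _ "u \<otimes> v \<otimes> t"])
qed

lemma frac_sym: "x \<in> carrier M \<Longrightarrow> s \<in> S \<Longrightarrow> (y, t) \<in> frac x s \<Longrightarrow> (x, s) \<in> frac y t"
  by (metis frac_mem)

lemma frac_refl: "x \<in> carrier M \<Longrightarrow> s \<in> S \<Longrightarrow> (x, s) \<in> frac x s"
  using S_one by (auto simp: frac_mem)

lemma frac_eq_mem:
  assumes "x \<in> carrier M" "s \<in> S" "y \<in> carrier M" "t \<in> S"
  shows "frac x s = frac y t \<longleftrightarrow> (y, t) \<in> frac x s"
proof
  assume "(y, t) \<in> frac x s"
  note 1 = this and 2 = frac_sym[OF assms(1,2) this]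
  show "frac x s = frac y t"
  proof (rule Set.set_eqI)
    fix p :: "'c \<times> 'a"
    obtain z w where p: "p = (z, w)" by (cases p)
    show "p \<in> frac x s \<longleftrightarrow> p \<in> frac y t"
      unfolding p using frac_trans[OF assms(1,2) 1, of z w] frac_trans[OF assms(3,4) 2, of z w] by blast
  qed
next
  assume eq: "frac x s = frac y t"
  show "(y, t) \<in> frac x s" unfolding eq by (rule frac_refl[OF assms(3,4)])
qed

lemma frac_eq:
  assumes "x \<in> carrier M" "s \<in> S" "y \<in> carrier M" "t \<in> S"
  shows "frac x s = frac y t \<longleftrightarrow> (\<exists>u\<in>S. u \<odot>\<^bsub>M\<^esub> (s \<odot>\<^bsub>M\<^esub> y) = u \<odot>\<^bsub>M\<^esub> (t \<odot>\<^bsub>M\<^esub> x))"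
  unfolding frac_eq_mem[OF assms] frac_mem using assms by auto

lemma frac_cancel:
  assumes "x \<in> carrier M" "s \<in> S" "t \<in> S"
  shows "frac (t \<odot>\<^bsub>M\<^esub> x) (t \<otimes> s) = frac x s"
  using assms S_one S_mult by (subst frac_eq) (auto intro!: bexI[of _ "\<one>"] simp: smult_assoc1 smult_lcomm)

lemma loc_closed: "x \<in> carrier M \<Longrightarrow> s \<in> S \<Longrightarrow> frac x s \<in> carrier M_loc"
  by (auto simp: localization_def)

lemma locE:
  assumes "X \<in> carrier M_loc"
  obtains x s where "X = frac x s" "x \<in> carrier M" "s \<in> S"
  using assms by (auto simp: localization_def)

lemma loc_zero: "\<zero>\<^bsub>M_loc\<^esub> = frac \<zero>\<^bsub>M\<^esub> \<one>"
  by (simp add: localization_def)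

lemma UN2_constant:
  assumes "a \<in> X" "b \<in> Y" "\<And>x y. x \<in> X \<Longrightarrow> y \<in> Y \<Longrightarrow> f x y = c"
  shows "(\<Union>x\<in>X. \<Union>y\<in>Y. f x y) = c"
  using assms by blast

text \<open>The double union collapses because the class of the sum does not depend on the
  representatives: multipliers \<open>u\<close> and \<open>v\<close> for the two fractions combine
  to \<open>u \<otimes> v\<close>.\<close>

lemma loc_add:
  assumes "x \<in> carrier M" "s \<in> S" "y \<in> carrier M" "t \<in> S"
  shows "frac x s \<oplus>\<^bsub>M_loc\<^esub> frac y t = frac (t \<odot>\<^bsub>M\<^esub> x \<oplus>\<^bsub>M\<^esub> s \<odot>\<^bsub>M\<^esub> y) (s \<otimes> t)"
proof -
  have "frac (snd q \<odot>\<^bsub>M\<^esub> fst p \<oplus>\<^bsub>M\<^esub> snd p \<odot>\<^bsub>M\<^esub> fst q) (snd p \<otimes> snd q) = frac (t \<odot>\<^bsub>M\<^esub> x \<oplus>\<^bsub>M\<^esub> s \<odot>\<^bsub>M\<^esub> y) (s \<otimes> t)"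
    if p: "p \<in> frac x s" and q: "q \<in> frac y t" for p q
  proof -
    obtain x' s' where p': "p = (x', s')" by (cases p)
    obtain y' t' where q': "q = (y', t')" by (cases q)
    obtain u where u: "u \<in> S" "u \<odot>\<^bsub>M\<^esub> (s \<odot>\<^bsub>M\<^esub> x') = u \<odot>\<^bsub>M\<^esub> (s' \<odot>\<^bsub>M\<^esub> x)" "x' \<in> carrier M" "s' \<in> S"
      using p unfolding p' frac_mem by auto
    obtain v where v: "v \<in> S" "v \<odot>\<^bsub>M\<^esub> (t \<odot>\<^bsub>M\<^esub> y') = v \<odot>\<^bsub>M\<^esub> (t' \<odot>\<^bsub>M\<^esub> y)" "y' \<in> carrier M" "t' \<in> S"
      using q unfolding q' frac_mem by auto
    note c = assms u(1,3,4) v(1,3,4)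
    have "(u \<otimes> v) \<odot>\<^bsub>M\<^esub> ((s' \<otimes> t') \<odot>\<^bsub>M\<^esub> (t \<odot>\<^bsub>M\<^esub> x \<oplus>\<^bsub>M\<^esub> s \<odot>\<^bsub>M\<^esub> y)) =
      v \<odot>\<^bsub>M\<^esub> (t \<odot>\<^bsub>M\<^esub> (t' \<odot>\<^bsub>M\<^esub> (u \<odot>\<^bsub>M\<^esub> (s' \<odot>\<^bsub>M\<^esub> x)))) \<oplus>\<^bsub>M\<^esub> u \<odot>\<^bsub>M\<^esub> (s \<odot>\<^bsub>M\<^esub> (s' \<odot>\<^bsub>M\<^esub> (v \<odot>\<^bsub>M\<^esub> (t' \<odot>\<^bsub>M\<^esub> y))))"
      using c by (simp add: smult_r_distr smult_assoc1[symmetric] R.m_ac)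
    also have "\<dots> = (u \<otimes> v) \<odot>\<^bsub>M\<^esub> ((s \<otimes> t) \<odot>\<^bsub>M\<^esub> (t' \<odot>\<^bsub>M\<^esub> x' \<oplus>\<^bsub>M\<^esub> s' \<odot>\<^bsub>M\<^esub> y'))"
      unfolding u(2)[symmetric] v(2)[symmetric] using c by (simp add: smult_r_distr smult_assoc1[symmetric] R.m_ac)
    finally show ?thesis
      unfolding p' q' using c S_mult by (subst frac_eq) (auto intro!: bexI[of _ "u \<otimes> v"])
  qed
  then have "(\<Union>p\<in>frac x s. \<Union>q\<in>frac y t. frac (snd q \<odot>\<^bsub>M\<^esub> fst p \<oplus>\<^bsub>M\<^esub> snd p \<odot>\<^bsub>M\<^esub> fst q) (snd p \<otimes> snd q)) =
    frac (t \<odot>\<^bsub>M\<^esub> x \<oplus>\<^bsub>M\<^esub> s \<odot>\<^bsub>M\<^esub> y) (s \<otimes> t)"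
    by (rule UN2_constant[OF frac_refl[OF assms(1,2)] frac_refl[OF assms(3,4)]])
  then show ?thesis by (simp add: localization_def)
qed

lemma loc_add_same:
  assumes "x \<in> carrier M" "s \<in> S" "y \<in> carrier M"
  shows "frac x s \<oplus>\<^bsub>M_loc\<^esub> frac y s = frac (x \<oplus>\<^bsub>M\<^esub> y) s"
  using frac_cancel[of "x \<oplus>\<^bsub>M\<^esub> y" s s] assms by (simp add: loc_add smult_r_distr)

lemma common_denominator:
  assumes "finite I" "\<And>i. i \<in> I \<Longrightarrow> q i \<in> carrier M_loc"
  shows "\<exists>s\<in>S. \<exists>x\<in>I \<rightarrow> carrier M. \<forall>i\<in>I. q i = frac (x i) s"
  using assms
proof (induction I)
  case empty
  then show ?case using S_one by auto
next
  case (insert j I)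
  then obtain s x where sx: "s \<in> S" "x \<in> I \<rightarrow> carrier M" "\<And>i. i \<in> I \<Longrightarrow> q i = frac (x i) s" by fastforce
  obtain y t where yt: "q j = frac y t" "y \<in> carrier M" "t \<in> S"
    using insert.prems[of j] by (meson insertI1 locE)
  \<comment> \<open>The new fraction is expanded by the old denominator \<open>s\<close>, the old
    ones by the new denominator \<open>t\<close>.\<close>
  let ?x = "\<lambda>i. if i = j then s \<odot>\<^bsub>M\<^esub> y else t \<odot>\<^bsub>M\<^esub> x i"
  have A: "q i = frac (?x i) (t \<otimes> s)" if "i \<in> insert j I" for i
  proof (cases "i = j")
    case True
    have "frac (s \<odot>\<^bsub>M\<^esub> y) (s \<otimes> t) = frac y t" by (rule frac_cancel) (use yt sx in auto)
    then show ?thesis using True yt sx by (simp add: R.m_comm)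
  next
    case False
    then have "i \<in> I" using that by simp
    then show ?thesis using frac_cancel[of "x i" s t] sx yt False by auto
  qed
  have "?x \<in> insert j I \<rightarrow> carrier M" using sx(1,2) yt by (auto simp: Pi_iff)
  with A have "\<exists>x\<in>insert j I \<rightarrow> carrier M. \<forall>i\<in>insert j I. q i = frac (x i) (t \<otimes> s)"
    by (intro bexI[of _ ?x] ballI)
  then show ?case using S_mult[OF yt(3) sx(1)] by (rule bexI)
qed

lemma loc_monoid: "abelian_monoid M_loc"
proof (rule abelian_monoidI)
  fix X Y Z assume XYZ: "X \<in> carrier M_loc" "Y \<in> carrier M_loc" "Z \<in> carrier M_loc"
  \<comment> \<open>Over a common denominator the addition of three fractions is that of their
    numerators.\<close>
  obtain s x where sx: "s \<in> S" "x \<in> {..<3::nat} \<rightarrow> carrier M" "\<And>i. i < 3 \<Longrightarrow> [X, Y, Z] ! i = frac (x i) s"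
  proof -
    have "\<exists>s\<in>S. \<exists>x\<in>{..<3} \<rightarrow> carrier M. \<forall>i\<in>{..<3::nat}. [X, Y, Z] ! i = frac (x i) s"
      by (rule common_denominator) (use XYZ in \<open>auto simp: less_Suc_eq numeral_3_eq_3\<close>)
    then obtain s x where "s \<in> S" "x \<in> {..<3} \<rightarrow> carrier M" "\<forall>i\<in>{..<3::nat}. [X, Y, Z] ! i = frac (x i) s" by (elim bexE)
    then show ?thesis by (intro that[of s x]) simp_all
  qed
  have e: "X = frac (x 0) s" "Y = frac (x 1) s" "Z = frac (x 2) s"
    using sx(3)[of 0] sx(3)[of 1] sx(3)[of 2] by (auto simp: numeral_2_eq_2)
  have c: "x 0 \<in> carrier M" "x 1 \<in> carrier M" "x 2 \<in> carrier M" using sx(2) by auto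
  show "X \<oplus>\<^bsub>M_loc\<^esub> Y \<oplus>\<^bsub>M_loc\<^esub> Z = X \<oplus>\<^bsub>M_loc\<^esub> (Y \<oplus>\<^bsub>M_loc\<^esub> Z)"
    unfolding e using c sx(1) by (simp add: loc_add_same M.a_assoc)
next
  fix X Y assume XY: "X \<in> carrier M_loc" "Y \<in> carrier M_loc"
  then obtain x s y t where e: "X = frac x s" "x \<in> carrier M" "s \<in> S" "Y = frac y t" "y \<in> carrier M" "t \<in> S"
    by (metis locE)
  show "X \<oplus>\<^bsub>M_loc\<^esub> Y \<in> carrier M_loc" unfolding e(1,4) using e S_mult by (auto simp: loc_add intro!: loc_closed)
  show "X \<oplus>\<^bsub>M_loc\<^esub> Y = Y \<oplus>\<^bsub>M_loc\<^esub> X" unfolding e(1,4) using e by (simp add: loc_add M.a_comm R.m_comm)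
next
  fix X assume "X \<in> carrier M_loc"
  then obtain x s where e: "X = frac x s" "x \<in> carrier M" "s \<in> S" by (rule locE)
  show "\<zero>\<^bsub>M_loc\<^esub> \<oplus>\<^bsub>M_loc\<^esub> X = X" unfolding e loc_zero using e S_one by (simp add: loc_add)
qed (use loc_zero loc_closed S_one in auto)

sublocale Loc: abelian_monoid M_loc by (rule loc_monoid)

lemma loc_finsum:
  assumes "x \<in> I \<rightarrow> carrier M" "s \<in> S"
  shows "(\<Oplus>\<^bsub>M_loc\<^esub>i\<in>I. frac (x i) s) = frac (\<Oplus>\<^bsub>M\<^esub>i\<in>I. x i) s"
proof -
  have z: "\<zero>\<^bsub>M_loc\<^esub> = frac \<zero>\<^bsub>M\<^esub> s"
    unfolding loc_zero using assms S_one by (subst frac_eq) auto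
  show ?thesis
  proof (cases "finite I")
    case True
    then show ?thesis using assms(1)
    proof (induction I)
      case (insert i I)
      have c: "(\<lambda>i. frac (x i) s) \<in> I \<rightarrow> carrier M_loc" "frac (x i) s \<in> carrier M_loc"
        using insert.prems assms(2) by (auto intro!: loc_closed)
      have xc: "x i \<in> carrier M" "x \<in> I \<rightarrow> carrier M" using insert.prems by auto
      have "(\<Oplus>\<^bsub>M_loc\<^esub>i\<in>insert i I. frac (x i) s) = frac (x i) s \<oplus>\<^bsub>M_loc\<^esub> (\<Oplus>\<^bsub>M_loc\<^esub>i\<in>I. frac (x i) s)"
        by (rule Loc.finsum_insert[OF insert.hyps c])
      also have "\<dots> = frac (x i \<oplus>\<^bsub>M\<^esub> (\<Oplus>\<^bsub>M\<^esub>i\<in>I. x i)) s"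
        unfolding insert.IH[OF xc(2)] using xc assms(2) by (intro loc_add_same) auto
      also have "x i \<oplus>\<^bsub>M\<^esub> (\<Oplus>\<^bsub>M\<^esub>i\<in>I. x i) = (\<Oplus>\<^bsub>M\<^esub>i\<in>insert i I. x i)"
        using M.finsum_insert[OF insert.hyps xc(2,1)] by simp
      finally show ?case .
    qed (simp add: z)
  qed (simp add: z)
qed

lemma common_annihilator:
  assumes "finite I" "\<And>i. i \<in> I \<Longrightarrow> c i \<in> carrier M" "\<And>i. i \<in> I \<Longrightarrow> \<exists>t\<in>S. t \<odot>\<^bsub>M\<^esub> c i = \<zero>\<^bsub>M\<^esub>"
  shows "\<exists>t\<in>S. \<forall>i\<in>I. t \<odot>\<^bsub>M\<^esub> c i = \<zero>\<^bsub>M\<^esub>"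
  using assms
proof (induction I)
  case empty
  then show ?case using S_one by auto
next
  case (insert j I)
  then obtain t where t: "t \<in> S" "\<And>i. i \<in> I \<Longrightarrow> t \<odot>\<^bsub>M\<^esub> c i = \<zero>\<^bsub>M\<^esub>" by auto
  obtain u where u: "u \<in> S" "u \<odot>\<^bsub>M\<^esub> c j = \<zero>\<^bsub>M\<^esub>" using insert.prems by auto
  have "(t \<otimes> u) \<odot>\<^bsub>M\<^esub> c i = \<zero>\<^bsub>M\<^esub>" if "i \<in> insert j I" for i
  proof (cases "i = j")
    case True
    then show ?thesis using t u insert.prems(1)[of j] by (simp add: smult_assoc1)
  next
    case False
    then have "i \<in> I" using that by simp
    then show ?thesis using t u insert.prems(1)[of i] by (simp add: smult_assoc1 smult_lcomm[of t u])
  qed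
  then show ?case using t u S_mult by blast
qed

end

locale module_localization = mult_localization
begin

sublocale Self: mult_localization R "self_module R" S
  by (intro mult_localization.intro self_module_module R.is_cring mult_localization_axioms.intro S_sub S_one S_mult)

abbreviation R_loc where "R_loc \<equiv> localization R S (self_module R)"

lemma loc_smult:
  assumes "p \<in> carrier R" "s \<in> S" "x \<in> carrier M" "t \<in> S"
  shows "Self.frac p s \<odot>\<^bsub>M_loc\<^esub> frac x t = frac (p \<odot>\<^bsub>M\<^esub> x) (s \<otimes> t)"
proof -
  have pr: "(p, s) \<in> Self.frac p s" by (rule Self.frac_refl) (use assms in auto)
  have "frac (fst a \<odot>\<^bsub>M\<^esub> fst b) (snd a \<otimes> snd b) = frac (p \<odot>\<^bsub>M\<^esub> x) (s \<otimes> t)"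
    if a: "a \<in> Self.frac p s" and b: "b \<in> frac x t" for a b
  proof -
    obtain p' s' where a': "a = (p', s')" by (cases a)
    obtain x' t' where b': "b = (x', t')" by (cases b)
    obtain u where u: "u \<in> S" "u \<otimes> (s \<otimes> p') = u \<otimes> (s' \<otimes> p)" "p' \<in> carrier R" "s' \<in> S"
      using a unfolding a' Self.frac_mem by auto
    obtain v where v: "v \<in> S" "v \<odot>\<^bsub>M\<^esub> (t \<odot>\<^bsub>M\<^esub> x') = v \<odot>\<^bsub>M\<^esub> (t' \<odot>\<^bsub>M\<^esub> x)" "x' \<in> carrier M" "t' \<in> S"
      using b unfolding b' frac_mem by auto
    note c = assms u(1,3,4) v(1,3,4)
    have "(u \<otimes> v) \<odot>\<^bsub>M\<^esub> ((s' \<otimes> t') \<odot>\<^bsub>M\<^esub> (p \<odot>\<^bsub>M\<^esub> x)) = (u \<otimes> (s' \<otimes> p)) \<odot>\<^bsub>M\<^esub> (v \<odot>\<^bsub>M\<^esub> (t' \<odot>\<^bsub>M\<^esub> x))"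
      using c by (simp add: smult_assoc1[symmetric] R.m_ac)
    also have "\<dots> = (u \<otimes> v) \<odot>\<^bsub>M\<^esub> ((s \<otimes> t) \<odot>\<^bsub>M\<^esub> (p' \<odot>\<^bsub>M\<^esub> x'))"
      unfolding u(2)[symmetric] v(2)[symmetric] using c by (simp add: smult_assoc1[symmetric] R.m_ac)
    finally show ?thesis
      unfolding a' b' using c S_mult by (subst frac_eq) (auto intro!: bexI[of _ "u \<otimes> v"])
  qed
  then have "(\<Union>a\<in>Self.frac p s. \<Union>b\<in>frac x t. frac (fst a \<odot>\<^bsub>M\<^esub> fst b) (snd a \<otimes> snd b)) = frac (p \<odot>\<^bsub>M\<^esub> x) (s \<otimes> t)"
    by (rule UN2_constant[OF pr frac_refl[OF assms(3,4)]])
  then show ?thesis by (simp add: localization_def)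
qed

text \<open>Freeness of the localization on the fractions with numerators \<open>b i\<close> and
  denominator 1, stated without fractions: denominators are cleared in the spanning condition, and
  the coefficients of a vanishing combination are killed by a common element of
  \<open>S\<close>.\<close>

definition local_basis where "local_basis n b \<longleftrightarrow> b \<in> {..<n::nat} \<rightarrow> carrier M \<and>
  (\<forall>x\<in>carrier M. \<exists>t\<in>S. \<exists>c\<in>{..<n} \<rightarrow> carrier R. t \<odot>\<^bsub>M\<^esub> x = (\<Oplus>\<^bsub>M\<^esub>i\<in>{..<n}. c i \<odot>\<^bsub>M\<^esub> b i)) \<and>
  (\<forall>c\<in>{..<n} \<rightarrow> carrier R. (\<Oplus>\<^bsub>M\<^esub>i\<in>{..<n}. c i \<odot>\<^bsub>M\<^esub> b i) = \<zero>\<^bsub>M\<^esub> \<longrightarrow> (\<exists>t\<in>S. \<forall>i<n. t \<otimes> c i = \<zero>))"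

text \<open>A basis of the localization consists of fractions with numerators \<open>b i\<close> and
  denominators \<open>k i\<close>. The numerators alone serve, because the \<open>k i\<close> become
  units.\<close>

lemma local_basis_of_free:
  assumes free: "free_of_rank R_loc n M_loc"
  shows "\<exists>b. local_basis n b"
proof -
  obtain e where e: "e \<in> {..<n} \<rightarrow> carrier M_loc"
    and ex0: "\<forall>x\<in>carrier M_loc. \<exists>!c. c \<in> {..<n} \<rightarrow>\<^sub>E carrier R_loc \<and> x = (\<Oplus>\<^bsub>M_loc\<^esub>i\<in>{..<n}. c i \<odot>\<^bsub>M_loc\<^esub> e i)"
    using free unfolding free_of_rank_def by (elim bexE)
  note ex = ex0[THEN bspec]
  have "\<forall>i\<in>{..<n}. \<exists>x s. e i = frac x s \<and> x \<in> carrier M \<and> s \<in> S"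
  proof
    fix i assume "i \<in> {..<n}"
    then have "e i \<in> carrier M_loc" using e by auto
    then show "\<exists>x s. e i = frac x s \<and> x \<in> carrier M \<and> s \<in> S" by (rule locE) (intro exI conjI)
  qed
  then obtain b k where bk: "\<And>i. i < n \<Longrightarrow> e i = frac (b i) (k i)" "\<And>i. i < n \<Longrightarrow> b i \<in> carrier M" "\<And>i. i < n \<Longrightarrow> k i \<in> S"
    by (metis lessThan_iff)
  have span: "\<exists>t\<in>S. \<exists>c\<in>{..<n} \<rightarrow> carrier R. t \<odot>\<^bsub>M\<^esub> x = (\<Oplus>\<^bsub>M\<^esub>i\<in>{..<n}. c i \<odot>\<^bsub>M\<^esub> b i)" if x: "x \<in> carrier M" for x
  proof -
    obtain c where c: "c \<in> {..<n} \<rightarrow>\<^sub>E carrier R_loc" "frac x \<one> = (\<Oplus>\<^bsub>M_loc\<^esub>i\<in>{..<n}. c i \<odot>\<^bsub>M_loc\<^esub> e i)"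
      using ex1_implies_ex[OF ex[OF loc_closed[OF x S_one]]] by (elim exE conjE)
    have "\<forall>i\<in>{..<n}. \<exists>p l. c i = Self.frac p l \<and> p \<in> carrier R \<and> l \<in> S"
    proof
      fix i assume "i \<in> {..<n}"
      then have "c i \<in> carrier R_loc" using c(1) by auto
      then show "\<exists>p l. c i = Self.frac p l \<and> p \<in> carrier R \<and> l \<in> S" by (rule Self.locE) auto
    qed
    then obtain p l where pl: "\<And>i. i < n \<Longrightarrow> c i = Self.frac (p i) (l i)" "\<And>i. i < n \<Longrightarrow> p i \<in> carrier R" "\<And>i. i < n \<Longrightarrow> l i \<in> S"
      by (metis lessThan_iff)
    have "\<exists>s\<in>S. \<exists>r\<in>{..<n} \<rightarrow> carrier (self_module R). \<forall>i\<in>{..<n}. Self.frac (p i) (l i \<otimes> k i) = Self.frac (r i) s"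
      by (rule Self.common_denominator) (use pl bk S_mult in \<open>auto intro!: Self.loc_closed\<close>)
    then obtain s r where "s \<in> S" "r \<in> {..<n} \<rightarrow> carrier (self_module R)" "\<forall>i\<in>{..<n}. Self.frac (p i) (l i \<otimes> k i) = Self.frac (r i) s"
      by (elim bexE)
    then have sr: "s \<in> S" "\<And>i. i < n \<Longrightarrow> r i \<in> carrier R" "\<And>i. i < n \<Longrightarrow> Self.frac (p i) (l i \<otimes> k i) = Self.frac (r i) s"
      by (simp_all add: Pi_iff)
    have ce: "c i \<odot>\<^bsub>M_loc\<^esub> e i = frac (r i \<odot>\<^bsub>M\<^esub> b i) s" if i: "i < n" for i
    proof -
      have "c i \<odot>\<^bsub>M_loc\<^esub> e i = frac (p i \<odot>\<^bsub>M\<^esub> b i) (l i \<otimes> k i)"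
        using pl[OF i] bk[OF i] by (simp add: loc_smult)
      also have "\<dots> = Self.frac (p i) (l i \<otimes> k i) \<odot>\<^bsub>M_loc\<^esub> frac (b i) \<one>"
        using pl[OF i] bk[OF i] S_one S_mult by (simp add: loc_smult)
      also have "\<dots> = frac (r i \<odot>\<^bsub>M\<^esub> b i) s"
        unfolding sr(3)[OF i] using bk[OF i] sr(1) sr(2)[OF i] S_one by (simp add: loc_smult)
      finally show ?thesis .
    qed
    have rb: "(\<lambda>i. r i \<odot>\<^bsub>M\<^esub> b i) \<in> {..<n} \<rightarrow> carrier M" using sr bk by auto
    have "frac x \<one> = (\<Oplus>\<^bsub>M_loc\<^esub>i\<in>{..<n}. frac (r i \<odot>\<^bsub>M\<^esub> b i) s)"
      unfolding c(2) by (rule Loc.finsum_cong'[OF refl]) (use ce rb sr in \<open>auto intro!: loc_closed\<close>)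
    also have "\<dots> = frac (\<Oplus>\<^bsub>M\<^esub>i\<in>{..<n}. r i \<odot>\<^bsub>M\<^esub> b i) s" by (rule loc_finsum[OF rb sr(1)])
    finally obtain u where u: "u \<in> S" "u \<odot>\<^bsub>M\<^esub> (\<one> \<odot>\<^bsub>M\<^esub> (\<Oplus>\<^bsub>M\<^esub>i\<in>{..<n}. r i \<odot>\<^bsub>M\<^esub> b i)) = u \<odot>\<^bsub>M\<^esub> (s \<odot>\<^bsub>M\<^esub> x)"
      using frac_eq[OF x S_one M.finsum_closed[OF rb] sr(1)] by blast
    have "(u \<otimes> s) \<odot>\<^bsub>M\<^esub> x = u \<odot>\<^bsub>M\<^esub> (\<Oplus>\<^bsub>M\<^esub>i\<in>{..<n}. r i \<odot>\<^bsub>M\<^esub> b i)"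
      using u sr x M.finsum_closed[OF rb] by (simp add: smult_assoc1)
    also have "\<dots> = (\<Oplus>\<^bsub>M\<^esub>i\<in>{..<n}. u \<odot>\<^bsub>M\<^esub> (r i \<odot>\<^bsub>M\<^esub> b i))"
      by (rule finsum_smult_ldistr) (use u rb in auto)
    also have "\<dots> = (\<Oplus>\<^bsub>M\<^esub>i\<in>{..<n}. (u \<otimes> r i) \<odot>\<^bsub>M\<^esub> b i)"
      by (rule M.finsum_cong'[OF refl]) (use u sr bk in \<open>auto simp: smult_assoc1\<close>)
    finally show ?thesis using u sr S_mult by (intro bexI[of _ "u \<otimes> s"] bexI[of _ "\<lambda>i. u \<otimes> r i"]) auto
  qed
  have indep: "\<exists>t\<in>S. \<forall>i<n. t \<otimes> c i = \<zero>" if c: "c \<in> {..<n} \<rightarrow> carrier R" and z: "(\<Oplus>\<^bsub>M\<^esub>i\<in>{..<n}. c i \<odot>\<^bsub>M\<^esub> b i) = \<zero>\<^bsub>M\<^esub>" for c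
  proof -
    \<comment> \<open>The factor \<open>k i\<close> cancels the denominator of \<open>e i\<close>,
      so these coefficients turn the combination of the \<open>e i\<close> into the given one of the
      \<open>b i\<close>.\<close>
    let ?c = "restrict (\<lambda>i. Self.frac (c i \<otimes> k i) \<one>) {..<n}" and ?d = "restrict (\<lambda>i. Self.frac \<zero> \<one>) {..<n}"
    have cc: "i < n \<Longrightarrow> c i \<in> carrier R" for i using c by auto
    have "(\<Oplus>\<^bsub>M_loc\<^esub>i\<in>{..<n}. ?c i \<odot>\<^bsub>M_loc\<^esub> e i) = (\<Oplus>\<^bsub>M_loc\<^esub>i\<in>{..<n}. frac (c i \<odot>\<^bsub>M\<^esub> b i) \<one>)"
    proof (rule Loc.finsum_cong'[OF refl])
      fix i assume "i \<in> {..<n}"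
      then have i: "i < n" by simp
      have "?c i \<odot>\<^bsub>M_loc\<^esub> e i = frac (k i \<odot>\<^bsub>M\<^esub> (c i \<odot>\<^bsub>M\<^esub> b i)) (k i \<otimes> \<one>)"
        using i bk[OF i] cc[OF i] S_one by (simp add: loc_smult smult_assoc1[symmetric] R.m_comm)
      also have "\<dots> = frac (c i \<odot>\<^bsub>M\<^esub> b i) \<one>" by (rule frac_cancel) (use i bk[OF i] cc[OF i] S_one in auto)
      finally show "?c i \<odot>\<^bsub>M_loc\<^esub> e i = frac (c i \<odot>\<^bsub>M\<^esub> b i) \<one>" .
    qed (use bk cc S_one in \<open>auto intro!: loc_closed\<close>)
    also have "\<dots> = frac \<zero>\<^bsub>M\<^esub> \<one>" by (subst loc_finsum) (use bk cc S_one z in auto)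
    finally have 1: "frac \<zero>\<^bsub>M\<^esub> \<one> = (\<Oplus>\<^bsub>M_loc\<^esub>i\<in>{..<n}. ?c i \<odot>\<^bsub>M_loc\<^esub> e i)" ..
    have "(\<Oplus>\<^bsub>M_loc\<^esub>i\<in>{..<n}. ?d i \<odot>\<^bsub>M_loc\<^esub> e i) = (\<Oplus>\<^bsub>M_loc\<^esub>i\<in>{..<n}. frac \<zero>\<^bsub>M\<^esub> \<one>)"
    proof (rule Loc.finsum_cong'[OF refl])
      fix i assume "i \<in> {..<n}"
      then have i: "i < n" by simp
      have "?d i \<odot>\<^bsub>M_loc\<^esub> e i = frac \<zero>\<^bsub>M\<^esub> (k i)"
        using i bk[OF i] S_one by (simp add: loc_smult)
      also have "\<dots> = frac \<zero>\<^bsub>M\<^esub> \<one>" using bk[OF i] S_one by (subst frac_eq) auto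
      finally show "?d i \<odot>\<^bsub>M_loc\<^esub> e i = frac \<zero>\<^bsub>M\<^esub> \<one>" .
    qed (use S_one in \<open>auto intro!: loc_closed\<close>)
    also have "\<dots> = frac \<zero>\<^bsub>M\<^esub> \<one>" by (subst loc_finsum) (use S_one in auto)
    finally have 2: "frac \<zero>\<^bsub>M\<^esub> \<one> = (\<Oplus>\<^bsub>M_loc\<^esub>i\<in>{..<n}. ?d i \<odot>\<^bsub>M_loc\<^esub> e i)" ..
    have m: "?c \<in> {..<n} \<rightarrow>\<^sub>E carrier R_loc" "?d \<in> {..<n} \<rightarrow>\<^sub>E carrier R_loc"
      using bk cc S_one by (auto intro!: Self.loc_closed)
    have "?c = ?d"
      by (rule ex1_eq[OF ex[OF loc_closed[OF M.zero_closed S_one]]]) (rule conjI, rule m, rule 1 2)+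
    have ann: "\<exists>t\<in>S. t \<odot>\<^bsub>self_module R\<^esub> c i = \<zero>\<^bsub>self_module R\<^esub>" if i: "i \<in> {..<n}" for i
    proof -
      have "Self.frac (c i \<otimes> k i) \<one> = Self.frac \<zero> \<one>" using fun_cong[OF \<open>?c = ?d\<close>, of i] i by simp
      then obtain u where u: "u \<in> S" "u \<otimes> (\<one> \<otimes> \<zero>) = u \<otimes> (\<one> \<otimes> (c i \<otimes> k i))"
        using i bk cc S_one by (subst (asm) Self.frac_eq) auto
      then have "(u \<otimes> k i) \<otimes> c i = \<zero>"
        using i bk(3)[of i] cc[of i] by (simp add: R.m_ac)
      then show ?thesis using u i bk S_mult by auto
    qed
    have "\<exists>t\<in>S. \<forall>i\<in>{..<n}. t \<odot>\<^bsub>self_module R\<^esub> c i = \<zero>\<^bsub>self_module R\<^esub>"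
      by (rule Self.common_annihilator[OF _ _ ann]) (use cc in auto)
    then show ?thesis by (simp add: Ball_def)
  qed
  have "b \<in> {..<n} \<rightarrow> carrier M" using bk(2) by auto
  then have "local_basis n b" unfolding local_basis_def by (intro conjI ballI impI span indep)
  then show ?thesis by (intro exI[of _ b])
qed

lemma free_of_local_basis:
  assumes "local_basis n b"
  shows "free_of_rank R_loc n M_loc"
  unfolding free_of_rank_def
proof (intro bexI[of _ "\<lambda>i. frac (b i) \<one>"] ballI)
  have b: "i < n \<Longrightarrow> b i \<in> carrier M" for i using assms by (auto simp: local_basis_def)
  show "(\<lambda>i. frac (b i) \<one>) \<in> {..<n} \<rightarrow> carrier M_loc" using b S_one by (auto intro!: loc_closed)
  have comb: "(\<Oplus>\<^bsub>M_loc\<^esub>i\<in>{..<n}. c i \<odot>\<^bsub>M_loc\<^esub> frac (b i) \<one>) = frac (\<Oplus>\<^bsub>M\<^esub>i\<in>{..<n}. p i \<odot>\<^bsub>M\<^esub> b i) s"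
    if c: "\<And>i. i < n \<Longrightarrow> c i = Self.frac (p i) s" and p: "\<And>i. i < n \<Longrightarrow> p i \<in> carrier R" and s: "s \<in> S" for c p s
  proof -
    have "(\<Oplus>\<^bsub>M_loc\<^esub>i\<in>{..<n}. c i \<odot>\<^bsub>M_loc\<^esub> frac (b i) \<one>) = (\<Oplus>\<^bsub>M_loc\<^esub>i\<in>{..<n}. frac (p i \<odot>\<^bsub>M\<^esub> b i) s)"
      by (rule Loc.finsum_cong'[OF refl]) (use c p s b S_one in \<open>auto simp: loc_smult intro!: loc_closed\<close>)
    also have "\<dots> = frac (\<Oplus>\<^bsub>M\<^esub>i\<in>{..<n}. p i \<odot>\<^bsub>M\<^esub> b i) s"
      by (rule loc_finsum) (use p b s in auto)
    finally show ?thesis .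
  qed
  fix X assume "X \<in> carrier M_loc"
  then obtain x s where X: "X = frac x s" "x \<in> carrier M" "s \<in> S" by (rule locE)
  obtain t c where t: "t \<in> S" and c: "c \<in> {..<n} \<rightarrow> carrier R" and tx: "t \<odot>\<^bsub>M\<^esub> x = (\<Oplus>\<^bsub>M\<^esub>i\<in>{..<n}. c i \<odot>\<^bsub>M\<^esub> b i)"
    using assms X(2) unfolding local_basis_def by blast
  let ?c = "restrict (\<lambda>i. Self.frac (c i) (t \<otimes> s)) {..<n}"
  have 1: "X = (\<Oplus>\<^bsub>M_loc\<^esub>i\<in>{..<n}. ?c i \<odot>\<^bsub>M_loc\<^esub> frac (b i) \<one>)"
  proof -
    have "(\<Oplus>\<^bsub>M_loc\<^esub>i\<in>{..<n}. ?c i \<odot>\<^bsub>M_loc\<^esub> frac (b i) \<one>) = frac (t \<odot>\<^bsub>M\<^esub> x) (t \<otimes> s)"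
      unfolding tx by (rule comb) (use c t X S_mult in auto)
    also have "\<dots> = X" unfolding X by (rule frac_cancel) (use X t in auto)
    finally show ?thesis by simp
  qed
  show "\<exists>!c. c \<in> {..<n} \<rightarrow>\<^sub>E carrier R_loc \<and> X = (\<Oplus>\<^bsub>M_loc\<^esub>i\<in>{..<n}. c i \<odot>\<^bsub>M_loc\<^esub> frac (b i) \<one>)"
  proof (rule ex1I[of _ ?c])
    have "?c \<in> {..<n} \<rightarrow>\<^sub>E carrier R_loc" using c t X S_mult by (auto intro!: Self.loc_closed)
    then show "?c \<in> {..<n} \<rightarrow>\<^sub>E carrier R_loc \<and> X = (\<Oplus>\<^bsub>M_loc\<^esub>i\<in>{..<n}. ?c i \<odot>\<^bsub>M_loc\<^esub> frac (b i) \<one>)"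
      using 1 by blast
    fix d assume d: "d \<in> {..<n} \<rightarrow>\<^sub>E carrier R_loc \<and> X = (\<Oplus>\<^bsub>M_loc\<^esub>i\<in>{..<n}. d i \<odot>\<^bsub>M_loc\<^esub> frac (b i) \<one>)"
    \<comment> \<open>For uniqueness the coefficients of \<open>d\<close> are given a common
      denominator. Comparing the two expansions of \<open>X\<close> then yields a relation between
      the \<open>b i\<close>, whose coefficients are killed by some \<open>z\<close> in
      \<open>S\<close>.\<close>
    have "\<exists>s\<in>S. \<exists>q\<in>{..<n} \<rightarrow> carrier (self_module R). \<forall>i\<in>{..<n}. d i = Self.frac (q i) s"
      by (rule Self.common_denominator) (use d in auto)
    then obtain s' q where "s' \<in> S" "q \<in> {..<n} \<rightarrow> carrier (self_module R)" "\<forall>i\<in>{..<n}. d i = Self.frac (q i) s'"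
      by (elim bexE)
    then have q: "s' \<in> S" "\<And>i. i < n \<Longrightarrow> q i \<in> carrier R" "\<And>i. i < n \<Longrightarrow> d i = Self.frac (q i) s'"
      by (simp_all add: Pi_iff)
    let ?S = "t \<otimes> s"
    have S: "?S \<in> S" using t X S_mult by auto
    have cc: "i < n \<Longrightarrow> c i \<in> carrier R" for i using c by auto
    have fc: "(\<Oplus>\<^bsub>M\<^esub>i\<in>{..<n}. q i \<odot>\<^bsub>M\<^esub> b i) \<in> carrier M" "(\<Oplus>\<^bsub>M\<^esub>i\<in>{..<n}. c i \<odot>\<^bsub>M\<^esub> b i) \<in> carrier M"
      using q b cc by (auto intro!: M.finsum_closed)
    have "X = frac (\<Oplus>\<^bsub>M\<^esub>i\<in>{..<n}. q i \<odot>\<^bsub>M\<^esub> b i) s'"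
      using d comb[of d q s'] q by simp
    moreover have "X = frac (\<Oplus>\<^bsub>M\<^esub>i\<in>{..<n}. c i \<odot>\<^bsub>M\<^esub> b i) ?S"
      unfolding 1 by (rule comb) (use cc S in auto)
    ultimately obtain u where u: "u \<in> S" "u \<odot>\<^bsub>M\<^esub> (s' \<odot>\<^bsub>M\<^esub> (\<Oplus>\<^bsub>M\<^esub>i\<in>{..<n}. c i \<odot>\<^bsub>M\<^esub> b i)) = u \<odot>\<^bsub>M\<^esub> (?S \<odot>\<^bsub>M\<^esub> (\<Oplus>\<^bsub>M\<^esub>i\<in>{..<n}. q i \<odot>\<^bsub>M\<^esub> b i))"
      using frac_eq[OF fc(1) q(1) fc(2) S] by auto
    let ?v = "u \<otimes> s'" and ?w = "u \<otimes> ?S"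
    have vw: "?v \<in> carrier R" "?w \<in> carrier R" using u q S by auto
    have dist: "v \<odot>\<^bsub>M\<^esub> (\<Oplus>\<^bsub>M\<^esub>i\<in>{..<n}. p i \<odot>\<^bsub>M\<^esub> b i) = (\<Oplus>\<^bsub>M\<^esub>i\<in>{..<n}. (v \<otimes> p i) \<odot>\<^bsub>M\<^esub> b i)"
      if "v \<in> carrier R" "\<And>i. i < n \<Longrightarrow> p i \<in> carrier R" for v p
    proof -
      have "v \<odot>\<^bsub>M\<^esub> (\<Oplus>\<^bsub>M\<^esub>i\<in>{..<n}. p i \<odot>\<^bsub>M\<^esub> b i) = (\<Oplus>\<^bsub>M\<^esub>i\<in>{..<n}. v \<odot>\<^bsub>M\<^esub> (p i \<odot>\<^bsub>M\<^esub> b i))"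
        by (rule finsum_smult_ldistr) (use that b in auto)
      also have "\<dots> = (\<Oplus>\<^bsub>M\<^esub>i\<in>{..<n}. (v \<otimes> p i) \<odot>\<^bsub>M\<^esub> b i)"
        by (rule M.finsum_cong'[OF refl]) (use that b in \<open>auto simp: smult_assoc1\<close>)
      finally show ?thesis .
    qed
    have eq: "(\<Oplus>\<^bsub>M\<^esub>i\<in>{..<n}. (?v \<otimes> c i) \<odot>\<^bsub>M\<^esub> b i) = (\<Oplus>\<^bsub>M\<^esub>i\<in>{..<n}. (?w \<otimes> q i) \<odot>\<^bsub>M\<^esub> b i)"
    proof -
      have "(\<Oplus>\<^bsub>M\<^esub>i\<in>{..<n}. (?v \<otimes> c i) \<odot>\<^bsub>M\<^esub> b i) = ?v \<odot>\<^bsub>M\<^esub> (\<Oplus>\<^bsub>M\<^esub>i\<in>{..<n}. c i \<odot>\<^bsub>M\<^esub> b i)"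
        by (rule dist[symmetric]) (use vw cc in auto)
      also have "\<dots> = ?w \<odot>\<^bsub>M\<^esub> (\<Oplus>\<^bsub>M\<^esub>i\<in>{..<n}. q i \<odot>\<^bsub>M\<^esub> b i)"
        using u q S fc by (simp add: smult_assoc1)
      also have "\<dots> = (\<Oplus>\<^bsub>M\<^esub>i\<in>{..<n}. (?w \<otimes> q i) \<odot>\<^bsub>M\<^esub> b i)"
        by (rule dist) (use vw q in auto)
      finally show ?thesis .
    qed
    have "(\<Oplus>\<^bsub>M\<^esub>i\<in>{..<n}. (?v \<otimes> c i \<ominus> ?w \<otimes> q i) \<odot>\<^bsub>M\<^esub> b i) =
      (\<Oplus>\<^bsub>M\<^esub>i\<in>{..<n}. (?v \<otimes> c i) \<odot>\<^bsub>M\<^esub> b i \<oplus>\<^bsub>M\<^esub> \<ominus>\<^bsub>M\<^esub> ((?w \<otimes> q i) \<odot>\<^bsub>M\<^esub> b i))"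
      by (rule M.finsum_cong'[OF refl]) (use vw q b cc in \<open>auto simp: a_minus_def smult_l_distr smult_l_minus\<close>)
    also have "\<dots> = (\<Oplus>\<^bsub>M\<^esub>i\<in>{..<n}. (?v \<otimes> c i) \<odot>\<^bsub>M\<^esub> b i) \<oplus>\<^bsub>M\<^esub> (\<Oplus>\<^bsub>M\<^esub>i\<in>{..<n}. \<ominus>\<^bsub>M\<^esub> ((?w \<otimes> q i) \<odot>\<^bsub>M\<^esub> b i))"
      by (rule M.finsum_addf) (use vw q b cc in auto)
    also have "\<dots> = \<zero>\<^bsub>M\<^esub>"
      unfolding eq by (subst M.finsum_minus) (use vw q b in \<open>auto intro!: M.r_neg M.finsum_closed\<close>)
    finally have "(\<Oplus>\<^bsub>M\<^esub>i\<in>{..<n}. (?v \<otimes> c i \<ominus> ?w \<otimes> q i) \<odot>\<^bsub>M\<^esub> b i) = \<zero>\<^bsub>M\<^esub>" .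
    moreover have "(\<lambda>i. ?v \<otimes> c i \<ominus> ?w \<otimes> q i) \<in> {..<n} \<rightarrow> carrier R" using vw q cc by auto
    ultimately obtain z where z: "z \<in> S" "\<And>i. i < n \<Longrightarrow> z \<otimes> (?v \<otimes> c i \<ominus> ?w \<otimes> q i) = \<zero>"
      using assms unfolding local_basis_def by meson
    show "d = ?c"
    proof
      fix i show "d i = ?c i"
      proof (cases "i < n")
        case True
        have cq: "c i \<in> carrier R" "q i \<in> carrier R" "z \<in> carrier R" "u \<in> carrier R" "s' \<in> carrier R" "?S \<in> carrier R"
          using cc[OF True] q(2)[OF True] z u q S by auto
        have "z \<otimes> (?v \<otimes> c i) \<ominus> z \<otimes> (?w \<otimes> q i) = \<zero>"
          using z(2)[OF True] cq vw by (simp add: a_minus_def R.r_distr R.r_minus)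
        then have "z \<otimes> (?v \<otimes> c i) = z \<otimes> (?w \<otimes> q i)"
          by (rule R.eqI_minus[rotated 2]) (use cq vw in auto)
        then have "(z \<otimes> u) \<otimes> (s' \<otimes> c i) = (z \<otimes> u) \<otimes> (?S \<otimes> q i)"
          using cq by (simp only: R.m_assoc R.m_closed)
        then have "Self.frac (q i) s' = Self.frac (c i) ?S"
          using z u q S True cc S_mult by (subst Self.frac_eq) auto
        then show ?thesis using True q by simp
      next
        case False
        then show ?thesis using d by (auto simp: PiE_def extensional_def)
      qed
    qed
  qed
qed

end

section \<open>From bases of localizations to coordinate forms on the module itself\<close>

section \<open>Lifting coordinates from localizations\<close>

lemma (in cring) idealI':
  assumes sub: "I \<subseteq> carrier R" and z: "\<zero> \<in> I" and a: "\<And>x y. x \<in> I \<Longrightarrow> y \<in> I \<Longrightarrow> x \<oplus> y \<in> I"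
    and m: "\<And>r x. r \<in> carrier R \<Longrightarrow> x \<in> I \<Longrightarrow> r \<otimes> x \<in> I"
  shows "ideal I R"
proof (rule idealI)
  show "ring R" by (rule ring_axioms)
  show "subgroup I (add_monoid R)"
  proof (rule add.subgroupI)
    fix x assume x: "x \<in> I"
    then have "\<ominus> x = \<ominus> \<one> \<otimes> x" using sub by (auto simp: l_minus)
    then show "\<ominus> x \<in> I" using m[OF _ x, of "\<ominus> \<one>"] by simp
  qed (use sub z a in auto)
  fix x r assume "x \<in> I" "r \<in> carrier R"
  then show "r \<otimes> x \<in> I" "x \<otimes> r \<in> I" using m sub by (auto simp: m_comm[of x r] subset_iff)
qed

text \<open>One generator at a time is adjoined to \<open>J\<close>. If
  \<open>\<one> = j \<oplus> a \<otimes> r\<close> with \<open>j\<close> in \<open>J\<close>, then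
  \<open>\<one> \<ominus> (a \<otimes> r) [^] k\<close> lies in \<open>J\<close> for every
  \<open>k\<close>, and a power of \<open>r\<close> in \<open>J\<close> finishes the
  argument.\<close>

lemma (in cring) unit_ideal_induct:
  assumes "finite F" "F \<subseteq> carrier R" "ideal J R" "\<And>r. r \<in> F \<Longrightarrow> \<exists>k::nat. r [^] k \<in> J"
    and "\<And>I. ideal I R \<Longrightarrow> J \<subseteq> I \<Longrightarrow> F \<subseteq> I \<Longrightarrow> \<one> \<in> I"
  shows "\<one> \<in> J"
  using assms
proof (induction F arbitrary: J rule: finite_induct)
  case empty
  then show ?case by auto
next
  case (insert r F)
  interpret J: ideal J R by fact
  have r: "r \<in> carrier R" using insert.prems by auto
  have Jc: "x \<in> J \<Longrightarrow> x \<in> carrier R" for x using J.a_Hcarr .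
  let ?J = "{x \<in> carrier R. \<exists>j\<in>J. \<exists>a\<in>carrier R. x = j \<oplus> a \<otimes> r}"
  have mem: "j \<oplus> a \<otimes> r \<in> ?J" if "j \<in> J" "a \<in> carrier R" for j a
    using that Jc[OF that(1)] r by blast
  have id: "ideal ?J R"
  proof (rule idealI')
    show "\<zero> \<in> ?J" using mem[OF J.zero_closed zero_closed] r by simp
    fix x y assume "x \<in> ?J" "y \<in> ?J"
    then obtain j a k b where e: "j \<in> J" "a \<in> carrier R" "x = j \<oplus> a \<otimes> r" "k \<in> J" "b \<in> carrier R" "y = k \<oplus> b \<otimes> r" by blast
    have "x \<oplus> y = (j \<oplus> k) \<oplus> (a \<oplus> b) \<otimes> r" using e r Jc by (simp add: l_distr a_ac)
    then show "x \<oplus> y \<in> ?J" using mem[OF J.a_closed[OF e(1,4)] a_closed[OF e(2,5)]] by (simp only:)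
  next
    fix s x assume s: "s \<in> carrier R" and "x \<in> ?J"
    then obtain j a where e: "j \<in> J" "a \<in> carrier R" "x = j \<oplus> a \<otimes> r" by blast
    have "s \<otimes> x = s \<otimes> j \<oplus> (s \<otimes> a) \<otimes> r" using e r s Jc by (simp add: r_distr m_assoc)
    then show "s \<otimes> x \<in> ?J" using mem[OF J.I_l_closed[OF e(1) s] m_closed[OF s e(2)]] by (simp only:)
  qed auto
  have JJ: "J \<subseteq> ?J"
  proof
    fix j assume "j \<in> J"
    then show "j \<in> ?J" using mem[of j \<zero>] Jc[of j] r by simp
  qed
  have rJ: "r \<in> ?J" using mem[OF J.zero_closed one_closed] r by simp
  have "\<one> \<in> ?J"
  proof (rule insert.IH[OF _ id])
    show "F \<subseteq> carrier R" using insert.prems by auto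
    show "\<exists>k. s [^] (k::nat) \<in> ?J" if "s \<in> F" for s using insert.prems(3)[of s] that JJ by blast
    fix I assume I: "ideal I R" "?J \<subseteq> I" "F \<subseteq> I"
    have "insert r F \<subseteq> I" "J \<subseteq> I" using I rJ JJ by blast+
    then show "\<one> \<in> I" using insert.prems(4)[OF I(1)] by blast
  qed
  then obtain j a where ja: "j \<in> J" "a \<in> carrier R" "\<one> = j \<oplus> a \<otimes> r" by blast
  have u: "\<one> \<ominus> (a \<otimes> r) [^] k \<in> J" for k :: nat
  proof (induction k)
    case 0
    then show ?case using J.zero_closed by simp
  next
    case (Suc k)
    let ?u = "a \<otimes> r" and ?v = "(a \<otimes> r) [^] k"
    have uv: "?u \<in> carrier R" "?v \<in> carrier R" using ja r by auto
    have "\<one> \<ominus> ?v \<otimes> ?u = (\<one> \<ominus> ?v) \<oplus> ?v \<otimes> (\<one> \<ominus> ?u)"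
      using uv by algebra
    moreover have "\<one> \<ominus> ?u = j" 
    proof -
      have "j \<oplus> ?u \<ominus> ?u = j" using ja uv Jc by (simp add: a_minus_def a_assoc r_neg)
      then show ?thesis using ja(3) by simp
    qed
    ultimately show ?case using Suc J.a_closed[OF Suc J.I_l_closed[OF ja(1) uv(2)]] by simp
  qed
  obtain k :: nat where k: "r [^] k \<in> J" using insert.prems(3)[of r] by auto
  have "(a \<otimes> r) [^] k = a [^] k \<otimes> r [^] k" using ja r by (simp add: nat_pow_distrib)
  then have "(a \<otimes> r) [^] k \<in> J" using J.I_l_closed[OF k, of "a [^] k"] ja by simp
  then have "(\<one> \<ominus> (a \<otimes> r) [^] k) \<oplus> (a \<otimes> r) [^] k \<in> J" using u J.a_closed by blast
  then show "\<one> \<in> J" using ja r by (simp add: a_minus_def a_assoc l_neg)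
qed

lemma (in cring) unit_ideal_powers:
  assumes "finite F" "F \<subseteq> carrier R" "Idl F = carrier R" "ideal J R" "\<And>r. r \<in> F \<Longrightarrow> \<exists>t\<in>powers R r. t \<in> J"
  shows "\<one> \<in> J"
proof (rule unit_ideal_induct[OF assms(1,2,4)])
  show "\<exists>k::nat. r [^] k \<in> J" if "r \<in> F" for r using assms(5)[OF that] by (auto simp: powers_def)
  show "\<one> \<in> I" if "ideal I R" "F \<subseteq> I" for I using genideal_minimal[OF that] assms(3) by auto
qed

text \<open>The annihilator of \<open>x\<close> is an ideal that contains a power of each generator
  of the unit ideal.\<close>

lemma (in module) local_zero:
  assumes F: "finite F" "F \<subseteq> carrier R" "Idl\<^bsub>R\<^esub> F = carrier R"
    and x: "x \<in> carrier M" and z: "\<And>r. r \<in> F \<Longrightarrow> \<exists>t\<in>powers R r. t \<odot>\<^bsub>M\<^esub> x = \<zero>\<^bsub>M\<^esub>"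
  shows "x = \<zero>\<^bsub>M\<^esub>"
proof -
  let ?J = "{c \<in> carrier R. c \<odot>\<^bsub>M\<^esub> x = \<zero>\<^bsub>M\<^esub>}"
  have "\<one> \<in> ?J"
  proof (rule R.unit_ideal_powers[OF F])
    show "ideal ?J R" by (rule R.idealI') (use x in \<open>auto simp: smult_l_distr smult_assoc1\<close>)
    show "\<exists>t\<in>powers R r. t \<in> ?J" if "r \<in> F" for r
      using z[OF that] F(2) that by (auto simp: powers_def)
  qed
  then show ?thesis using x by simp
qed

text \<open>The combinations of the elements \<open>t r\<close> form an ideal, which contains a
  power of each generator of the unit ideal.\<close>

lemma (in cring) power_partition:
  assumes F: "finite F" "F \<subseteq> carrier R" "Idl F = carrier R"
    and t: "\<And>r. r \<in> F \<Longrightarrow> t r \<in> powers R r"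
  shows "\<exists>y\<in>F \<rightarrow> carrier R. (\<Oplus>r\<in>F. y r \<otimes> t r) = \<one>"
proof -
  have tc: "r \<in> F \<Longrightarrow> t r \<in> carrier R" for r using t[of r] F(2) by (auto simp: powers_def)
  let ?J = "{c. \<exists>y\<in>F \<rightarrow> carrier R. c = (\<Oplus>r\<in>F. y r \<otimes> t r)}"
  have "\<one> \<in> ?J"
  proof (rule unit_ideal_powers[OF F])
    show "ideal ?J R"
    proof (rule idealI')
      show "?J \<subseteq> carrier R" using tc by (auto intro!: finsum_closed)
      have "(\<Oplus>r\<in>F. \<zero> \<otimes> t r) = (\<Oplus>r\<in>F. \<zero>)" by (rule finsum_cong'[OF refl]) (use tc in auto)
      then have "\<zero> = (\<Oplus>r\<in>F. \<zero> \<otimes> t r)" by simp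
      then show "\<zero> \<in> ?J" by (intro CollectI bexI[of _ "\<lambda>_. \<zero>"]) auto
      fix c d assume "c \<in> ?J" "d \<in> ?J"
      then obtain y z where yz: "y \<in> F \<rightarrow> carrier R" "c = (\<Oplus>r\<in>F. y r \<otimes> t r)" "z \<in> F \<rightarrow> carrier R" "d = (\<Oplus>r\<in>F. z r \<otimes> t r)" by blast
      have m: "r \<in> F \<Longrightarrow> y r \<in> carrier R" "r \<in> F \<Longrightarrow> z r \<in> carrier R" for r using yz by auto
      have "(\<Oplus>r\<in>F. (y r \<oplus> z r) \<otimes> t r) = (\<Oplus>r\<in>F. y r \<otimes> t r \<oplus> z r \<otimes> t r)"
        by (rule finsum_cong'[OF refl]) (use m tc in \<open>auto simp: l_distr\<close>)
      also have "\<dots> = c \<oplus> d" unfolding yz by (rule finsum_addf) (use m tc in auto)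
      finally show "c \<oplus> d \<in> ?J" using m by (intro CollectI bexI[of _ "\<lambda>r. y r \<oplus> z r"]) auto
    next
      fix s c assume s: "s \<in> carrier R" and "c \<in> ?J"
      then obtain y where y: "y \<in> F \<rightarrow> carrier R" "c = (\<Oplus>r\<in>F. y r \<otimes> t r)" by blast
      have m: "r \<in> F \<Longrightarrow> y r \<in> carrier R" for r using y by auto
      have "s \<otimes> c = (\<Oplus>r\<in>F. s \<otimes> (y r \<otimes> t r))" unfolding y by (rule finsum_rdistr) (use m tc s F in auto)
      also have "\<dots> = (\<Oplus>r\<in>F. (s \<otimes> y r) \<otimes> t r)" by (rule finsum_cong'[OF refl]) (use m tc s in \<open>auto simp: m_assoc\<close>)
      finally show "s \<otimes> c \<in> ?J" using m s by (intro CollectI bexI[of _ "\<lambda>r. s \<otimes> y r"]) auto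
    qed
    fix r assume r: "r \<in> F"
    have "(\<Oplus>q\<in>F. (if q = r then \<one> else \<zero>) \<otimes> t q) = (\<Oplus>q\<in>F. if q = r then t q else \<zero>)"
      by (rule finsum_cong'[OF refl]) (use tc in auto)
    also have "\<dots> = t r" using add.finprod_singleton_swap[of r F t] r F tc by simp
    finally have "t r \<in> ?J" by (intro CollectI bexI[of _ "\<lambda>q. if q = r then \<one> else \<zero>"]) auto
    then show "\<exists>t\<in>powers R r. t \<in> ?J" using t[OF r] by blast
  qed
  then obtain y where "y \<in> F \<rightarrow> carrier R" "\<one> = (\<Oplus>r\<in>F. y r \<otimes> t r)" by blast
  then show ?thesis by (intro bexI[of _ y]) simp_all
qed

lemma (in cring) free_module_ext:
  assumes N: "abelian_group N" and h: "h \<in> semilinear R \<sigma> (free_module R B) N" and k: "k \<in> semilinear R \<sigma> (free_module R B) N"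
    and eq: "\<And>x. x \<in> B \<Longrightarrow> h (single R x) = k (single R x)" and c: "c \<in> carrier (free_module R B)"
  shows "h c = k c"
  using c
proof (induction rule: free_module_induct)
  case zero
  have "abelian_group (free_module R B)" by (rule module.axioms(2)[OF free_module_module])
  then show ?case using semilinear_zero[OF _ N h] semilinear_zero[OF _ N k] by simp
next
  case (add c d)
  then show ?case using semilinear_add[OF h, of c d] semilinear_add[OF k, of c d] by simp
next
  case (single r x)
  then show ?case using semilinear_smult[OF h, of r "single R x"] semilinear_smult[OF k, of r "single R x"] eq by simp
qed

lemma semilinear_factor:
  assumes P: "module R P" and M: "module R M" and N: "module R N"
    and pi: "pi \<in> semilinear R id P M" and surj: "\<And>x. x \<in> carrier M \<Longrightarrow> \<exists>p\<in>carrier P. pi p = x"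
    and h: "h \<in> semilinear R id P N" and ker: "\<And>p. p \<in> carrier P \<Longrightarrow> pi p = \<zero>\<^bsub>M\<^esub> \<Longrightarrow> h p = \<zero>\<^bsub>N\<^esub>"
  shows "\<exists>k\<in>semilinear R id M N. \<forall>p\<in>carrier P. k (pi p) = h p"
proof -
  interpret P: module R P by fact
  interpret M: module R M by fact
  interpret N: module R N by fact
  let ?s = "\<lambda>x. SOME p. p \<in> carrier P \<and> pi p = x"
  have s: "?s x \<in> carrier P \<and> pi (?s x) = x" if "x \<in> carrier M" for x
    using someI_ex[of "\<lambda>p. p \<in> carrier P \<and> pi p = x"] surj[OF that] by blast
  have k: "h (?s (pi p)) = h p" if p: "p \<in> carrier P" for p
  proof -
    have q: "?s (pi p) \<in> carrier P" "pi (?s (pi p)) = pi p" using s[OF semilinear_closed[OF pi p]] by auto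
    have "pi (?s (pi p) \<ominus>\<^bsub>P\<^esub> p) = \<zero>\<^bsub>M\<^esub>"
      using semilinear_diff[OF P.abelian_group_axioms M.abelian_group_axioms pi q(1) p] q semilinear_closed[OF pi p] by simp
    then have "h (?s (pi p) \<ominus>\<^bsub>P\<^esub> p) = \<zero>\<^bsub>N\<^esub>" using ker q p by simp
    then have "h (?s (pi p)) \<ominus>\<^bsub>N\<^esub> h p = \<zero>\<^bsub>N\<^esub>"
      using semilinear_diff[OF P.abelian_group_axioms N.abelian_group_axioms h q(1) p] by simp
    then show ?thesis using N.M.eqI_minus semilinear_closed[OF h] q p by blast
  qed
  show ?thesis
  proof (intro bexI[of _ "\<lambda>x. h (?s x)"] ballI k)
    show "(\<lambda>x. h (?s x)) \<in> semilinear R id M N"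
    proof (rule semilinearI)
      fix x assume x: "x \<in> carrier M"
      show "h (?s x) \<in> carrier N" using s[OF x] semilinear_closed[OF h] by blast
      show "h (?s (x \<oplus>\<^bsub>M\<^esub> y)) = h (?s x) \<oplus>\<^bsub>N\<^esub> h (?s y)" if y: "y \<in> carrier M" for y
        using k[of "?s x \<oplus>\<^bsub>P\<^esub> ?s y"] s[OF x] s[OF y] semilinear_add[OF pi] semilinear_add[OF h] by simp
      show "h (?s (r \<odot>\<^bsub>M\<^esub> x)) = id r \<odot>\<^bsub>N\<^esub> h (?s x)" if r: "r \<in> carrier R" for r
        using k[of "r \<odot>\<^bsub>P\<^esub> ?s x"] s[OF x] r semilinear_smult[OF pi] semilinear_smult[OF h] by simp
    qed
  qed
qed

lemma (in mult_localization) common_multiplier: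
  assumes "finite I" "\<And>i. i \<in> I \<Longrightarrow> \<exists>t\<in>S. Q i t" "\<And>i t u. i \<in> I \<Longrightarrow> t \<in> S \<Longrightarrow> u \<in> S \<Longrightarrow> Q i t \<Longrightarrow> Q i (u \<otimes> t)"
  shows "\<exists>t\<in>S. \<forall>i\<in>I. Q i t"
  using assms
proof (induction I)
  case empty
  then show ?case using S_one by blast
next
  case (insert j I)
  then obtain t where t: "t \<in> S" "\<forall>i\<in>I. Q i t" by (metis insertCI)
  obtain u where u: "u \<in> S" "Q j u" using insert.prems(1) by blast
  have ut: "u \<otimes> t \<in> S" "u \<otimes> t = t \<otimes> u" using t u S_mult by (auto simp: R.m_comm)
  have "Q i (u \<otimes> t)" if "i \<in> insert j I" for i
  proof (cases "i = j")
    case True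
    then show ?thesis using insert.prems(2)[of j u t] t u ut by simp
  next
    case False
    then show ?thesis using insert.prems(2)[of i t u] t u that by simp
  qed
  then show ?case using ut(1) by (intro bexI[of _ "u \<otimes> t"] ballI)
qed

lemma (in cring) powers_mult: "r \<in> carrier R \<Longrightarrow> s \<in> powers R r \<Longrightarrow> t \<in> powers R r \<Longrightarrow> s \<otimes> t \<in> powers R r"
  by (auto simp: powers_def nat_pow_mult)

lemma (in module) powers_localization: "r \<in> carrier R \<Longrightarrow> module_localization R M (powers R r)"
  unfolding module_localization_def
  by (intro mult_localization.intro module_axioms mult_localization_axioms.intro)
    (auto simp: R.powers_mult, auto simp: powers_def intro: range_eqI[of _ _ 0])

locale locally_free = module R M for R (structure) and M (structure) +
  fixes n and F and b
  assumes F: "finite F" "F \<subseteq> carrier R" "Idl F = carrier R"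
    and b: "r \<in> F \<Longrightarrow> module_localization.local_basis R M (powers R r) n (b r)"
begin

lemma loc: "r \<in> F \<Longrightarrow> module_localization R M (powers R r)"
  using powers_localization F(2) by blast

lemma b_closed: "r \<in> F \<Longrightarrow> j < n \<Longrightarrow> b r j \<in> carrier M"
  using b[of r] module_localization.local_basis_def[OF loc[of r]] by auto

lemma b_span: "r \<in> F \<Longrightarrow> x \<in> carrier M \<Longrightarrow> \<exists>t\<in>powers R r. \<exists>c\<in>{..<n} \<rightarrow> carrier R. t \<odot>\<^bsub>M\<^esub> x = (\<Oplus>\<^bsub>M\<^esub>i\<in>{..<n}. c i \<odot>\<^bsub>M\<^esub> b r i)"
  using b[of r] module_localization.local_basis_def[OF loc[of r], of n "b r"] by simp

lemma b_indep: "r \<in> F \<Longrightarrow> c \<in> {..<n} \<rightarrow> carrier R \<Longrightarrow> (\<Oplus>\<^bsub>M\<^esub>i\<in>{..<n}. c i \<odot>\<^bsub>M\<^esub> b r i) = \<zero>\<^bsub>M\<^esub> \<Longrightarrow>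
    \<exists>t\<in>powers R r. \<forall>i<n. t \<otimes> c i = \<zero>"
  using b[of r] module_localization.local_basis_def[OF loc[of r], of n "b r"] by simp

lemma powers_closed: "r \<in> F \<Longrightarrow> t \<in> powers R r \<Longrightarrow> t \<in> carrier R"
  using F(2) by (auto simp: powers_def)

lemma comb_smult:
  assumes "r \<in> F" "v \<in> carrier R" "\<And>i. i < n \<Longrightarrow> c i \<in> carrier R"
  shows "v \<odot>\<^bsub>M\<^esub> (\<Oplus>\<^bsub>M\<^esub>i\<in>{..<n}. c i \<odot>\<^bsub>M\<^esub> b r i) = (\<Oplus>\<^bsub>M\<^esub>i\<in>{..<n}. (v \<otimes> c i) \<odot>\<^bsub>M\<^esub> b r i)"
proof -
  have "v \<odot>\<^bsub>M\<^esub> (\<Oplus>\<^bsub>M\<^esub>i\<in>{..<n}. c i \<odot>\<^bsub>M\<^esub> b r i) = (\<Oplus>\<^bsub>M\<^esub>i\<in>{..<n}. v \<odot>\<^bsub>M\<^esub> (c i \<odot>\<^bsub>M\<^esub> b r i))"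
    by (rule finsum_smult_ldistr) (use assms b_closed in auto)
  also have "\<dots> = (\<Oplus>\<^bsub>M\<^esub>i\<in>{..<n}. (v \<otimes> c i) \<odot>\<^bsub>M\<^esub> b r i)"
    by (rule M.finsum_cong'[OF refl]) (use assms b_closed in \<open>auto simp: smult_assoc1\<close>)
  finally show ?thesis .
qed

abbreviation gens where "gens \<equiv> F \<times> {..<n}"
abbreviation P where "P \<equiv> free_module R gens"
text \<open>All local bases together, finitely many elements, define a map from one free module. It
  is onto because they generate locally.\<close>

definition pi where "pi = free_lift R id M (\<lambda>p. b (fst p) (snd p))"

sublocale P: module R P by (rule R.free_module_module)

lemma pi: "pi \<in> semilinear R id P M" and pi_single: "r \<in> F \<Longrightarrow> j < n \<Longrightarrow> pi (single R (r, j)) = b r j"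
  unfolding pi_def using free_lift[OF R.is_cring module_axioms id_ring_hom, of gens "\<lambda>p. b (fst p) (snd p)"] b_closed
  by auto

lemma pi_surj:
  assumes x: "x \<in> carrier M"
  shows "\<exists>p\<in>carrier P. pi p = x"
proof -
  let ?J = "{c \<in> carrier R. \<exists>p\<in>carrier P. pi p = c \<odot>\<^bsub>M\<^esub> x}"
  have "\<one> \<in> ?J"
  proof (rule R.unit_ideal_powers[OF F])
    show "ideal ?J R"
    proof (rule R.idealI')
      have "pi \<zero>\<^bsub>P\<^esub> = \<zero> \<odot>\<^bsub>M\<^esub> x"
        using semilinear_zero[OF P.abelian_group_axioms abelian_group_axioms pi] x by simp
      then show "\<zero> \<in> ?J" using P.M.zero_closed by blast
      fix c d assume "c \<in> ?J" "d \<in> ?J"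
      then obtain p q where pq: "c \<in> carrier R" "p \<in> carrier P" "pi p = c \<odot>\<^bsub>M\<^esub> x" "d \<in> carrier R" "q \<in> carrier P" "pi q = d \<odot>\<^bsub>M\<^esub> x" by blast
      have "pi (p \<oplus>\<^bsub>P\<^esub> q) = (c \<oplus> d) \<odot>\<^bsub>M\<^esub> x" using semilinear_add[OF pi pq(2,5)] pq x by (simp add: smult_l_distr)
      then show "c \<oplus> d \<in> ?J" using pq P.M.a_closed[OF pq(2,5)] by blast
    next
      fix s c assume s: "s \<in> carrier R" and "c \<in> ?J"
      then obtain p where p: "c \<in> carrier R" "p \<in> carrier P" "pi p = c \<odot>\<^bsub>M\<^esub> x" by blast
      have "pi (s \<odot>\<^bsub>P\<^esub> p) = (s \<otimes> c) \<odot>\<^bsub>M\<^esub> x" using semilinear_smult[OF pi s p(2)] p s x by (simp add: smult_assoc1)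
      then show "s \<otimes> c \<in> ?J" using s p(1) P.smult_closed[OF s p(2)] by blast
    qed auto
    fix r assume r: "r \<in> F"
    obtain t c where tc: "t \<in> powers R r" "c \<in> {..<n} \<rightarrow> carrier R" "t \<odot>\<^bsub>M\<^esub> x = (\<Oplus>\<^bsub>M\<^esub>i\<in>{..<n}. c i \<odot>\<^bsub>M\<^esub> b r i)"
      using b_span[OF r x] by (elim bexE)
    have cc: "i < n \<Longrightarrow> c i \<in> carrier R" for i using tc(2) by auto
    have sc: "i < n \<Longrightarrow> single R (r, i) \<in> carrier P" for i using r by auto
    let ?p = "\<Oplus>\<^bsub>P\<^esub>i\<in>{..<n}. c i \<odot>\<^bsub>P\<^esub> single R (r, i)"
    have pc: "?p \<in> carrier P" by (rule P.M.finsum_closed) (use cc sc P.smult_closed in blast)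
    have "pi ?p = (\<Oplus>\<^bsub>M\<^esub>i\<in>{..<n}. pi (c i \<odot>\<^bsub>P\<^esub> single R (r, i)))"
      by (rule semilinear_finsum[OF P.abelian_group_axioms abelian_group_axioms pi]) (use cc sc P.smult_closed in blast)
    also have "\<dots> = (\<Oplus>\<^bsub>M\<^esub>i\<in>{..<n}. c i \<odot>\<^bsub>M\<^esub> b r i)"
    proof (rule M.finsum_cong'[OF refl])
      fix i assume "i \<in> {..<n}"
      then have i: "i < n" by simp
      show "pi (c i \<odot>\<^bsub>P\<^esub> single R (r, i)) = c i \<odot>\<^bsub>M\<^esub> b r i"
        using semilinear_smult[OF pi cc[OF i] sc[OF i]] pi_single[OF r i] by simp
    qed (use cc b_closed r in auto)
    finally have "pi ?p = t \<odot>\<^bsub>M\<^esub> x" using tc(3) by simp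
    then show "\<exists>t\<in>powers R r. t \<in> ?J" using tc(1) powers_closed[OF r tc(1)] pc by blast
  qed
  then show ?thesis using x by auto
qed

text \<open>As there are finitely many generators, one power of \<open>r\<close> clears all
  denominators. The coordinates live on the free module \<open>P\<close>, where values on generators
  can be prescribed; relations in \<open>M\<close> are so far respected only up to powers of
  \<open>r\<close>.\<close>

lemma local_coordinates:
  assumes r: "r \<in> F"
  shows "\<exists>\<kappa>\<in>powers R r. \<exists>\<tau>. (\<forall>j<n. \<tau> j \<in> semilinear R id P (self_module R)) \<and>
    (\<forall>p\<in>carrier P. \<kappa> \<odot>\<^bsub>M\<^esub> pi p = (\<Oplus>\<^bsub>M\<^esub>j\<in>{..<n}. \<tau> j p \<odot>\<^bsub>M\<^esub> b r j))"
proof -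
  interpret S: module_localization R M "powers R r" by (rule loc[OF r])
  let ?Q = "\<lambda>p t. \<exists>c\<in>{..<n} \<rightarrow> carrier R. t \<odot>\<^bsub>M\<^esub> b (fst p) (snd p) = (\<Oplus>\<^bsub>M\<^esub>i\<in>{..<n}. c i \<odot>\<^bsub>M\<^esub> b r i)"
  have "\<exists>t\<in>powers R r. \<forall>p\<in>gens. ?Q p t"
  proof (rule S.common_multiplier)
    show "finite gens" using F by simp
    show "\<exists>t\<in>powers R r. ?Q p t" if "p \<in> gens" for p
      by (rule b_span[OF r b_closed]) (use that in auto)
    fix p t u assume p: "p \<in> gens" and t: "t \<in> powers R r" and u: "u \<in> powers R r" and "?Q p t"
    then obtain c where c: "c \<in> {..<n} \<rightarrow> carrier R" "t \<odot>\<^bsub>M\<^esub> b (fst p) (snd p) = (\<Oplus>\<^bsub>M\<^esub>i\<in>{..<n}. c i \<odot>\<^bsub>M\<^esub> b r i)" by (elim bexE)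
    have cc: "i < n \<Longrightarrow> c i \<in> carrier R" for i using c by auto
    have bc: "b (fst p) (snd p) \<in> carrier M" using p b_closed by auto
    note tu = powers_closed[OF r t] powers_closed[OF r u]
    have "(u \<otimes> t) \<odot>\<^bsub>M\<^esub> b (fst p) (snd p) = (\<Oplus>\<^bsub>M\<^esub>i\<in>{..<n}. (u \<otimes> c i) \<odot>\<^bsub>M\<^esub> b r i)"
      using comb_smult[OF r tu(2) cc] c(2) tu bc by (simp add: smult_assoc1)
    then show "?Q p (u \<otimes> t)" using cc tu by (intro bexI[of _ "\<lambda>i. u \<otimes> c i"]) auto
  qed
  then obtain \<kappa> where \<kappa>: "\<kappa> \<in> powers R r" "\<forall>p\<in>gens. ?Q p \<kappa>" by (elim bexE)
  from bchoice[OF \<kappa>(2)[unfolded Bex_def]] obtain s where "\<forall>p\<in>gens. s p \<in> {..<n} \<rightarrow> carrier R \<and>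
    \<kappa> \<odot>\<^bsub>M\<^esub> b (fst p) (snd p) = (\<Oplus>\<^bsub>M\<^esub>i\<in>{..<n}. s p i \<odot>\<^bsub>M\<^esub> b r i)" by (elim exE)
  then have s: "\<And>p. p \<in> gens \<Longrightarrow> s p \<in> {..<n} \<rightarrow> carrier R"
    "\<And>p. p \<in> gens \<Longrightarrow> \<kappa> \<odot>\<^bsub>M\<^esub> b (fst p) (snd p) = (\<Oplus>\<^bsub>M\<^esub>i\<in>{..<n}. s p i \<odot>\<^bsub>M\<^esub> b r i)"
    by (simp_all (no_asm_simp))
  have sc: "p \<in> gens \<Longrightarrow> j < n \<Longrightarrow> s p j \<in> carrier R" for p j using s(1) by auto
  define \<tau> where "\<tau> j = free_lift R id (self_module R) (\<lambda>p. s p j)" for j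
  have \<tau>: "\<tau> j \<in> semilinear R id P (self_module R)" "\<And>p. p \<in> gens \<Longrightarrow> \<tau> j (single R p) = s p j" if "j < n" for j
    unfolding \<tau>_def using free_lift[OF R.is_cring self_module_module[OF R.is_cring] id_ring_hom, of gens "\<lambda>p. s p j"] sc that by auto
  have l1: "(\<lambda>p. \<kappa> \<odot>\<^bsub>M\<^esub> pi p) \<in> semilinear R id P M"
    by (rule semilinear_scale[OF module_axioms _ pi]) (use powers_closed[OF r \<kappa>(1)] in auto)
  have l2: "(\<lambda>p. \<Oplus>\<^bsub>M\<^esub>j\<in>{..<n}. \<tau> j p \<odot>\<^bsub>M\<^esub> b r j) \<in> semilinear R id P M"
    by (rule semilinear_sum[OF module_axioms]) (use \<tau> b_closed r in \<open>auto intro!: semilinear_smult_left[OF module_axioms]\<close>)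
  have "\<kappa> \<odot>\<^bsub>M\<^esub> pi p = (\<Oplus>\<^bsub>M\<^esub>j\<in>{..<n}. \<tau> j p \<odot>\<^bsub>M\<^esub> b r j)" if p: "p \<in> carrier P" for p
  proof (rule R.free_module_ext[OF abelian_group_axioms l1 l2 _ p])
    fix q assume q: "q \<in> gens"
    have "(\<Oplus>\<^bsub>M\<^esub>j\<in>{..<n}. \<tau> j (single R q) \<odot>\<^bsub>M\<^esub> b r j) = (\<Oplus>\<^bsub>M\<^esub>j\<in>{..<n}. s q j \<odot>\<^bsub>M\<^esub> b r j)"
      by (rule M.finsum_cong'[OF refl]) (use \<tau>(2)[OF _ q] sc[OF q] b_closed r in auto)
    then show "\<kappa> \<odot>\<^bsub>M\<^esub> pi (single R q) = (\<Oplus>\<^bsub>M\<^esub>j\<in>{..<n}. \<tau> j (single R q) \<odot>\<^bsub>M\<^esub> b r j)"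
      using s(2)[OF q] pi_single[of "fst q" "snd q"] q by auto
  qed
  then show ?thesis by (intro bexI[OF _ \<kappa>(1)] exI[of _ \<tau>] conjI allI impI ballI \<tau>(1))
qed

text \<open>The coordinates on \<open>P\<close> have to be multiplied until they vanish on the
  kernel of \<open>pi\<close>. Each kernel element asks for some power of \<open>r\<close>, and one
  power must serve for all. It does, because the kernel is locally generated by the finitely many
  relations \<open>w t (single R s)\<close>.\<close>

lemma lifted_coordinates:
  assumes r: "r \<in> F"
  shows "\<exists>\<rho>\<in>powers R r. \<exists>\<zeta>. (\<forall>j<n. \<zeta> j \<in> semilinear R id M (self_module R)) \<and>
    (\<forall>x\<in>carrier M. \<rho> \<odot>\<^bsub>M\<^esub> x = (\<Oplus>\<^bsub>M\<^esub>j\<in>{..<n}. \<zeta> j x \<odot>\<^bsub>M\<^esub> b r j)) \<and>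
    (\<forall>i<n. \<forall>j<n. \<zeta> j (b r i) = (if i = j then \<rho> else \<zero>))"
proof -
  interpret S: module_localization R M "powers R r" by (rule loc[OF r])
  have SM: "module R (self_module R)" by (rule self_module_module[OF R.is_cring])
  have SG: "abelian_group (self_module R)" using SM by (simp add: module_def)
  have "\<forall>t\<in>F. \<exists>\<kappa>. \<kappa> \<in> powers R t \<and> (\<exists>\<tau>. (\<forall>j<n. \<tau> j \<in> semilinear R id P (self_module R)) \<and>
    (\<forall>p\<in>carrier P. \<kappa> \<odot>\<^bsub>M\<^esub> pi p = (\<Oplus>\<^bsub>M\<^esub>j\<in>{..<n}. \<tau> j p \<odot>\<^bsub>M\<^esub> b t j)))"
  proof (rule ballI)
    fix t assume "t \<in> F"
    from local_coordinates[OF this, unfolded Bex_def]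
    show "\<exists>\<kappa>. \<kappa> \<in> powers R t \<and> (\<exists>\<tau>. (\<forall>j<n. \<tau> j \<in> semilinear R id P (self_module R)) \<and>
      (\<forall>p\<in>carrier P. \<kappa> \<odot>\<^bsub>M\<^esub> pi p = (\<Oplus>\<^bsub>M\<^esub>j\<in>{..<n}. \<tau> j p \<odot>\<^bsub>M\<^esub> b t j)))" .
  qed
  from bchoice[OF this] obtain \<kappa> where
    "\<forall>t\<in>F. \<kappa> t \<in> powers R t \<and> (\<exists>\<tau>. (\<forall>j<n. \<tau> j \<in> semilinear R id P (self_module R)) \<and>
    (\<forall>p\<in>carrier P. \<kappa> t \<odot>\<^bsub>M\<^esub> pi p = (\<Oplus>\<^bsub>M\<^esub>j\<in>{..<n}. \<tau> j p \<odot>\<^bsub>M\<^esub> b t j)))" by (elim exE)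
  then have \<kappa>: "\<And>t. t \<in> F \<Longrightarrow> \<kappa> t \<in> powers R t"
    and *: "\<forall>t\<in>F. \<exists>\<tau>. (\<forall>j<n. \<tau> j \<in> semilinear R id P (self_module R)) \<and>
    (\<forall>p\<in>carrier P. \<kappa> t \<odot>\<^bsub>M\<^esub> pi p = (\<Oplus>\<^bsub>M\<^esub>j\<in>{..<n}. \<tau> j p \<odot>\<^bsub>M\<^esub> b t j))" by (simp_all (no_asm_simp))
  from bchoice[OF *] obtain \<tau> where
    "\<forall>t\<in>F. (\<forall>j<n. \<tau> t j \<in> semilinear R id P (self_module R)) \<and>
    (\<forall>p\<in>carrier P. \<kappa> t \<odot>\<^bsub>M\<^esub> pi p = (\<Oplus>\<^bsub>M\<^esub>j\<in>{..<n}. \<tau> t j p \<odot>\<^bsub>M\<^esub> b t j))" by (elim exE)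
  then have \<tau>: "\<And>t j. t \<in> F \<Longrightarrow> j < n \<Longrightarrow> \<tau> t j \<in> semilinear R id P (self_module R)"
    and \<kappa>\<tau>: "\<And>t p. t \<in> F \<Longrightarrow> p \<in> carrier P \<Longrightarrow> \<kappa> t \<odot>\<^bsub>M\<^esub> pi p = (\<Oplus>\<^bsub>M\<^esub>j\<in>{..<n}. \<tau> t j p \<odot>\<^bsub>M\<^esub> b t j)"
    by (simp_all (no_asm_simp))
  have \<kappa>c: "t \<in> F \<Longrightarrow> \<kappa> t \<in> carrier R" for t using powers_closed \<kappa> by blast
  have \<tau>c: "t \<in> F \<Longrightarrow> j < n \<Longrightarrow> p \<in> carrier P \<Longrightarrow> \<tau> t j p \<in> carrier R" for t j p using semilinear_closed[OF \<tau>] by simp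
  have sP: "t \<in> F \<Longrightarrow> j < n \<Longrightarrow> single R (t, j) \<in> carrier P" for t j by auto
  \<comment> \<open>A relation attached to \<open>p\<close>: a multiple of \<open>p\<close> minus
    its expansion in the generators belonging to \<open>t\<close>. It depends linearly on
    \<open>p\<close>.\<close>
  define w where "w t p = \<kappa> t \<odot>\<^bsub>P\<^esub> p \<ominus>\<^bsub>P\<^esub> (\<Oplus>\<^bsub>P\<^esub>j\<in>{..<n}. \<tau> t j p \<odot>\<^bsub>P\<^esub> single R (t, j))" for t p
  have corr: "(\<lambda>p. \<Oplus>\<^bsub>P\<^esub>j\<in>{..<n}. \<tau> t j p \<odot>\<^bsub>P\<^esub> single R (t, j)) \<in> semilinear R id P P" if "t \<in> F" for t
  proof (rule semilinear_sum[OF P.module_axioms])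
    fix j assume "j \<in> {..<n}"
    then show "(\<lambda>p. \<tau> t j p \<odot>\<^bsub>P\<^esub> single R (t, j)) \<in> semilinear R id P P"
      by (intro semilinear_smult_left[OF P.module_axioms _ \<tau>[OF that]] sP[OF that]) auto
  qed simp
  have w: "w t \<in> semilinear R id P P" if t: "t \<in> F" for t
    unfolding w_def[abs_def]
    by (rule semilinear_diff_fun[OF P.module_axioms _ semilinear_scale[OF P.module_axioms _ id_semilinear \<kappa>c[OF t]] corr[OF t]]) auto
  have pi_w: "pi (w t p) = \<zero>\<^bsub>M\<^esub>" if t: "t \<in> F" and p: "p \<in> carrier P" for t p
  proof -
    have c: "\<kappa> t \<odot>\<^bsub>P\<^esub> p \<in> carrier P" by (rule P.smult_closed[OF \<kappa>c[OF t] p])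
    have d: "(\<Oplus>\<^bsub>P\<^esub>j\<in>{..<n}. \<tau> t j p \<odot>\<^bsub>P\<^esub> single R (t, j)) \<in> carrier P" by (rule semilinear_closed[OF corr[OF t] p])
    have "pi (\<Oplus>\<^bsub>P\<^esub>j\<in>{..<n}. \<tau> t j p \<odot>\<^bsub>P\<^esub> single R (t, j)) = (\<Oplus>\<^bsub>M\<^esub>j\<in>{..<n}. pi (\<tau> t j p \<odot>\<^bsub>P\<^esub> single R (t, j)))"
      by (rule semilinear_finsum[OF P.abelian_group_axioms abelian_group_axioms pi])
        (use P.smult_closed[OF \<tau>c[OF t _ p] sP[OF t]] in blast)
    also have "\<dots> = (\<Oplus>\<^bsub>M\<^esub>j\<in>{..<n}. \<tau> t j p \<odot>\<^bsub>M\<^esub> b t j)"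
    proof (rule M.finsum_cong'[OF refl])
      fix j assume "j \<in> {..<n}"
      then have j: "j < n" by simp
      show "pi (\<tau> t j p \<odot>\<^bsub>P\<^esub> single R (t, j)) = \<tau> t j p \<odot>\<^bsub>M\<^esub> b t j"
        using semilinear_smult[OF pi \<tau>c[OF t j p] sP[OF t j]] pi_single[OF t j] by simp
    qed (use \<tau>c[OF t _ p] b_closed[OF t] in auto)
    also have "\<dots> = \<kappa> t \<odot>\<^bsub>M\<^esub> pi p" using \<kappa>\<tau>[OF t p] by simp
    finally show ?thesis
      unfolding w_def using semilinear_diff[OF P.abelian_group_axioms abelian_group_axioms pi c d] 
        semilinear_smult[OF pi \<kappa>c[OF t] p] smult_closed[OF \<kappa>c[OF t] semilinear_closed[OF pi p]] by simp
  qed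
  have ker: "\<exists>u\<in>powers R t. \<forall>j<n. u \<otimes> \<tau> t j p = \<zero>" if t: "t \<in> F" and p: "p \<in> carrier P" and z: "pi p = \<zero>\<^bsub>M\<^esub>" for t p
    by (rule b_indep[OF t]) (use \<tau>c[OF t _ p] \<kappa>\<tau>[OF t p] z \<kappa>c[OF t] in auto)
  \<comment> \<open>One power \<open>u\<close> of \<open>r\<close> for all relations
    \<open>w t (single R s)\<close> and all coordinates.\<close>
  have "\<exists>u\<in>powers R r. \<forall>q\<in>F \<times> (gens \<times> {..<n}). u \<odot>\<^bsub>self_module R\<^esub> \<tau> r (snd (snd q)) (w (fst q) (single R (fst (snd q)))) = \<zero>\<^bsub>self_module R\<^esub>"
  proof (rule S.Self.common_annihilator)
    show "finite (F \<times> (gens \<times> {..<n}))" using F by simp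
    fix q assume "q \<in> F \<times> (gens \<times> {..<n})"
    then obtain t s j where q: "q = (t, s, j)" "t \<in> F" "s \<in> gens" "j < n" by (cases q) auto
    have sp: "single R s \<in> carrier P" using q by (intro R.single_closed)
    have wp: "w t (single R s) \<in> carrier P" by (rule semilinear_closed[OF w[OF q(2)] sp])
    show "\<tau> r (snd (snd q)) (w (fst q) (single R (fst (snd q)))) \<in> carrier (self_module R)"
      using \<tau>c[OF r q(4) wp] q(1) by simp
    show "\<exists>u\<in>powers R r. u \<odot>\<^bsub>self_module R\<^esub> \<tau> r (snd (snd q)) (w (fst q) (single R (fst (snd q)))) = \<zero>\<^bsub>self_module R\<^esub>"
      using ker[OF r wp pi_w[OF q(2) sp]] q by auto
  qed
  then obtain u where u: "u \<in> powers R r" 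
    and uz0: "\<forall>q\<in>F \<times> (gens \<times> {..<n}). u \<odot>\<^bsub>self_module R\<^esub> \<tau> r (snd (snd q)) (w (fst q) (single R (fst (snd q)))) = \<zero>\<^bsub>self_module R\<^esub>"
    by (elim bexE)
  have uz: "u \<otimes> \<tau> r j (w t (single R s)) = \<zero>" if "t \<in> F" "s \<in> gens" "j < n" for t s j
    using bspec[OF uz0, of "(t, s, j)"] that by simp
  have uc: "u \<in> carrier R" by (rule powers_closed[OF r u])
  have uw: "u \<otimes> \<tau> r j (w t p) = \<zero>" if t: "t \<in> F" and j: "j < n" and p: "p \<in> carrier P" for t j p
  proof (rule R.free_module_ext[OF SG _ _ _ p, where \<sigma> = id, simplified])
    have "(\<lambda>p. \<tau> r j (w t p)) \<in> semilinear R id P (self_module R)"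
      using semilinear_comp[OF w[OF t] \<tau>[OF r j]] by (simp add: id_def)
    then show "(\<lambda>p. u \<otimes> \<tau> r j (w t p)) \<in> semilinear R id P (self_module R)"
      using semilinear_scale[OF SM _ _ uc, of R id] by simp
    show "(\<lambda>p. \<zero>) \<in> semilinear R id P (self_module R)" by (rule semilinearI) auto
  qed (use uz[OF t _ j] in auto)
  \<comment> \<open>If \<open>p\<close> is in the kernel, its coordinates at \<open>t\<close> are
    killed by a power \<open>v\<close> of \<open>t\<close>, so \<open>w t p\<close> and
    \<open>\<kappa> t\<close> times \<open>p\<close> agree after multiplication by \<open>v\<close>.
    As \<open>u\<close> kills the coordinates of \<open>w t p\<close>, a power of each
    \<open>t\<close> kills \<open>u \<otimes> \<tau> r j p\<close>, and \<open>local_zero\<close>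
    applies.\<close>
  have well: "u \<otimes> \<tau> r j p = \<zero>" if j: "j < n" and p: "p \<in> carrier P" and z: "pi p = \<zero>\<^bsub>M\<^esub>" for j p
  proof -
    have "u \<otimes> \<tau> r j p = \<zero>\<^bsub>self_module R\<^esub>"
    proof (rule module.local_zero[OF SM F])
      show "u \<otimes> \<tau> r j p \<in> carrier (self_module R)" using uc \<tau>c[OF r j p] by simp
      fix t assume t: "t \<in> F"
      obtain v where v: "v \<in> powers R t" "\<And>j. j < n \<Longrightarrow> v \<otimes> \<tau> t j p = \<zero>" using ker[OF t p z] by blast
      have vc: "v \<in> carrier R" by (rule powers_closed[OF t v(1)])
      have kp: "\<kappa> t \<odot>\<^bsub>P\<^esub> p \<in> carrier P" by (rule P.smult_closed[OF \<kappa>c[OF t] p])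
      have d: "(\<Oplus>\<^bsub>P\<^esub>i\<in>{..<n}. \<tau> t i p \<odot>\<^bsub>P\<^esub> single R (t, i)) \<in> carrier P" by (rule semilinear_closed[OF corr[OF t] p])
      have "v \<odot>\<^bsub>P\<^esub> (\<Oplus>\<^bsub>P\<^esub>i\<in>{..<n}. \<tau> t i p \<odot>\<^bsub>P\<^esub> single R (t, i)) = (\<Oplus>\<^bsub>P\<^esub>i\<in>{..<n}. v \<odot>\<^bsub>P\<^esub> (\<tau> t i p \<odot>\<^bsub>P\<^esub> single R (t, i)))"
        by (rule P.finsum_smult_ldistr[OF _ vc]) (use P.smult_closed[OF \<tau>c[OF t _ p] sP[OF t]] in auto)
      also have "\<dots> = (\<Oplus>\<^bsub>P\<^esub>i\<in>{..<n}. \<zero>\<^bsub>P\<^esub>)"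
      proof (rule P.M.finsum_cong'[OF refl])
        fix i assume "i \<in> {..<n}"
        then have i: "i < n" by simp
        have "v \<odot>\<^bsub>P\<^esub> (\<tau> t i p \<odot>\<^bsub>P\<^esub> single R (t, i)) = (v \<otimes> \<tau> t i p) \<odot>\<^bsub>P\<^esub> single R (t, i)"
          by (rule P.smult_assoc1[OF vc \<tau>c[OF t i p] sP[OF t i], symmetric])
        then show "v \<odot>\<^bsub>P\<^esub> (\<tau> t i p \<odot>\<^bsub>P\<^esub> single R (t, i)) = \<zero>\<^bsub>P\<^esub>"
          unfolding v(2)[OF i] using P.smult_l_null[OF sP[OF t i]] by simp
      qed blast
      also have "\<dots> = \<zero>\<^bsub>P\<^esub>" by (rule P.M.finsum_zero)
      finally have vz: "v \<odot>\<^bsub>P\<^esub> (\<Oplus>\<^bsub>P\<^esub>i\<in>{..<n}. \<tau> t i p \<odot>\<^bsub>P\<^esub> single R (t, i)) = \<zero>\<^bsub>P\<^esub>" .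
      have "v \<odot>\<^bsub>P\<^esub> w t p = v \<odot>\<^bsub>P\<^esub> (\<kappa> t \<odot>\<^bsub>P\<^esub> p)"
        unfolding w_def a_minus_def
        by (simp only: P.smult_r_distr[OF vc kp P.M.a_inv_closed[OF d]] P.smult_r_minus[OF vc d] vz P.M.a_inv_zero
            P.M.r_zero[OF P.smult_closed[OF vc kp]])
      then have "\<tau> r j (v \<odot>\<^bsub>P\<^esub> w t p) = \<tau> r j (v \<odot>\<^bsub>P\<^esub> (\<kappa> t \<odot>\<^bsub>P\<^esub> p))" by simp
      then have "v \<otimes> \<tau> r j (w t p) = v \<otimes> (\<kappa> t \<otimes> \<tau> r j p)"
        using semilinear_smult[OF \<tau>[OF r j] vc semilinear_closed[OF w[OF t] p]] semilinear_smult[OF \<tau>[OF r j] vc kp]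
          semilinear_smult[OF \<tau>[OF r j] \<kappa>c[OF t] p] by simp
      then have "(v \<otimes> \<kappa> t) \<otimes> (u \<otimes> \<tau> r j p) = v \<otimes> (u \<otimes> \<tau> r j (w t p))"
        using vc uc \<kappa>c[OF t] \<tau>c[OF r j p] \<tau>c[OF r j semilinear_closed[OF w[OF t] p]]
        by (metis R.m_assoc R.m_closed R.m_lcomm)
      also have "\<dots> = \<zero>" using uw[OF t j p] vc by simp
      finally show "\<exists>s\<in>powers R t. s \<odot>\<^bsub>self_module R\<^esub> (u \<otimes> \<tau> r j p) = \<zero>\<^bsub>self_module R\<^esub>"
        using R.powers_mult[OF _ v(1) \<kappa>[OF t]] t F(2) by auto
    qed
    then show ?thesis by simp
  qed
  have ex: "\<exists>k\<in>semilinear R id M (self_module R). \<forall>p\<in>carrier P. k (pi p) = u \<otimes> \<tau> r j p" if j: "j \<in> {..<n}" for j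
    by (rule semilinear_factor[OF P.module_axioms module_axioms SM pi pi_surj])
      (use semilinear_scale[OF SM _ \<tau>[OF r] uc, of j] well[of j] j in auto)
  have "\<forall>j\<in>{..<n}. \<exists>k. k \<in> semilinear R id M (self_module R) \<and> (\<forall>p\<in>carrier P. k (pi p) = u \<otimes> \<tau> r j p)"
    by (rule ballI) (rule ex[unfolded Bex_def])
  from bchoice[OF this] obtain z where
    "\<forall>j\<in>{..<n}. z j \<in> semilinear R id M (self_module R) \<and> (\<forall>p\<in>carrier P. z j (pi p) = u \<otimes> \<tau> r j p)" by (elim exE)
  then have z: "\<And>j. j < n \<Longrightarrow> z j \<in> semilinear R id M (self_module R)"
    and zpi: "\<And>j p. j < n \<Longrightarrow> p \<in> carrier P \<Longrightarrow> z j (pi p) = u \<otimes> \<tau> r j p" by (simp_all (no_asm_simp))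
  have zc: "j < n \<Longrightarrow> x \<in> carrier M \<Longrightarrow> z j x \<in> carrier R" for j x using semilinear_closed[OF z] by simp
  let ?l = "u \<otimes> \<kappa> r"
  have lc: "?l \<in> carrier R" using uc \<kappa>c[OF r] by simp
  have lz: "?l \<odot>\<^bsub>M\<^esub> x = (\<Oplus>\<^bsub>M\<^esub>j\<in>{..<n}. z j x \<odot>\<^bsub>M\<^esub> b r j)" if x: "x \<in> carrier M" for x
  proof -
    obtain p where p: "p \<in> carrier P" "pi p = x" using pi_surj[OF x] by blast
    have "?l \<odot>\<^bsub>M\<^esub> x = u \<odot>\<^bsub>M\<^esub> (\<kappa> r \<odot>\<^bsub>M\<^esub> pi p)" using p x uc \<kappa>c[OF r] by (simp add: smult_assoc1)
    also have "\<dots> = (\<Oplus>\<^bsub>M\<^esub>j\<in>{..<n}. (u \<otimes> \<tau> r j p) \<odot>\<^bsub>M\<^esub> b r j)"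
      unfolding \<kappa>\<tau>[OF r p(1)] by (rule comb_smult[OF r uc \<tau>c[OF r _ p(1)]])
    also have "\<dots> = (\<Oplus>\<^bsub>M\<^esub>j\<in>{..<n}. z j x \<odot>\<^bsub>M\<^esub> b r j)"
      by (rule M.finsum_cong'[OF refl]) (use zpi[OF _ p(1)] zc x p(2) b_closed[OF r] uc \<tau>c[OF r _ p(1)] in auto)
    finally show ?thesis .
  qed
  \<comment> \<open>The defect of duality between the lifted coordinates and \<open>b r\<close>. It
    vanishes after localization, so a further power \<open>v\<close> of \<open>r\<close> kills it,
    and \<open>\<rho>\<close> becomes \<open>v \<otimes> (u \<otimes> \<kappa> r)\<close>.\<close>
  let ?d = "\<lambda>i j. z j (b r i) \<ominus> (if i = j then ?l else \<zero>)"
  have dc: "?d i j \<in> carrier R" if "i < n" "j < n" for i j using zc b_closed[OF r] lc that by auto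
  have dz: "\<exists>v\<in>powers R r. \<forall>j<n. v \<otimes> ?d i j = \<zero>" if i: "i < n" for i
  proof (rule b_indep[OF r])
    have bi: "b r i \<in> carrier M" by (rule b_closed[OF r i])
    have "(\<Oplus>\<^bsub>M\<^esub>j\<in>{..<n}. ?d i j \<odot>\<^bsub>M\<^esub> b r j) = (\<Oplus>\<^bsub>M\<^esub>j\<in>{..<n}. z j (b r i) \<odot>\<^bsub>M\<^esub> b r j \<oplus>\<^bsub>M\<^esub> \<ominus>\<^bsub>M\<^esub> (if j = i then ?l \<odot>\<^bsub>M\<^esub> b r j else \<zero>\<^bsub>M\<^esub>))"
      by (rule M.finsum_cong'[OF refl]) (use zc bi b_closed[OF r] lc in \<open>auto simp: a_minus_def smult_l_distr smult_l_minus\<close>)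
    also have "\<dots> = (\<Oplus>\<^bsub>M\<^esub>j\<in>{..<n}. z j (b r i) \<odot>\<^bsub>M\<^esub> b r j) \<oplus>\<^bsub>M\<^esub> (\<Oplus>\<^bsub>M\<^esub>j\<in>{..<n}. \<ominus>\<^bsub>M\<^esub> (if j = i then ?l \<odot>\<^bsub>M\<^esub> b r j else \<zero>\<^bsub>M\<^esub>))"
      by (rule M.finsum_addf) (use zc bi b_closed[OF r] lc in auto)
    also have "(\<Oplus>\<^bsub>M\<^esub>j\<in>{..<n}. \<ominus>\<^bsub>M\<^esub> (if j = i then ?l \<odot>\<^bsub>M\<^esub> b r j else \<zero>\<^bsub>M\<^esub>)) = \<ominus>\<^bsub>M\<^esub> (\<Oplus>\<^bsub>M\<^esub>j\<in>{..<n}. if j = i then ?l \<odot>\<^bsub>M\<^esub> b r j else \<zero>\<^bsub>M\<^esub>)"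
      by (rule M.finsum_minus) (use b_closed[OF r] lc in auto)
    also have "(\<Oplus>\<^bsub>M\<^esub>j\<in>{..<n}. if j = i then ?l \<odot>\<^bsub>M\<^esub> b r j else \<zero>\<^bsub>M\<^esub>) = ?l \<odot>\<^bsub>M\<^esub> b r i"
      by (rule M.add.finprod_singleton_swap) (use i b_closed[OF r] lc in auto)
    finally show "(\<Oplus>\<^bsub>M\<^esub>j\<in>{..<n}. ?d i j \<odot>\<^bsub>M\<^esub> b r j) = \<zero>\<^bsub>M\<^esub>"
      using lz[OF bi] smult_closed[OF lc bi] by (simp add: M.r_neg)
  qed (use dc[OF i] in auto)
  have "\<exists>v\<in>powers R r. \<forall>q\<in>{..<n} \<times> {..<n}. v \<odot>\<^bsub>self_module R\<^esub> ?d (fst q) (snd q) = \<zero>\<^bsub>self_module R\<^esub>"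
  proof (rule S.Self.common_annihilator)
    fix q assume q: "q \<in> {..<n} \<times> {..<n}"
    then show "?d (fst q) (snd q) \<in> carrier (self_module R)" using dc[of "fst q" "snd q"] by auto
    from q obtain v where "v \<in> powers R r" "\<forall>j<n. v \<otimes> ?d (fst q) j = \<zero>" using dz[of "fst q"] by auto
    then show "\<exists>v\<in>powers R r. v \<odot>\<^bsub>self_module R\<^esub> ?d (fst q) (snd q) = \<zero>\<^bsub>self_module R\<^esub>" using q by (intro bexI[of _ v]) auto
  qed simp
  then obtain v where v: "v \<in> powers R r" 
    and vd0: "\<forall>q\<in>{..<n} \<times> {..<n}. v \<odot>\<^bsub>self_module R\<^esub> ?d (fst q) (snd q) = \<zero>\<^bsub>self_module R\<^esub>" by (elim bexE)
  have vd: "v \<otimes> ?d i j = \<zero>" if "i < n" "j < n" for i j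
    using bspec[OF vd0, of "(i, j)"] that by simp
  have vc: "v \<in> carrier R" by (rule powers_closed[OF r v])
  have rR: "r \<in> carrier R" using r F(2) by auto
  show ?thesis
  proof (intro bexI[of _ "v \<otimes> ?l"] exI[of _ "\<lambda>j x. v \<otimes> z j x"] conjI allI impI ballI)
    show "v \<otimes> ?l \<in> powers R r" by (intro R.powers_mult[OF rR] v u \<kappa>[OF r])
    show "(\<lambda>x. v \<otimes> z j x) \<in> semilinear R id M (self_module R)" if "j < n" for j
      using semilinear_scale[OF SM _ z[OF that] vc] by simp
    show "(v \<otimes> ?l) \<odot>\<^bsub>M\<^esub> x = (\<Oplus>\<^bsub>M\<^esub>j\<in>{..<n}. (v \<otimes> z j x) \<odot>\<^bsub>M\<^esub> b r j)" if x: "x \<in> carrier M" for x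
      using comb_smult[OF r vc zc[OF _ x]] lz[OF x] vc lc x by (simp add: smult_assoc1)
    show "v \<otimes> z j (b r i) = (if i = j then v \<otimes> ?l else \<zero>)" if ij: "i < n" "j < n" for i j
    proof -
      let ?e = "if i = j then ?l else \<zero>"
      have ec: "?e \<in> carrier R" using lc by simp
      have zb: "z j (b r i) \<in> carrier R" by (rule zc[OF ij(2) b_closed[OF r ij(1)]])
      have "v \<otimes> z j (b r i) \<ominus> v \<otimes> ?e = \<zero>"
        using vd[OF ij] vc ec zb by (simp only: a_minus_def R.r_distr R.a_inv_closed R.r_minus)
      then have "v \<otimes> z j (b r i) = v \<otimes> ?e"
        by (rule R.eqI_minus[rotated 2]) (intro R.m_closed vc ec zb)+
      then show ?thesis using vc by auto
    qed
  qed
qed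

end

section \<open>Existence of charts, and the trace on the top exterior power\<close>

section \<open>Charts of algebras of rank n\<close>

text \<open>Forms \<open>\<zeta> r\<close> defined on all of \<open>A\<close> and local bases
  \<open>b r\<close>, dual to each other up to the power \<open>\<rho> r\<close> of
  \<open>r\<close>. In these terms no fractions occur from here on.\<close>

locale coordinates = wedge_algebra R A n for R (structure) and A (structure) and n +
  fixes F \<rho> b \<zeta>
  assumes F: "finite F" "F \<subseteq> carrier R" "Idl F = carrier R"
    and \<rho>: "r \<in> F \<Longrightarrow> \<rho> r \<in> powers R r"
    and b: "r \<in> F \<Longrightarrow> b r \<in> vecs"
    and \<zeta>: "r \<in> F \<Longrightarrow> j < n \<Longrightarrow> \<zeta> r j \<in> semilinear R id A (self_module R)"
    and expand: "r \<in> F \<Longrightarrow> x \<in> carrier A \<Longrightarrow> \<rho> r \<odot>\<^bsub>A\<^esub> x = (\<Oplus>\<^bsub>A\<^esub>j\<in>{..<n}. \<zeta> r j x \<odot>\<^bsub>A\<^esub> b r j)"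
    and dual: "r \<in> F \<Longrightarrow> i < n \<Longrightarrow> j < n \<Longrightarrow> \<zeta> r j (b r i) = (if i = j then \<rho> r else \<zero>)"
begin

lemma SM: "module R (self_module R)" by (rule self_module_module[OF A.R.is_cring])

lemma SG: "abelian_group (self_module R)" using SM by (simp add: module_def)

lemma \<rho>_closed [simp, intro]: "r \<in> F \<Longrightarrow> \<rho> r \<in> carrier R"
  using \<rho> F(2) by (fastforce simp: powers_def)

lemma \<zeta>_closed [simp, intro]: "r \<in> F \<Longrightarrow> j < n \<Longrightarrow> x \<in> carrier A \<Longrightarrow> \<zeta> r j x \<in> carrier R"
  using semilinear_closed[OF \<zeta>] by simp

lemma b_closed [simp, intro]: "r \<in> F \<Longrightarrow> j < n \<Longrightarrow> b r j \<in> carrier A"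
  using b[of r] by auto

lemma \<rho>_pow: "r \<in> F \<Longrightarrow> \<rho> r [^] (k::nat) \<in> powers R r"
proof (induction k)
  case 0
  then show ?case by (auto simp: powers_def intro: range_eqI[of _ _ 0])
next
  case (Suc k)
  then show ?case using A.R.powers_mult[of r "\<rho> r [^] k" "\<rho> r"] \<rho>[of r] F(2) by auto
qed

lemma pow_closed [simp, intro]: "r \<in> F \<Longrightarrow> \<rho> r [^] (k::nat) \<in> carrier R"
  using A.R.nat_pow_closed by simp

text \<open>The first \<open>k\<close> entries are those not yet known to be basis vectors.
  Expanding one of them costs a factor \<open>\<rho> r\<close>; with none left, the tuple repeats an
  entry or is a permutation of \<open>b r\<close>.\<close>

lemma vanish_aux:
  assumes N: "module R N" and g: "alternating R A id N n g" and r: "r \<in> F" and z: "g (b r) = \<zero>\<^bsub>N\<^esub>"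
  shows "a \<in> vecs \<Longrightarrow> k \<le> n \<Longrightarrow> (\<And>i. k \<le> i \<Longrightarrow> i < n \<Longrightarrow> \<exists>l<n. a i = b r l) \<Longrightarrow>
    \<rho> r [^] k \<odot>\<^bsub>N\<^esub> g a = \<zero>\<^bsub>N\<^esub>"
proof (induction k arbitrary: a)
  interpret N: module R N by fact
  interpret G: alternating_map R A R N id n g
    by unfold_locales (use g in \<open>auto simp: ring_hom_def\<close>)
  case 0
  have "\<forall>i\<in>{..<n}. \<exists>l. l < n \<and> a i = b r l" using "0.prems"(3) by auto
  from bchoice[OF this] obtain q where q0: "\<forall>i\<in>{..<n}. q i < n \<and> a i = b r (q i)" by (elim exE)
  then have q: "\<And>i. i < n \<Longrightarrow> q i < n" "\<And>i. i < n \<Longrightarrow> a i = b r (q i)" by auto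
  have "g a = \<zero>\<^bsub>N\<^esub>"
  proof (cases "inj_on q {..<n}")
    case True
    define p where "p i = (if i < n then q i else i)" for i
    have "q ` {..<n} = {..<n}" using True q by (intro endo_inj_surj) auto
    then have "bij_betw q {..<n} {..<n}" using True by (simp add: bij_betw_def)
    then have "bij_betw p {..<n} {..<n}" by (rule bij_betw_cong[THEN iffD1, rotated]) (simp add: p_def)
    then have pp: "p permutes {..<n}" by (rule bij_imp_permutes) (simp add: p_def)
    have "g (b r \<circ> p) = g a" by (rule alternating_cong[OF g "0.prems"(1)]) (simp add: p_def q)
    then show ?thesis using G.permute[OF pp b[OF r]] z by (simp split: if_splits)
  next
    case False
    then obtain i j where "i < n" "j < n" "i \<noteq> j" "q i = q j" by (auto simp: inj_on_def)
    then show ?thesis using alternating_repeated[OF g "0.prems"(1), of i j] q by simp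
  qed
  then show ?case by simp
next
  interpret N: module R N by fact
  case (Suc k)
  have k: "k < n" using Suc.prems by simp
  have ak: "a k \<in> carrier A" using Suc.prems(1) k by auto
  have lin: "(\<lambda>x. g (a(k := x))) \<in> semilinear R id A N" by (rule alternating_semilinear[OF g Suc.prems(1) k])
  note gc = semilinear_closed[OF lin]
  have IH: "\<rho> r [^] k \<odot>\<^bsub>N\<^esub> g (a(k := b r l)) = \<zero>\<^bsub>N\<^esub>" if l: "l < n" for l
  proof (rule Suc.IH)
    show "a(k := b r l) \<in> vecs" using Suc.prems(1) b_closed[OF r l] by auto
    show "\<exists>l'<n. (a(k := b r l)) i = b r l'" if "k \<le> i" "i < n" for i
      using Suc.prems(3)[of i] that l by (cases "i = k") auto
  qed (use k in simp)
  have "\<rho> r \<odot>\<^bsub>N\<^esub> g a = g (a(k := \<rho> r \<odot>\<^bsub>A\<^esub> a k))"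
    using semilinear_smult[OF lin, of "\<rho> r" "a k"] r ak by simp
  also have "\<dots> = (\<Oplus>\<^bsub>N\<^esub>l\<in>{..<n}. g (a(k := \<zeta> r l (a k) \<odot>\<^bsub>A\<^esub> b r l)))"
    unfolding expand[OF r ak]
    by (rule semilinear_finsum[OF A.abelian_group_axioms N.abelian_group_axioms lin]) (use r ak in auto)
  also have "\<dots> = (\<Oplus>\<^bsub>N\<^esub>l\<in>{..<n}. \<zeta> r l (a k) \<odot>\<^bsub>N\<^esub> g (a(k := b r l)))"
    by (rule N.M.finsum_cong'[OF refl]) (use r ak gc semilinear_smult[OF lin] in auto)
  finally have 1: "\<rho> r \<odot>\<^bsub>N\<^esub> g a = (\<Oplus>\<^bsub>N\<^esub>l\<in>{..<n}. \<zeta> r l (a k) \<odot>\<^bsub>N\<^esub> g (a(k := b r l)))" .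
  have ga: "g a \<in> carrier N" by (rule alternating_closed[OF g Suc.prems(1)])
  have "\<rho> r [^] Suc k \<odot>\<^bsub>N\<^esub> g a = \<rho> r [^] k \<odot>\<^bsub>N\<^esub> (\<rho> r \<odot>\<^bsub>N\<^esub> g a)"
    using r ga by (simp add: N.smult_assoc1)
  also have "\<dots> = (\<Oplus>\<^bsub>N\<^esub>l\<in>{..<n}. \<rho> r [^] k \<odot>\<^bsub>N\<^esub> (\<zeta> r l (a k) \<odot>\<^bsub>N\<^esub> g (a(k := b r l))))"
    unfolding 1 by (rule N.finsum_smult_ldistr) (use r ak gc in auto)
  also have "\<dots> = (\<Oplus>\<^bsub>N\<^esub>l\<in>{..<n}. \<zero>\<^bsub>N\<^esub>)"
  proof (rule N.M.finsum_cong'[OF refl])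
    fix l assume "l \<in> {..<n}"
    then have l: "l < n" by simp
    have c: "\<zeta> r l (a k) \<in> carrier R" "\<rho> r [^] k \<in> carrier R" "g (a(k := b r l)) \<in> carrier N"
      using r ak l gc by auto
    have "\<rho> r [^] k \<odot>\<^bsub>N\<^esub> (\<zeta> r l (a k) \<odot>\<^bsub>N\<^esub> g (a(k := b r l))) = \<zeta> r l (a k) \<odot>\<^bsub>N\<^esub> (\<rho> r [^] k \<odot>\<^bsub>N\<^esub> g (a(k := b r l)))"
      using c by (simp add: N.smult_assoc1[symmetric] A.R.m_comm)
    then show "\<rho> r [^] k \<odot>\<^bsub>N\<^esub> (\<zeta> r l (a k) \<odot>\<^bsub>N\<^esub> g (a(k := b r l))) = \<zero>\<^bsub>N\<^esub>"
      using IH[OF l] c by simp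
  qed auto
  finally show ?case by simp
qed

lemma vanish:
  assumes "module R N" "alternating R A id N n g" "r \<in> F" "g (b r) = \<zero>\<^bsub>N\<^esub>" "a \<in> vecs"
  shows "\<rho> r [^] n \<odot>\<^bsub>N\<^esub> g a = \<zero>\<^bsub>N\<^esub>"
  by (rule vanish_aux[OF assms(1-5) order_refl]) simp

text \<open>Applies \<open>vanish\<close> to the multiple of \<open>g\<close> by
  \<open>\<rho> r\<close> for each \<open>r\<close>, and glues over \<open>F\<close>.\<close>

lemma alternating_zero:
  assumes N: "module R N" and g: "alternating R A id N n g" and a: "a \<in> vecs"
    and z: "\<And>r. r \<in> F \<Longrightarrow> \<rho> r \<odot>\<^bsub>N\<^esub> g (b r) = \<zero>\<^bsub>N\<^esub>"
  shows "g a = \<zero>\<^bsub>N\<^esub>"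
proof -
  interpret N: module R N by fact
  have ga: "g a \<in> carrier N" by (rule alternating_closed[OF g a])
  show ?thesis
  proof (rule N.local_zero[OF F ga])
    fix r assume r: "r \<in> F"
    have s: "(\<lambda>x. \<rho> r \<odot>\<^bsub>N\<^esub> x) \<in> semilinear R id N N"
      by (rule semilinear_scale[OF N _ id_semilinear]) (use r in auto)
    have "alternating R A (\<lambda>r. id (id r)) N n (\<lambda>f. \<rho> r \<odot>\<^bsub>N\<^esub> g f)"
      by (rule alternating_comp[OF g s N.abelian_group_axioms N.abelian_group_axioms]) auto
    then have "alternating R A id N n (\<lambda>f. \<rho> r \<odot>\<^bsub>N\<^esub> g f)" by (simp add: id_def)
    from vanish[OF N this r z[OF r] a] have "(\<rho> r [^] n \<otimes> \<rho> r) \<odot>\<^bsub>N\<^esub> g a = \<zero>\<^bsub>N\<^esub>"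
      using r ga by (simp add: N.smult_assoc1)
    moreover have "\<rho> r [^] n \<otimes> \<rho> r \<in> powers R r"
      using \<rho>_pow[OF r, of "Suc n"] by simp
    ultimately show "\<exists>t\<in>powers R r. t \<odot>\<^bsub>N\<^esub> g a = \<zero>\<^bsub>N\<^esub>" by (rule bexI)
  qed
qed

lemma prod_multilinear: "multilinear R (self_module R) id (self_module R) n (\<lambda>f. \<Otimes>i\<in>{..<n}. f i)"
proof (rule multilinearI)
  fix f :: "nat \<Rightarrow> _" assume "f \<in> {..<n} \<rightarrow> carrier (self_module R)"
  then have f: "f \<in> {..<n} \<rightarrow> carrier R" by simp
  show "(\<Otimes>i\<in>{..<n}. f i) \<in> carrier (self_module R)" using f A.R.finprod_closed by simp
  show "(\<Otimes>i\<in>{..<n}. h i) = (\<Otimes>i\<in>{..<n}. f i)" if "\<And>i. i < n \<Longrightarrow> h i = f i" for h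
    by (rule A.R.finprod_cong'[OF refl f]) (use that in auto)
  fix i assume i: "i < n"
  let ?c = "\<Otimes>j\<in>{..<n} - {i}. f j"
  have c: "?c \<in> carrier R" using f by (intro A.R.finprod_closed) auto
  have eq: "(\<Otimes>j\<in>{..<n}. (f(i := a)) j) = a \<otimes> ?c" if a: "a \<in> carrier R" for a
  proof -
    have ins: "{..<n} = insert i ({..<n} - {i})" using i by auto
    have "(\<Otimes>j\<in>insert i ({..<n} - {i}). (f(i := a)) j) = (f(i := a)) i \<otimes> (\<Otimes>j\<in>{..<n} - {i}. (f(i := a)) j)"
      by (rule A.R.finprod_insert) (use a f in \<open>auto simp: Pi_iff\<close>)
    also have "(\<Otimes>j\<in>{..<n} - {i}. (f(i := a)) j) = ?c"
      by (rule A.R.finprod_cong'[OF refl]) (use f in auto)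
    finally show ?thesis using ins by simp
  qed
  show "(\<lambda>a. \<Otimes>j\<in>{..<n}. (f(i := a)) j) \<in> semilinear R id (self_module R) (self_module R)"
    by (rule semilinearI) (use eq c in \<open>auto simp: A.R.l_distr A.R.m_assoc\<close>)
qed

text \<open>The determinant of the coordinates of \<open>a\<close> with respect to
  \<open>b r\<close>: an alternating form, with value \<open>\<rho> r [^] n\<close> at
  \<open>b r\<close> itself.\<close>

definition dt where "dt r a = (\<Oplus>p\<in>perms n. 
  (if evenperm p then \<one> else \<ominus> \<one>) \<otimes> (\<Otimes>i\<in>{..<n}. \<zeta> r i (a (p i))))"

lemma dt_alternating:
  assumes r: "r \<in> F"
  shows "alternating R A id (self_module R) n (dt r)"
proof (rule multilinear_alternating)
  let ?s = "\<lambda>p. if evenperm p then \<one> else \<ominus> \<one>"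
  have "multilinear R A id (self_module R) n (\<lambda>a. ?s p \<otimes> (\<Otimes>i\<in>{..<n}. \<zeta> r i (a (p i))))" if p: "p \<in> perms n" for p
  proof -
    have m: "multilinear R A id (self_module R) n (\<lambda>a. \<Otimes>i\<in>{..<n}. \<zeta> r i (a (p i)))"
      by (rule multilinear_permuted[OF prod_multilinear]) (use p r \<zeta> in \<open>auto simp: perms_def\<close>)
    have s: "(\<lambda>x. ?s p \<otimes> x) \<in> semilinear R id (self_module R) (self_module R)"
      using semilinear_scale[OF SM _ id_semilinear, of R "?s p"] by simp
    have "multilinear R A (\<lambda>r. id (id r)) (self_module R) n (\<lambda>a. ?s p \<otimes> (\<Otimes>i\<in>{..<n}. \<zeta> r i (a (p i))))"
      by (rule multilinear_comp[OF m s]) simp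
    then show ?thesis by (simp add: id_def)
  qed
  then have "multilinear R A id (self_module R) n (\<lambda>a. \<Oplus>\<^bsub>self_module R\<^esub>p\<in>perms n. ?s p \<otimes> (\<Otimes>i\<in>{..<n}. \<zeta> r i (a (p i))))"
    by (intro multilinear_sum[OF SM]) auto
  then show "multilinear R A id (self_module R) n (dt r)" by (simp add: dt_def[abs_def])
  fix a k l assume a: "a \<in> vecs" and kl: "k < n" "l < n" "k \<noteq> l" "a k = a l"
  let ?t = "Transposition.transpose k l"
  have t: "?t \<in> perms n" "\<not> evenperm ?t" using kl by (auto simp: transpose_perms evenperm_swap)
  have pc: "(\<Otimes>i\<in>{..<n}. \<zeta> r i (a (p i))) \<in> carrier R" if "p \<in> perms n" for p
    by (rule A.R.finprod_closed) (use that r a perms_less[OF that] in \<open>auto simp: Pi_iff\<close>)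
  have "dt r a = \<zero>"
    unfolding dt_def
  proof (rule A.R.finsum_involution[where p = "\<lambda>p. ?t \<circ> p"])
    fix p assume p: "p \<in> perms n"
    show "?t \<circ> p \<in> perms n" using p t by (auto simp: perms_def permutes_compose)
    show "?t \<circ> (?t \<circ> p) = p" by (simp add: o_assoc)
    have ev: "evenperm (?t \<circ> p) \<longleftrightarrow> \<not> evenperm p"
      using permutes_evenperm_comp[of ?t n p] p t by (auto simp: perms_def)
    have at: "a ((?t \<circ> p) i) = a (p i)" for i using transpose_same[of a k l "p i", OF kl(4)] by simp
    show "?s (?t \<circ> p) \<otimes> (\<Otimes>i\<in>{..<n}. \<zeta> r i (a ((?t \<circ> p) i))) = \<ominus> (?s p \<otimes> (\<Otimes>i\<in>{..<n}. \<zeta> r i (a (p i))))"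
      unfolding at using ev pc[OF p] by (simp add: A.R.l_minus)
    show "?s p \<otimes> (\<Otimes>i\<in>{..<n}. \<zeta> r i (a (p i))) = \<zero>" if "?t \<circ> p = p"
      using ev that by simp
  qed (use pc perms_finite in auto)
  then show "dt r a = \<zero>\<^bsub>self_module R\<^esub>" by simp
qed

lemma dt_closed [simp, intro]: "r \<in> F \<Longrightarrow> a \<in> vecs \<Longrightarrow> dt r a \<in> carrier R"
  using alternating_closed[OF dt_alternating] by simp

lemma dt_b:
  assumes r: "r \<in> F"
  shows "dt r (b r) = \<rho> r [^] n"
proof -
  have pr: "(\<Otimes>i\<in>{..<n}. \<zeta> r i (b r (p i))) = (if p = id then \<rho> r [^] n else \<zero>)" if p: "p \<in> perms n" for p
  proof (cases "p = id")
    case True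
    have "(\<Otimes>i\<in>{..<n}. \<zeta> r i (b r (p i))) = (\<Otimes>i\<in>{..<n}. \<rho> r)"
      by (rule A.R.finprod_cong'[OF refl]) (use True r dual[OF r] in auto)
    also have "\<dots> = \<rho> r [^] n" using A.R.finprod_const[of "\<rho> r" "{..<n}"] r by simp
    finally show ?thesis using True by simp
  next
    case False
    then obtain i where i: "p i \<noteq> i" by (auto simp: fun_eq_iff)
    have pp: "p permutes {..<n}" using p by (simp add: perms_def)
    have "i \<in> {..<n}" using i permutes_not_in[OF pp] by blast
    then have iln: "i < n" by simp
    have pn: "j < n \<Longrightarrow> p j < n" for j using perms_less[OF p] by simp
    have ins: "{..<n} = insert i ({..<n} - {i})" using iln by auto
    have "(\<Otimes>i\<in>insert i ({..<n} - {i}). \<zeta> r i (b r (p i))) = \<zeta> r i (b r (p i)) \<otimes> (\<Otimes>i\<in>{..<n} - {i}. \<zeta> r i (b r (p i)))"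
      by (rule A.R.finprod_insert) (use iln pn r in auto)
    also have "\<dots> = \<zero>"
    proof -
      have "(\<Otimes>i\<in>{..<n} - {i}. \<zeta> r i (b r (p i))) \<in> carrier R" by (rule A.R.finprod_closed) (use pn r in auto)
      then show ?thesis using dual[OF r pn[OF iln] iln] i by simp
    qed
    finally show ?thesis using False ins by simp
  qed
  have "dt r (b r) = (\<Oplus>p\<in>perms n. if p = id then \<rho> r [^] n else \<zero>)"
    unfolding dt_def by (rule A.R.finsum_cong'[OF refl]) (use r in \<open>auto simp: pr\<close>)
  also have "\<dots> = \<rho> r [^] n"
    by (rule A.R.add.finprod_singleton_swap) (use r perms_finite permutes_id in \<open>auto simp: perms_def\<close>)
  finally show ?thesis .
qed

text \<open>The exponent collects two factors \<open>\<rho> r [^] n\<close>: one is the value of the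
  determinant at the basis, the other is what \<open>vanish\<close> charges for killing the defect
  \<open>?h\<close> of the expansion.\<close>

lemma top_form:
  assumes r: "r \<in> F"
  shows "\<exists>f\<in>semilinear R id L (self_module R).
    (\<forall>x\<in>carrier L. \<rho> r [^] (2 * n) \<odot>\<^bsub>L\<^esub> x = f x \<odot>\<^bsub>L\<^esub> W (b r)) \<and> f (W (b r)) = \<rho> r [^] (2 * n)"
proof -
  let ?p = "\<rho> r [^] n"
  have pc: "?p \<in> carrier R" using r by simp
  have pp: "\<rho> r [^] (2 * n) = ?p \<otimes> ?p" using A.R.nat_pow_mult[of "\<rho> r" n n] r by (simp add: mult_2)
  obtain d where d: "d \<in> semilinear R id L (self_module R)" "\<forall>a\<in>vecs. d (W a) = dt r a"
    using L_lift[OF SM id_ring_hom dt_alternating[OF r]] by (elim bexE)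
  have dc: "x \<in> carrier L \<Longrightarrow> d x \<in> carrier R" for x using semilinear_closed[OF d(1)] by simp
  have Wb: "W (b r) \<in> carrier L" by (rule W_closed[OF b[OF r]])
  let ?h = "\<lambda>x. ?p \<odot>\<^bsub>L\<^esub> x \<ominus>\<^bsub>L\<^esub> d x \<odot>\<^bsub>L\<^esub> W (b r)"
  have h: "?h \<in> semilinear R id L L"
    by (rule semilinear_diff_fun[OF L.module_axioms])
      (use semilinear_scale[OF L.module_axioms _ id_semilinear pc] semilinear_smult_left[OF L.module_axioms _ d(1) Wb] in auto)
  have ph: "(\<lambda>x. ?p \<odot>\<^bsub>L\<^esub> ?h x) \<in> semilinear R id L L"
    by (rule semilinear_scale[OF L.module_axioms _ h pc]) simp
  have zero: "(\<lambda>_. \<zero>\<^bsub>L\<^esub>) \<in> semilinear R id L L" by (rule semilinearI) auto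
  have "alternating R A (\<lambda>r. id (id r)) L n (\<lambda>a. ?h (W a))"
    by (rule alternating_comp[OF W_alternating h L.abelian_group_axioms L.abelian_group_axioms]) simp
  then have ah: "alternating R A id L n (\<lambda>a. ?h (W a))" by (simp add: id_def)
  have "?h (W (b r)) = \<zero>\<^bsub>L\<^esub>" using d(2) b[OF r] dt_b[OF r] pc Wb by simp
  from vanish[OF L.module_axioms ah r this]
  have "?p \<odot>\<^bsub>L\<^esub> ?h x = \<zero>\<^bsub>L\<^esub>" if "x \<in> carrier L" for x
    by (rule L_ext[OF L.abelian_group_axioms ph zero _ that])
  then have eq: "\<rho> r [^] (2 * n) \<odot>\<^bsub>L\<^esub> x = (?p \<otimes> d x) \<odot>\<^bsub>L\<^esub> W (b r)" if x: "x \<in> carrier L" for x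
  proof -
    have "?p \<odot>\<^bsub>L\<^esub> (?p \<odot>\<^bsub>L\<^esub> x) \<ominus>\<^bsub>L\<^esub> ?p \<odot>\<^bsub>L\<^esub> (d x \<odot>\<^bsub>L\<^esub> W (b r)) = \<zero>\<^bsub>L\<^esub>"
      using \<open>\<And>x. x \<in> carrier L \<Longrightarrow> ?p \<odot>\<^bsub>L\<^esub> ?h x = \<zero>\<^bsub>L\<^esub>\<close>[OF x] pc x Wb dc[OF x]
      by (simp add: a_minus_def L.smult_r_distr L.smult_r_minus)
    then have "?p \<odot>\<^bsub>L\<^esub> (?p \<odot>\<^bsub>L\<^esub> x) = ?p \<odot>\<^bsub>L\<^esub> (d x \<odot>\<^bsub>L\<^esub> W (b r))"
      by (rule L.M.eqI_minus[rotated 2]) (use pc x Wb dc[OF x] in auto)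
    then show ?thesis unfolding pp using pc x Wb dc[OF x] by (simp add: L.smult_assoc1)
  qed
  have "(\<lambda>x. ?p \<otimes> d x) \<in> semilinear R id L (self_module R)"
    using semilinear_scale[OF SM _ d(1) pc] by simp
  then show ?thesis
    by (rule bexI[rotated]) (use eq d(2) b[OF r] dt_b[OF r] in \<open>simp add: pp\<close>)
qed

text \<open>The forms of \<open>top_form\<close>, weighted by a partition of unity in the powers
  \<open>\<rho> r [^] (2 * n)\<close>, make up a chart.\<close>

lemma exists_chart:
  "\<exists>m e cf. disc_chart R A n m e cf"
proof -
  have "\<forall>r\<in>F. \<exists>f. f \<in> semilinear R id L (self_module R) \<and>
    ((\<forall>x\<in>carrier L. \<rho> r [^] (2 * n) \<odot>\<^bsub>L\<^esub> x = f x \<odot>\<^bsub>L\<^esub> W (b r)) \<and> f (W (b r)) = \<rho> r [^] (2 * n))"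
    by (rule ballI) (rule top_form[unfolded Bex_def])
  from bchoice[OF this] obtain f where f0: "\<forall>r\<in>F. f r \<in> semilinear R id L (self_module R) \<and>
    ((\<forall>x\<in>carrier L. \<rho> r [^] (2 * n) \<odot>\<^bsub>L\<^esub> x = f r x \<odot>\<^bsub>L\<^esub> W (b r)) \<and> f r (W (b r)) = \<rho> r [^] (2 * n))"
    by (elim exE)
  then have f: "\<And>r. r \<in> F \<Longrightarrow> f r \<in> semilinear R id L (self_module R)"
    and fx: "\<And>r x. r \<in> F \<Longrightarrow> x \<in> carrier L \<Longrightarrow> \<rho> r [^] (2 * n) \<odot>\<^bsub>L\<^esub> x = f r x \<odot>\<^bsub>L\<^esub> W (b r)"
    and fb: "\<And>r. r \<in> F \<Longrightarrow> f r (W (b r)) = \<rho> r [^] (2 * n)" by (simp_all (no_asm_simp))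
  have fc: "r \<in> F \<Longrightarrow> x \<in> carrier L \<Longrightarrow> f r x \<in> carrier R" for r x using semilinear_closed[OF f] by simp
  obtain y where y: "y \<in> F \<rightarrow> carrier R" "(\<Oplus>r\<in>F. y r \<otimes> \<rho> r [^] (2 * n)) = \<one>"
  proof -
    have "\<exists>y\<in>F \<rightarrow> carrier R. (\<Oplus>r\<in>F. y r \<otimes> \<rho> r [^] (2 * n)) = \<one>"
      by (rule A.R.power_partition[OF F]) (rule \<rho>_pow)
    then show thesis by (elim bexE) (rule that)
  qed
  have yc: "r \<in> F \<Longrightarrow> y r \<in> carrier R" for r using y(1) by auto
  have Wb: "r \<in> F \<Longrightarrow> W (b r) \<in> carrier L" for r by (rule W_closed[OF b])
  \<comment> \<open>At each \<open>t\<close> both sides are expressed through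
    \<open>W (b t)\<close>, where they become symmetric in \<open>x\<close> and
    \<open>z\<close>.\<close>
  have rank1: "f r x \<odot>\<^bsub>L\<^esub> z = f r z \<odot>\<^bsub>L\<^esub> x" if r: "r \<in> F" and x: "x \<in> carrier L" and z: "z \<in> carrier L" for r x z
  proof -
    have "f r x \<odot>\<^bsub>L\<^esub> z \<ominus>\<^bsub>L\<^esub> f r z \<odot>\<^bsub>L\<^esub> x = \<zero>\<^bsub>L\<^esub>"
    proof (rule L.local_zero[OF F])
      show "f r x \<odot>\<^bsub>L\<^esub> z \<ominus>\<^bsub>L\<^esub> f r z \<odot>\<^bsub>L\<^esub> x \<in> carrier L" using fc r x z by simp
      fix t assume t: "t \<in> F"
      let ?q = "\<rho> t [^] (2 * n)"
      have q: "?q \<in> carrier R" using t by simp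
      have qq: "?q \<otimes> ?q \<in> powers R t" by (rule A.R.powers_mult[OF _ \<rho>_pow[OF t] \<rho>_pow[OF t]]) (use t F in auto)
      have e: "(?q \<otimes> ?q) \<odot>\<^bsub>L\<^esub> (f r x \<odot>\<^bsub>L\<^esub> z) = (f t x \<otimes> f t z) \<odot>\<^bsub>L\<^esub> (f r (W (b t)) \<odot>\<^bsub>L\<^esub> W (b t))"
        if x: "x \<in> carrier L" and z: "z \<in> carrier L" for x z
      proof -
        have c: "f r x \<in> carrier R" "f t x \<in> carrier R" "f t z \<in> carrier R" "f r (W (b t)) \<in> carrier R" "W (b t) \<in> carrier L"
          using fc r t x z Wb by auto
        have 1: "?q \<otimes> f r x = f t x \<otimes> f r (W (b t))"
          using semilinear_smult[OF f[OF r] q x] semilinear_smult[OF f[OF r] c(2,5)] fx[OF t x] by simp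
        have "(?q \<otimes> ?q) \<odot>\<^bsub>L\<^esub> (f r x \<odot>\<^bsub>L\<^esub> z) = (?q \<otimes> f r x) \<odot>\<^bsub>L\<^esub> (?q \<odot>\<^bsub>L\<^esub> z)"
          using q c z by (simp add: L.smult_assoc1[symmetric] A.R.m_ac)
        also have "\<dots> = (f t x \<otimes> f t z) \<odot>\<^bsub>L\<^esub> (f r (W (b t)) \<odot>\<^bsub>L\<^esub> W (b t))"
          unfolding 1 fx[OF t z] using c by (simp add: L.smult_assoc1[symmetric] A.R.m_ac)
        finally show ?thesis .
      qed
      have "(?q \<otimes> ?q) \<odot>\<^bsub>L\<^esub> (f r x \<odot>\<^bsub>L\<^esub> z) = (?q \<otimes> ?q) \<odot>\<^bsub>L\<^esub> (f r z \<odot>\<^bsub>L\<^esub> x)"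
        unfolding e[OF x z] e[OF z x] using fc[OF t x] fc[OF t z] by (simp add: A.R.m_comm)
      then have "(?q \<otimes> ?q) \<odot>\<^bsub>L\<^esub> (f r x \<odot>\<^bsub>L\<^esub> z \<ominus>\<^bsub>L\<^esub> f r z \<odot>\<^bsub>L\<^esub> x) = \<zero>\<^bsub>L\<^esub>"
        using fc[OF r x] fc[OF r z] x z q by (simp add: a_minus_def L.smult_r_distr L.smult_r_minus L.M.r_neg)
      then show "\<exists>s\<in>powers R t. s \<odot>\<^bsub>L\<^esub> (f r x \<odot>\<^bsub>L\<^esub> z \<ominus>\<^bsub>L\<^esub> f r z \<odot>\<^bsub>L\<^esub> x) = \<zero>\<^bsub>L\<^esub>" using qq by (rule bexI)
    qed
    then show ?thesis by (rule L.M.eqI_minus[rotated 2]) (use fc r x z in auto)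
  qed
  obtain h where h: "bij_betw h {0..<card F} F" using ex_bij_betw_nat_finite[OF F(1)] by (elim exE)
  then have h: "bij_betw h {..<card F} F" by (simp add: atLeast0LessThan)
  have hF: "s < card F \<Longrightarrow> h s \<in> F" for s using bij_betwE[OF h] by simp
  have "disc_chart R A n (card F) (\<lambda>s. b (h s)) (\<lambda>s x. y (h s) \<otimes> f (h s) x)"
  proof (intro disc_chart.intro wedge_algebra_axioms disc_chart_axioms.intro)
    fix s assume s: "s < card F"
    show "b (h s) \<in> vecs" by (rule b[OF hF[OF s]])
    show "(\<lambda>x. y (h s) \<otimes> f (h s) x) \<in> semilinear R id L (self_module R)"
      using semilinear_scale[OF SM _ f[OF hF[OF s]] yc[OF hF[OF s]]] by simp
    show "(y (h s) \<otimes> f (h s) x) \<odot>\<^bsub>L\<^esub> z = (y (h s) \<otimes> f (h s) z) \<odot>\<^bsub>L\<^esub> x" if "x \<in> carrier L" "z \<in> carrier L" for x z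
      using rank1[OF hF[OF s] that] yc[OF hF[OF s]] fc[OF hF[OF s]] that by (simp add: L.smult_assoc1)
  next
    have "(\<Oplus>r\<in>F. y r \<otimes> \<rho> r [^] (2 * n)) = (\<Oplus>s\<in>{..<card F}. y (h s) \<otimes> \<rho> (h s) [^] (2 * n))"
      by (rule A.R.finsum_bij[OF h]) (use yc in auto)
    also have "\<dots> = (\<Oplus>s\<in>{..<card F}. y (h s) \<otimes> f (h s) (W (b (h s))))"
      by (rule A.R.finsum_cong'[OF refl]) (use yc hF fc Wb fb in auto)
    finally show "(\<Oplus>s\<in>{..<card F}. y (h s) \<otimes> f (h s) (W (b (h s)))) = \<one>" using y(2) by simp
  qed
  then show ?thesis by (intro exI)
qed

text \<open>The elements \<open>b r j\<close> for all \<open>r\<close> and \<open>j\<close>, with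
  the forms \<open>\<zeta> r j\<close> weighted by a partition of unity in the
  \<open>\<rho> r\<close>, which sums up the local expansions.\<close>

lemma exists_dual_basis: "\<exists>k e \<xi>. dual_basis R A k e \<xi>"
proof -
  obtain y where y: "y \<in> F \<rightarrow> carrier R" "(\<Oplus>r\<in>F. y r \<otimes> \<rho> r) = \<one>"
  proof -
    have "\<exists>y\<in>F \<rightarrow> carrier R. (\<Oplus>r\<in>F. y r \<otimes> \<rho> r) = \<one>"
      by (rule A.R.power_partition[OF F]) (rule \<rho>)
    then show thesis by (elim bexE) (rule that)
  qed
  have yc: "r \<in> F \<Longrightarrow> y r \<in> carrier R" for r using y(1) by auto
  let ?I = "F \<times> {..<n}"
  have fin: "finite ?I" using F by simp
  obtain h where h0: "bij_betw h {0..<card ?I} ?I" using ex_bij_betw_nat_finite[OF fin] by (elim exE)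
  then have h: "bij_betw h {..<card ?I} ?I" by (simp add: atLeast0LessThan)
  have hF: "fst (h s) \<in> F" "snd (h s) < n" if "s < card ?I" for s using bij_betwE[OF h] that by (auto simp: mem_Times_iff)
  have "dual_basis R A (card ?I) (\<lambda>s. b (fst (h s)) (snd (h s))) (\<lambda>s x. y (fst (h s)) \<otimes> \<zeta> (fst (h s)) (snd (h s)) x)"
    unfolding dual_basis_def
  proof (intro conjI allI impI ballI)
    fix s assume s: "s < card ?I"
    show "b (fst (h s)) (snd (h s)) \<in> carrier A" by (rule b_closed[OF hF[OF s]])
    show "(\<lambda>x. y (fst (h s)) \<otimes> \<zeta> (fst (h s)) (snd (h s)) x) \<in> semilinear R id A (self_module R)"
      using semilinear_scale[OF SM _ \<zeta>[OF hF[OF s]] yc[OF hF(1)[OF s]]] by simp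
  next
    fix x assume x: "x \<in> carrier A"
    have "(\<Oplus>\<^bsub>A\<^esub>s\<in>{..<card ?I}. (y (fst (h s)) \<otimes> \<zeta> (fst (h s)) (snd (h s)) x) \<odot>\<^bsub>A\<^esub> b (fst (h s)) (snd (h s)))
      = (\<Oplus>\<^bsub>A\<^esub>p\<in>?I. (y (fst p) \<otimes> \<zeta> (fst p) (snd p) x) \<odot>\<^bsub>A\<^esub> b (fst p) (snd p))"
      by (rule A.M.finsum_bij[OF h, symmetric]) (use x yc in auto)
    also have "\<dots> = (\<Oplus>\<^bsub>A\<^esub>r\<in>F. \<Oplus>\<^bsub>A\<^esub>j\<in>{..<n}. (y r \<otimes> \<zeta> r j x) \<odot>\<^bsub>A\<^esub> b r j)"
      by (rule A.M.finsum_times[symmetric]) (use x yc F in auto)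
    also have "\<dots> = (\<Oplus>\<^bsub>A\<^esub>r\<in>F. (y r \<otimes> \<rho> r) \<odot>\<^bsub>A\<^esub> x)"
    proof (rule A.M.finsum_cong'[OF refl])
      fix r assume r: "r \<in> F"
      have "(\<Oplus>\<^bsub>A\<^esub>j\<in>{..<n}. (y r \<otimes> \<zeta> r j x) \<odot>\<^bsub>A\<^esub> b r j) = (\<Oplus>\<^bsub>A\<^esub>j\<in>{..<n}. y r \<odot>\<^bsub>A\<^esub> (\<zeta> r j x \<odot>\<^bsub>A\<^esub> b r j))"
        by (rule A.M.finsum_cong'[OF refl]) (use r x yc in \<open>auto simp: A.smult_assoc1\<close>)
      also have "\<dots> = y r \<odot>\<^bsub>A\<^esub> (\<rho> r \<odot>\<^bsub>A\<^esub> x)"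
        unfolding expand[OF r x] by (rule A.finsum_smult_ldistr[symmetric]) (use r x yc in auto)
      finally show "(\<Oplus>\<^bsub>A\<^esub>j\<in>{..<n}. (y r \<otimes> \<zeta> r j x) \<odot>\<^bsub>A\<^esub> b r j) = (y r \<otimes> \<rho> r) \<odot>\<^bsub>A\<^esub> x"
        using r x yc by (simp add: A.smult_assoc1)
    qed (use x yc in auto)
    also have "\<dots> = (\<Oplus>r\<in>F. y r \<otimes> \<rho> r) \<odot>\<^bsub>A\<^esub> x"
      by (rule A.finsum_smult_rdistr[symmetric]) (use x yc in auto)
    finally show "x = (\<Oplus>\<^bsub>A\<^esub>s\<in>{..<card ?I}. (y (fst (h s)) \<otimes> \<zeta> (fst (h s)) (snd (h s)) x) \<odot>\<^bsub>A\<^esub> b (fst (h s)) (snd (h s)))"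
      using x y(2) by simp
  qed
  then show ?thesis by (intro exI)
qed

text \<open>The wedge of \<open>u\<close> with all the \<open>v j\<close> has \<open>n + 1\<close>
  factors and vanishes in rank \<open>n\<close>; contracting it with \<xi> gives this relation. The
  proof works in degree \<open>n\<close>: the difference of the sides is alternating in
  \<open>v\<close> and linear in \<open>u\<close>, so it suffices to take both from a local basis
  \<open>b r\<close>.\<close>

lemma cramer:
  assumes \<xi>: "\<xi> \<in> semilinear R id A (self_module R)" and u: "u \<in> carrier A" and v: "v \<in> vecs"
  shows "\<xi> u \<odot>\<^bsub>L\<^esub> W v = (\<Oplus>\<^bsub>L\<^esub>j\<in>{..<n}. \<xi> (v j) \<odot>\<^bsub>L\<^esub> W (v(j := u)))"
proof -
  have xc: "x \<in> carrier A \<Longrightarrow> \<xi> x \<in> carrier R" for x using semilinear_closed[OF \<xi>] by simp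
  let ?g = "\<lambda>u v. \<xi> u \<odot>\<^bsub>L\<^esub> W v \<ominus>\<^bsub>L\<^esub> (\<Oplus>\<^bsub>L\<^esub>j\<in>{..<n}. \<xi> (v j) \<odot>\<^bsub>L\<^esub> W (v(j := u)))"
  have Wu: "W (v(j := u)) \<in> carrier L" if "v \<in> vecs" "u \<in> carrier A" for v j u
    by (rule W_closed[OF upd_Pi[OF that]])
  have trm: "multilinear R A id L n (\<lambda>v. \<xi> (v j) \<odot>\<^bsub>L\<^esub> W (v(j := u)))" if j: "j < n" and u: "u \<in> carrier A" for j u
  proof (rule multilinearI)
    fix f assume f: "f \<in> vecs"
    have fj: "f j \<in> carrier A" using f j by auto
    show "\<xi> (f j) \<odot>\<^bsub>L\<^esub> W (f(j := u)) \<in> carrier L" using xc[OF fj] Wu[OF f u] by simp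
    show "\<xi> (h j) \<odot>\<^bsub>L\<^esub> W (h(j := u)) = \<xi> (f j) \<odot>\<^bsub>L\<^esub> W (f(j := u))" if h: "\<And>i. i < n \<Longrightarrow> h i = f i" for h
    proof -
      have "W (h(j := u)) = W (f(j := u))"
        by (rule alternating_cong[OF W_alternating upd_Pi[OF f u]]) (use h in auto)
      then show ?thesis using h[OF j] by simp
    qed
    fix i assume i: "i < n"
    show "(\<lambda>a. \<xi> ((f(i := a)) j) \<odot>\<^bsub>L\<^esub> W ((f(i := a))(j := u))) \<in> semilinear R id A L"
    proof (cases "i = j")
      case True
      then show ?thesis using semilinear_smult_left[OF L.module_axioms _ \<xi> Wu[OF f u, of j]] by simp
    next
      case False
      have "(\<lambda>a. W ((f(j := u))(i := a))) \<in> semilinear R id A L"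
        by (rule alternating_semilinear[OF W_alternating upd_Pi[OF f u] i])
      from semilinear_scale[OF L.module_axioms _ this xc[OF fj]] show ?thesis using False
        by (simp add: fun_upd_twist)
    qed
  qed
  have gm: "multilinear R A id L n (?g u)" if u: "u \<in> carrier A" for u
  proof -
    have s: "(\<lambda>x. \<xi> u \<odot>\<^bsub>L\<^esub> x) \<in> semilinear R id L L"
      by (rule semilinear_scale[OF L.module_axioms _ id_semilinear xc[OF u]]) simp
    have "multilinear R A (\<lambda>r. id (id r)) L n (\<lambda>v. \<xi> u \<odot>\<^bsub>L\<^esub> W v)"
      by (rule multilinear_comp[OF alternating_multilinear[OF W_alternating] s]) simp
    then have 1: "multilinear R A id L n (\<lambda>v. \<xi> u \<odot>\<^bsub>L\<^esub> W v)" by (simp add: id_def)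
    have 2: "multilinear R A id L n (\<lambda>v. \<Oplus>\<^bsub>L\<^esub>j\<in>{..<n}. \<xi> (v j) \<odot>\<^bsub>L\<^esub> W (v(j := u)))"
      by (rule multilinear_sum[OF L.module_axioms _ trm[OF _ u]]) auto
    show ?thesis by (rule multilinear_diff[OF L.module_axioms _ 1 2]) simp
  qed
  have ga: "alternating R A id L n (?g u)" if u: "u \<in> carrier A" for u
  proof (rule multilinear_alternating[OF gm[OF u]])
    fix f k l assume f: "f \<in> vecs" and kl: "k < n" "l < n" "k \<noteq> l" "f k = f l"
    let ?t = "Transposition.transpose k l"
    have fj: "j < n \<Longrightarrow> f j \<in> carrier A" for j using f by auto
    have "(\<Oplus>\<^bsub>L\<^esub>j\<in>{..<n}. \<xi> (f j) \<odot>\<^bsub>L\<^esub> W (f(j := u))) = \<zero>\<^bsub>L\<^esub>"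
    \<comment> \<open>Exchanging the places \<open>k\<close> and \<open>l\<close> of equal entries
      moves \<open>u\<close> from one to the other and flips the sign. If \<open>u\<close> sits in a
      third place, the wedge still contains the repetition.\<close>
    proof (rule L.M.finsum_involution[where p = ?t])
      fix j assume j: "j \<in> {..<n}"
      have tn: "?t \<in> perms n" using kl by (simp add: transpose_perms)
      show "?t j \<in> {..<n}" using perms_less[OF tn] j by simp
      have ft: "f (?t i) = f i" for i by (rule transpose_same[of f k l, OF kl(4)])
      have "(\<lambda>i. (f(j := u)) (?t i)) = f(?t j := u)"
      proof
        fix i
        have "?t i = j \<longleftrightarrow> i = ?t j" by (metis transpose_involutory)
        then show "(f(j := u)) (?t i) = (f(?t j := u)) i" using ft by simp
      qed
      then have "W (f(?t j := u)) = \<ominus>\<^bsub>L\<^esub> W (f(j := u))"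
        using W_permute[OF tn upd_Pi[OF f u, of j]] kl by (simp add: evenperm_swap)
      then show "\<xi> (f (?t j)) \<odot>\<^bsub>L\<^esub> W (f(?t j := u)) = \<ominus>\<^bsub>L\<^esub> (\<xi> (f j) \<odot>\<^bsub>L\<^esub> W (f(j := u)))"
        using ft xc[OF fj] j Wu[OF f u] by (simp add: L.smult_r_minus)
      show "\<xi> (f j) \<odot>\<^bsub>L\<^esub> W (f(j := u)) = \<zero>\<^bsub>L\<^esub>" if "?t j = j"
      proof -
        have "j \<noteq> k" "j \<noteq> l" using that kl(3) by (auto simp: Transposition.transpose_def)
        then have "W (f(j := u)) = \<zero>\<^bsub>L\<^esub>"
          using alternating_repeated[OF W_alternating upd_Pi[OF f u, of j] kl(1-3)] kl(4) by simp
        then show ?thesis using xc[OF fj] j by simp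
      qed
    qed (use xc[OF fj] Wu[OF f u] in auto)
    moreover have "W f = \<zero>\<^bsub>L\<^esub>" by (rule alternating_repeated[OF W_alternating f kl])
    ultimately show "?g u f = \<zero>\<^bsub>L\<^esub>" using xc[OF u] by simp
  qed
  have gu: "(\<lambda>u. ?g u v) \<in> semilinear R id A L" if v: "v \<in> vecs" for v
  proof (rule semilinear_diff_fun[OF L.module_axioms])
    show "(\<lambda>u. \<xi> u \<odot>\<^bsub>L\<^esub> W v) \<in> semilinear R id A L"
      by (rule semilinear_smult_left[OF L.module_axioms _ \<xi> W_closed[OF v]]) simp
    show "(\<lambda>u. \<Oplus>\<^bsub>L\<^esub>j\<in>{..<n}. \<xi> (v j) \<odot>\<^bsub>L\<^esub> W (v(j := u))) \<in> semilinear R id A L"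
    proof (rule semilinear_sum[OF L.module_axioms])
      fix j assume "j \<in> {..<n}"
      then have j: "j < n" by simp
      have vj: "v j \<in> carrier A" using v j by auto
      show "(\<lambda>u. \<xi> (v j) \<odot>\<^bsub>L\<^esub> W (v(j := u))) \<in> semilinear R id A L"
        by (rule semilinear_scale[OF L.module_axioms _ alternating_semilinear[OF W_alternating v j] xc[OF vj]]) simp
    qed simp
  qed simp
  have gb: "?g (b r i) (b r) = \<zero>\<^bsub>L\<^esub>" if r: "r \<in> F" and i: "i < n" for r i
  proof -
    have bi: "b r i \<in> carrier A" using r i by simp
    have "(\<Oplus>\<^bsub>L\<^esub>j\<in>{..<n}. \<xi> (b r j) \<odot>\<^bsub>L\<^esub> W ((b r)(j := b r i))) = (\<Oplus>\<^bsub>L\<^esub>j\<in>{..<n}. if j = i then \<xi> (b r j) \<odot>\<^bsub>L\<^esub> W (b r) else \<zero>\<^bsub>L\<^esub>)"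
    proof (rule L.M.finsum_cong'[OF refl])
      fix j assume "j \<in> {..<n}"
      then have j: "j < n" by simp
      have "W ((b r)(j := b r i)) = \<zero>\<^bsub>L\<^esub>" if "j \<noteq> i"
        by (rule alternating_repeated[OF W_alternating upd_Pi[OF b[OF r] bi] j i]) (use that in auto)
      then show "\<xi> (b r j) \<odot>\<^bsub>L\<^esub> W ((b r)(j := b r i)) = (if j = i then \<xi> (b r j) \<odot>\<^bsub>L\<^esub> W (b r) else \<zero>\<^bsub>L\<^esub>)"
        using xc[OF b_closed[OF r j]] by (cases "j = i") simp_all
    qed (use xc r b in auto)
    also have "\<dots> = \<xi> (b r i) \<odot>\<^bsub>L\<^esub> W (b r)"
      by (rule L.M.add.finprod_singleton_swap) (use i xc r b in auto)
    finally show ?thesis using xc[OF bi] W_closed[OF b[OF r]] by simp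
  qed
  have "?g u v = \<zero>\<^bsub>L\<^esub>"
  proof (rule alternating_zero[OF L.module_axioms ga[OF u] v])
    fix r assume r: "r \<in> F"
    note lin = gu[OF b[OF r]]
    have "\<rho> r \<odot>\<^bsub>L\<^esub> ?g u (b r) = ?g (\<rho> r \<odot>\<^bsub>A\<^esub> u) (b r)"
      using semilinear_smult[OF lin \<rho>_closed[OF r] u] by simp
    also have "\<dots> = (\<Oplus>\<^bsub>L\<^esub>i\<in>{..<n}. ?g (\<zeta> r i u \<odot>\<^bsub>A\<^esub> b r i) (b r))"
      unfolding expand[OF r u]
      by (rule semilinear_finsum[OF A.abelian_group_axioms L.abelian_group_axioms lin]) (use r u in auto)
    also have "\<dots> = (\<Oplus>\<^bsub>L\<^esub>i\<in>{..<n}. \<zero>\<^bsub>L\<^esub>)"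
    proof (rule L.M.finsum_cong'[OF refl])
      fix i assume "i \<in> {..<n}"
      then have i: "i < n" by simp
      show "?g (\<zeta> r i u \<odot>\<^bsub>A\<^esub> b r i) (b r) = \<zero>\<^bsub>L\<^esub>"
        using semilinear_smult[OF lin \<zeta>_closed[OF r i u] b_closed[OF r i]] gb[OF r i] r i u by simp
    qed auto
    also have "\<dots> = \<zero>\<^bsub>L\<^esub>" by simp
    finally show "\<rho> r \<odot>\<^bsub>L\<^esub> ?g u (b r) = \<zero>\<^bsub>L\<^esub>" .
  qed
  moreover have "\<xi> (v j) \<odot>\<^bsub>L\<^esub> W (v(j := u)) \<in> carrier L" if "j < n" for j
    using xc[of "v j"] Wu[OF v u] v that by auto
  ultimately show ?thesis
    by (intro L.M.eqI_minus[of "\<xi> u \<odot>\<^bsub>L\<^esub> W v"]) (use u v xc in \<open>auto intro!: L.M.finsum_closed\<close>)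
qed

text \<open>Applies \<open>cramer\<close> to the forms of a dual basis, with \<open>x\<close> times
  \<open>e i\<close> for \<open>u\<close>. After the sums are exchanged, the dual basis expansion of
  \<open>v j\<close> reassembles in each entry.\<close>

lemma trace_wedge:
  assumes x: "x \<in> carrier A"
  shows "algebra_trace R A x \<in> carrier R"
    and "v \<in> vecs \<Longrightarrow>
      algebra_trace R A x \<odot>\<^bsub>L\<^esub> W v = (\<Oplus>\<^bsub>L\<^esub>j\<in>{..<n}. W (v(j := x \<otimes>\<^bsub>A\<^esub> v j)))"
proof -
  obtain k e \<xi> where d: "dual_basis R A k e \<xi>" using exists_dual_basis by (elim exE)
  note D = dual_basisD[OF d]
  have tr: "algebra_trace R A x = (\<Oplus>i\<in>{..<k}. \<xi> i (x \<otimes>\<^bsub>A\<^esub> e i))"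
    unfolding algebra_trace_def by (rule module_trace_eq[OF A.module_axioms d mult_semilinear(1)[OF x]])
  have xc: "i < k \<Longrightarrow> y \<in> carrier A \<Longrightarrow> \<xi> i y \<in> carrier R" for i y using semilinear_closed[OF D(2)] by simp
  show "algebra_trace R A x \<in> carrier R" unfolding tr by (rule A.R.finsum_closed) (use xc x D(1) in auto)
  assume v: "v \<in> vecs"
  have vj: "j < n \<Longrightarrow> v j \<in> carrier A" for j using v by auto
  have Wc: "W (v(j := x \<otimes>\<^bsub>A\<^esub> y)) \<in> carrier L" if "y \<in> carrier A" for j y
    by (rule W_closed[OF upd_Pi[OF v]]) (use x that in simp)
  have "algebra_trace R A x \<odot>\<^bsub>L\<^esub> W v = (\<Oplus>\<^bsub>L\<^esub>i\<in>{..<k}. \<xi> i (x \<otimes>\<^bsub>A\<^esub> e i) \<odot>\<^bsub>L\<^esub> W v)"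
    unfolding tr by (rule L.finsum_smult_rdistr) (use xc x D(1) v in auto)
  also have "\<dots> = (\<Oplus>\<^bsub>L\<^esub>i\<in>{..<k}. \<Oplus>\<^bsub>L\<^esub>j\<in>{..<n}. \<xi> i (v j) \<odot>\<^bsub>L\<^esub> W (v(j := x \<otimes>\<^bsub>A\<^esub> e i)))"
    by (rule L.M.finsum_cong'[OF refl])
      (use cramer[OF D(2) _ v] xc x D(1) vj Wc in \<open>auto intro!: L.M.finsum_closed\<close>)
  also have "\<dots> = (\<Oplus>\<^bsub>L\<^esub>j\<in>{..<n}. \<Oplus>\<^bsub>L\<^esub>i\<in>{..<k}. \<xi> i (v j) \<odot>\<^bsub>L\<^esub> W (v(j := x \<otimes>\<^bsub>A\<^esub> e i)))"
    by (rule L.M.finsum_swap) (use xc x D(1) vj Wc in auto)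
  also have "\<dots> = (\<Oplus>\<^bsub>L\<^esub>j\<in>{..<n}. W (v(j := x \<otimes>\<^bsub>A\<^esub> v j)))"
  proof (rule L.M.finsum_cong'[OF refl])
    fix j assume "j \<in> {..<n}"
    then have j: "j < n" by simp
    have lin: "(\<lambda>y. W (v(j := x \<otimes>\<^bsub>A\<^esub> y))) \<in> semilinear R id A L"
      using semilinear_comp[OF mult_semilinear(1)[OF x] alternating_semilinear[OF W_alternating v j]] by (simp add: id_def)
    have "W (v(j := x \<otimes>\<^bsub>A\<^esub> v j)) = W (v(j := x \<otimes>\<^bsub>A\<^esub> (\<Oplus>\<^bsub>A\<^esub>i\<in>{..<k}. \<xi> i (v j) \<odot>\<^bsub>A\<^esub> e i)))"
      using D(3)[OF vj[OF j]] by simp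
    also have "\<dots> = (\<Oplus>\<^bsub>L\<^esub>i\<in>{..<k}. W (v(j := x \<otimes>\<^bsub>A\<^esub> (\<xi> i (v j) \<odot>\<^bsub>A\<^esub> e i))))"
      by (rule semilinear_finsum[OF A.abelian_group_axioms L.abelian_group_axioms lin]) (use xc D(1) vj j in auto)
    also have "\<dots> = (\<Oplus>\<^bsub>L\<^esub>i\<in>{..<k}. \<xi> i (v j) \<odot>\<^bsub>L\<^esub> W (v(j := x \<otimes>\<^bsub>A\<^esub> e i)))"
      by (rule L.M.finsum_cong'[OF refl]) (use xc D(1) vj j Wc semilinear_smult[OF lin] in auto)
    finally show "(\<Oplus>\<^bsub>L\<^esub>i\<in>{..<k}. \<xi> i (v j) \<odot>\<^bsub>L\<^esub> W (v(j := x \<otimes>\<^bsub>A\<^esub> e i))) = W (v(j := x \<otimes>\<^bsub>A\<^esub> v j))" by simp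
  qed (use Wc vj in auto)
  finally show "algebra_trace R A x \<odot>\<^bsub>L\<^esub> W v = (\<Oplus>\<^bsub>L\<^esub>j\<in>{..<n}. W (v(j := x \<otimes>\<^bsub>A\<^esub> v j)))" .
qed

lemma exists_traced_chart: "\<exists>m e cf. traced_chart R A n m e cf (algebra_trace R A)"
proof -
  obtain m e cf where c: "disc_chart R A n m e cf" using exists_chart by (elim exE)
  have "traced_chart R A n m e cf (algebra_trace R A)"
    by (intro traced_chart.intro c traced_chart_axioms.intro trace_wedge)
  then show ?thesis by (intro exI)
qed

end

lemma rank_algebra_chart:
  assumes "rank_algebra R n A"
  shows "\<exists>m e cf. traced_chart R A n m e cf (algebra_trace R A)"
proof -
  interpret A: algebra R A using assms by (simp add: rank_algebra_def)
  obtain F where F: "finite F" "F \<subseteq> carrier R" "Idl\<^bsub>R\<^esub> F = carrier R"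
    and free: "\<forall>r\<in>F. free_of_rank (localization R (powers R r) (self_module R)) n (localization R (powers R r) A)"
    using assms unfolding rank_algebra_def locally_free_of_rank_def by (elim conjE exE)
  have "\<forall>r\<in>F. \<exists>b. module_localization.local_basis R A (powers R r) n b"
  proof
    fix r assume r: "r \<in> F"
    then have "module_localization R A (powers R r)" using A.powers_localization F(2) by blast
    from module_localization.local_basis_of_free[OF this bspec[OF free r]]
    show "\<exists>b. module_localization.local_basis R A (powers R r) n b" .
  qed
  from bchoice[OF this] obtain b where b: "\<forall>r\<in>F. module_localization.local_basis R A (powers R r) n (b r)" by (elim exE)
  interpret locally_free R A n F b
    by unfold_locales (use F b in auto)
  have "\<forall>r\<in>F. \<exists>\<rho>. \<rho> \<in> powers R r \<and> (\<exists>\<zeta>. (\<forall>j<n. \<zeta> j \<in> semilinear R id A (self_module R)) \<and>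
    (\<forall>x\<in>carrier A. \<rho> \<odot>\<^bsub>A\<^esub> x = (\<Oplus>\<^bsub>A\<^esub>j\<in>{..<n}. \<zeta> j x \<odot>\<^bsub>A\<^esub> b r j)) \<and>
    (\<forall>i<n. \<forall>j<n. \<zeta> j (b r i) = (if i = j then \<rho> else \<zero>\<^bsub>R\<^esub>)))"
    by (rule ballI) (rule lifted_coordinates[unfolded Bex_def])
  from bchoice[OF this] obtain \<rho> where \<rho>: "\<forall>r\<in>F. \<rho> r \<in> powers R r \<and> (\<exists>\<zeta>. (\<forall>j<n. \<zeta> j \<in> semilinear R id A (self_module R)) \<and>
    (\<forall>x\<in>carrier A. \<rho> r \<odot>\<^bsub>A\<^esub> x = (\<Oplus>\<^bsub>A\<^esub>j\<in>{..<n}. \<zeta> j x \<odot>\<^bsub>A\<^esub> b r j)) \<and>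
    (\<forall>i<n. \<forall>j<n. \<zeta> j (b r i) = (if i = j then \<rho> r else \<zero>\<^bsub>R\<^esub>)))" by (elim exE)
  then have "\<forall>r\<in>F. \<exists>\<zeta>. (\<forall>j<n. \<zeta> j \<in> semilinear R id A (self_module R)) \<and>
    (\<forall>x\<in>carrier A. \<rho> r \<odot>\<^bsub>A\<^esub> x = (\<Oplus>\<^bsub>A\<^esub>j\<in>{..<n}. \<zeta> j x \<odot>\<^bsub>A\<^esub> b r j)) \<and>
    (\<forall>i<n. \<forall>j<n. \<zeta> j (b r i) = (if i = j then \<rho> r else \<zero>\<^bsub>R\<^esub>))" by (simp (no_asm_simp))
  from bchoice[OF this] obtain \<zeta> where \<zeta>: "\<forall>r\<in>F. (\<forall>j<n. \<zeta> r j \<in> semilinear R id A (self_module R)) \<and>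
    (\<forall>x\<in>carrier A. \<rho> r \<odot>\<^bsub>A\<^esub> x = (\<Oplus>\<^bsub>A\<^esub>j\<in>{..<n}. \<zeta> r j x \<odot>\<^bsub>A\<^esub> b r j)) \<and>
    (\<forall>i<n. \<forall>j<n. \<zeta> r j (b r i) = (if i = j then \<rho> r else \<zero>\<^bsub>R\<^esub>))" by (elim exE)
  have "coordinates R A n F \<rho> b \<zeta>"
  proof (intro coordinates.intro wedge_algebra.intro exterior_power.intro A.algebra_axioms A.module_axioms coordinates_axioms.intro F)
    fix r assume r: "r \<in> F"
    note z = bspec[OF \<zeta> r]
    show "\<rho> r \<in> powers R r" using bspec[OF \<rho> r] by (elim conjE)
    show "b r \<in> {..<n} \<rightarrow> carrier A" using b_closed[OF r] by auto
    show "\<zeta> r j \<in> semilinear R id A (self_module R)" if "j < n" for j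
      using conjunct1[OF z] that by (elim allE impE)
    show "\<rho> r \<odot>\<^bsub>A\<^esub> x = (\<Oplus>\<^bsub>A\<^esub>j\<in>{..<n}. \<zeta> r j x \<odot>\<^bsub>A\<^esub> b r j)" if "x \<in> carrier A" for x
      by (rule bspec[OF conjunct1[OF conjunct2[OF z]] that])
    show "\<zeta> r j (b r i) = (if i = j then \<rho> r else \<zero>\<^bsub>R\<^esub>)" if "i < n" "j < n" for i j
      using conjunct2[OF conjunct2[OF z]] that by (simp (no_asm_simp))
  qed
  then show ?thesis by (rule coordinates.exists_traced_chart)
qed

section \<open>Rank two of the discriminant algebra\<close>

section \<open>Local freeness of the discriminant algebra\<close>

lemma (in abelian_monoid) finsum_lessThan_2:
  "f 0 \<in> carrier G \<Longrightarrow> f 1 \<in> carrier G \<Longrightarrow> (\<Oplus>i\<in>{..<2::nat}. f i) = f 0 \<oplus> f 1"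
proof -
  assume f: "f 0 \<in> carrier G" "f 1 \<in> carrier G"
  have "{..<2::nat} = {0, 1}" by auto
  then show ?thesis using f by simp
qed

lemma (in cring) ideal_finsum:
  assumes J: "ideal J R" and "finite S" "\<And>s. s \<in> S \<Longrightarrow> f s \<in> J"
  shows "(\<Oplus>s\<in>S. f s) \<in> J"
  using assms(2,3)
proof (induction S)
  case empty
  show ?case using additive_subgroup.zero_closed[OF ideal.axioms(1)[OF J]] by simp
next
  case (insert s S)
  have "f t \<in> carrier R" if "t \<in> insert s S" for t
    using additive_subgroup.a_subset[OF ideal.axioms(1)[OF J]] insert(4)[OF that] by auto
  then have "(\<Oplus>t\<in>insert s S. f t) = f s \<oplus> (\<Oplus>t\<in>S. f t)" using insert by (intro finsum_insert) auto
  then show ?case using additive_subgroup.a_closed[OF ideal.axioms(1)[OF J]] insert by simp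
qed

text \<open>Where \<open>cf s (W (e s))\<close> is inverted, \<open>W (e s)\<close> generates
  \<open>L\<close>: by rank one, this element times \<open>x\<close> equals \<open>cf s x\<close>
  times \<open>W (e s)\<close>. Its first power already serves as multiplier in both conditions of
  \<open>local_basis\<close>.\<close>

lemma (in disc_algebra) Delta_local_basis:
  assumes s: "s < m"
  shows "module_localization.local_basis R Delta (powers R (cf s (W (e s)))) 2
    ((\<lambda>_. enc (\<one>, \<zero>\<^bsub>L\<^esub>))(1 := enc (\<zero>, W (e s))))"
proof -
  let ?r = "cf s (W (e s))" and ?b = "(\<lambda>_::nat. enc (\<one>, \<zero>\<^bsub>L\<^esub>))(1 := enc (\<zero>, W (e s)))"
  have r: "?r \<in> carrier R" using s by simp
  then have rp: "?r \<in> powers R ?r" unfolding powers_def by (intro range_eqI[of _ _ 1]) simp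
  have comb: "(\<Oplus>\<^bsub>Delta\<^esub>i\<in>{..<2}. c i \<odot>\<^bsub>Delta\<^esub> ?b i) = enc (c 0, c 1 \<odot>\<^bsub>L\<^esub> W (e s))"
    if c: "c 0 \<in> carrier R" "c 1 \<in> carrier R" for c :: "nat \<Rightarrow> _"
    using s c by (subst D.M.finsum_lessThan_2) simp_all
  show ?thesis
    unfolding module_localization.local_basis_def[OF D.powers_localization[OF r]]
  proof (intro conjI ballI impI)
    show "?b \<in> {..<2} \<rightarrow> carrier Delta" using s by (intro pair_Pi) auto
    fix X assume "X \<in> carrier Delta"
    then obtain u x where X: "X = enc (u, x)" "u \<in> carrier R" "x \<in> carrier L" by (rule DeltaE)
    show "\<exists>t\<in>powers R ?r. \<exists>c\<in>{..<2} \<rightarrow> carrier R. t \<odot>\<^bsub>Delta\<^esub> X = (\<Oplus>\<^bsub>Delta\<^esub>i\<in>{..<2}. c i \<odot>\<^bsub>Delta\<^esub> ?b i)"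
    proof (rule bexI[OF _ rp], rule bexI[of _ "(\<lambda>_. ?r \<otimes> u)(1 := cf s x)"])
      show "?r \<odot>\<^bsub>Delta\<^esub> X = (\<Oplus>\<^bsub>Delta\<^esub>i\<in>{..<2}. ((\<lambda>_. ?r \<otimes> u)(1 := cf s x)) i \<odot>\<^bsub>Delta\<^esub> ?b i)"
        using X r s cf_rank1[OF s We_closed[OF s] X(3)] by (subst comb) auto
    qed (use X s in auto)
  next
    fix c assume c: "c \<in> {..<2::nat} \<rightarrow> carrier R" and z: "(\<Oplus>\<^bsub>Delta\<^esub>i\<in>{..<2}. c i \<odot>\<^bsub>Delta\<^esub> ?b i) = \<zero>\<^bsub>Delta\<^esub>"
    have c01: "c 0 \<in> carrier R" "c 1 \<in> carrier R" using c by auto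
    have W: "c 1 \<odot>\<^bsub>L\<^esub> W (e s) \<in> carrier L" using c01 s by simp
    have "dec (enc (c 0, c 1 \<odot>\<^bsub>L\<^esub> W (e s))) = dec (enc (\<zero>, \<zero>\<^bsub>L\<^esub>))" using z comb[OF c01] by simp
    then have c0: "c 0 = \<zero>" and W0: "c 1 \<odot>\<^bsub>L\<^esub> W (e s) = \<zero>\<^bsub>L\<^esub>" using c01 W by simp_all
    have "c 1 \<otimes> ?r = cf s (c 1 \<odot>\<^bsub>L\<^esub> W (e s))"
      using semilinear_smult[OF cf[OF s] c01(2) We_closed[OF s]] by simp
    then have "?r \<otimes> c 1 = \<zero>"
      using W0 semilinear_zero[OF L.abelian_group_axioms self_group_R cf[OF s]] A.R.m_comm[OF r c01(2)] by simp
    then show "\<exists>t\<in>powers R ?r. \<forall>i<2. t \<otimes> c i = \<zero>"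
      using r c0 by (intro bexI[OF _ rp]) (simp add: less_2_cases_iff)
  qed
qed

text \<open>The elements to be inverted sum to one by the definition of a chart, so they generate
  the unit ideal.\<close>

lemma (in disc_algebra) Delta_rank: "rank_algebra R 2 Delta"
  unfolding rank_algebra_def locally_free_of_rank_def
proof (intro conjI exI ballI)
  let ?F = "(\<lambda>s. cf s (W (e s))) ` {..<m}"
  show "algebra R Delta" by (rule Delta_algebra)
  show "finite ?F" by simp
  show F: "?F \<subseteq> carrier R" by auto
  have J: "ideal (Idl ?F) R" by (rule A.R.genideal_ideal[OF F])
  have "(\<Oplus>s\<in>{..<m}. cf s (W (e s))) \<in> Idl ?F"
    by (rule A.R.ideal_finsum[OF J]) (use A.R.genideal_self[OF F] in auto)
  then show "Idl ?F = carrier R" using cf_sum by (intro ideal.one_imp_carrier[OF J]) simp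
  fix r assume "r \<in> ?F"
  then obtain s where s: "s < m" "r = cf s (W (e s))" by auto
  have r: "r \<in> carrier R" using s by simp
  show "free_of_rank (localization R (powers R r) (self_module R)) 2 (localization R (powers R r) Delta)"
    by (rule module_localization.free_of_local_basis[OF D.powers_localization[OF r]])
      (rule Delta_local_basis[OF s(1), folded s(2)])
qed

section \<open>Transition maps between charts along isomorphisms\<close>

section \<open>Functoriality\<close>

lemma (in cring) minus_plus: "x \<in> carrier R \<Longrightarrow> y \<in> carrier R \<Longrightarrow> (x \<ominus> y) \<oplus> y = x"
  by algebra

lemma (in cring) tau_transfer_identity:
  assumes "p \<in> carrier R" "q \<in> carrier R" "p' \<in> carrier R" "q' \<in> carrier R" and eq: "p' \<oplus> q' = p \<oplus> q"
  shows "((p' \<ominus> p) \<oplus> (p' \<ominus> p)) \<oplus> (q' \<ominus> p') = q \<ominus> p"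
proof -
  have "((p' \<ominus> p) \<oplus> (p' \<ominus> p)) \<oplus> (q' \<ominus> p') = (p' \<oplus> q') \<ominus> (p \<oplus> p)" using assms(1-4) by algebra
  then show ?thesis unfolding eq using assms(1,2) by algebra
qed

text \<open>To be read in the target ring: \<open>p\<close>, \<open>u\<close> are the even and odd
  half norms of the first tuple, \<open>q\<close> is the even one of the second, \<open>x\<close>
  and \<open>y\<close> are the shifts \<lambda>, and \<open>d\<close> is the dual sum of the
  source.\<close>

lemma (in cring) kap_transfer_identity:
  assumes "p \<in> carrier R" "q \<in> carrier R" "u \<in> carrier R" "d \<in> carrier R" "x \<in> carrier R" "y \<in> carrier R"
  shows "((x \<oplus> p) \<otimes> (y \<oplus> q) \<ominus> ((u \<otimes> y \<oplus> q \<otimes> x) \<oplus> d)) \<oplus> (u \<ominus> p) \<otimes> y = x \<otimes> y \<oplus> (p \<otimes> q \<ominus> d)"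
  using assms by algebra

lemma multilinear_precomp:
  assumes g: "multilinear S N \<tau> K n g" and h: "h \<in> semilinear R \<sigma> M N"
    and \<sigma>: "\<And>r. r \<in> carrier R \<Longrightarrow> \<sigma> r \<in> carrier S"
  shows "multilinear R M (\<lambda>r. \<tau> (\<sigma> r)) K n (\<lambda>f. g (\<lambda>j. h (f j)))"
proof (rule multilinearI)
  fix f :: "nat \<Rightarrow> _" assume f: "f \<in> {..<n} \<rightarrow> carrier M"
  have hf: "(\<lambda>j. h (f j)) \<in> {..<n} \<rightarrow> carrier N" using f semilinear_closed[OF h] by auto
  show "g (\<lambda>j. h (f j)) \<in> carrier K" by (rule multilinear_closed[OF g hf])
  show "g (\<lambda>j. h (k j)) = g (\<lambda>j. h (f j))" if "\<And>i. i < n \<Longrightarrow> k i = f i" for k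
    by (rule multilinear_cong[OF g hf]) (simp add: that)
  fix i assume i: "i < n"
  have "(\<lambda>j. h ((f(i := a)) j)) = (\<lambda>j. h (f j))(i := h a)" for a by auto
  then show "(\<lambda>a. g (\<lambda>j. h ((f(i := a)) j))) \<in> semilinear R (\<lambda>r. \<tau> (\<sigma> r)) M K"
    using semilinear_comp[OF h multilinear_semilinear[OF g hf i] \<sigma>] by simp
qed

text \<open>\<open>ext_map\<close> is a definite description: extensionality and the values on
  wedges make the map unique, and it exists by the universal property.\<close>

lemma
  assumes M: "module R M" and M': "module R' M'" and \<sigma>: "\<sigma> \<in> ring_hom R R'"
    and h: "h \<in> semilinear R \<sigma> M M'"
  shows ext_map_semilinear: "ext_map R M R' M' k \<sigma> h \<in> semilinear R \<sigma> (ext_power R k M) (ext_power R' k M')" (is ?s)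
    and ext_map_W: "f \<in> {..<k} \<rightarrow> carrier M \<Longrightarrow>
      ext_map R M R' M' k \<sigma> h (wedge_fun R k M f) = wedge_fun R' k M' (\<lambda>j. h (f j))" (is "_ \<Longrightarrow> ?w")
proof -
  interpret E: exterior_power R M k by (intro exterior_power.intro M)
  interpret E': exterior_power R' M' k by (intro exterior_power.intro M')
  let ?P = "\<lambda>g. g \<in> extensional (carrier E.L) \<and> g \<in> semilinear R \<sigma> E.L E'.L \<and>
    (\<forall>xs\<in>tuples M k. g (wedge R k M xs) = wedge R' k M' (map h xs))"
  have \<sigma>c: "r \<in> carrier R \<Longrightarrow> \<sigma> r \<in> carrier R'" for r using \<sigma> by (rule ring_hom_closed)
  have hf: "(\<lambda>j. h (f j)) \<in> {..<k} \<rightarrow> carrier M'" if "f \<in> {..<k} \<rightarrow> carrier M" for f :: "nat \<Rightarrow> _"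
    using that semilinear_closed[OF h] by auto
  have "multilinear R M (\<lambda>r. id (\<sigma> r)) E'.L k (\<lambda>f. E'.W (\<lambda>j. h (f j)))"
    by (rule multilinear_precomp[OF alternating_multilinear[OF E'.W_alternating] h \<sigma>c])
  then have m: "multilinear R M \<sigma> E'.L k (\<lambda>f. E'.W (\<lambda>j. h (f j)))" by simp
  have "alternating R M \<sigma> E'.L k (\<lambda>f. E'.W (\<lambda>j. h (f j)))"
  proof (rule multilinear_alternating[OF m])
    fix f i j assume f: "f \<in> {..<k} \<rightarrow> carrier M" and ij: "i < k" "j < k" "i \<noteq> j" "f i = f j"
    show "E'.W (\<lambda>j. h (f j)) = \<zero>\<^bsub>E'.L\<^esub>"
      by (rule alternating_repeated[OF E'.W_alternating hf[OF f] ij(1-3)]) (simp add: ij(4))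
  qed
  from E.L_lift[OF E'.L.module_axioms \<sigma> this]
  obtain g where g: "g \<in> semilinear R \<sigma> E.L E'.L" 
    and gW: "\<forall>f\<in>{..<k} \<rightarrow> carrier M. g (E.W f) = E'.W (\<lambda>j. h (f j))" by (elim bexE)
  let ?g = "restrict g (carrier E.L)"
  have gr: "?g \<in> semilinear R \<sigma> E.L E'.L" using g by (auto simp: semilinear_def)
  have tup: "g' (wedge R k M xs) = wedge R' k M' (map h xs)"
    if g': "\<And>f. f \<in> {..<k} \<rightarrow> carrier M \<Longrightarrow> g' (E.W f) = E'.W (\<lambda>j. h (f j))" and xs: "xs \<in> tuples M k" for g' xs
  proof -
    obtain f where f: "f \<in> {..<k} \<rightarrow> carrier M" "xs = map f [0..<k]" using xs unfolding tuples_conv by (elim bexE)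
    then show ?thesis using g'[OF f(1)] by (simp add: wedge_fun_def comp_def)
  qed
  have gW2: "g' (E.W f) = E'.W (\<lambda>j. h (f j))" if "?P g'" and f: "f \<in> {..<k} \<rightarrow> carrier M" for g' f
  proof -
    have "map f [0..<k] \<in> tuples M k" using f by (auto simp: tuples_def)
    with that(1) show ?thesis by (simp add: wedge_fun_def comp_def)
  qed
  have P: "?P ?g"
    using gr by (intro conjI ballI tup restrict_extensional) (simp_all add: gW[rule_format] E.W_closed)
  have "ext_map R M R' M' k \<sigma> h = ?g"
    unfolding ext_map_def
  proof (rule the_equality[where P = ?P, OF P])
    fix g' assume g': "?P g'"
    show "g' = ?g"
    proof (rule extensionalityI)
      fix X assume X: "X \<in> carrier E.L"
      show "g' X = ?g X"
        by (rule E.L_ext[OF E'.L.abelian_group_axioms _ gr _ X]) (use g' gW2[OF g'] gW2[OF P] in simp_all)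
    qed (use g' in simp_all)
  qed
  then show ?s "f \<in> {..<k} \<rightarrow> carrier M \<Longrightarrow> ?w" using gr gW2[OF P] by simp_all
qed

lemma semilinear_cong_base: "(\<And>r. r \<in> carrier R \<Longrightarrow> \<sigma> r = \<tau> r) \<Longrightarrow> semilinear R \<sigma> M N = semilinear R \<tau> M N"
  by (auto simp: semilinear_def)

text \<open>Both sides carry a chart and an encoding of their own, with no compatibility assumed.
  For the identity isomorphism this compares two charts of one algebra.\<close>

locale algebra_iso_pair = S: disc_algebra R A n m e cf T enc + S': disc_algebra R' A' n m' e' cf' T' enc'
  for R (structure) and A (structure) and n m e cf T enc R' A' m' e' cf' T' enc' +
  fixes \<sigma> \<phi>
  assumes iso: "(\<sigma>, \<phi>) \<in> algebra_iso R A R' A'"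
begin

lemma \<sigma>: "\<sigma> \<in> ring_hom R R'" and \<phi>_hom: "\<phi> \<in> ring_hom A A'" and \<phi>: "\<phi> \<in> semilinear R \<sigma> A A'"
  and \<sigma>_bij: "bij_betw \<sigma> (carrier R) (carrier R')" and \<phi>_bij: "bij_betw \<phi> (carrier A) (carrier A')"
  using iso by (auto simp: algebra_iso_def ring_iso_def)

lemma \<sigma>_closed [simp, intro]: "r \<in> carrier R \<Longrightarrow> \<sigma> r \<in> carrier R'" using \<sigma> by (rule ring_hom_closed)

lemma \<phi>_closed [simp, intro]: "x \<in> carrier A \<Longrightarrow> \<phi> x \<in> carrier A'" by (rule semilinear_closed[OF \<phi>])

lemma \<phi>_Pi [simp, intro]: "a \<in> S.vecs \<Longrightarrow> (\<lambda>j. \<phi> (a j)) \<in> S'.vecs" by auto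

lemma \<sigma>_semilinear: "\<sigma> \<in> semilinear R \<sigma> (self_module R) (self_module R')" by (rule semilinear_ring_hom[OF \<sigma>])

lemma \<sigma>_ring: "r \<in> carrier R \<Longrightarrow> s \<in> carrier R \<Longrightarrow> \<sigma> (r \<oplus> s) = \<sigma> r \<oplus>\<^bsub>R'\<^esub> \<sigma> s"
  "r \<in> carrier R \<Longrightarrow> s \<in> carrier R \<Longrightarrow> \<sigma> (r \<otimes> s) = \<sigma> r \<otimes>\<^bsub>R'\<^esub> \<sigma> s"
  "r \<in> carrier R \<Longrightarrow> s \<in> carrier R \<Longrightarrow> \<sigma> (r \<ominus> s) = \<sigma> r \<ominus>\<^bsub>R'\<^esub> \<sigma> s"
  "\<sigma> \<one> = \<one>\<^bsub>R'\<^esub>"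
  using ring_hom_add[OF \<sigma>] ring_hom_mult[OF \<sigma>] ring_hom_one[OF \<sigma>]
    semilinear_diff[OF S.self_group_R S'.self_group_R \<sigma>_semilinear] by simp_all

lemma \<sigma>_finsum: "f \<in> I \<rightarrow> carrier R \<Longrightarrow> \<sigma> (\<Oplus>i\<in>I. f i) = (\<Oplus>\<^bsub>R'\<^esub>i\<in>I. \<sigma> (f i))"
  using semilinear_finsum[OF S.self_group_R S'.self_group_R \<sigma>_semilinear, of f I] by simp

abbreviation "\<phi>L \<equiv> ext_map R A R' A' n \<sigma> \<phi>"

lemma \<phi>L: "\<phi>L \<in> semilinear R \<sigma> S.L S'.L"
  by (rule ext_map_semilinear[OF S.A.module_axioms S'.A.module_axioms \<sigma> \<phi>])

lemma \<phi>L_W: "a \<in> S.vecs \<Longrightarrow> \<phi>L (S.W a) = S'.W (\<lambda>j. \<phi> (a j))"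
  by (rule ext_map_W[OF S.A.module_axioms S'.A.module_axioms \<sigma> \<phi>])

lemma \<phi>L_closed [simp, intro]: "x \<in> carrier S.L \<Longrightarrow> \<phi>L x \<in> carrier S'.L" by (rule semilinear_closed[OF \<phi>L])

lemma \<phi>L_Gam:
  assumes X: "X \<subseteq> perms n" and a: "a \<in> S.vecs" and v: "v \<in> S.vecs"
  shows "\<phi>L (S.Gam X a v) = S'.Gam X (\<lambda>j. \<phi> (a j)) (\<lambda>j. \<phi> (v j))"
proof -
  have p: "p \<in> X \<Longrightarrow> p \<in> perms n" for p using X by auto
  have c: "p \<in> X \<Longrightarrow> S.W (\<lambda>j. a (p j) \<otimes>\<^bsub>A\<^esub> v j) \<in> carrier S.L" for p by (rule S.W_prod[OF p a v])
  have pa: "p \<in> X \<Longrightarrow> (\<lambda>j. \<phi> (a (p j)) \<otimes>\<^bsub>A'\<^esub> \<phi> (v j)) \<in> S'.vecs" for p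
    using S'.prod_Pi[OF p \<phi>_Pi[OF a] \<phi>_Pi[OF v]] .
  have "\<phi>L (S.Gam X a v) = (\<Oplus>\<^bsub>S'.L\<^esub>p\<in>X. \<phi>L (S.W (\<lambda>j. a (p j) \<otimes>\<^bsub>A\<^esub> v j)))"
    unfolding S.Gam_def
    by (rule semilinear_finsum[OF S.L.abelian_group_axioms S'.L.abelian_group_axioms \<phi>L]) (use c in auto)
  also have "\<dots> = S'.Gam X (\<lambda>j. \<phi> (a j)) (\<lambda>j. \<phi> (v j))"
    unfolding S'.Gam_def
  proof (rule S'.L.M.finsum_cong'[OF refl])
    fix q assume q: "q \<in> X"
    have aq: "j < n \<Longrightarrow> a (q j) \<in> carrier A" for j using a perms_less[OF p[OF q]] by auto
    show "\<phi>L (S.W (\<lambda>j. a (q j) \<otimes>\<^bsub>A\<^esub> v j)) = S'.W (\<lambda>j. \<phi> (a (q j)) \<otimes>\<^bsub>A'\<^esub> \<phi> (v j))"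
      unfolding \<phi>L_W[OF S.prod_Pi[OF p[OF q] a v]]
      by (rule alternating_cong[OF S'.W_alternating pa[OF q]]) (use aq v ring_hom_mult[OF \<phi>_hom] in \<open>simp add: Pi_iff\<close>)
  qed (use pa in \<open>auto intro!: S'.W_closed simp del: Pi_split_insert_domain\<close>)
  finally show ?thesis .
qed

text \<open>Where the operator of \<open>a\<close> acts as a scalar, that scalar does not refer to
  the chart and is carried along by the isomorphism. This applies to the full norm always, and to
  the even half norm on tuples with a repetition.\<close>

lemma pol_scalar:
  assumes X: "X \<subseteq> perms n" and a: "a \<in> S.vecs"
    and s: "\<And>v. v \<in> S.vecs \<Longrightarrow> S.Gam X a v = S.pol X a \<odot>\<^bsub>S.L\<^esub> S.W v"
    and s': "\<And>v. v \<in> S'.vecs \<Longrightarrow> S'.Gam X (\<lambda>j. \<phi> (a j)) v = S'.pol X (\<lambda>j. \<phi> (a j)) \<odot>\<^bsub>S'.L\<^esub> S'.W v"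
  shows "S'.pol X (\<lambda>j. \<phi> (a j)) = \<sigma> (S.pol X a)"
proof (rule S'.scalar_cancel)
  show "S'.pol X (\<lambda>j. \<phi> (a j)) \<in> carrier R'" by (rule S'.pol_closed[OF X \<phi>_Pi[OF a]])
  show pc: "\<sigma> (S.pol X a) \<in> carrier R'" by (rule \<sigma>_closed[OF S.pol_closed[OF X a]])
  fix w assume w: "w \<in> S'.vecs"
  \<comment> \<open>Every wedge of the target comes from the source because \<open>\<phi>\<close> is
    bijective.\<close>
  define v where "v j = inv_into (carrier A) \<phi> (w j)" for j
  have v: "v \<in> S.vecs" using w bij_betwE[OF bij_betw_inv_into[OF \<phi>_bij]] by (auto simp: v_def)
  have "S'.W (\<lambda>j. \<phi> (v j)) = S'.W w"
    by (rule alternating_cong[OF S'.W_alternating w]) (use w bij_betw_inv_into_right[OF \<phi>_bij] in \<open>auto simp: v_def\<close>)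
  moreover have "S'.pol X (\<lambda>j. \<phi> (a j)) \<odot>\<^bsub>S'.L\<^esub> S'.W (\<lambda>j. \<phi> (v j)) = \<sigma> (S.pol X a) \<odot>\<^bsub>S'.L\<^esub> S'.W (\<lambda>j. \<phi> (v j))"
    using \<phi>L_Gam[OF X a v] s[OF v] s'[OF \<phi>_Pi[OF v]] semilinear_smult[OF \<phi>L S.pol_closed[OF X a] S.W_closed[OF v]] \<phi>L_W[OF v] by simp
  ultimately show "S'.pol X (\<lambda>j. \<phi> (a j)) \<odot>\<^bsub>S'.L\<^esub> S'.W w = \<sigma> (S.pol X a) \<odot>\<^bsub>S'.L\<^esub> S'.W w" by simp
qed

lemma pol_perms: "a \<in> S.vecs \<Longrightarrow> S'.pol (perms n) (\<lambda>j. \<phi> (a j)) = \<sigma> (S.pol (perms n) a)"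
  by (rule pol_scalar[OF perms_sub(3) _ S.norm_scalar S'.norm_scalar[OF \<phi>_Pi]])

lemma lam_alternating:
  "alternating R A \<sigma> (self_module R') n (\<lambda>a. S'.pol (even_perms n) (\<lambda>j. \<phi> (a j)) \<ominus>\<^bsub>R'\<^esub> \<sigma> (S.pol (even_perms n) a))"
proof (rule multilinear_alternating)
  have "multilinear R A (\<lambda>r. id (\<sigma> r)) (self_module R') n (\<lambda>a. S'.pol (even_perms n) (\<lambda>j. \<phi> (a j)))"
    by (rule multilinear_precomp[OF S'.pol_multilinear[OF perms_sub(1)] \<phi> \<sigma>_closed])
  then have 1: "multilinear R A \<sigma> (self_module R') n (\<lambda>a. S'.pol (even_perms n) (\<lambda>j. \<phi> (a j)))" by simp
  have "multilinear R A (\<lambda>r. \<sigma> (id r)) (self_module R') n (\<lambda>a. \<sigma> (S.pol (even_perms n) a))"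
    by (rule multilinear_comp[OF S.pol_multilinear[OF perms_sub(1)] \<sigma>_semilinear]) simp
  then have 2: "multilinear R A \<sigma> (self_module R') n (\<lambda>a. \<sigma> (S.pol (even_perms n) a))" by simp
  show "multilinear R A \<sigma> (self_module R') n (\<lambda>a. S'.pol (even_perms n) (\<lambda>j. \<phi> (a j)) \<ominus>\<^bsub>R'\<^esub> \<sigma> (S.pol (even_perms n) a))"
    using multilinear_diff[OF S'.self_module_R \<sigma>_closed 1 2] by simp
  fix a k l assume a: "a \<in> S.vecs" and kl: "k < n" "l < n" "k \<noteq> l" "a k = a l"
  have "S'.pol (even_perms n) (\<lambda>j. \<phi> (a j)) = \<sigma> (S.pol (even_perms n) a)"
    by (rule pol_scalar[OF perms_sub(1) a S.half_norm_scalar[OF a _ kl]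
        S'.half_norm_scalar[OF \<phi>_Pi[OF a] _ kl(1-3)]]) (simp_all add: kl(4))
  then show "S'.pol (even_perms n) (\<lambda>j. \<phi> (a j)) \<ominus>\<^bsub>R'\<^esub> \<sigma> (S.pol (even_perms n) a) = \<zero>\<^bsub>self_module R'\<^esub>"
    using a by simp
qed

definition lam where "lam = (SOME h. h \<in> semilinear R \<sigma> S.L (self_module R') \<and>
  (\<forall>a\<in>S.vecs. h (S.W a) = S'.pol (even_perms n) (\<lambda>j. \<phi> (a j)) \<ominus>\<^bsub>R'\<^esub> \<sigma> (S.pol (even_perms n) a)))"

lemma lam: "lam \<in> semilinear R \<sigma> S.L (self_module R')"
  and lam_W: "a \<in> S.vecs \<Longrightarrow>
    lam (S.W a) = S'.pol (even_perms n) (\<lambda>j. \<phi> (a j)) \<ominus>\<^bsub>R'\<^esub> \<sigma> (S.pol (even_perms n) a)"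
proof -
  have "\<exists>h. h \<in> semilinear R \<sigma> S.L (self_module R') \<and>
    (\<forall>a\<in>S.vecs. h (S.W a) = S'.pol (even_perms n) (\<lambda>j. \<phi> (a j)) \<ominus>\<^bsub>R'\<^esub> \<sigma> (S.pol (even_perms n) a))"
    by (rule S.L_lift[OF S'.self_module_R \<sigma> lam_alternating, unfolded Bex_def])
  from someI_ex[OF this, folded lam_def]
  have l: "lam \<in> semilinear R \<sigma> S.L (self_module R') \<and> (\<forall>a\<in>S.vecs.
    lam (S.W a) = S'.pol (even_perms n) (\<lambda>j. \<phi> (a j)) \<ominus>\<^bsub>R'\<^esub> \<sigma> (S.pol (even_perms n) a))" .
  show "lam \<in> semilinear R \<sigma> S.L (self_module R')" by (rule conjunct1[OF l])
  show "a \<in> S.vecs \<Longrightarrow>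
    lam (S.W a) = S'.pol (even_perms n) (\<lambda>j. \<phi> (a j)) \<ominus>\<^bsub>R'\<^esub> \<sigma> (S.pol (even_perms n) a)"
    by (rule bspec[OF conjunct2[OF l]])
qed

lemma lam_closed [simp, intro]: "x \<in> carrier S.L \<Longrightarrow> lam x \<in> carrier R'"
  using semilinear_closed[OF lam] by simp

text \<open>The norm G + G' is independent of the chart, so a change of G by \<lambda> forces the
  opposite change of G', and their difference \<tau> changes by twice \<lambda>.\<close>

lemma tau_transfer:
  assumes x: "x \<in> carrier S.L"
  shows "(lam x \<oplus>\<^bsub>R'\<^esub> lam x) \<oplus>\<^bsub>R'\<^esub> S'.tau (\<phi>L x) = \<sigma> (S.tau x)"
proof (rule S.L_ext[OF S'.self_group_R _ _ _ x])
  have 1: "(\<lambda>x. S'.tau (\<phi>L x)) \<in> semilinear R \<sigma> S.L (self_module R')"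
    using semilinear_comp[OF \<phi>L S'.tau \<sigma>_closed] by simp
  have 2: "(\<lambda>x. lam x \<oplus>\<^bsub>self_module R'\<^esub> lam x) \<in> semilinear R \<sigma> S.L (self_module R')"
    by (rule semilinear_add_fun[OF S'.self_module_R \<sigma>_closed lam lam])
  show "(\<lambda>x. (lam x \<oplus>\<^bsub>R'\<^esub> lam x) \<oplus>\<^bsub>R'\<^esub> S'.tau (\<phi>L x)) \<in> semilinear R \<sigma> S.L (self_module R')"
    using semilinear_add_fun[OF S'.self_module_R \<sigma>_closed 2 1] by simp
  show "(\<lambda>x. \<sigma> (S.tau x)) \<in> semilinear R \<sigma> S.L (self_module R')"
    using semilinear_comp[OF S.tau \<sigma>_semilinear] by simp
  fix a assume a: "a \<in> S.vecs"
  let ?P = "S.pol (even_perms n) a" and ?O = "S.pol (odd_perms n) a"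
  let ?P' = "S'.pol (even_perms n) (\<lambda>j. \<phi> (a j))" and ?O' = "S'.pol (odd_perms n) (\<lambda>j. \<phi> (a j))"
  have c: "\<sigma> ?P \<in> carrier R'" "\<sigma> ?O \<in> carrier R'" "?P' \<in> carrier R'" "?O' \<in> carrier R'" using a by auto
  have "?P' \<oplus>\<^bsub>R'\<^esub> ?O' = \<sigma> ?P \<oplus>\<^bsub>R'\<^esub> \<sigma> ?O"
    using pol_perms[OF a] a by (simp add: S.pol_split[OF a] S'.pol_split[OF \<phi>_Pi[OF a]] \<sigma>_ring)
  from S'.A.R.tau_transfer_identity[OF c this]
  show "(lam (S.W a) \<oplus>\<^bsub>R'\<^esub> lam (S.W a)) \<oplus>\<^bsub>R'\<^esub> S'.tau (\<phi>L (S.W a)) = \<sigma> (S.tau (S.W a))"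
    using a by (simp add: lam_W S.tau_W S'.tau_W \<phi>L_W \<sigma>_ring)
qed

text \<open>Each half norm in the sum changes by \<lambda> of a wedge; together these give \<lambda>
  of the even sum of wedges, which \<open>even_half_product\<close> evaluates.\<close>

lemma dual_sum_transfer:
  assumes a: "a \<in> S.vecs" and b: "b \<in> S.vecs"
  shows "S'.dual_sum (\<lambda>j. \<phi> (a j)) (\<lambda>j. \<phi> (b j)) = 
    (\<sigma> (S.pol (odd_perms n) a) \<otimes>\<^bsub>R'\<^esub> lam (S.W b) \<oplus>\<^bsub>R'\<^esub> \<sigma> (S.pol (even_perms n) b) \<otimes>\<^bsub>R'\<^esub> lam (S.W a)) \<oplus>\<^bsub>R'\<^esub> \<sigma> (S.dual_sum a b)"
proof -
  let ?ab = "\<lambda>q j. a j \<otimes>\<^bsub>A\<^esub> b (q j)"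
  have ab: "q \<in> even_perms n \<Longrightarrow> ?ab q \<in> S.vecs" for q by (rule S.prod_Pi'[OF _ a b]) auto
  have Wc: "q \<in> even_perms n \<Longrightarrow> S.W (?ab q) \<in> carrier S.L" for q by (rule S.W_closed[OF ab])
  have eq: "S'.pol (even_perms n) (\<lambda>j. \<phi> (a j) \<otimes>\<^bsub>A'\<^esub> \<phi> (b (q j))) = lam (S.W (?ab q)) \<oplus>\<^bsub>R'\<^esub> \<sigma> (S.pol (even_perms n) (?ab q))"
    if q: "q \<in> even_perms n" for q
  proof -
    have bq: "j < n \<Longrightarrow> b (q j) \<in> carrier A" for j using b perms_less[OF perms_memI(1)[OF q]] by auto
    have "S'.pol (even_perms n) (\<lambda>j. \<phi> (a j) \<otimes>\<^bsub>A'\<^esub> \<phi> (b (q j))) = S'.pol (even_perms n) (\<lambda>j. \<phi> (?ab q j))"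
      by (rule multilinear_cong[OF S'.pol_multilinear[OF perms_sub(1)] \<phi>_Pi[OF ab[OF q]]])
        (use a bq ring_hom_mult[OF \<phi>_hom] in \<open>simp add: Pi_iff\<close>)
    also have "\<dots> = lam (S.W (?ab q)) \<oplus>\<^bsub>R'\<^esub> \<sigma> (S.pol (even_perms n) (?ab q))"
    proof -
      have c: "S'.pol (even_perms n) (\<lambda>j. \<phi> (?ab q j)) \<in> carrier R'" "\<sigma> (S.pol (even_perms n) (?ab q)) \<in> carrier R'"
        by (rule S'.pol_closed'(2)[OF \<phi>_Pi[OF ab[OF q]]], rule \<sigma>_closed[OF S.pol_closed'(2)[OF ab[OF q]]])
      then show ?thesis unfolding lam_W[OF ab[OF q]] by (rule S'.A.R.minus_plus[symmetric])
    qed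
    finally show ?thesis .
  qed
  have lc: "q \<in> even_perms n \<Longrightarrow> lam (S.W (?ab q)) \<in> carrier R'" for q by (rule lam_closed[OF Wc])
  have pc: "q \<in> even_perms n \<Longrightarrow> \<sigma> (S.pol (even_perms n) (?ab q)) \<in> carrier R'" for q
    by (rule \<sigma>_closed[OF S.pol_closed'(2)[OF ab]])
  have "S'.dual_sum (\<lambda>j. \<phi> (a j)) (\<lambda>j. \<phi> (b j)) = (\<Oplus>\<^bsub>R'\<^esub>q\<in>even_perms n. lam (S.W (?ab q)) \<oplus>\<^bsub>R'\<^esub> \<sigma> (S.pol (even_perms n) (?ab q)))"
    unfolding S'.dual_sum_def by (rule S'.A.R.finsum_cong'[OF refl]) (use lc pc eq in auto)
  also have "\<dots> = (\<Oplus>\<^bsub>R'\<^esub>q\<in>even_perms n. lam (S.W (?ab q))) \<oplus>\<^bsub>R'\<^esub> (\<Oplus>\<^bsub>R'\<^esub>q\<in>even_perms n. \<sigma> (S.pol (even_perms n) (?ab q)))"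
    by (rule S'.A.R.finsum_addf) (use lc pc in auto)
  also have "(\<Oplus>\<^bsub>R'\<^esub>q\<in>even_perms n. \<sigma> (S.pol (even_perms n) (?ab q))) = \<sigma> (S.dual_sum a b)"
    unfolding S.dual_sum_def by (rule \<sigma>_finsum[symmetric]) (use S.pol_closed'(2)[OF ab] in auto)
  also have "(\<Oplus>\<^bsub>R'\<^esub>q\<in>even_perms n. lam (S.W (?ab q))) = lam (S.Gam (even_perms n) a b)"
    using S.semilinear_even_sum[OF lam S'.self_group_R a b] by simp
  also have "\<dots> = \<sigma> (S.pol (odd_perms n) a) \<otimes>\<^bsub>R'\<^esub> lam (S.W b) \<oplus>\<^bsub>R'\<^esub> \<sigma> (S.pol (even_perms n) b) \<otimes>\<^bsub>R'\<^esub> lam (S.W a)"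
    unfolding S.even_half_product[OF a b]
    using a b by (simp add: semilinear_add[OF lam, simplified] semilinear_smult[OF lam, simplified])
  finally show ?thesis .
qed

text \<open>Checked on wedges in both variables, where it becomes an identity between half norms and
  shifts. The term with \<tau> appears because \<open>dual_sum_transfer\<close> involves the odd
  half norm of the first tuple.\<close>

lemma kap_transfer:
  assumes x: "x \<in> carrier S.L" and y: "y \<in> carrier S.L"
  shows "S'.kap (\<phi>L x) (\<phi>L y) \<oplus>\<^bsub>R'\<^esub> \<sigma> (S.tau x) \<otimes>\<^bsub>R'\<^esub> lam y = lam x \<otimes>\<^bsub>R'\<^esub> lam y \<oplus>\<^bsub>R'\<^esub> \<sigma> (S.kap x y)"
proof -
  have add: "(\<lambda>x. h x \<oplus>\<^bsub>R'\<^esub> k x) \<in> semilinear R \<sigma> S.L (self_module R')"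
    if "h \<in> semilinear R \<sigma> S.L (self_module R')" "k \<in> semilinear R \<sigma> S.L (self_module R')" for h k
    using semilinear_add_fun[OF S'.self_module_R \<sigma>_closed that] by simp
  have sc: "(\<lambda>x. c \<otimes>\<^bsub>R'\<^esub> h x) \<in> semilinear R \<sigma> S.L (self_module R')"
    "(\<lambda>x. h x \<otimes>\<^bsub>R'\<^esub> c) \<in> semilinear R \<sigma> S.L (self_module R')"
    if "c \<in> carrier R'" "h \<in> semilinear R \<sigma> S.L (self_module R')" for h c
    using semilinear_scale[OF S'.self_module_R \<sigma>_closed that(2,1)] semilinear_smult_left[OF S'.self_module_R \<sigma>_closed that(2), of c] that by simp_all
  have st: "(\<lambda>x. \<sigma> (S.tau x)) \<in> semilinear R \<sigma> S.L (self_module R')"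
    using semilinear_comp[OF S.tau \<sigma>_semilinear] by simp
  have sk: "(\<lambda>y. \<sigma> (S.kap x y)) \<in> semilinear R \<sigma> S.L (self_module R')" if "x \<in> carrier S.L" for x
    using semilinear_comp[OF S.kap[OF that] \<sigma>_semilinear] by simp
  have sk': "(\<lambda>x. \<sigma> (S.kap x y)) \<in> semilinear R \<sigma> S.L (self_module R')" if "y \<in> carrier S.L" for y
    using semilinear_comp[OF S.kap'[OF that] \<sigma>_semilinear] by simp
  have k: "(\<lambda>y. S'.kap (\<phi>L x) (\<phi>L y)) \<in> semilinear R \<sigma> S.L (self_module R')" if "x \<in> carrier S.L" for x
    using semilinear_comp[OF \<phi>L S'.kap[OF \<phi>L_closed[OF that]] \<sigma>_closed] by simp
  have k': "(\<lambda>x. S'.kap (\<phi>L x) (\<phi>L y)) \<in> semilinear R \<sigma> S.L (self_module R')" if "y \<in> carrier S.L" for y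
    using semilinear_comp[OF \<phi>L S'.kap'[OF \<phi>L_closed[OF that]] \<sigma>_closed] by simp
  have tc: "x \<in> carrier S.L \<Longrightarrow> \<sigma> (S.tau x) \<in> carrier R'" for x by auto
  show ?thesis
  proof (rule S.L_ext[OF S'.self_group_R add[OF k'[OF y] sc(2)[OF lam_closed[OF y] st]] add[OF sc(2)[OF lam_closed[OF y] lam] sk'[OF y]] _ x])
    fix a assume a: "a \<in> S.vecs"
    note Wa = S.W_closed[OF a]
    show "S'.kap (\<phi>L (S.W a)) (\<phi>L y) \<oplus>\<^bsub>R'\<^esub> \<sigma> (S.tau (S.W a)) \<otimes>\<^bsub>R'\<^esub> lam y = lam (S.W a) \<otimes>\<^bsub>R'\<^esub> lam y \<oplus>\<^bsub>R'\<^esub> \<sigma> (S.kap (S.W a) y)"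
    proof (rule S.L_ext[OF S'.self_group_R add[OF k[OF Wa] sc(1)[OF tc[OF Wa] lam]] add[OF sc(1)[OF lam_closed[OF Wa] lam] sk[OF Wa]] _ y])
      fix b assume b: "b \<in> S.vecs"
      let ?E = "even_perms n"
      have p': "S'.pol ?E (\<lambda>j. \<phi> (c j)) = lam (S.W c) \<oplus>\<^bsub>R'\<^esub> \<sigma> (S.pol ?E c)" if c: "c \<in> S.vecs" for c
      proof -
        have "S'.pol ?E (\<lambda>j. \<phi> (c j)) \<in> carrier R'" "\<sigma> (S.pol ?E c) \<in> carrier R'" using c by auto
        then show ?thesis unfolding lam_W[OF c] by (rule S'.A.R.minus_plus[symmetric])
      qed
      have dc: "\<sigma> (S.dual_sum a b) \<in> carrier R'"
        unfolding S.dual_sum_def by (intro \<sigma>_closed S.A.R.finsum_closed) (auto intro!: S.pol_prod_closed a b perms_sub)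
      have cl: "lam (S.W a) \<in> carrier R'" "lam (S.W b) \<in> carrier R'" "\<sigma> (S.pol ?E a) \<in> carrier R'" "\<sigma> (S.pol ?E b) \<in> carrier R'"
        "\<sigma> (S.pol (odd_perms n) a) \<in> carrier R'" using a b by auto
      have dc0: "S.dual_sum a b \<in> carrier R"
        unfolding S.dual_sum_def by (intro S.A.R.finsum_closed) (auto intro!: S.pol_prod_closed a b perms_sub)
      have l: "S'.kap (\<phi>L (S.W a)) (\<phi>L (S.W b)) = (lam (S.W a) \<oplus>\<^bsub>R'\<^esub> \<sigma> (S.pol ?E a)) \<otimes>\<^bsub>R'\<^esub> (lam (S.W b) \<oplus>\<^bsub>R'\<^esub> \<sigma> (S.pol ?E b)) \<ominus>\<^bsub>R'\<^esub>
        ((\<sigma> (S.pol (odd_perms n) a) \<otimes>\<^bsub>R'\<^esub> lam (S.W b) \<oplus>\<^bsub>R'\<^esub> \<sigma> (S.pol ?E b) \<otimes>\<^bsub>R'\<^esub> lam (S.W a)) \<oplus>\<^bsub>R'\<^esub> \<sigma> (S.dual_sum a b))"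
        by (simp add: \<phi>L_W a b S'.kap_W p' dual_sum_transfer)
      have r: "\<sigma> (S.kap (S.W a) (S.W b)) = \<sigma> (S.pol ?E a) \<otimes>\<^bsub>R'\<^esub> \<sigma> (S.pol ?E b) \<ominus>\<^bsub>R'\<^esub> \<sigma> (S.dual_sum a b)"
        "\<sigma> (S.tau (S.W a)) = \<sigma> (S.pol (odd_perms n) a) \<ominus>\<^bsub>R'\<^esub> \<sigma> (S.pol ?E a)"
        using a b dc0 by (simp_all add: S.kap_W S.tau_W \<sigma>_ring)
      show "S'.kap (\<phi>L (S.W a)) (\<phi>L (S.W b)) \<oplus>\<^bsub>R'\<^esub> \<sigma> (S.tau (S.W a)) \<otimes>\<^bsub>R'\<^esub> lam (S.W b) =
        lam (S.W a) \<otimes>\<^bsub>R'\<^esub> lam (S.W b) \<oplus>\<^bsub>R'\<^esub> \<sigma> (S.kap (S.W a) (S.W b))"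
        unfolding l r by (rule S'.A.R.kap_transfer_identity) (use cl dc in auto)
    qed
  qed
qed

end

text \<open>The hypothesis \<open>eq\<close> is \<open>kap_transfer\<close>, with \<open>x\<close>
  and \<open>y\<close> the shifts and \<open>t\<close> the value of \<tau> in the source. It turns
  the product of the shifted scalars into the shifted scalar part of the product.\<close>

lemma (in cring) Phi_identity:
  assumes "a \<in> carrier R" "b \<in> carrier R" "k \<in> carrier R" "k' \<in> carrier R" "x \<in> carrier R" "y \<in> carrier R" "t \<in> carrier R"
    and eq: "k' \<oplus> t \<otimes> y = x \<otimes> y \<oplus> k"
  shows "(a \<otimes> b \<ominus> k) \<oplus> ((a \<otimes> y \<oplus> b \<otimes> x) \<oplus> t \<otimes> y) = (a \<oplus> x) \<otimes> (b \<oplus> y) \<ominus> k'"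
proof -
  have "(a \<otimes> b \<ominus> k) \<oplus> ((a \<otimes> y \<oplus> b \<otimes> x) \<oplus> t \<otimes> y) = ((a \<otimes> b \<ominus> k) \<oplus> (a \<otimes> y \<oplus> b \<otimes> x)) \<oplus> ((k' \<oplus> t \<otimes> y) \<ominus> k')"
    using assms(1-7) by algebra
  then show ?thesis unfolding eq using assms(1-6) by algebra
qed

lemma (in cring) minus_chain: "x \<in> carrier R \<Longrightarrow> y \<in> carrier R \<Longrightarrow> z \<in> carrier R \<Longrightarrow> (y \<ominus> x) \<oplus> (z \<ominus> y) = z \<ominus> x"
  by algebra

context algebra_iso_pair
begin

definition Phi where
  "Phi X = enc' (\<sigma> (fst (S.dec X)) \<oplus>\<^bsub>R'\<^esub> lam (snd (S.dec X)), \<phi>L (snd (S.dec X)))"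

lemma Phi_enc: "r \<in> carrier R \<Longrightarrow> x \<in> carrier S.L \<Longrightarrow> Phi (enc (r, x)) = enc' (\<sigma> r \<oplus>\<^bsub>R'\<^esub> lam x, \<phi>L x)"
  by (simp add: Phi_def)

lemmas lam_lin = semilinear_add[OF lam, simplified] semilinear_smult[OF lam, simplified]
lemmas \<phi>L_lin = semilinear_add[OF \<phi>L] semilinear_smult[OF \<phi>L]

lemma lam_swap: "x \<in> carrier S.L \<Longrightarrow> y \<in> carrier S.L \<Longrightarrow> lam x \<odot>\<^bsub>S'.L\<^esub> \<phi>L y = lam y \<odot>\<^bsub>S'.L\<^esub> \<phi>L x"
  by (rule S.rank1[OF S'.L.module_axioms \<sigma> lam \<phi>L])

lemma Phi_closed: "X \<in> carrier S.Delta \<Longrightarrow> Phi X \<in> carrier S'.Delta"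
  by (auto elim!: S.DeltaE simp: Phi_enc)

lemma Phi_add: 
  assumes "X \<in> carrier S.Delta" "Y \<in> carrier S.Delta"
  shows "Phi (X \<oplus>\<^bsub>S.Delta\<^esub> Y) = Phi X \<oplus>\<^bsub>S'.Delta\<^esub> Phi Y"
proof -
  obtain r x where X: "X = enc (r, x)" "r \<in> carrier R" "x \<in> carrier S.L" using assms(1) by (rule S.DeltaE)
  obtain s y where Y: "Y = enc (s, y)" "s \<in> carrier R" "y \<in> carrier S.L" using assms(2) by (rule S.DeltaE)
  show ?thesis using X Y by (simp add: Phi_enc lam_lin \<phi>L_lin \<sigma>_ring S'.A.R.a_ac)
qed

text \<open>The first coordinates agree by \<open>kap_transfer\<close>. In the second ones, the
  change of \<tau> by twice \<lambda> is made up for by the two shifted scalars, since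
  \<open>lam x\<close> times the image of \<open>y\<close> is symmetric by rank one.\<close>

lemma Phi_mult: 
  assumes "X \<in> carrier S.Delta" "Y \<in> carrier S.Delta"
  shows "Phi (X \<otimes>\<^bsub>S.Delta\<^esub> Y) = Phi X \<otimes>\<^bsub>S'.Delta\<^esub> Phi Y"
proof -
  obtain r x where X: "X = enc (r, x)" "r \<in> carrier R" "x \<in> carrier S.L" using assms(1) by (rule S.DeltaE)
  obtain s y where Y: "Y = enc (s, y)" "s \<in> carrier R" "y \<in> carrier S.L" using assms(2) by (rule S.DeltaE)
  note c = X(2,3) Y(2,3)
  have 1: "(\<sigma> r \<otimes>\<^bsub>R'\<^esub> \<sigma> s \<ominus>\<^bsub>R'\<^esub> \<sigma> (S.kap x y)) \<oplus>\<^bsub>R'\<^esub> ((\<sigma> r \<otimes>\<^bsub>R'\<^esub> lam y \<oplus>\<^bsub>R'\<^esub> \<sigma> s \<otimes>\<^bsub>R'\<^esub> lam x) \<oplus>\<^bsub>R'\<^esub> \<sigma> (S.tau x) \<otimes>\<^bsub>R'\<^esub> lam y) =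
    (\<sigma> r \<oplus>\<^bsub>R'\<^esub> lam x) \<otimes>\<^bsub>R'\<^esub> (\<sigma> s \<oplus>\<^bsub>R'\<^esub> lam y) \<ominus>\<^bsub>R'\<^esub> S'.kap (\<phi>L x) (\<phi>L y)"
    by (rule S'.A.R.Phi_identity) (use c kap_transfer in auto)
  have 2: "(\<sigma> r \<odot>\<^bsub>S'.L\<^esub> \<phi>L y \<oplus>\<^bsub>S'.L\<^esub> \<sigma> s \<odot>\<^bsub>S'.L\<^esub> \<phi>L x) \<oplus>\<^bsub>S'.L\<^esub> \<sigma> (S.tau x) \<odot>\<^bsub>S'.L\<^esub> \<phi>L y =
    ((\<sigma> r \<oplus>\<^bsub>R'\<^esub> lam x) \<odot>\<^bsub>S'.L\<^esub> \<phi>L y \<oplus>\<^bsub>S'.L\<^esub> (\<sigma> s \<oplus>\<^bsub>R'\<^esub> lam y) \<odot>\<^bsub>S'.L\<^esub> \<phi>L x) \<oplus>\<^bsub>S'.L\<^esub> S'.tau (\<phi>L x) \<odot>\<^bsub>S'.L\<^esub> \<phi>L y"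
    unfolding tau_transfer[OF c(2), symmetric]
    using c lam_swap[OF c(4,2)] by (simp add: S'.L.smult_l_distr S'.L.M.a_ac)
  show ?thesis using X Y 1 2 by (simp add: Phi_enc lam_lin \<phi>L_lin \<sigma>_ring)
qed

lemma Phi_semilinear: "Phi \<in> semilinear R \<sigma> S.Delta S'.Delta"
proof (rule semilinearI)
  fix t X assume t: "t \<in> carrier R" and "X \<in> carrier S.Delta"
  then obtain r x where X: "X = enc (r, x)" "r \<in> carrier R" "x \<in> carrier S.L" by (elim S.DeltaE)
  then show "Phi (t \<odot>\<^bsub>S.Delta\<^esub> X) = \<sigma> t \<odot>\<^bsub>S'.Delta\<^esub> Phi X"
    using t by (simp add: Phi_enc lam_lin \<phi>L_lin \<sigma>_ring S'.A.R.r_distr)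
qed (simp_all add: Phi_closed Phi_add)

lemma Phi_one: "Phi \<one>\<^bsub>S.Delta\<^esub> = \<one>\<^bsub>S'.Delta\<^esub>"
  using semilinear_zero[OF S.L.abelian_group_axioms S'.self_group_R lam]
    semilinear_zero[OF S.L.abelian_group_axioms S'.L.abelian_group_axioms \<phi>L]
  by (simp add: Phi_enc \<sigma>_ring)

text \<open>In the minor the shifts contribute \<open>lam x\<close> times the image of
  \<open>y\<close> and, with the opposite sign, the same with \<open>x\<close> and \<open>y\<close>
  exchanged; they cancel by rank one.\<close>

lemma theta_natural:
  assumes X: "X \<in> carrier S.D2.L"
  shows "S'.theta (ext_map R S.Delta R' S'.Delta 2 \<sigma> Phi X) = \<phi>L (S.theta X)"
proof (rule S.D2.L_ext[OF S'.L.abelian_group_axioms _ _ _ X])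
  note E = ext_map_semilinear[OF S.D.module_axioms S'.D.module_axioms \<sigma> Phi_semilinear, of 2]
  show "(\<lambda>X. S'.theta (ext_map R S.Delta R' S'.Delta 2 \<sigma> Phi X)) \<in> semilinear R \<sigma> S.D2.L S'.L"
    using semilinear_comp[OF E S'.theta \<sigma>_closed] by simp
  show "(\<lambda>X. \<phi>L (S.theta X)) \<in> semilinear R \<sigma> S.D2.L S'.L"
    using semilinear_comp[OF S.theta \<phi>L] by simp
  fix f :: "nat \<Rightarrow> _" assume f: "f \<in> {..<2} \<rightarrow> carrier S.Delta"
  have f01: "f 0 \<in> carrier S.Delta" "f 1 \<in> carrier S.Delta" using f by auto
  obtain r x where X: "f 0 = enc (r, x)" "r \<in> carrier R" "x \<in> carrier S.L" using f01(1) by (rule S.DeltaE)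
  obtain s y where Y: "f 1 = enc (s, y)" "s \<in> carrier R" "y \<in> carrier S.L" using f01(2) by (rule S.DeltaE)
  have Pf: "(\<lambda>j. Phi (f j)) \<in> {..<2} \<rightarrow> carrier S'.Delta" using f Phi_closed by auto
  have "S'.theta (ext_map R S.Delta R' S'.Delta 2 \<sigma> Phi (S.D2.W f)) = 
    (\<sigma> r \<oplus>\<^bsub>R'\<^esub> lam x) \<odot>\<^bsub>S'.L\<^esub> \<phi>L y \<ominus>\<^bsub>S'.L\<^esub> (\<sigma> s \<oplus>\<^bsub>R'\<^esub> lam y) \<odot>\<^bsub>S'.L\<^esub> \<phi>L x"
    unfolding ext_map_W[OF S.D.module_axioms S'.D.module_axioms \<sigma> Phi_semilinear f] S'.theta_W[OF Pf]
    using X Y by (simp add: Phi_enc)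
  also have "\<dots> = \<sigma> r \<odot>\<^bsub>S'.L\<^esub> \<phi>L y \<ominus>\<^bsub>S'.L\<^esub> \<sigma> s \<odot>\<^bsub>S'.L\<^esub> \<phi>L x"
    using X Y lam_swap[OF Y(3) X(3)]
    by (simp add: S'.L.smult_l_distr a_minus_def S'.L.M.minus_add S'.L.M.a_ac S'.L.M.r_neg S'.L.M.r_neg1 S'.L.M.r_neg2)
  also have "\<dots> = \<phi>L (S.theta (S.D2.W f))"
    unfolding S.theta_W[OF f] using X Y
    by (simp add: semilinear_diff[OF S.L.abelian_group_axioms S'.L.abelian_group_axioms \<phi>L] \<phi>L_lin)
  finally show "S'.theta (ext_map R S.Delta R' S'.Delta 2 \<sigma> Phi (S.D2.W f)) = \<phi>L (S.theta (S.D2.W f))" .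
qed

end

lemma algebra_iso_cong:
  assumes "algebra R A" "(\<sigma>', \<phi>') \<in> algebra_iso R A R' A'"
    and "\<And>r. r \<in> carrier R \<Longrightarrow> \<sigma> r = \<sigma>' r" "\<And>a. a \<in> carrier A \<Longrightarrow> \<phi> a = \<phi>' a"
  shows "(\<sigma>, \<phi>) \<in> algebra_iso R A R' A'"
proof -
  interpret algebra R A by fact
  have "bij_betw \<sigma> (carrier R) (carrier R') = bij_betw \<sigma>' (carrier R) (carrier R')"
    by (rule bij_betw_cong) (rule assms(3))
  moreover have "bij_betw \<phi> (carrier A) (carrier A') = bij_betw \<phi>' (carrier A) (carrier A')"
    by (rule bij_betw_cong) (rule assms(4))
  ultimately show ?thesis using assms(2-4)
    by (auto simp: algebra_iso_def ring_iso_def ring_hom_def semilinear_def Pi_iff)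
qed

lemma algebra_iso_comp:
  assumes "algebra R A" "(\<sigma>, \<phi>) \<in> algebra_iso R A R' A'" "(\<sigma>', \<phi>') \<in> algebra_iso R' A' R'' A''"
  shows "(\<lambda>r. \<sigma>' (\<sigma> r), \<lambda>a. \<phi>' (\<phi> a)) \<in> algebra_iso R A R'' A''"
proof -
  have i: "\<sigma> \<in> ring_iso R R'" "\<sigma>' \<in> ring_iso R' R''" "\<phi> \<in> ring_iso A A'" "\<phi>' \<in> ring_iso A' A''"
    and s: "\<phi> \<in> semilinear R \<sigma> A A'" "\<phi>' \<in> semilinear R' \<sigma>' A' A''"
    using assms(2,3) by (auto simp: algebra_iso_def)
  have \<sigma>: "\<And>r. r \<in> carrier R \<Longrightarrow> \<sigma> r \<in> carrier R'" using i(1) by (auto simp: ring_iso_def ring_hom_def)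
  show ?thesis
    using ring_iso_set_trans[OF i(1,2)] ring_iso_set_trans[OF i(3,4)] semilinear_comp[OF s \<sigma>]
    by (simp add: algebra_iso_def comp_def)
qed

lemma algebra_iso_id: "(\<lambda>r. r, \<lambda>a. a) \<in> algebra_iso R A R A"
  by (simp add: algebra_iso_def ring_iso_def ring_hom_def semilinear_def bij_betw_def inj_on_def)

lemma algebra_iso_inv:
  assumes "algebra R A" and iso: "(\<sigma>, \<phi>) \<in> algebra_iso R A R' A'"
  shows "(inv_into (carrier R) \<sigma>, inv_into (carrier A) \<phi>) \<in> algebra_iso R' A' R A"
proof -
  interpret algebra R A by fact
  have i: "\<sigma> \<in> ring_iso R R'" "\<phi> \<in> ring_iso A A'" and s: "\<phi> \<in> semilinear R \<sigma> A A'"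
    using iso by (auto simp: algebra_iso_def)
  have R: "ring R" and A: "ring A" ..
  let ?s = "inv_into (carrier R) \<sigma>" and ?p = "inv_into (carrier A) \<phi>"
  have b: "bij_betw \<sigma> (carrier R) (carrier R')" "bij_betw \<phi> (carrier A) (carrier A')"
    using i by (auto simp: ring_iso_def)
  have i': "?s \<in> ring_iso R' R" "?p \<in> ring_iso A' A"
    using ring_iso_set_sym[OF R i(1)] ring_iso_set_sym[OF A i(2)] by auto
  have sc: "r \<in> carrier R' \<Longrightarrow> ?s r \<in> carrier R" for r using i'(1) by (auto simp: ring_iso_def ring_hom_def)
  have pc: "x \<in> carrier A' \<Longrightarrow> ?p x \<in> carrier A" for x using i'(2) by (auto simp: ring_iso_def ring_hom_def)
  have "?p \<in> semilinear R' ?s A' A"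
  proof (rule semilinearI)
    fix x y assume "x \<in> carrier A'" "y \<in> carrier A'"
    then show "?p (x \<oplus>\<^bsub>A'\<^esub> y) = ?p x \<oplus>\<^bsub>A\<^esub> ?p y" using i'(2) by (auto simp: ring_iso_def ring_hom_def)
  next
    fix r x assume r: "r \<in> carrier R'" and x: "x \<in> carrier A'"
    have c: "?s r \<odot>\<^bsub>A\<^esub> ?p x \<in> carrier A" using sc[OF r] pc[OF x] by simp
    have "\<phi> (?s r \<odot>\<^bsub>A\<^esub> ?p x) = r \<odot>\<^bsub>A'\<^esub> x"
      using semilinear_smult[OF s sc[OF r] pc[OF x]] bij_betw_inv_into_right[OF b(1) r] bij_betw_inv_into_right[OF b(2) x] by simp
    then show "?p (r \<odot>\<^bsub>A'\<^esub> x) = ?s r \<odot>\<^bsub>A\<^esub> ?p x" using bij_betw_inv_into_left[OF b(2) c] by simp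
  qed (rule pc)
  then show ?thesis using i' by (simp add: algebra_iso_def)
qed

text \<open>Source and target share the chart here, so \<lambda> vanishes. Between different charts
  of one algebra the identity could induce a nonzero shift.\<close>

lemma Phi_id:
  assumes "algebra_iso_pair R A n m e cf T enc R A m e cf T enc \<sigma> \<phi>"
    and \<sigma>_id: "\<And>r. r \<in> carrier R \<Longrightarrow> \<sigma> r = r" and \<phi>_id: "\<And>a. a \<in> carrier A \<Longrightarrow> \<phi> a = a"
    and X: "X \<in> carrier (disc_algebra.Delta R A n m e cf enc)"
  shows "algebra_iso_pair.Phi R A n m e cf enc R A m e cf enc \<sigma> \<phi> X = X"
proof -
  interpret algebra_iso_pair R A n m e cf T enc R A m e cf T enc \<sigma> \<phi> by fact
  obtain r x where rx: "X = enc (r, x)" "r \<in> carrier R" "x \<in> carrier S.L" using X by (rule S.DeltaE)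
  have cong: "semilinear R \<sigma> S.L N = semilinear R id S.L N" for N :: "('a, 'x, 'y) module_scheme"
    by (rule semilinear_cong_base) (simp add: \<sigma>_id)
  have W: "S.W (\<lambda>j. \<phi> (a j)) = S.W a" if a: "a \<in> {..<n} \<rightarrow> carrier A" for a
    by (rule alternating_cong[OF S.W_alternating a]) (use a \<phi>_id in auto)
  have "\<phi>L x = x"
    by (rule S.L_ext[OF S.L.abelian_group_axioms \<phi>L[unfolded cong] id_semilinear _ rx(3)]) (simp add: \<phi>L_W W)
  moreover have "lam x = \<zero>\<^bsub>R\<^esub>"
  proof (rule S.L_ext[OF S.self_group_R lam[unfolded cong] _ _ rx(3)])
    show "(\<lambda>x. \<zero>\<^bsub>R\<^esub>) \<in> semilinear R id S.L (self_module R)" by (rule semilinearI) simp_all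
    fix a assume a: "a \<in> {..<n} \<rightarrow> carrier A"
    have "S.pol (even_perms n) (\<lambda>j. \<phi> (a j)) = S.pol (even_perms n) a"
      by (rule multilinear_cong[OF S.pol_multilinear[OF perms_sub(1)] a]) (use a \<phi>_id in auto)
    then show "lam (S.W a) = \<zero>\<^bsub>R\<^esub>" using a \<sigma>_id by (simp add: lam_W)
  qed
  ultimately show ?thesis using rx \<sigma>_id by (simp add: Phi_enc)
qed

text \<open>The shifts satisfy a cocycle relation, because the differences of half norms
  telescope.\<close>

lemma Phi_comp:
  assumes P: "algebra_iso_pair R A n m e cf T enc R' A' m' e' cf' T' enc' \<sigma> \<phi>"
    and P': "algebra_iso_pair R' A' n m' e' cf' T' enc' R'' A'' m'' e'' cf'' T'' enc'' \<sigma>' \<phi>'"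
    and P'': "algebra_iso_pair R A n m e cf T enc R'' A'' m'' e'' cf'' T'' enc'' \<sigma>'' \<phi>''"
    and \<sigma>: "\<And>r. r \<in> carrier R \<Longrightarrow> \<sigma>'' r = \<sigma>' (\<sigma> r)" and \<phi>: "\<And>a. a \<in> carrier A \<Longrightarrow> \<phi>'' a = \<phi>' (\<phi> a)"
    and X: "X \<in> carrier (disc_algebra.Delta R A n m e cf enc)"
  shows "algebra_iso_pair.Phi R A n m e cf enc R'' A'' m'' e'' cf'' enc'' \<sigma>'' \<phi>'' X =
    algebra_iso_pair.Phi R' A' n m' e' cf' enc' R'' A'' m'' e'' cf'' enc'' \<sigma>' \<phi>'
      (algebra_iso_pair.Phi R A n m e cf enc R' A' m' e' cf' enc' \<sigma> \<phi> X)"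
proof -
  interpret P: algebra_iso_pair R A n m e cf T enc R' A' m' e' cf' T' enc' \<sigma> \<phi> by fact
  interpret P': algebra_iso_pair R' A' n m' e' cf' T' enc' R'' A'' m'' e'' cf'' T'' enc'' \<sigma>' \<phi>' by fact
  interpret P'': algebra_iso_pair R A n m e cf T enc R'' A'' m'' e'' cf'' T'' enc'' \<sigma>'' \<phi>'' by fact
  obtain r x where rx: "X = enc (r, x)" "r \<in> carrier R" "x \<in> carrier P.S.L" using X by (rule P.S.DeltaE)
  have sc: "r \<in> carrier R \<Longrightarrow> \<sigma>' (\<sigma> r) \<in> carrier R''" for r by simp
  have "semilinear R \<sigma>'' P.S.L (self_module R'') = semilinear R (\<lambda>r. \<sigma>' (\<sigma> r)) P.S.L (self_module R'')"
    by (rule semilinear_cong_base) (rule \<sigma>)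
  note lam = P''.lam[unfolded this]
  have "semilinear R \<sigma>'' P.S.L P'.S'.L = semilinear R (\<lambda>r. \<sigma>' (\<sigma> r)) P.S.L P'.S'.L"
    by (rule semilinear_cong_base) (rule \<sigma>)
  note \<phi>L = P''.\<phi>L[unfolded this]
  have \<phi>': "(\<lambda>j. \<phi>' (\<phi> (a j))) \<in> {..<n} \<rightarrow> carrier A''" if a: "a \<in> {..<n} \<rightarrow> carrier A" for a
    by (rule P'.\<phi>_Pi[OF P.\<phi>_Pi[OF a]])
  have aj: "j < n \<Longrightarrow> a j \<in> carrier A" if a: "a \<in> {..<n} \<rightarrow> carrier A" for a j using a by auto
  have 1: "P''.\<phi>L x = P'.\<phi>L (P.\<phi>L x)"
  proof (rule P.S.L_ext[OF P'.S'.L.abelian_group_axioms \<phi>L semilinear_comp[OF P.\<phi>L P'.\<phi>L P.\<sigma>_closed] _ rx(3)])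
    fix a assume a: "a \<in> {..<n} \<rightarrow> carrier A"
    have "P'.S'.W (\<lambda>j. \<phi>'' (a j)) = P'.S'.W (\<lambda>j. \<phi>' (\<phi> (a j)))"
      by (rule alternating_cong[OF P'.S'.W_alternating \<phi>'[OF a]]) (rule \<phi>[OF aj[OF a]])
    then show "P''.\<phi>L (P.S.W a) = P'.\<phi>L (P.\<phi>L (P.S.W a))" using a by (simp add: P.\<phi>L_W P'.\<phi>L_W P''.\<phi>L_W)
  qed
  have 2: "P''.lam x = \<sigma>' (P.lam x) \<oplus>\<^bsub>R''\<^esub> P'.lam (P.\<phi>L x)"
  proof (rule P.S.L_ext[OF P'.S'.self_group_R lam _ _ rx(3)])
    show "(\<lambda>x. \<sigma>' (P.lam x) \<oplus>\<^bsub>R''\<^esub> P'.lam (P.\<phi>L x)) \<in> semilinear R (\<lambda>r. \<sigma>' (\<sigma> r)) P.S.L (self_module R'')"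
      using semilinear_add_fun[OF P'.S'.self_module_R sc semilinear_comp[OF P.lam P'.\<sigma>_semilinear P.\<sigma>_closed]
          semilinear_comp[OF P.\<phi>L P'.lam P.\<sigma>_closed]] by simp
    fix a assume a: "a \<in> {..<n} \<rightarrow> carrier A"
    let ?E = "even_perms n"
    have eq: "P'.S'.pol ?E (\<lambda>j. \<phi>'' (a j)) = P'.S'.pol ?E (\<lambda>j. \<phi>' (\<phi> (a j)))"
      by (rule multilinear_cong[OF P'.S'.pol_multilinear[OF perms_sub(1)] \<phi>'[OF a]]) (rule \<phi>[OF aj[OF a]])
    have p: "P.S.pol ?E a \<in> carrier R" "P.S'.pol ?E (\<lambda>j. \<phi> (a j)) \<in> carrier R'" "P'.S'.pol ?E (\<lambda>j. \<phi>' (\<phi> (a j))) \<in> carrier R''"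
      using P.S.pol_closed'(2)[OF a] P.S'.pol_closed'(2)[OF P.\<phi>_Pi[OF a]] P'.S'.pol_closed'(2)[OF \<phi>'[OF a]] by auto
    have "\<sigma>' (P.lam (P.S.W a)) \<oplus>\<^bsub>R''\<^esub> P'.lam (P.\<phi>L (P.S.W a)) =
      (\<sigma>' (P.S'.pol ?E (\<lambda>j. \<phi> (a j))) \<ominus>\<^bsub>R''\<^esub> \<sigma>' (\<sigma> (P.S.pol ?E a))) \<oplus>\<^bsub>R''\<^esub>
      (P'.S'.pol ?E (\<lambda>j. \<phi>' (\<phi> (a j))) \<ominus>\<^bsub>R''\<^esub> \<sigma>' (P.S'.pol ?E (\<lambda>j. \<phi> (a j))))"
      using a p by (simp add: P.lam_W P.\<phi>L_W P'.lam_W P'.\<sigma>_ring)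
    also have "\<dots> = P'.S'.pol ?E (\<lambda>j. \<phi>' (\<phi> (a j))) \<ominus>\<^bsub>R''\<^esub> \<sigma>' (\<sigma> (P.S.pol ?E a))"
      by (rule P'.S'.A.R.minus_chain) (use p in auto)
    also have "\<dots> = P''.lam (P.S.W a)" using a p \<sigma> eq by (simp add: P''.lam_W)
    finally show "P''.lam (P.S.W a) = \<sigma>' (P.lam (P.S.W a)) \<oplus>\<^bsub>R''\<^esub> P'.lam (P.\<phi>L (P.S.W a))" ..
  qed
  show ?thesis
    unfolding rx(1) using rx(2,3) \<sigma>
    by (simp add: P.Phi_enc P'.Phi_enc P''.Phi_enc 1 2 P'.\<sigma>_ring P'.S'.A.R.a_assoc)
qed

lemma (in algebra_iso_pair) Phi_left_inverse:
  assumes Q: "algebra_iso_pair R' A' n m' e' cf' T' enc' R A m e cf T enc \<sigma>' \<phi>'"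
    and \<sigma>': "\<And>r. r \<in> carrier R \<Longrightarrow> \<sigma>' (\<sigma> r) = r" and \<phi>': "\<And>a. a \<in> carrier A \<Longrightarrow> \<phi>' (\<phi> a) = a"
    and X: "X \<in> carrier S.Delta"
  shows "algebra_iso_pair.Phi R' A' n m' e' cf' enc' R A m e cf enc \<sigma>' \<phi>' (Phi X) = X"
proof -
  have I: "algebra_iso_pair R A n m e cf T enc R A m e cf T enc (\<lambda>r. r) (\<lambda>a. a)"
    by (intro algebra_iso_pair.intro S.disc_algebra_axioms algebra_iso_pair_axioms.intro algebra_iso_id)
  show ?thesis
    using Phi_comp[OF algebra_iso_pair_axioms Q I \<sigma>'[symmetric] \<phi>'[symmetric] X] Phi_id[OF I _ _ X] by simp
qed

text \<open>Bijectivity comes from functoriality: the inverse isomorphism, with the same two charts,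
  induces the inverse map.\<close>

lemma (in algebra_iso_pair) Phi_iso: "(\<sigma>, Phi) \<in> algebra_iso R S.Delta R' S'.Delta"
proof -
  let ?s = "inv_into (carrier R) \<sigma>" and ?p = "inv_into (carrier A) \<phi>"
  have Q: "algebra_iso_pair R' A' n m' e' cf' T' enc' R A m e cf T enc ?s ?p"
    by (intro algebra_iso_pair.intro S.disc_algebra_axioms S'.disc_algebra_axioms algebra_iso_pair_axioms.intro
        algebra_iso_inv[OF S.A.algebra_axioms iso])
  interpret Q: algebra_iso_pair R' A' n m' e' cf' T' enc' R A m e cf T enc ?s ?p by (rule Q)
  have "bij_betw Phi (carrier S.Delta) (carrier S'.Delta)"
  proof (rule bij_betwI)
    show "Phi \<in> carrier S.Delta \<rightarrow> carrier S'.Delta" using Phi_closed by auto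
    show "Q.Phi \<in> carrier S'.Delta \<rightarrow> carrier S.Delta" using Q.Phi_closed by auto
    show "Q.Phi (Phi X) = X" if "X \<in> carrier S.Delta" for X
      by (rule Phi_left_inverse[OF Q _ _ that])
        (simp_all add: bij_betw_inv_into_left[OF \<sigma>_bij] bij_betw_inv_into_left[OF \<phi>_bij])
    show "Phi (Q.Phi Y) = Y" if "Y \<in> carrier S'.Delta" for Y
      by (rule Q.Phi_left_inverse[OF algebra_iso_pair_axioms _ _ that])
        (simp_all add: bij_betw_inv_into_right[OF \<sigma>_bij] bij_betw_inv_into_right[OF \<phi>_bij])
  qed
  moreover have "\<sigma> \<in> ring_iso R R'" using iso by (simp add: algebra_iso_def)
  ultimately show ?thesis
    using Phi_closed Phi_add Phi_mult Phi_one Phi_semilinear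
    by (simp add: algebra_iso_def ring_iso_def ring_hom_def Pi_iff del: S.Delta_simps S'.Delta_simps)
qed

section \<open>Storing pairs in the type of the exterior power, and the final assembly\<close>

section \<open>Encoding of scalars and wedges\<close>

text \<open>Lists of length \<open>n + 1\<close> are not in the support of any tuple in a coset \<open>\<omega>\<close>, so their
  coefficient is free to hold the scalar part of \<open>(r, \<omega>)\<close>.\<close>

definition tag :: "nat \<Rightarrow> ('a, 'y) ring_scheme \<Rightarrow> 'r \<times> ('a list \<Rightarrow> 'r) set \<Rightarrow> ('a list \<Rightarrow> 'r) set"
  where "tag n A p = (\<lambda>g. g(replicate (Suc n) \<zero>\<^bsub>A\<^esub> := fst p)) ` snd p"

text \<open>Resetting the tagged coefficient to zero recovers the coset, whose elements vanish off
  the \<open>n\<close>-tuples. The values of that coefficient recover the scalar, because cosets are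
  nonempty.\<close>

lemma (in exterior_power) tag_inj: "inj_on (tag n M) (carrier R \<times> carrier L)"
proof -
  let ?z = "replicate (Suc n) \<zero>\<^bsub>M\<^esub>"
  have z: "?z \<notin> tuples M n" by (simp add: tuples_def)
  have ne: "X \<noteq> {}" and sub: "X \<subseteq> carrier F" if X: "X \<in> carrier L" for X
  proof -
    obtain x where x: "x \<in> carrier F" "X = K +>\<^bsub>F\<^esub> x" using X unfolding L_eq by (rule Q.carrier_quotientE)
    show "X \<noteq> {}" using Q.a_rcos_self[OF x(1)] x(2) by auto
    show "X \<subseteq> carrier F" using abelian_monoid.a_r_coset_subset_G[OF abelian_group.axioms(1)[OF F.abelian_group_axioms] Q.a_subset x(1)] x(2) by simp
  qed
  have untag: "(\<lambda>g. g(?z := \<zero>)) ` tag n M (r, X) = X" if "X \<in> carrier L" for r X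
  proof -
    have "(g(?z := r))(?z := \<zero>) = g" if g: "g \<in> X" for g
    proof -
      have "g \<in> carrier F" using sub[OF \<open>X \<in> carrier L\<close>] g by auto
      then have "g ?z = \<zero>" using z unfolding carrier_free_module by blast
      then show ?thesis by (simp add: fun_upd_idem)
    qed
    then show ?thesis by (force simp: tag_def image_image)
  qed
  have val: "(\<lambda>g. g ?z) ` tag n M (r, X) = {r}" if "X \<in> carrier L" for r X
    using ne[OF that] by (auto simp: tag_def image_image)
  show ?thesis
  proof (rule inj_onI)
    fix p q assume p: "p \<in> carrier R \<times> carrier L" and q: "q \<in> carrier R \<times> carrier L" and eq: "tag n M p = tag n M q"
    obtain r X s Y where pq: "p = (r, X)" "q = (s, Y)" by (metis surj_pair)
    have XY: "X \<in> carrier L" "Y \<in> carrier L" using p q pq by auto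
    have "X = Y" using untag[OF XY(1), of r] untag[OF XY(2), of s] eq pq by simp
    moreover have "{r} = {s}" using val[OF XY(1), of r] val[OF XY(2), of s] eq pq by simp
    ultimately show "p = q" using pq by simp
  qed
qed

text \<open>An arbitrary choice for each pair \<open>(R, A)\<close>, with no compatibility between
  isomorphic pairs; the shifts in \<open>Phi\<close> absorb the difference.\<close>

definition chart where
  "chart n R A = (SOME c. traced_chart R A n (fst c) (fst (snd c)) (snd (snd c)) (algebra_trace R A))"

abbreviation "chart_size n R A \<equiv> fst (chart n R A)"
abbreviation "chart_vectors n R A \<equiv> fst (snd (chart n R A))"
abbreviation "chart_forms n R A \<equiv> snd (snd (chart n R A))"

definition discriminant_algebra where
  "discriminant_algebra n R A =
    disc_algebra.Delta R A n (chart_size n R A) (chart_vectors n R A) (chart_forms n R A) (tag n A)"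

definition discriminant_map where
  "discriminant_map n R A R' A' f = algebra_iso_pair.Phi
    R A n (chart_size n R A) (chart_vectors n R A) (chart_forms n R A) (tag n A)
    R' A' (chart_size n R' A') (chart_vectors n R' A') (chart_forms n R' A') (tag n A') (fst f) (snd f)"

definition discriminant_wedge where
  "discriminant_wedge n R A =
    disc_algebra.theta R A n (chart_size n R A) (chart_vectors n R A) (chart_forms n R A) (tag n A)"

lemma disc_algebra_chart:
  assumes "rank_algebra R n A"
  shows "disc_algebra R A n (chart_size n R A) (chart_vectors n R A) (chart_forms n R A) (algebra_trace R A) (tag n A)"
proof -
  have "\<exists>c. traced_chart R A n (fst c) (fst (snd c)) (snd (snd c)) (algebra_trace R A)"
    using rank_algebra_chart[OF assms] by auto
  then have c: "traced_chart R A n (chart_size n R A) (chart_vectors n R A) (chart_forms n R A) (algebra_trace R A)"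
    unfolding chart_def by (rule someI_ex)
  interpret traced_chart R A n "chart_size n R A" "chart_vectors n R A" "chart_forms n R A" "algebra_trace R A" by (rule c)
  show ?thesis by (intro disc_algebra.intro c disc_algebra_axioms.intro tag_inj)
qed

lemma algebra_iso_pair_chart:
  assumes "rank_algebra R n A" "rank_algebra R' n A'" "(\<sigma>, \<phi>) \<in> algebra_iso R A R' A'"
  shows "algebra_iso_pair
    R A n (chart_size n R A) (chart_vectors n R A) (chart_forms n R A) (algebra_trace R A) (tag n A)
    R' A' (chart_size n R' A') (chart_vectors n R' A') (chart_forms n R' A') (algebra_trace R' A') (tag n A') \<sigma> \<phi>"
  by (intro algebra_iso_pair.intro algebra_iso_pair_axioms.intro disc_algebra_chart assms)

text \<open>Canonicity is expressed by functoriality and naturality for isomorphisms of pairs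
  \<open>(R, A)\<close>. The elements of \<Delta> have the type of elements of the exterior power of
  \<open>A\<close>, which the injection \<open>tag\<close> makes possible.\<close>

theorem theorem1:
  fixes n :: nat
  shows "\<exists>(\<Delta> :: 'r ring \<Rightarrow> ('r, 'a) module \<Rightarrow> ('r, ('a list \<Rightarrow> 'r) set) module) \<Phi> \<theta>.
    (\<forall>R A. rank_algebra R n A \<longrightarrow>
       rank_algebra R 2 (\<Delta> R A) \<and>
       \<theta> R A \<in> module_iso R (ext_power R 2 (\<Delta> R A)) (ext_power R n A) \<and>
       identifies_disc_forms R 2 (\<Delta> R A) n A (\<theta> R A)) \<and>
    iso_functorial n \<Delta> \<Phi> \<and> iso_natural n \<Delta> \<Phi> \<theta>"
proof (rule exI[of _ "discriminant_algebra n"], rule exI[of _ "discriminant_map n"],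
    rule exI[of _ "discriminant_wedge n"], intro conjI allI impI)
  fix R :: "'r ring" and A :: "('r, 'a) module"
  assume A: "rank_algebra R n A"
  note D = disc_algebra_chart[OF A]
  show "rank_algebra R 2 (discriminant_algebra n R A)"
    unfolding discriminant_algebra_def by (rule disc_algebra.Delta_rank[OF D])
  show "discriminant_wedge n R A \<in> module_iso R (ext_power R 2 (discriminant_algebra n R A)) (ext_power R n A)"
    unfolding discriminant_algebra_def discriminant_wedge_def by (rule disc_algebra.theta_iso[OF D])
  show "identifies_disc_forms R 2 (discriminant_algebra n R A) n A (discriminant_wedge n R A)"
    unfolding discriminant_algebra_def discriminant_wedge_def
    by (rule disc_algebra.disc_forms_identified[OF D refl])
next
  show "iso_functorial n (discriminant_algebra n :: 'r ring \<Rightarrow> ('r, 'a) module \<Rightarrow> _) (discriminant_map n)"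
    unfolding iso_functorial_def
  proof (intro conjI allI impI ballI)
    fix R R' :: "'r ring" and A A' :: "('r, 'a) module" and \<sigma> \<phi>
    assume "rank_algebra R n A" "rank_algebra R' n A'" "(\<sigma>, \<phi>) \<in> algebra_iso R A R' A'"
    note P = algebra_iso_pair_chart[OF this]
    show "(\<sigma>, discriminant_map n R A R' A' (\<sigma>, \<phi>)) \<in> algebra_iso R (discriminant_algebra n R A) R' (discriminant_algebra n R' A')"
      using algebra_iso_pair.Phi_iso[OF P]
      by (simp add: discriminant_map_def[abs_def] discriminant_algebra_def)
  next
    fix R :: "'r ring" and A :: "('r, 'a) module" and \<sigma> \<phi> X
    assume A: "rank_algebra R n A" and \<sigma>: "\<forall>r\<in>carrier R. \<sigma> r = r" and \<phi>: "\<forall>a\<in>carrier A. \<phi> a = a"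
      and X: "X \<in> carrier (discriminant_algebra n R A)"
    have "algebra R A" using A by (simp add: rank_algebra_def)
    then have "(\<sigma>, \<phi>) \<in> algebra_iso R A R A"
      by (rule algebra_iso_cong[OF _ algebra_iso_id]) (simp_all add: \<sigma> \<phi>)
    note P = algebra_iso_pair_chart[OF A A this]
    show "discriminant_map n R A R A (\<sigma>, \<phi>) X = X"
      using Phi_id[OF P _ _ X[unfolded discriminant_algebra_def]] \<sigma> \<phi> by (simp add: discriminant_map_def)
  next
    fix R R' R'' :: "'r ring" and A A' A'' :: "('r, 'a) module" and \<sigma> \<phi> \<sigma>' \<phi>' \<sigma>'' \<phi>'' X
    assume A: "rank_algebra R n A" "rank_algebra R' n A'" "rank_algebra R'' n A''"
      and i: "(\<sigma>, \<phi>) \<in> algebra_iso R A R' A'" "(\<sigma>', \<phi>') \<in> algebra_iso R' A' R'' A''"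
      and \<sigma>: "\<forall>r\<in>carrier R. \<sigma>'' r = \<sigma>' (\<sigma> r)" and \<phi>: "\<forall>a\<in>carrier A. \<phi>'' a = \<phi>' (\<phi> a)"
      and X: "X \<in> carrier (discriminant_algebra n R A)"
    have a: "algebra R A" using A(1) by (simp add: rank_algebra_def)
    then have "(\<sigma>'', \<phi>'') \<in> algebra_iso R A R'' A''"
      by (rule algebra_iso_cong[OF _ algebra_iso_comp[OF a i]]) (simp_all add: \<sigma> \<phi>)
    note P'' = algebra_iso_pair_chart[OF A(1,3) this]
    note P = algebra_iso_pair_chart[OF A(1,2) i(1)] and P' = algebra_iso_pair_chart[OF A(2,3) i(2)]
    show "discriminant_map n R A R'' A'' (\<sigma>'', \<phi>'') X =
      discriminant_map n R' A' R'' A'' (\<sigma>', \<phi>') (discriminant_map n R A R' A' (\<sigma>, \<phi>) X)"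
      using Phi_comp[OF P P' P'' _ _ X[unfolded discriminant_algebra_def]] \<sigma> \<phi> by (simp add: discriminant_map_def)
  qed
next
  show "iso_natural n (discriminant_algebra n :: 'r ring \<Rightarrow> ('r, 'a) module \<Rightarrow> _) (discriminant_map n) (discriminant_wedge n)"
    unfolding iso_natural_def
  proof (intro allI impI ballI)
    fix R R' :: "'r ring" and A A' :: "('r, 'a) module" and \<sigma> \<phi> X
    assume "rank_algebra R n A" "rank_algebra R' n A'" "(\<sigma>, \<phi>) \<in> algebra_iso R A R' A'"
    note P = algebra_iso_pair_chart[OF this]
    assume X: "X \<in> carrier (ext_power R 2 (discriminant_algebra n R A))"
    show "discriminant_wedge n R' A' (ext_map R (discriminant_algebra n R A) R' (discriminant_algebra n R' A') 2 \<sigma>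
        (discriminant_map n R A R' A' (\<sigma>, \<phi>)) X) = ext_map R A R' A' n \<sigma> \<phi> (discriminant_wedge n R A X)"
      using algebra_iso_pair.theta_natural[OF P X[unfolded discriminant_algebra_def]]
      by (simp add: discriminant_map_def[abs_def] discriminant_algebra_def discriminant_wedge_def)
  qed
qed

end
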